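(* Let $M$ be a compact smooth $7$-manifold. A $\mathrm{G}_2$-structure $\varphi$ on $M$ is a stationary point of the Ricci-harmonic flow, i.e. satisfies $$\left(-\mathrm{Ric}+3T^tT-|T|^2g\right)\diamond\varphi+\operatorname{div}T\lrcorner\psi=0,$$ if and only if $\varphi$ is torsion-free, i.e. $T=0$.
   Context: A $\mathrm{G}_2$-structure on a smooth $7$-manifold $M$ is a nondegenerate $3$-form $\varphi$, i.e. one that determines a Riemannian metric $g$ and an orientation by $(X\lrcorner\varphi)\wedge(Y\lrcorner\varphi)\wedge\varphi=-6\,g(X,Y)\,\mathrm{vol}$; put $\psi=*\varphi$. Indices refer to local orthonormal frames and repeated indices are summed. $\nabla$ is the Levi-Civita connection of $g$ and $\mathrm{Ric}$ its Ricci tensor. The torsion of $\varphi$ is the $2$-tensor $T$ with $\nabla_m\varphi_{ijk}=T_{mp}\psi_{pijk}$. Further: $(T^tT)_{ij}=T_{pi}T_{pj}$, $|T|^2=T_{ij}T_{ij}$, $(\operatorname{div}T)_j=\nabla_iT_{ij}$. For a symmetric $2$-tensor $h$, $(h\diamond\varphi)_{ijk}=h_{ip}\varphi_{pjk}+h_{jp}\varphi_{ipk}+h_{kp}\varphi_{ijp}$, and for a vector field $X$, $(X\lrcorner\psi)_{ijk}=X_l\psi_{lijk}$. The Ricci-harmonic flow of $\mathrm{G}_2$-structures is $\frac{\partial\varphi}{\partial t}=(-\mathrm{Ric}+3T^tT-|T|^2g)\diamond\varphi+\operatorname{div}T\lrcorner\psi$. *)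

theory Defs
  imports "HOL-Analysis.Analysis" "HOL-Library.Numeral_Type" "HOL-Combinatorics.Permutations"
begin

section \<open>Smooth maps\<close>

text \<open>\<open>f\<close> is \<open>k\<close> times differentiable on the open set \<open>S\<close>, with continuous derivatives
  in all directions; only the values of \<open>f\<close> on \<open>S\<close> matter.\<close>

primrec higher_differentiable_on ::
  "'a::real_normed_vector set \<Rightarrow> ('a \<Rightarrow> 'b::real_normed_vector) \<Rightarrow> nat \<Rightarrow> bool" where
  "higher_differentiable_on S f 0 \<longleftrightarrow> continuous_on S f"
| "higher_differentiable_on S f (Suc n) \<longleftrightarrow>
     (\<forall>x\<in>S. f differentiable (at x)) \<and>
     (\<forall>v. higher_differentiable_on S (\<lambda>x. frechet_derivative f (at x) v) n)"

definition smooth_on ::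
  "'a::real_normed_vector set \<Rightarrow> ('a \<Rightarrow> 'b::real_normed_vector) \<Rightarrow> bool" where
  "smooth_on S f \<longleftrightarrow> (\<forall>n. higher_differentiable_on S f n)"

definition partial :: "7 \<Rightarrow> (real^7 \<Rightarrow> real) \<Rightarrow> real^7 \<Rightarrow> real" where
  "partial i f x = frechet_derivative f (at x) (axis i 1)"


section \<open>Smooth 7-manifolds (without boundary)\<close>

type_synonym 'a chart = "'a set \<times> ('a \<Rightarrow> real^7)"

definition chart_image :: "'a chart \<Rightarrow> (real^7) set" where
  "chart_image c = snd c ` fst c"

definition is_chart :: "'a topology \<Rightarrow> 'a chart \<Rightarrow> bool" where
  "is_chart M c \<longleftrightarrow>
     openin M (fst c) \<and> open (chart_image c) \<and>
     homeomorphic_map (subtopology M (fst c)) (top_of_set (chart_image c)) (snd c)"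

text \<open>The coordinates of \<open>d\<close> as functions of the coordinates of \<open>c\<close>,
  defined on the image under \<open>c\<close> of the overlap of the two chart domains.\<close>

definition transition :: "'a chart \<Rightarrow> 'a chart \<Rightarrow> real^7 \<Rightarrow> real^7" where
  "transition c d = snd d \<circ> inv_into (fst c) (snd c)"

definition overlap :: "'a chart \<Rightarrow> 'a chart \<Rightarrow> (real^7) set" where
  "overlap c d = snd c ` (fst c \<inter> fst d)"

definition smooth_7_manifold :: "'a topology \<Rightarrow> 'a chart set \<Rightarrow> bool" where
  "smooth_7_manifold M A \<longleftrightarrow>
     Hausdorff_space M \<and> second_countable M \<and>
     (\<forall>c\<in>A. is_chart M c) \<and> (\<Union>c\<in>A. fst c) = topspace M \<and>
     (\<forall>c\<in>A. \<forall>d\<in>A. smooth_on (overlap c d) (transition c d))"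


section \<open>Linear algebra of 3-forms on a 7-dimensional space\<close>

text \<open>Tensors are given by their components in a basis, with all indices in the type \<open>7\<close>
  (so the numeral \<open>7\<close> denotes the same index as \<open>0\<close>, and the ordered basis is numbered
  \<open>1, \<dots>, 7\<close>). The basis is not assumed orthonormal, so a contraction of two lower indices
  in an orthonormal frame becomes a contraction with the inverse metric.\<close>

type_synonym tensor2 = "7 \<Rightarrow> 7 \<Rightarrow> real"
type_synonym tensor3 = "7 \<Rightarrow> 7 \<Rightarrow> 7 \<Rightarrow> real"
type_synonym tensor4 = "7 \<Rightarrow> 7 \<Rightarrow> 7 \<Rightarrow> 7 \<Rightarrow> real"

definition alternating3 :: "tensor3 \<Rightarrow> bool" where
  "alternating3 w \<longleftrightarrow> (\<forall>i j k. w i j k = - w j i k \<and> w i j k = - w i k j)"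

text \<open>The coefficient of \<open>e\<^sup>1 \<and> \<dots> \<and> e\<^sup>7\<close> in \<open>(e\<^sub>i \<lrcorner> w) \<and> (e\<^sub>j \<lrcorner> w) \<and> w\<close>.
  The wedge product is normalised so that \<open>(e\<^sup>1 \<and> \<dots> \<and> e\<^sup>k)(e\<^sub>1, \<dots>, e\<^sub>k) = 1\<close>,
  whence the factor \<open>1 / (2! 2! 3!)\<close>.\<close>

definition contraction_wedge :: "tensor3 \<Rightarrow> tensor2" where
  "contraction_wedge w i j =
     (\<Sum>p | p permutes (UNIV :: 7 set).
        of_int (sign p) * w i (p 1) (p 2) * w j (p 3) (p 4) * w (p 5) (p 6) (p 7))
     / (fact 2 * fact 2 * fact 3)"

definition inner_product_matrix :: "real^7^7 \<Rightarrow> bool" where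
  "inner_product_matrix G \<longleftrightarrow> transpose G = G \<and> (\<forall>v. v \<noteq> 0 \<longrightarrow> v \<bullet> (G *v v) > 0)"

text \<open>An orientation is encoded by a sign \<open>e\<close>, which is \<open>1\<close> if the basis is positively
  oriented and \<open>-1\<close> otherwise. The volume form is then
  \<open>e * sqrt (det G)\<close> times \<open>e\<^sup>1 \<and> \<dots> \<and> e\<^sup>7\<close>.\<close>

definition volume_coeff :: "real^7^7 \<Rightarrow> real \<Rightarrow> real" where
  "volume_coeff G e = e * sqrt (det G)"

definition determines :: "tensor3 \<Rightarrow> real^7^7 \<Rightarrow> real \<Rightarrow> bool" where
  "determines w G e \<longleftrightarrow>
     inner_product_matrix G \<and> e \<in> {1, -1} \<and>
     (\<forall>i j. contraction_wedge w i j = - 6 * G $ i $ j * volume_coeff G e)"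

definition nondegenerate :: "tensor3 \<Rightarrow> bool" where
  "nondegenerate w \<longleftrightarrow> (\<exists>G e. determines w G e)"

text \<open>At most one pair \<open>(G, e)\<close> is determined by \<open>w\<close>.\<close>

definition metric :: "tensor3 \<Rightarrow> real^7^7" where
  "metric w = (THE G. \<exists>e. determines w G e)"

definition orientation :: "tensor3 \<Rightarrow> real" where
  "orientation w = (THE e. \<exists>G. determines w G e)"

definition lower_metric :: "tensor3 \<Rightarrow> tensor2" where
  "lower_metric w i j = metric w $ i $ j"

definition upper_metric :: "tensor3 \<Rightarrow> tensor2" where
  "upper_metric w i j = matrix_inv (metric w) $ i $ j"

text \<open>\<open>\<psi> = *w\<close>, that is \<open>\<psi>\<^sub>i\<^sub>j\<^sub>k\<^sub>l = w\<^sup>a\<^sup>b\<^sup>c vol\<^sub>a\<^sub>b\<^sub>c\<^sub>i\<^sub>j\<^sub>k\<^sub>l / 3!\<close>,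
  where \<open>w\<^sup>a\<^sup>b\<^sup>c\<close> denotes \<open>w\<close> with raised indices.\<close>

definition raise3 :: "tensor3 \<Rightarrow> tensor3" where
  "raise3 w a b c =
     (\<Sum>i\<in>UNIV. \<Sum>j\<in>UNIV. \<Sum>k\<in>UNIV.
        upper_metric w a i * upper_metric w b j * upper_metric w c k * w i j k)"

definition hodge_dual :: "tensor3 \<Rightarrow> tensor4" where
  "hodge_dual w i j k l =
     volume_coeff (metric w) (orientation w) *
     (\<Sum>p | p permutes (UNIV :: 7 set) \<and> p 4 = i \<and> p 5 = j \<and> p 6 = k \<and> p 7 = l.
        of_int (sign p) * raise3 w (p 1) (p 2) (p 3)) / fact 3"

definition diamond :: "tensor2 \<Rightarrow> tensor3 \<Rightarrow> tensor3" where
  "diamond h w i j k =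
     (\<Sum>p\<in>UNIV. \<Sum>q\<in>UNIV. upper_metric w p q *
        (h i p * w q j k + h j p * w i q k + h k p * w i j q))"

text \<open>\<open>X \<lrcorner> \<psi>\<close> for a vector \<open>X\<close> given by its lower components.\<close>

definition contract_dual :: "(7 \<Rightarrow> real) \<Rightarrow> tensor3 \<Rightarrow> tensor3" where
  "contract_dual X w i j k =
     (\<Sum>l\<in>UNIV. \<Sum>m\<in>UNIV. upper_metric w l m * X m * hodge_dual w l i j k)"


section \<open>Local differential geometry of a field of 3-forms\<close>

text \<open>Here \<open>w\<close> is a field of nondegenerate 3-forms on an open subset of \<open>\<real>\<^sup>7\<close> and all
  components refer to the coordinate basis. \<open>christoffel w x k i j\<close> is \<open>\<Gamma>\<^sup>k\<^sub>i\<^sub>j\<close>.\<close>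

definition christoffel :: "(real^7 \<Rightarrow> tensor3) \<Rightarrow> real^7 \<Rightarrow> tensor3" where
  "christoffel w x k i j =
     (\<Sum>l\<in>UNIV. upper_metric (w x) k l *
        (partial i (\<lambda>y. lower_metric (w y) j l) x
         + partial j (\<lambda>y. lower_metric (w y) i l) x
         - partial l (\<lambda>y. lower_metric (w y) i j) x)) / 2"

text \<open>The first index of the covariant derivative is the direction of differentiation.\<close>

definition nabla2 :: "(real^7 \<Rightarrow> tensor3) \<Rightarrow> (real^7 \<Rightarrow> tensor2) \<Rightarrow> real^7 \<Rightarrow> tensor3" where
  "nabla2 w h x m i j =
     partial m (\<lambda>y. h y i j) x
     - (\<Sum>l\<in>UNIV. christoffel w x l m i * h x l j + christoffel w x l m j * h x i l)"

definition nabla3 :: "(real^7 \<Rightarrow> tensor3) \<Rightarrow> (real^7 \<Rightarrow> tensor3) \<Rightarrow> real^7 \<Rightarrow> tensor4" where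
  "nabla3 w u x m i j k =
     partial m (\<lambda>y. u y i j k) x
     - (\<Sum>l\<in>UNIV. christoffel w x l m i * u x l j k
                  + christoffel w x l m j * u x i l k
                  + christoffel w x l m k * u x i j l)"

text \<open>The sign convention makes the Ricci tensor of round spheres positive.\<close>

definition ricci :: "(real^7 \<Rightarrow> tensor3) \<Rightarrow> real^7 \<Rightarrow> tensor2" where
  "ricci w x j k =
     (\<Sum>l\<in>UNIV.
        partial l (\<lambda>y. christoffel w y l j k) x - partial j (\<lambda>y. christoffel w y l l k) x
        + (\<Sum>m\<in>UNIV. christoffel w x l l m * christoffel w x m j k
                     - christoffel w x l j m * christoffel w x m l k))"

text \<open>The tensor \<open>T\<close> with \<open>\<nabla>\<^sub>m w\<^sub>i\<^sub>j\<^sub>k = T\<^sub>m\<^sub>p \<psi>\<^sub>p\<^sub>i\<^sub>j\<^sub>k\<close>, which exists and is unique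
  for nondegenerate \<open>w\<close>.\<close>

definition torsion :: "(real^7 \<Rightarrow> tensor3) \<Rightarrow> real^7 \<Rightarrow> tensor2" where
  "torsion w x = (THE T. \<forall>m i j k.
     nabla3 w w x m i j k =
       (\<Sum>p\<in>UNIV. \<Sum>q\<in>UNIV. T m p * upper_metric (w x) p q * hodge_dual (w x) q i j k))"

definition torsion_square :: "(real^7 \<Rightarrow> tensor3) \<Rightarrow> real^7 \<Rightarrow> tensor2" where
  "torsion_square w x i j =
     (\<Sum>p\<in>UNIV. \<Sum>q\<in>UNIV. upper_metric (w x) p q * torsion w x p i * torsion w x q j)"

definition torsion_norm_sq :: "(real^7 \<Rightarrow> tensor3) \<Rightarrow> real^7 \<Rightarrow> real" where
  "torsion_norm_sq w x =
     (\<Sum>i\<in>UNIV. \<Sum>j\<in>UNIV. \<Sum>k\<in>UNIV. \<Sum>l\<in>UNIV.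
        upper_metric (w x) i k * upper_metric (w x) j l * torsion w x i j * torsion w x k l)"

definition div_torsion :: "(real^7 \<Rightarrow> tensor3) \<Rightarrow> real^7 \<Rightarrow> 7 \<Rightarrow> real" where
  "div_torsion w x j =
     (\<Sum>k\<in>UNIV. \<Sum>i\<in>UNIV. upper_metric (w x) k i * nabla2 w (torsion w) x k i j)"

text \<open>The right-hand side of the Ricci-harmonic flow.\<close>

definition ricci_harmonic :: "(real^7 \<Rightarrow> tensor3) \<Rightarrow> real^7 \<Rightarrow> tensor3" where
  "ricci_harmonic w x i j k =
     diamond (\<lambda>a b. - ricci w x a b + 3 * torsion_square w x a b
                    - torsion_norm_sq w x * lower_metric (w x) a b) (w x) i j k
     + contract_dual (div_torsion w x) (w x) i j k"


section \<open>\<open>G\<^sub>2\<close>-structures on manifolds\<close>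

text \<open>A 3-form on the manifold with atlas \<open>A\<close> is a family of component functions, one for each
  chart (\<open>\<phi> c\<close> being a function on the image of \<open>c\<close>), which are related by the tensor
  transformation law on overlaps.\<close>

definition jacobian :: "'a chart \<Rightarrow> 'a chart \<Rightarrow> real^7 \<Rightarrow> tensor2" where
  "jacobian c d x a i = partial i (\<lambda>y. transition c d y $ a) x"

definition smooth_3_form :: "'a chart set \<Rightarrow> ('a chart \<Rightarrow> real^7 \<Rightarrow> tensor3) \<Rightarrow> bool" where
  "smooth_3_form A \<phi> \<longleftrightarrow>
     (\<forall>c\<in>A. \<forall>i j k. smooth_on (chart_image c) (\<lambda>x. \<phi> c x i j k)) \<and>
     (\<forall>c\<in>A. \<forall>x\<in>chart_image c. alternating3 (\<phi> c x)) \<and>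
     (\<forall>c\<in>A. \<forall>d\<in>A. \<forall>x\<in>overlap c d. \<forall>i j k.
        \<phi> c x i j k =
          (\<Sum>a\<in>UNIV. \<Sum>b\<in>UNIV. \<Sum>e\<in>UNIV.
             jacobian c d x a i * jacobian c d x b j * jacobian c d x e k
             * \<phi> d (transition c d x) a b e))"

definition G2_structure :: "'a chart set \<Rightarrow> ('a chart \<Rightarrow> real^7 \<Rightarrow> tensor3) \<Rightarrow> bool" where
  "G2_structure A \<phi> \<longleftrightarrow>
     smooth_3_form A \<phi> \<and> (\<forall>c\<in>A. \<forall>x\<in>chart_image c. nondegenerate (\<phi> c x))"

definition stationary_ricci_harmonic ::
  "'a chart set \<Rightarrow> ('a chart \<Rightarrow> real^7 \<Rightarrow> tensor3) \<Rightarrow> bool" where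
  "stationary_ricci_harmonic A \<phi> \<longleftrightarrow>
     (\<forall>c\<in>A. \<forall>x\<in>chart_image c. \<forall>i j k. ricci_harmonic (\<phi> c) x i j k = 0)"

definition torsion_free :: "'a chart set \<Rightarrow> ('a chart \<Rightarrow> real^7 \<Rightarrow> tensor3) \<Rightarrow> bool" where
  "torsion_free A \<phi> \<longleftrightarrow>
     (\<forall>c\<in>A. \<forall>x\<in>chart_image c. \<forall>i j. torsion (\<phi> c) x i j = 0)"

end

theory Submission
  imports Defs
begin

text \<open>
  Contract the stationarity equation with the 3-form itself. The
  term \<open>div T \<lrcorner> \<psi>\<close> drops out, because \<open>\<phi>\<close> and \<open>X \<lrcorner> \<psi>\<close> lie in different irreducible
  \<open>G\<^sub>2\<close>-components of the 3-forms (\<open>trace_contract_dual\<close>), and \<open>h \<diamond> \<phi>\<close> contributes \<open>18\<close> times the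
  trace of \<open>h\<close> (\<open>trace_diamond\<close>). As the trace of \<open>T\<^sup>tT\<close> is \<open>|T|\<^sup>2\<close> and that of \<open>g\<close> is \<open>7\<close>, what
  remains is a single scalar equation, \<open>R = - 4 |T|\<^sup>2\<close> for the scalar curvature \<open>R\<close>.

  On the other hand the scalar curvature of any metric induced by a \<open>G\<^sub>2\<close>-structure is a divergence
  up to terms quadratic in the torsion. Let \<open>V\<close> be the vector field obtained by contracting
  \<open>\<nabla>\<phi>\<close> with \<open>\<phi>\<close>. Taking its divergence and commuting the two covariant derivatives that
  fall on \<open>\<phi>\<close> produces curvature terms which add up to a multiple of \<open>R\<close>
  (\<open>curvature_contraction\<close>, \<open>divergence_identity\<close>). The quadratic remainder
  satisfies a pointwise inequality (\<open>torsion_inequality\<close>) that, once \<open>R = - 4 |T|\<^sup>2\<close> is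
  inserted, still leaves a definite sign: \<open>div V \<le> - 2 |T|\<^sup>2\<close> (\<open>stationary_divergence\<close>).
  On a compact manifold the integral of a divergence vanishes, so \<open>T = 0\<close>.

  All tensor identities are verified in a frame in which the
  3-form is the standard one, so that they become finite computations with the structure constants of the
  octonions; the substance of this reduction is that every nondegenerate 3-form, in the sense that it
  determines a metric, has such a frame (\<open>model_frame_exists\<close>). Existence of the torsion tensor
  is a consequence: \<open>\<nabla>\<phi>\<close> lies in the 7-dimensional component since \<open>\<phi>\<close> has constant
  contraction with itself (\<open>parallel_identity\<close>).

  The field \<open>V\<close> is defined chart by chart. Its transformation law (\<open>V_map\<close>) is not derived from
  that of the Levi-Civita connection: \<open>V\<close> can be written with the exterior derivative
  of \<open>\<phi>\<close> instead of \<open>\<nabla>\<phi>\<close> (\<open>Y_ext_d\<close>), and the exterior derivative transforms without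
  second derivatives of the coordinate change. The divergence theorem is obtained from a partition of
  unity, the translation invariance of Lebesgue measure and the change of variables formula
  (\<open>divergence_theorem\<close>); functions of class \<open>C\<^sup>1\<close> suffice for it.

  The converse direction is local: if \<open>T = 0\<close> then \<open>\<phi>\<close> is parallel, hence invariant under
  the curvature, which forces the Ricci tensor to vanish (\<open>torsion_free_stationary\<close>).
\<close>

section \<open>The index type and the Levi-Civita symbol\<close>

lemma exhaust_7:
  fixes x :: 7
  shows "x = 1 \<or> x = 2 \<or> x = 3 \<or> x = 4 \<or> x = 5 \<or> x = 6 \<or> x = 7"
proof (induct x)
  case (of_int z)
  then have "z = 0 \<or> z = 1 \<or> z = 2 \<or> z = 3 \<or> z = 4 \<or> z = 5 \<or> z = 6" by auto
  then show ?case by auto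
qed

lemma UNIV_7: "UNIV = {1, 2, 3, 4, 5, 6, 7::7}"
  using exhaust_7 by auto

lemma forall_7: "(\<forall>i::7. P i) \<longleftrightarrow> P 1 \<and> P 2 \<and> P 3 \<and> P 4 \<and> P 5 \<and> P 6 \<and> P 7"
  by (metis exhaust_7)

lemma sum_7: "sum f (UNIV::7 set) = f 1 + f 2 + f 3 + f 4 + f 5 + f 6 + f 7"
  unfolding UNIV_7 by (simp add: ac_simps)

lemma prod_7: "prod f (UNIV::7 set) = f 1 * f 2 * f 3 * f 4 * f 5 * f 6 * f 7"
  unfolding UNIV_7 by (simp add: ac_simps)

definition tup :: "'b \<Rightarrow> 'b \<Rightarrow> 'b \<Rightarrow> 'b \<Rightarrow> 'b \<Rightarrow> 'b \<Rightarrow> 'b \<Rightarrow> 7 \<Rightarrow> 'b" where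
  "tup a b c d e f g i = (if i = 1 then a else if i = 2 then b else if i = 3 then c
     else if i = 4 then d else if i = 5 then e else if i = 6 then f else g)"

lemma tup_simps [simp]:
  "tup a b c d e f g 1 = a" "tup a b c d e f g 2 = b" "tup a b c d e f g 3 = c"
  "tup a b c d e f g 4 = d" "tup a b c d e f g 5 = e" "tup a b c d e f g 6 = f"
  "tup a b c d e f g 7 = g"
  by (simp_all add: tup_def)

lemma tup_collapse: "tup (p 1) (p 2) (p 3) (p 4) (p 5) (p 6) (p 7) = p"
proof
  fix i show "tup (p 1) (p 2) (p 3) (p 4) (p 5) (p 6) (p 7) i = p i"
    using exhaust_7[of i] by auto
qed

lemma sum_functions:
  fixes h :: "(7 \<Rightarrow> 7) \<Rightarrow> 'b::comm_monoid_add"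
  shows "(\<Sum>p\<in>UNIV. h p) = (\<Sum>a\<in>UNIV. \<Sum>b\<in>UNIV. \<Sum>c\<in>UNIV. \<Sum>d\<in>UNIV. \<Sum>e\<in>UNIV. \<Sum>f\<in>UNIV. \<Sum>g\<in>UNIV.
     h (tup a b c d e f g))"
proof -
  have bij: "bij_betw (\<lambda>(a,b,c,d,e,f,g). tup a b c d e f g) UNIV UNIV"
    by (rule bij_betw_byWitness[where f' = "\<lambda>p. (p 1, p 2, p 3, p 4, p 5, p 6, p 7)"])
       (auto simp: tup_collapse)
  have "(\<Sum>p\<in>UNIV. h p) = (\<Sum>x\<in>UNIV. h ((\<lambda>(a,b,c,d,e,f,g). tup a b c d e f g) x))"
    by (rule sum.reindex_bij_betw[OF bij, symmetric])
  also have "\<dots> = (\<Sum>a\<in>UNIV. \<Sum>b\<in>UNIV. \<Sum>c\<in>UNIV. \<Sum>d\<in>UNIV. \<Sum>e\<in>UNIV. \<Sum>f\<in>UNIV. \<Sum>g\<in>UNIV.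
     h (tup a b c d e f g))"
    by (simp only: sum.cartesian_product UNIV_Times_UNIV) (rule sum.cong, auto)
  finally show ?thesis .
qed

definition levi :: "(7 \<Rightarrow> 7) \<Rightarrow> real" where
  "levi p = (if p permutes UNIV then of_int (sign p) else 0)"

definition eps :: "7 \<Rightarrow> 7 \<Rightarrow> 7 \<Rightarrow> 7 \<Rightarrow> 7 \<Rightarrow> 7 \<Rightarrow> 7 \<Rightarrow> real" where
  "eps a b c d e f g = levi (tup a b c d e f g)"

lemma sum_permutations:
  "(\<Sum>p | p permutes (UNIV::7 set). of_int (sign p) * h p) = (\<Sum>p\<in>UNIV. levi p * h p)"
proof -
  have "(\<Sum>p\<in>UNIV. levi p * h p) = (\<Sum>p | p permutes (UNIV::7 set). levi p * h p)"
    by (rule sum.mono_neutral_right) (auto simp: levi_def)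
  also have "\<dots> = (\<Sum>p | p permutes (UNIV::7 set). of_int (sign p) * h p)"
    by (rule sum.cong) (auto simp: levi_def)
  finally show ?thesis ..
qed

lemma levi_swap:
  assumes "i \<noteq> j"
  shows "levi (p \<circ> Transposition.transpose i j) = - levi p"
proof (cases "p permutes UNIV")
  case True
  have t: "Transposition.transpose i j permutes (UNIV::7 set)" by (rule permutes_swap_id) auto
  have "sign (p \<circ> Transposition.transpose i j) = sign p * sign (Transposition.transpose i j)"
    using True t by (intro sign_compose) (auto simp: permutation_permutes)
  then show ?thesis using True t assms
    by (simp add: levi_def permutes_compose sign_swap_id)
next
  case False
  have t: "Transposition.transpose i j permutes (UNIV::7 set)" by (rule permutes_swap_id) auto
  have "\<not> (p \<circ> Transposition.transpose i j) permutes UNIV"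
  proof
    assume "(p \<circ> Transposition.transpose i j) permutes UNIV"
    from permutes_compose[OF t this] have "p permutes UNIV" by (simp add: comp_assoc)
    with False show False by blast
  qed
  with False show ?thesis by (simp add: levi_def)
qed

lemma eps_swap:
  "eps b a c d e f g = - eps a b c d e f g"
  "eps a c b d e f g = - eps a b c d e f g"
  "eps a b d c e f g = - eps a b c d e f g"
  "eps a b c e d f g = - eps a b c d e f g"
  "eps a b c d f e g = - eps a b c d e f g"
  "eps a b c d e g f = - eps a b c d e f g"
proof -
  have *: "tup b a c d e f g = tup a b c d e f g \<circ> Transposition.transpose 1 2"
    "tup a c b d e f g = tup a b c d e f g \<circ> Transposition.transpose 2 3"
    "tup a b d c e f g = tup a b c d e f g \<circ> Transposition.transpose 3 4"
    "tup a b c e d f g = tup a b c d e f g \<circ> Transposition.transpose 4 5"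
    "tup a b c d f e g = tup a b c d e f g \<circ> Transposition.transpose 5 6"
    "tup a b c d e g f = tup a b c d e f g \<circ> Transposition.transpose 6 7"
    unfolding fun_eq_iff forall_7 by (simp_all add: Transposition.transpose_def)
  show "eps b a c d e f g = - eps a b c d e f g"
    "eps a c b d e f g = - eps a b c d e f g"
    "eps a b d c e f g = - eps a b c d e f g"
    "eps a b c e d f g = - eps a b c d e f g"
    "eps a b c d f e g = - eps a b c d e f g"
    "eps a b c d e g f = - eps a b c d e f g"
    unfolding eps_def * by (simp_all add: levi_swap)
qed

lemma eps_id: "eps 1 2 3 4 5 6 7 = 1"
proof -
  have "tup 1 2 3 4 5 6 7 = id" using tup_collapse[of id] by simp
  then show ?thesis by (simp add: eps_def levi_def permutes_id)
qed

lemma eps_repeat: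
  "\<not> distinct [a,b,c,d,e,f,g] \<Longrightarrow> eps a b c d e f g = 0"
proof -
  assume nd: "\<not> distinct [a,b,c,d,e,f,g]"
  have "\<not> tup a b c d e f g permutes UNIV"
  proof
    assume p: "tup a b c d e f g permutes UNIV"
    have "inj (tup a b c d e f g)" using p by (rule permutes_inj)
    then have "distinct (map (tup a b c d e f g) [1,2,3,4,5,6,7])"
      unfolding distinct_map by (intro conjI) (simp, meson inj_on_subset subset_UNIV)
    with nd show False by simp
  qed
  then show ?thesis by (simp add: eps_def levi_def)
qed

text \<open>Sums over the squares of the diagonal-free index sets, exploiting antisymmetry.\<close>

lemma contraction_wedge_eps:
  "contraction_wedge w i j = (\<Sum>a\<in>UNIV. \<Sum>b\<in>UNIV. \<Sum>c\<in>UNIV. \<Sum>d\<in>UNIV. \<Sum>e\<in>UNIV. \<Sum>f\<in>UNIV. \<Sum>g\<in>UNIV.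
     eps a b c d e f g * (w i a b * w j c d * w e f g)) / 24"
  unfolding contraction_wedge_def mult.assoc sum_permutations sum_functions
  by (simp add: eps_def fact_numeral mult.assoc)

lemma hodge_dual_eps:
  "hodge_dual w i j k l = volume_coeff (metric w) (orientation w) *
     (\<Sum>a\<in>UNIV. \<Sum>b\<in>UNIV. \<Sum>c\<in>UNIV. eps a b c i j k l * raise3 w a b c) / 6"
proof -
  have delta: "(\<Sum>g\<in>UNIV. X g * (if C \<and> g = l then r else 0)) = X l * (if C then r else 0)"
    for X :: "7 \<Rightarrow> real" and C l r by (cases C) (simp_all add: if_distrib[of "(*) _"] cong: if_cong)
  let ?Q = "\<lambda>p::7\<Rightarrow>7. p 4 = i \<and> p 5 = j \<and> p 6 = k \<and> p 7 = l"
  let ?h = "\<lambda>p::7\<Rightarrow>7. raise3 w (p 1) (p 2) (p 3)"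
  have "(\<Sum>p | p permutes (UNIV :: 7 set) \<and> p 4 = i \<and> p 5 = j \<and> p 6 = k \<and> p 7 = l.
        of_int (sign p) * ?h p)
     = (\<Sum>p\<in>{p. p permutes (UNIV::7 set)} \<inter> {p. ?Q p}. of_int (sign p) * ?h p)"
    by (rule sum.cong) auto
  also have "\<dots> = (\<Sum>p | p permutes (UNIV::7 set). of_int (sign p) * (if ?Q p then ?h p else 0))"
    by (subst sum.inter_restrict) (auto intro!: sum.cong simp: finite_permutations)
  also have "\<dots> = (\<Sum>a\<in>UNIV. \<Sum>b\<in>UNIV. \<Sum>c\<in>UNIV. \<Sum>d\<in>UNIV. \<Sum>e\<in>UNIV. \<Sum>f\<in>UNIV. \<Sum>g\<in>UNIV.
     eps a b c d e f g * (if d = i \<and> e = j \<and> f = k \<and> g = l then raise3 w a b c else 0))"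
    unfolding sum_permutations sum_functions eps_def tup_simps by (rule refl)
  also have "\<dots> = (\<Sum>a\<in>UNIV. \<Sum>b\<in>UNIV. \<Sum>c\<in>UNIV. eps a b c i j k l * raise3 w a b c)"
    unfolding conj_assoc[symmetric] by (simp only: delta) (simp add: if_distrib[of "(*) _"] cong: if_cong)
  finally show ?thesis
    unfolding hodge_dual_def by (simp add: fact_numeral)
qed

lemma det_eps_row:
  fixes F :: "real^7^7"
  shows "(\<Sum>p\<in>UNIV. levi p * (\<Prod>k\<in>UNIV. F $ p k $ q k)) = det F * levi q"
proof -
  have "(\<Sum>p\<in>UNIV. levi p * (\<Prod>k\<in>UNIV. F $ p k $ q k)) = det (transpose (\<chi> i j. F $ i $ q j))"
    unfolding det_def sum_permutations[symmetric] by (simp add: Finite_Cartesian_Product.transpose_def)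
  also have "\<dots> = det (\<chi> i j. F $ i $ q j)" by (rule det_transpose)
  also have "\<dots> = det F * levi q"
  proof (cases "q permutes UNIV")
    case True
    then show ?thesis by (simp add: det_permute_columns levi_def)
  next
    case False
    then have "\<not> inj q"
      using bij_imp_permutes[of q UNIV] finite_UNIV_inj_surj[of q] by (auto simp: bij_betw_def)
    then obtain a b where ab: "a \<noteq> b" "q a = q b" by (auto simp: inj_def)
    have "det (\<chi> i j. F $ i $ q j) = 0"
      by (rule det_identical_columns[of a b]) (use ab in \<open>auto simp: column_def vec_eq_iff\<close>)
    with False show ?thesis by (simp add: levi_def)
  qed
  finally show ?thesis .
qed

lemma eps_det:
  fixes F :: "real^7^7"
  shows "(\<Sum>a\<in>UNIV. \<Sum>b\<in>UNIV. \<Sum>c\<in>UNIV. \<Sum>d\<in>UNIV. \<Sum>e\<in>UNIV. \<Sum>f\<in>UNIV. \<Sum>g\<in>UNIV.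
     eps a b c d e f g * (F$a$h * F$b$i * F$c$j * F$d$k * F$e$l * F$f$m * F$g$n)) = det F * eps h i j k l m n"
  using det_eps_row[of F "tup h i j k l m n"]
  unfolding sum_functions eps_def prod_7 by simp

section \<open>Pull-back of tensors along linear maps\<close>

definition pull2 :: "real^7^7 \<Rightarrow> tensor2 \<Rightarrow> tensor2" where
  "pull2 F w i j = (\<Sum>a\<in>UNIV. \<Sum>b\<in>UNIV. F$a$i * F$b$j * w a b)"

definition pull3 :: "real^7^7 \<Rightarrow> tensor3 \<Rightarrow> tensor3" where
  "pull3 F w i j k = (\<Sum>a\<in>UNIV. \<Sum>b\<in>UNIV. \<Sum>c\<in>UNIV. F$a$i * F$b$j * F$c$k * w a b c)"

lemma contraction_wedge_pull3:
  "contraction_wedge (pull3 F w) i j = det F * pull2 F (contraction_wedge w) i j"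
proof -
  let ?X = "\<lambda>a b p. w a (p 1) (p 2) * w b (p 3) (p 4) * w (p 5) (p 6) (p (7::7))"
  have factor: "(\<Sum>b\<in>UNIV. A * (B b * C)) = A * (\<Sum>b\<in>UNIV. B b) * C" for A C :: real and B :: "7 \<Rightarrow> real"
    by (simp add: sum_distrib_left sum_distrib_right mult.assoc)
  have 1: "pull3 F w i (p 1) (p 2) * pull3 F w j (p 3) (p 4) * pull3 F w (p 5) (p 6) (p 7)
    = (\<Sum>a\<in>UNIV. \<Sum>b\<in>UNIV. F$a$i * F$b$j * (\<Sum>q\<in>UNIV. (\<Prod>k\<in>UNIV. F $ q k $ p k) * ?X a b q))" for p :: "7 \<Rightarrow> 7"
  proof -
    have "(\<Sum>b\<in>UNIV. \<Sum>q\<in>UNIV. F$a$i * F$b$j * ((\<Prod>k\<in>UNIV. F $ q k $ p k) * ?X a b q))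
      = (\<Sum>a1\<in>UNIV. \<Sum>a2\<in>UNIV. F$a$i * F$a1$p 1 * F$a2$p 2 * w a a1 a2) *
        (\<Sum>b\<in>UNIV. \<Sum>a3\<in>UNIV. \<Sum>a4\<in>UNIV. F$b$j * F$a3$p 3 * F$a4$p 4 * w b a3 a4) *
        (\<Sum>a5\<in>UNIV. \<Sum>a6\<in>UNIV. \<Sum>a7\<in>UNIV. F$a5$p 5 * F$a6$p 6 * F$a7$p 7 * w a5 a6 a7)" (is "_ = ?R") for a
    proof -
      have "(\<Sum>b\<in>UNIV. \<Sum>q\<in>UNIV. F$a$i * F$b$j * ((\<Prod>k\<in>UNIV. F $ q k $ p k) * ?X a b q))
       = (\<Sum>b\<in>UNIV. \<Sum>a1\<in>UNIV. \<Sum>a2\<in>UNIV. \<Sum>a3\<in>UNIV. \<Sum>a4\<in>UNIV. \<Sum>a5\<in>UNIV. \<Sum>a6\<in>UNIV. \<Sum>a7\<in>UNIV.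
           (F$a$i * F$a1$p 1 * F$a2$p 2 * w a a1 a2) * ((F$b$j * F$a3$p 3 * F$a4$p 4 * w b a3 a4) *
             (F$a5$p 5 * F$a6$p 6 * F$a7$p 7 * w a5 a6 a7)))"
        unfolding sum_functions prod_7 by (simp add: mult_ac)
      also have "\<dots> = (\<Sum>b\<in>UNIV. (\<Sum>a1\<in>UNIV. \<Sum>a2\<in>UNIV. F$a$i * F$a1$p 1 * F$a2$p 2 * w a a1 a2) *
          ((\<Sum>a3\<in>UNIV. \<Sum>a4\<in>UNIV. F$b$j * F$a3$p 3 * F$a4$p 4 * w b a3 a4) *
        (\<Sum>a5\<in>UNIV. \<Sum>a6\<in>UNIV. \<Sum>a7\<in>UNIV. F$a5$p 5 * F$a6$p 6 * F$a7$p 7 * w a5 a6 a7)))"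
        by (simp only: sum_distrib_left[symmetric] sum_distrib_right[symmetric])
      also have "\<dots> = ?R" by (rule factor)
      finally show ?thesis .
    qed
    note * = this
    have "(\<Sum>a\<in>UNIV. \<Sum>b\<in>UNIV. F$a$i * F$b$j * (\<Sum>q\<in>UNIV. (\<Prod>k\<in>UNIV. F $ q k $ p k) * ?X a b q))
      = (\<Sum>a\<in>UNIV. \<Sum>b\<in>UNIV. \<Sum>q\<in>UNIV. F$a$i * F$b$j * ((\<Prod>k\<in>UNIV. F $ q k $ p k) * ?X a b q))"
      by (simp only: sum_distrib_left)
    also have "\<dots> = pull3 F w i (p 1) (p 2) * pull3 F w j (p 3) (p 4) * pull3 F w (p 5) (p 6) (p 7)"
      unfolding * sum_distrib_right[symmetric] pull3_def by (rule refl)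
    finally show ?thesis ..
  qed
  have "contraction_wedge (pull3 F w) i j = (\<Sum>p\<in>UNIV. levi p * (\<Sum>a\<in>UNIV. \<Sum>b\<in>UNIV. F$a$i * F$b$j * (\<Sum>q\<in>UNIV. (\<Prod>k\<in>UNIV. F $ q k $ p k) * ?X a b q))) / 24"
    unfolding contraction_wedge_def 1[symmetric] sum_permutations[symmetric] by (simp add: fact_numeral mult.assoc)
  also have "(\<Sum>p\<in>UNIV. levi p * (\<Sum>a\<in>UNIV. \<Sum>b\<in>UNIV. F$a$i * F$b$j * (\<Sum>q\<in>UNIV. (\<Prod>k\<in>UNIV. F $ q k $ p k) * ?X a b q)))
    = (\<Sum>a\<in>UNIV. \<Sum>b\<in>UNIV. F$a$i * F$b$j * (\<Sum>p\<in>UNIV. levi p * (\<Sum>q\<in>UNIV. (\<Prod>k\<in>UNIV. F $ q k $ p k) * ?X a b q)))"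
    unfolding sum_distrib_left
    by (subst sum.swap, rule sum.cong[OF refl], subst sum.swap) (simp only: mult_ac)
  also have "(\<lambda>a b. \<Sum>p\<in>UNIV. levi p * (\<Sum>q\<in>UNIV. (\<Prod>k\<in>UNIV. F $ q k $ p k) * ?X a b q))
    = (\<lambda>a b. det F * (\<Sum>q\<in>UNIV. levi q * ?X a b q))"
  proof (intro ext)
    fix a b
    have c: "(\<Sum>p\<in>UNIV. levi p * (\<Prod>k\<in>UNIV. F $ q k $ p k)) = det F * levi q" for q :: "7 \<Rightarrow> 7"
      using det_eps_row[of "transpose F" q] by (simp add: transpose_def det_transpose[unfolded transpose_def])
    have "(\<Sum>p\<in>UNIV. levi p * (\<Sum>q\<in>UNIV. (\<Prod>k\<in>UNIV. F $ q k $ p k) * ?X a b q))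
      = (\<Sum>q\<in>UNIV. (\<Sum>p\<in>UNIV. levi p * (\<Prod>k\<in>UNIV. F $ q k $ p k)) * ?X a b q)"
      unfolding sum_distrib_left sum_distrib_right by (subst sum.swap) (simp only: mult_ac)
    then show "(\<Sum>p\<in>UNIV. levi p * (\<Sum>q\<in>UNIV. (\<Prod>k\<in>UNIV. F $ q k $ p k) * ?X a b q)) = det F * (\<Sum>q\<in>UNIV. levi q * ?X a b q)"
      unfolding c by (simp add: sum_distrib_left mult_ac)
  qed
  finally show ?thesis
    unfolding pull2_def contraction_wedge_def sum_permutations mult.assoc
    by (simp add: fact_numeral sum_distrib_left sum_divide_distrib mult_ac)
qed

section \<open>Explicit evaluation of alternating sums\<close>

definition num7 :: "7 \<Rightarrow> nat" where
  "num7 i = (if i = 1 then 0 else if i = 2 then 1 else if i = 3 then 2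
     else if i = 4 then 3 else if i = 5 then 4 else if i = 6 then 5 else 6)"

lemma num7_simps [simp]:
  "num7 1 = 0" "num7 2 = 1" "num7 3 = 2" "num7 4 = 3" "num7 5 = 4" "num7 6 = 5" "num7 7 = 6"
  by (simp_all add: num7_def)

lemma eps_eq_0:
  "eps a a c d e f g = 0"  "eps a b a d e f g = 0"  "eps a b c a e f g = 0"  "eps a b c d a f g = 0"
     "eps a b c d e a g = 0"  "eps a b c d e f a = 0"  "eps a b b d e f g = 0"  "eps a b c b e f g = 0"
     "eps a b c d b f g = 0"  "eps a b c d e b g = 0"  "eps a b c d e f b = 0"  "eps a b c c e f g = 0"
     "eps a b c d c f g = 0"  "eps a b c d e c g = 0"  "eps a b c d e f c = 0"  "eps a b c d d f g = 0"
     "eps a b c d e d g = 0"  "eps a b c d e f d = 0"  "eps a b c d e e g = 0"  "eps a b c d e f e = 0"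
     "eps a b c d e f f = 0"
  by (rule eps_repeat, simp)+

lemma eps_sort:
  "num7 b < num7 a \<Longrightarrow> eps a b c d e f g = - eps b a c d e f g"
  "num7 c < num7 b \<Longrightarrow> eps a b c d e f g = - eps a c b d e f g"
  "num7 d < num7 c \<Longrightarrow> eps a b c d e f g = - eps a b d c e f g"
  "num7 e < num7 d \<Longrightarrow> eps a b c d e f g = - eps a b c e d f g"
  "num7 f < num7 e \<Longrightarrow> eps a b c d e f g = - eps a b c d f e g"
  "num7 g < num7 f \<Longrightarrow> eps a b c d e f g = - eps a b c d e g f"
  by (rule eps_swap)+

lemmas eps_eval = eps_eq_0 eps_sort eps_id

definition pair_sum :: "(7 \<Rightarrow> 7 \<Rightarrow> real) \<Rightarrow> real" where
  "pair_sum f =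
     f 1 2 + f 1 3 + f 1 4 + f 1 5 + f 1 6 + f 1 7 + f 2 3 + f 2 4 + f 2 5 + f 2 6 + f 2 7 + f 3 4 +
     f 3 5 + f 3 6 + f 3 7 + f 4 5 + f 4 6 + f 4 7 + f 5 6 + f 5 7 + f 6 7"

definition triple_sum :: "(7 \<Rightarrow> 7 \<Rightarrow> 7 \<Rightarrow> real) \<Rightarrow> real" where
  "triple_sum f =
     f 1 2 3 + f 1 2 4 + f 1 2 5 + f 1 2 6 + f 1 2 7 + f 1 3 4 + f 1 3 5 + f 1 3 6 + f 1 3 7 + f 1 4
     5 + f 1 4 6 + f 1 4 7 + f 1 5 6 + f 1 5 7 + f 1 6 7 + f 2 3 4 + f 2 3 5 + f 2 3 6 + f 2 3 7 + f
     2 4 5 + f 2 4 6 + f 2 4 7 + f 2 5 6 + f 2 5 7 + f 2 6 7 + f 3 4 5 + f 3 4 6 + f 3 4 7 + f 3 5 6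
     + f 3 5 7 + f 3 6 7 + f 4 5 6 + f 4 5 7 + f 4 6 7 + f 5 6 7"

lemma sum_eq_pair_sum:
  assumes "\<And>a b. f a b = f b a" "\<And>a. f a a = 0"
  shows "(\<Sum>a\<in>UNIV. \<Sum>b\<in>UNIV. f a b) = 2 * pair_sum f"
  unfolding sum_7 pair_sum_def by (simp add: assms(2) assms(1))

lemma sum_eq_triple_sum:
  assumes 1: "\<And>a b c. f a b c = f b a c" and 2: "\<And>a b c. f a b c = f a c b" and 0: "\<And>a c. f a a c = 0"
  shows "(\<Sum>a\<in>UNIV. \<Sum>b\<in>UNIV. \<Sum>c\<in>UNIV. f a b c) = 6 * triple_sum f"
proof -
  have 3: "f a c a = 0" "f c a a = 0" for a c using 0 1 2 by metis+
  show ?thesis unfolding sum_7 triple_sum_def by (simp add: 0 3 1 2)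
qed

lemma alternating3_swap:
  assumes "alternating3 w"
  shows "w j i k = - w i j k" "w i k j = - w i j k" "w k j i = - w i j k"
  using assms unfolding alternating3_def by metis+

lemma alternating3_repeat:
  assumes "alternating3 w"
  shows "w i i k = 0" "w i k i = 0" "w k i i = 0"
  using alternating3_swap[OF assms, of i i k] alternating3_swap[OF assms, of i k i]
    alternating3_swap[OF assms, of k i i] by linarith+

lemma alternating3_sort:
  assumes "alternating3 w"
  shows "num7 b < num7 a \<Longrightarrow> w a b c = - w b a c" "num7 c < num7 b \<Longrightarrow> w a b c = - w a c b"
  using alternating3_swap[OF assms] by metis+

lemma alternating3_eqI:
  assumes u: "alternating3 u" and w: "alternating3 w"
    and "u 1 2 3 = w 1 2 3" "u 1 2 4 = w 1 2 4" "u 1 2 5 = w 1 2 5" "u 1 2 6 = w 1 2 6" "u 1 2 7 = w 1 2 7" "u 1 3 4 = w 1 3 4" "u 1 3 5 = w 1 3 5" "u 1 3 6 =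
     w 1 3 6" "u 1 3 7 = w 1 3 7" "u 1 4 5 = w 1 4 5" "u 1 4 6 = w 1 4 6" "u 1 4 7 = w 1 4 7" "u 1 5 6 = w 1 5 6" "u 1 5 7 = w 1 5 7" "u 1 6 7 = w 1 6 7"
     "u 2 3 4 = w 2 3 4" "u 2 3 5 = w 2 3 5" "u 2 3 6 = w 2 3 6" "u 2 3 7 = w 2 3 7" "u 2 4 5 = w 2 4 5" "u 2 4 6 = w 2 4 6" "u 2 4 7 = w 2 4 7" "u 2 5 6 =
     w 2 5 6" "u 2 5 7 = w 2 5 7" "u 2 6 7 = w 2 6 7" "u 3 4 5 = w 3 4 5" "u 3 4 6 = w 3 4 6" "u 3 4 7 = w 3 4 7" "u 3 5 6 = w 3 5 6" "u 3 5 7 = w 3 5 7"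
     "u 3 6 7 = w 3 6 7" "u 4 5 6 = w 4 5 6" "u 4 5 7 = w 4 5 7" "u 4 6 7 = w 4 6 7" "u 5 6 7 = w 5 6 7"
  shows "u = w"
proof -
  have "\<forall>i j k. u i j k = w i j k"
    unfolding forall_7
    using assms(3-)
    by (simp add: alternating3_repeat[OF u] alternating3_repeat[OF w] alternating3_sort[OF u] alternating3_sort[OF w])
  then show ?thesis by (simp add: fun_eq_iff)
qed

definition wedge_complement :: "tensor3 \<Rightarrow> tensor4" where
  "wedge_complement w a b c d = triple_sum (\<lambda>e f g. eps a b c d e f g * w e f g)"

definition wedge_row :: "tensor3 \<Rightarrow> 7 \<Rightarrow> tensor2" where
  "wedge_row w j a b = pair_sum (\<lambda>c d. w j c d * wedge_complement w a b c d)"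

lemma contraction_wedge_pair_sum:
  assumes "alternating3 w"
  shows "contraction_wedge w i j = pair_sum (\<lambda>a b. w i a b * wedge_row w j a b)"
proof -
  note sw = alternating3_swap[OF assms]
  note rp = alternating3_repeat[OF assms]
  have 1: "(\<Sum>e\<in>UNIV. \<Sum>f\<in>UNIV. \<Sum>g\<in>UNIV. eps a b c d e f g * (w i a b * w j c d * w e f g))
     = w i a b * (w j c d * (6 * wedge_complement w a b c d))" for a b c d
  proof -
    have "(\<Sum>e\<in>UNIV. \<Sum>f\<in>UNIV. \<Sum>g\<in>UNIV. eps a b c d e f g * w e f g) = 6 * wedge_complement w a b c d"
      unfolding wedge_complement_def
      by (rule sum_eq_triple_sum) (subst eps_swap(5), subst sw(1), simp, subst eps_swap(6), subst sw(2), simp, simp add: rp)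
    moreover have "(\<Sum>e\<in>UNIV. \<Sum>f\<in>UNIV. \<Sum>g\<in>UNIV. eps a b c d e f g * (w i a b * w j c d * w e f g))
      = w i a b * w j c d * (\<Sum>e\<in>UNIV. \<Sum>f\<in>UNIV. \<Sum>g\<in>UNIV. eps a b c d e f g * w e f g)"
      unfolding sum_distrib_left by (simp only: mult_ac)
    ultimately show ?thesis by simp
  qed
  have sw4: "wedge_complement w b a c d = - wedge_complement w a b c d"
    "wedge_complement w a b d c = - wedge_complement w a b c d" for a b c d
    unfolding wedge_complement_def triple_sum_def
      eps_swap(1)[of b a] eps_swap(3)[of a b d c] by simp_all
  have 2: "(\<Sum>c\<in>UNIV. \<Sum>d\<in>UNIV. w i a b * (w j c d * (6 * wedge_complement w a b c d)))
     = w i a b * (12 * wedge_row w j a b)" for a b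
  proof -
    have "(\<Sum>c\<in>UNIV. \<Sum>d\<in>UNIV. w j c d * wedge_complement w a b c d) = 2 * wedge_row w j a b"
      unfolding wedge_row_def
      by (rule sum_eq_pair_sum) (subst sw4(2), subst sw(2), simp, simp add: rp)
    moreover have "(\<Sum>c\<in>UNIV. \<Sum>d\<in>UNIV. w i a b * (w j c d * (6 * wedge_complement w a b c d)))
      = 6 * w i a b * (\<Sum>c\<in>UNIV. \<Sum>d\<in>UNIV. w j c d * wedge_complement w a b c d)"
      unfolding sum_distrib_left by (simp only: mult_ac)
    ultimately show ?thesis by simp
  qed
  have sw2: "wedge_row w j b a = - wedge_row w j a b" for a b
    unfolding wedge_row_def pair_sum_def sw4(1)[of b a] by simp
  have "(\<Sum>a\<in>UNIV. \<Sum>b\<in>UNIV. w i a b * wedge_row w j a b) = 2 * pair_sum (\<lambda>a b. w i a b * wedge_row w j a b)"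
    by (rule sum_eq_pair_sum) (subst sw2, subst sw(2), simp, simp add: rp)
  moreover have "(\<Sum>a\<in>UNIV. \<Sum>b\<in>UNIV. w i a b * (12 * wedge_row w j a b))
     = 12 * (\<Sum>a\<in>UNIV. \<Sum>b\<in>UNIV. w i a b * wedge_row w j a b)"
    unfolding sum_distrib_left by (simp only: mult_ac)
  ultimately show ?thesis
    unfolding contraction_wedge_eps 1 2 by simp
qed

section \<open>The model 3-form\<close>

definition cross_index :: "7 \<Rightarrow> 7 \<Rightarrow> 7" where
  "cross_index i j = tup
     (tup 1 3 2 5 4 7 6 j)
     (tup 3 2 1 6 7 4 5 j)
     (tup 2 1 3 7 6 5 4 j)
     (tup 5 6 7 4 1 2 3 j)
     (tup 4 7 6 1 5 3 2 j)
     (tup 7 4 5 2 3 6 1 j)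
     (tup 6 5 4 3 2 1 7 j) i"

definition cross_sign :: "7 \<Rightarrow> 7 \<Rightarrow> real" where
  "cross_sign i j = tup
     (tup 0 1 (-1) 1 (-1) (-1) 1 j)
     (tup (-1) 0 1 1 1 (-1) (-1) j)
     (tup 1 (-1) 0 1 (-1) 1 (-1) j)
     (tup (-1) (-1) (-1) 0 1 1 1 j)
     (tup 1 (-1) 1 (-1) 0 (-1) 1 j)
     (tup 1 1 (-1) (-1) 1 0 (-1) j)
     (tup (-1) 1 1 (-1) (-1) 1 0 j) i"

definition phi0 :: tensor3 where
  "phi0 i j k = (if k = cross_index i j then cross_sign i j else 0)"

definition delta :: tensor2 where
  "delta i j = (if i = j then 1 else 0)"

definition psi0 :: tensor4 where
  "psi0 i j k l = delta i k * delta j l - delta i l * delta j k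
     - (if cross_index i j = cross_index k l then cross_sign i j * cross_sign k l else 0)"

lemma cross_values:
  "cross_index 1 1 = 1"  "cross_index 1 2 = 3"  "cross_index 1 3 = 2"  "cross_index 1 4 = 5"  "cross_index 1 5 =
  4"  "cross_index 1 6 = 7"  "cross_index 1 7 = 6"  "cross_index 2 1 = 3"  "cross_index 2 2 = 2"  "cross_index 2
  3 = 1"  "cross_index 2 4 = 6"  "cross_index 2 5 = 7"  "cross_index 2 6 = 4"  "cross_index 2 7 = 5"
  "cross_index 3 1 = 2"  "cross_index 3 2 = 1"  "cross_index 3 3 = 3"  "cross_index 3 4 = 7"  "cross_index 3 5 =
  6"  "cross_index 3 6 = 5"  "cross_index 3 7 = 4"  "cross_index 4 1 = 5"  "cross_index 4 2 = 6"  "cross_index 4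
  3 = 7"  "cross_index 4 4 = 4"  "cross_index 4 5 = 1"  "cross_index 4 6 = 2"  "cross_index 4 7 = 3"
  "cross_index 5 1 = 4"  "cross_index 5 2 = 7"  "cross_index 5 3 = 6"  "cross_index 5 4 = 1"  "cross_index 5 5 =
  5"  "cross_index 5 6 = 3"  "cross_index 5 7 = 2"  "cross_index 6 1 = 7"  "cross_index 6 2 = 4"  "cross_index 6
  3 = 5"  "cross_index 6 4 = 2"  "cross_index 6 5 = 3"  "cross_index 6 6 = 6"  "cross_index 6 7 = 1"
  "cross_index 7 1 = 6"  "cross_index 7 2 = 5"  "cross_index 7 3 = 4"  "cross_index 7 4 = 3"  "cross_index 7 5 =
  2"  "cross_index 7 6 = 1"  "cross_index 7 7 = 7"  "cross_sign 1 1 = 0"  "cross_sign 1 2 = 1"  "cross_sign 1 3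
  = - 1"  "cross_sign 1 4 = 1"  "cross_sign 1 5 = - 1"  "cross_sign 1 6 = - 1"  "cross_sign 1 7 = 1"
  "cross_sign 2 1 = - 1"  "cross_sign 2 2 = 0"  "cross_sign 2 3 = 1"  "cross_sign 2 4 = 1"  "cross_sign 2 5 = 1"
  "cross_sign 2 6 = - 1"  "cross_sign 2 7 = - 1"  "cross_sign 3 1 = 1"  "cross_sign 3 2 = - 1"  "cross_sign 3 3
  = 0"  "cross_sign 3 4 = 1"  "cross_sign 3 5 = - 1"  "cross_sign 3 6 = 1"  "cross_sign 3 7 = - 1"  "cross_sign
  4 1 = - 1"  "cross_sign 4 2 = - 1"  "cross_sign 4 3 = - 1"  "cross_sign 4 4 = 0"  "cross_sign 4 5 = 1"
  "cross_sign 4 6 = 1"  "cross_sign 4 7 = 1"  "cross_sign 5 1 = 1"  "cross_sign 5 2 = - 1"  "cross_sign 5 3 = 1"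
  "cross_sign 5 4 = - 1"  "cross_sign 5 5 = 0"  "cross_sign 5 6 = - 1"  "cross_sign 5 7 = 1"  "cross_sign 6 1 =
  1"  "cross_sign 6 2 = 1"  "cross_sign 6 3 = - 1"  "cross_sign 6 4 = - 1"  "cross_sign 6 5 = 1"  "cross_sign 6
  6 = 0"  "cross_sign 6 7 = - 1"  "cross_sign 7 1 = - 1"  "cross_sign 7 2 = 1"  "cross_sign 7 3 = 1"
  "cross_sign 7 4 = - 1"  "cross_sign 7 5 = - 1"  "cross_sign 7 6 = 1"  "cross_sign 7 7 = 0"
  by (simp_all add: cross_index_def cross_sign_def)

lemma alternating_phi0: "alternating3 phi0"
  unfolding alternating3_def phi0_def forall_7
  by (simp add: cross_values)

lemma psi0_swap_mid: "psi0 i j k l = - psi0 i k j l"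
proof -
  have "\<forall>j k l. psi0 i j k l = - psi0 i k j l" if "i \<in> {1,2,3,4,5,6,7}" for i
    using that unfolding forall_7 psi0_def delta_def
    by (elim insertE emptyE) (simp_all add: cross_values)
  then show ?thesis using exhaust_7[of i] by blast
qed

lemma contraction_wedge_phi0: "contraction_wedge phi0 i j = - 6 * delta i j"
proof -
  have "\<forall>j. contraction_wedge phi0 i j = - 6 * delta i j" if "i \<in> {1,2,3,4,5,6,7}" for i
    using that unfolding forall_7 contraction_wedge_pair_sum[OF alternating_phi0]
    apply (elim insertE emptyE)
    apply (simp_all add: pair_sum_def phi0_def cross_values)
    apply (simp_all add: wedge_row_def pair_sum_def phi0_def cross_values delta_def)
    apply (simp_all add: wedge_complement_def triple_sum_def phi0_def cross_values eps_eval)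
    done
  then show ?thesis using exhaust_7[of i] by blast
qed

lemma hodge_phi0:
  "(\<Sum>a\<in>UNIV. \<Sum>b\<in>UNIV. \<Sum>c\<in>UNIV. eps a b c i j k l * phi0 a b c) = 6 * psi0 i j k l"
proof -
  note sw = alternating3_swap[OF alternating_phi0]
  note rp = alternating3_repeat[OF alternating_phi0]
  have "(\<Sum>a\<in>UNIV. \<Sum>b\<in>UNIV. \<Sum>c\<in>UNIV. eps a b c i j k l * phi0 a b c) = 6 * triple_sum (\<lambda>a b c. eps a b c i j k l * phi0 a b c)"
    by (rule sum_eq_triple_sum) (subst eps_swap(1), subst sw(1), simp, subst eps_swap(2), subst sw(2), simp, simp add: rp)
  also have "triple_sum (\<lambda>a b c. eps a b c i j k l * phi0 a b c) = 
     eps 1 2 3 i j k l + eps 1 4 5 i j k l - eps 1 6 7 i j k l + eps 2 4 6 i j k l + eps 2 5 7 i j k l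
     + eps 3 4 7 i j k l - eps 3 5 6 i j k l"
    unfolding triple_sum_def by (simp add: phi0_def cross_values)
  also have "\<dots> = psi0 i j k l"
  proof -
    have "\<forall>j k l. eps 1 2 3 i j k l + eps 1 4 5 i j k l - eps 1 6 7 i j k l + eps 2 4 6 i j k l + eps 2 5 7 i j k l
     + eps 3 4 7 i j k l - eps 3 5 6 i j k l = psi0 i j k l" if "i \<in> {1,2,3,4,5,6,7}" for i
      using that unfolding forall_7 
      apply (elim insertE emptyE)
      apply (simp_all add: eps_eval psi0_def cross_values delta_def)
      done
    then show ?thesis using exhaust_7[of i] by blast
  qed
  finally show ?thesis .
qed

section \<open>Contraction identities of the model\<close>

lemma delta_sum [simp]:
  "(\<Sum>a\<in>UNIV. delta a i * f a) = f i" "(\<Sum>a\<in>UNIV. delta i a * f a) = f i"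
  "(\<Sum>a\<in>UNIV. f a * delta a i) = f i" "(\<Sum>a\<in>UNIV. f a * delta i a) = f i"
  by (simp_all add: delta_def if_distrib[of "\<lambda>x. x * _"] if_distrib[of "(*) _"] cong: if_cong)

lemma delta_trace [simp]: "(\<Sum>a\<in>UNIV. delta a a) = 7" by (simp add: delta_def)

lemma delta_same [simp]: "delta i i = 1" by (simp add: delta_def)

lemma psi0_swap: "psi0 j i k l = - psi0 i j k l" "psi0 i k j l = - psi0 i j k l" "psi0 i j l k = - psi0 i j k l"
proof -
  have *: "cross_sign j i = - cross_sign i j \<and> (cross_index j i = cross_index i j)" for i j
  proof -
    have "\<forall>i j. cross_sign j i = - cross_sign i j \<and> (cross_index j i = cross_index i j)"
      unfolding forall_7 by (simp add: cross_values)
    then show ?thesis by blast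
  qed
  show "psi0 j i k l = - psi0 i j k l" unfolding psi0_def using *[of i j] by (auto simp: algebra_simps)
  show "psi0 i k j l = - psi0 i j k l" by (subst psi0_swap_mid) simp
  show "psi0 i j l k = - psi0 i j k l" unfolding psi0_def using *[of l k] by (auto simp: algebra_simps)
qed

lemma psi0_repeat: "psi0 i i k l = 0" "psi0 i k i l = 0" "psi0 i k l i = 0" "psi0 k i i l = 0" "psi0 k i l i = 0" "psi0 k l i i = 0"
proof -
  have a: "psi0 i i k l = 0" for i k l using psi0_swap(1)[of i i k l] by simp
  have b: "psi0 k i i l = 0" for i k l using psi0_swap(2)[of k i i l] by simp
  have c: "psi0 k l i i = 0" for i k l using psi0_swap(3)[of k l i i] by simp
  show "psi0 i i k l = 0" "psi0 k i i l = 0" "psi0 k l i i = 0" by (fact a b c)+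
  show "psi0 i k i l = 0" using psi0_swap(1)[of k i i l] b by simp
  show "psi0 k i l i = 0" using psi0_swap(2)[of k i l i] c by simp
  show "psi0 i k l i = 0" using psi0_swap(1)[of k i l i] psi0_swap(2)[of k i l i] c by simp
qed

lemma psi0_pair_swap: "psi0 k l i j = psi0 i j k l"
proof -
  have "psi0 k l i j = - psi0 k i l j" by (rule psi0_swap)
  also have "\<dots> = psi0 i k l j" by (simp add: psi0_swap(1)[of i k])
  also have "\<dots> = - psi0 i k j l" by (rule psi0_swap)
  also have "\<dots> = psi0 i j k l" by (simp add: psi0_swap(2)[of i k j])
  finally show ?thesis .
qed

lemma phi0_phi0: "(\<Sum>m\<in>UNIV. phi0 i j m * phi0 k l m) = delta i k * delta j l - delta i l * delta j k - psi0 i j k l"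
  by (simp add: phi0_def psi0_def if_distrib[of "\<lambda>x. x * _"] if_distrib[of "(*) _"] cong: if_cong)

lemma phi0_cyclic: "phi0 i j k = phi0 j k i"
  using alternating3_swap[OF alternating_phi0] by metis

lemma phi0_phi0_2: "(\<Sum>j\<in>UNIV. \<Sum>k\<in>UNIV. phi0 i j k * phi0 a j k) = 6 * delta i a"
  unfolding phi0_phi0 psi0_repeat sum_subtractf
  by simp

lemma phi0_psi0: "(\<Sum>j\<in>UNIV. \<Sum>k\<in>UNIV. phi0 j k m * psi0 q b j k) = - 4 * phi0 q b m"
proof -
  have "(\<Sum>j\<in>UNIV. \<Sum>k\<in>UNIV. phi0 j k m * psi0 q b j k) = (\<Sum>j\<in>UNIV. \<Sum>k\<in>UNIV. phi0 j k m * (delta q j * delta b k - delta q k * delta b j))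
    - (\<Sum>j\<in>UNIV. \<Sum>k\<in>UNIV. \<Sum>n\<in>UNIV. phi0 j k m * (phi0 q b n * phi0 j k n))"
    unfolding sum_subtractf[symmetric] sum_distrib_left[symmetric] phi0_phi0
    by (simp add: algebra_simps)
  also have "(\<Sum>j\<in>UNIV. \<Sum>k\<in>UNIV. \<Sum>n\<in>UNIV. phi0 j k m * (phi0 q b n * phi0 j k n))
    = (\<Sum>n\<in>UNIV. phi0 q b n * (\<Sum>j\<in>UNIV. \<Sum>k\<in>UNIV. phi0 j k m * phi0 j k n))"
    unfolding sum_distrib_left mult.left_commute[of _ "phi0 q b _"]
    by (subst (2) sum.swap, subst sum.swap, rule refl)
  also have "(\<lambda>n. \<Sum>j\<in>UNIV. \<Sum>k\<in>UNIV. phi0 j k m * phi0 j k n) = (\<lambda>n. \<Sum>j\<in>UNIV. \<Sum>k\<in>UNIV. phi0 m j k * phi0 n j k)"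
    by (intro ext sum.cong refl) (metis phi0_cyclic)
  also have "(\<Sum>n\<in>UNIV. phi0 q b n * (\<Sum>j\<in>UNIV. \<Sum>k\<in>UNIV. phi0 m j k * phi0 n j k)) = 6 * phi0 q b m"
    unfolding phi0_phi0_2 by (simp add: mult.left_commute[of _ 6] sum_distrib_left[symmetric])
  also have "(\<Sum>j\<in>UNIV. \<Sum>k\<in>UNIV. phi0 j k m * (delta q j * delta b k - delta q k * delta b j)) = phi0 q b m - phi0 b q m"
    by (simp add: right_diff_distrib sum_subtractf mult.left_commute[of "phi0 _ _ _"] sum_distrib_left[symmetric])
  also have "phi0 b q m = - phi0 q b m" by (rule alternating3_swap[OF alternating_phi0])
  finally show ?thesis by simp
qed

lemma psi0_psi0: "(\<Sum>j\<in>UNIV. \<Sum>k\<in>UNIV. psi0 p a j k * psi0 q b j k) = 4 * delta p q * delta a b - 4 * delta p b * delta a q - 2 * psi0 p a q b"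
proof -
  have "(\<Sum>j\<in>UNIV. \<Sum>k\<in>UNIV. psi0 p a j k * psi0 q b j k) = (\<Sum>j\<in>UNIV. \<Sum>k\<in>UNIV. (delta p j * delta a k - delta p k * delta a j) * psi0 q b j k)
    - (\<Sum>j\<in>UNIV. \<Sum>k\<in>UNIV. \<Sum>n\<in>UNIV. phi0 p a n * (phi0 j k n * psi0 q b j k))"
    unfolding sum_subtractf[symmetric] sum_distrib_left[symmetric] sum_distrib_right[symmetric] mult.assoc[symmetric] phi0_phi0
    by (simp add: algebra_simps)
  also have "(\<Sum>j\<in>UNIV. \<Sum>k\<in>UNIV. \<Sum>n\<in>UNIV. phi0 p a n * (phi0 j k n * psi0 q b j k))
    = (\<Sum>n\<in>UNIV. phi0 p a n * (\<Sum>j\<in>UNIV. \<Sum>k\<in>UNIV. phi0 j k n * psi0 q b j k))"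
    unfolding sum_distrib_left
    by (subst (2) sum.swap, subst sum.swap, rule refl)
  also have "\<dots> = - 4 * (delta p q * delta a b - delta p b * delta a q - psi0 p a q b)"
    unfolding phi0_psi0 phi0_phi0[symmetric] sum_distrib_left by (simp add: mult_ac)
  also have "(\<Sum>j\<in>UNIV. \<Sum>k\<in>UNIV. (delta p j * delta a k - delta p k * delta a j) * psi0 q b j k) = psi0 q b p a - psi0 q b a p"
    by (simp add: left_diff_distrib sum_subtractf mult.assoc sum_distrib_left[symmetric])
  also have "\<dots> = 2 * psi0 p a q b" using psi0_swap(3)[of q b p a] psi0_pair_swap[of q b p a] by simp
  finally show ?thesis by simp
qed

section \<open>Functoriality of the pull-back\<close>

lemma sum_swap33:
  "(\<Sum>a\<in>A. \<Sum>b\<in>B. \<Sum>c\<in>C. \<Sum>p\<in>P. \<Sum>q\<in>Q. \<Sum>r\<in>R. f a b c p q r)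
   = (\<Sum>p\<in>P. \<Sum>q\<in>Q. \<Sum>r\<in>R. \<Sum>a\<in>A. \<Sum>b\<in>B. \<Sum>c\<in>C. f a b c p q r)"
proof -
  have "(\<Sum>x\<in>A\<times>B\<times>C. \<Sum>y\<in>P\<times>Q\<times>R. f (fst x) (fst (snd x)) (snd (snd x)) (fst y) (fst (snd y)) (snd (snd y)))
    = (\<Sum>y\<in>P\<times>Q\<times>R. \<Sum>x\<in>A\<times>B\<times>C. f (fst x) (fst (snd x)) (snd (snd x)) (fst y) (fst (snd y)) (snd (snd y)))"
    by (rule sum.swap)
  then show ?thesis by (simp add: sum.cartesian_product' )
qed

lemma pull3_pull3: "pull3 E (pull3 F w) = pull3 (F ** E) w"
proof (intro ext)
  fix i j k
  have "pull3 E (pull3 F w) i j k = (\<Sum>a\<in>UNIV. \<Sum>b\<in>UNIV. \<Sum>c\<in>UNIV. \<Sum>p\<in>UNIV. \<Sum>q\<in>UNIV. \<Sum>r\<in>UNIV.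
     (F$p$a * E$a$i) * (F$q$b * E$b$j) * (F$r$c * E$c$k) * w p q r)"
    unfolding pull3_def sum_distrib_left by (simp only: mult_ac)
  also have "\<dots> = (\<Sum>p\<in>UNIV. \<Sum>q\<in>UNIV. \<Sum>r\<in>UNIV. \<Sum>a\<in>UNIV. \<Sum>b\<in>UNIV. \<Sum>c\<in>UNIV. 
     (F$p$a * E$a$i) * (F$q$b * E$b$j) * (F$r$c * E$c$k) * w p q r)"
    by (rule sum_swap33)
  also have "\<dots> = pull3 (F ** E) w i j k"
    unfolding pull3_def matrix_matrix_mult_def
    by (simp only: sum_distrib_left[symmetric] sum_distrib_right[symmetric] vec_lambda_beta)
  finally show "pull3 E (pull3 F w) i j k = pull3 (F ** E) w i j k" .
qed

lemma mat_1_delta: "mat 1 $ i $ j = delta i j" by (simp add: mat_def delta_def)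

lemma pull3_id: "pull3 (mat 1) w = w"
  unfolding pull3_def mat_1_delta fun_eq_iff mult.assoc sum_distrib_left[symmetric] by simp

lemma pull3_adjoint:
  "(\<Sum>a\<in>UNIV. \<Sum>b\<in>UNIV. \<Sum>c\<in>UNIV. pull3 F u a b c * v a b c) = (\<Sum>a\<in>UNIV. \<Sum>b\<in>UNIV. \<Sum>c\<in>UNIV. u a b c * pull3 (transpose F) v a b c)"
  unfolding pull3_def sum_distrib_left sum_distrib_right
  by (subst sum_swap33) (simp add: transpose_def mult_ac)

lemma alternating3_pull3:
  assumes "alternating3 w" shows "alternating3 (pull3 F w)"
  unfolding alternating3_def
proof (intro allI conjI)
  fix i j k
  note sw = alternating3_swap[OF assms]
  show "pull3 F w i j k = - pull3 F w j i k"
    unfolding pull3_def sum_negf[symmetric]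
    by (subst sum.swap, intro sum.cong refl, subst sw(1)) simp
  show "pull3 F w i j k = - pull3 F w i k j"
    unfolding pull3_def sum_negf[symmetric]
    by (rule sum.cong[OF refl], subst sum.swap, intro sum.cong refl, subst sw(2)) simp
qed

lemma pull3_inverse:
  assumes "F ** E = mat 1"
  shows "pull3 E (pull3 F w) = w"
  by (simp add: pull3_pull3 assms pull3_id)

section \<open>Uniqueness of the induced metric\<close>

lemma inner_product_matrix_det:
  assumes "inner_product_matrix G" shows "det G \<noteq> 0"
proof -
  have "G *v v \<noteq> 0" if "v \<noteq> 0" for v
    using assms that unfolding inner_product_matrix_def by fastforce
  then have "invertible G"
    by (metis invertible_def matrix_left_invertible_ker matrix_left_right_inverse)
  then show ?thesis by (simp add: invertible_det_nz)
qed

text \<open>The defining equation determines the metric up to a factor, and comparing determinants on both sides fixes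
  that factor and the sign.\<close>

lemma determines_unique:
  assumes 1: "determines w G e" and 2: "determines w G' e'"
  shows "G = G' \<and> e = e'"
proof -
  define s where "s = volume_coeff G e"
  define s' where "s' = volume_coeff G' e'"
  have G: "inner_product_matrix G" and G': "inner_product_matrix G'" and e: "e \<in> {1,-1}" "e' \<in> {1,-1}"
    and B: "contraction_wedge w i j = - 6 * G $ i $ j * s" "contraction_wedge w i j = - 6 * G' $ i $ j * s'" for i j
    using 1 2 by (auto simp: determines_def s_def s'_def)
  have d: "det G \<noteq> 0" "det G' \<noteq> 0" using G G' inner_product_matrix_det by auto
  have s0: "s \<noteq> 0" "s' \<noteq> 0" using d e by (auto simp: s_def s'_def volume_coeff_def)
  have ss: "s\<^sup>2 = \<bar>det G\<bar>" "s'\<^sup>2 = \<bar>det G'\<bar>"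
    using e by (auto simp: s_def s'_def volume_coeff_def power2_eq_square real_sqrt_mult_self)
  define k where "k = s / s'"
  have GG: "G' = k *\<^sub>R G"
    unfolding vec_eq_iff
  proof (intro allI)
    fix i j
    have "G' $ i $ j * s' = G $ i $ j * s" using B[of i j] by simp
    then show "G' $ i $ j = (k *\<^sub>R G) $ i $ j" using s0 by (simp add: k_def field_simps)
  qed
  have "axis 1 1 \<bullet> (G' *v axis 1 1) > 0" "axis 1 1 \<bullet> (G *v axis 1 1) > 0"
    using G G' by (auto simp: inner_product_matrix_def axis_eq_0_iff)
  then have k0: "k > 0"
    by (simp add: GG scaleR_matrix_vector_assoc[symmetric] zero_less_mult_iff)
  have "det G' = k ^ 7 * det G"
    unfolding GG det_def by (simp add: prod.distrib sum_distrib_left mult_ac)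
  then have "s'\<^sup>2 = k ^ 7 * s\<^sup>2" using ss k0 by (simp add: abs_mult)
  moreover have "s = k * s'" using s0 by (simp add: k_def)
  ultimately have "s'\<^sup>2 * (k ^ 9) = s'\<^sup>2 * 1" by (simp add: power_mult_distrib algebra_simps flip: power_add)
  then have "k ^ 9 = 1" using s0 by simp
  then have "k = 1" using k0 power_eq_imp_eq_base[of k 9 1] by simp
  then have "G = G'" "s = s'" using GG \<open>s = k * s'\<close> by auto
  moreover from this have "e = e'" using d by (simp add: s_def s'_def volume_coeff_def)
  ultimately show ?thesis by blast
qed

lemma determines_metric:
  assumes "determines w G e"
  shows "metric w = G" "orientation w = e"
  unfolding metric_def orientation_def using assms determines_unique by blast+

definition model_frame :: "tensor3 \<Rightarrow> real^7^7 \<Rightarrow> bool" where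
  "model_frame w F \<longleftrightarrow> det F \<noteq> 0 \<and> w = pull3 F phi0"

lemma pull2_delta: "pull2 F (\<lambda>i j. c * delta i j) i j = c * (transpose F ** F) $ i $ j"
  unfolding pull2_def matrix_matrix_mult_def transpose_def
  by (simp add: sum_distrib_left mult_ac)
    (simp add: sum_distrib_left[symmetric])

lemma model_frame_determines:
  assumes "model_frame w F"
  shows "determines w (transpose F ** F) (sgn (det F))" and "volume_coeff (transpose F ** F) (sgn (det F)) = det F"
proof -
  have d: "det F \<noteq> 0" and w: "w = pull3 F phi0" using assms by (auto simp: model_frame_def)
  show v: "volume_coeff (transpose F ** F) (sgn (det F)) = det F"
    by (simp add: volume_coeff_def det_mul det_transpose sgn_mult_abs real_sqrt_mult_self)
  have "invertible F" using d by (simp add: invertible_det_nz)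
  then have inj: "F *v x \<noteq> 0" if "x \<noteq> 0" for x
    using that by (metis invertible_def matrix_left_invertible_ker)
  have "inner_product_matrix (transpose F ** F)"
    unfolding inner_product_matrix_def
  proof (intro conjI allI impI)
    show "transpose (transpose F ** F) = transpose F ** F"
      by (simp add: matrix_transpose_mul)
    fix x :: "real^7" assume "x \<noteq> 0"
    have "x \<bullet> ((transpose F ** F) *v x) = (F *v x) \<bullet> (F *v x)"
      by (metis dot_lmul_matrix matrix_vector_mul_assoc transpose_matrix_vector inner_commute)
    then show "x \<bullet> ((transpose F ** F) *v x) > 0" using inj[OF \<open>x \<noteq> 0\<close>] by simp
  qed
  moreover have "contraction_wedge w i j = - 6 * (transpose F ** F) $ i $ j * det F" for i j
    unfolding w contraction_wedge_pull3 
    using pull2_delta[of F "-6" i j] contraction_wedge_phi0[abs_def] by (simp add: fun_eq_iff[symmetric])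
  ultimately show "determines w (transpose F ** F) (sgn (det F))"
    using d unfolding determines_def v by (auto simp: sgn_if)
qed

section \<open>The Hodge dual in an adapted frame\<close>

definition pull4 :: "real^7^7 \<Rightarrow> tensor4 \<Rightarrow> tensor4" where
  "pull4 F w i j k l = (\<Sum>a\<in>UNIV. \<Sum>b\<in>UNIV. \<Sum>c\<in>UNIV. \<Sum>d\<in>UNIV. F$a$i * F$b$j * F$c$k * F$d$l * w a b c d)"

lemma invertible_matrix_inv:
  fixes F :: "real^7^7"
  assumes "det F \<noteq> 0"
  shows "F ** matrix_inv F = mat 1" "matrix_inv F ** F = mat 1"
  using someI_ex[of "\<lambda>A. F ** A = mat 1 \<and> A ** F = mat 1"] assms
  unfolding matrix_inv_def by (auto simp: invertible_det_nz[symmetric] invertible_def)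

lemma matrix_inv_eqI:
  fixes A :: "real^7^7"
  assumes "A ** B = mat 1"
  shows "matrix_inv A = B"
proof -
  have "det A \<noteq> 0" using assms by (metis det_I det_mul mult_zero_left zero_neq_one)
  then have "matrix_inv A ** A = mat 1" by (rule invertible_matrix_inv)
  then have "matrix_inv A ** (A ** B) = B" by (simp add: matrix_mul_assoc)
  then show ?thesis using assms by simp
qed

lemma model_frame_metric:
  assumes "model_frame w F"
  shows "metric w = transpose F ** F" "orientation w = sgn (det F)"
    "volume_coeff (metric w) (orientation w) = det F"
    "matrix_inv (metric w) = matrix_inv F ** transpose (matrix_inv F)"
proof -
  show m: "metric w = transpose F ** F" and o: "orientation w = sgn (det F)"
    using determines_metric[OF model_frame_determines(1)[OF assms]] by auto
  show "volume_coeff (metric w) (orientation w) = det F"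
    unfolding m o by (rule model_frame_determines(2)[OF assms])
  have d: "det F \<noteq> 0" using assms by (simp add: model_frame_def)
  have "(transpose F ** F) ** (matrix_inv F ** transpose (matrix_inv F)) = transpose F ** (F ** matrix_inv F) ** transpose (matrix_inv F)"
    by (simp add: matrix_mul_assoc)
  also have "\<dots> = transpose (matrix_inv F ** F)"
    by (simp only: invertible_matrix_inv(1)[OF d] matrix_transpose_mul matrix_mul_rid)
  also have "\<dots> = mat 1" by (simp add: invertible_matrix_inv[OF d] transpose_mat)
  finally show "matrix_inv (metric w) = matrix_inv F ** transpose (matrix_inv F)"
    unfolding m by (rule matrix_inv_eqI)
qed

lemma raise3_pull3: "raise3 w = pull3 (transpose (matrix_inv (metric w))) w"
  by (simp add: fun_eq_iff raise3_def pull3_def upper_metric_def transpose_def)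

lemma model_frame_raise3:
  assumes "model_frame w F"
  shows "raise3 w = pull3 (transpose (matrix_inv F)) phi0"
proof -
  have d: "det F \<noteq> 0" and w: "w = pull3 F phi0" using assms by (auto simp: model_frame_def)
  have "raise3 w = pull3 (F ** transpose (matrix_inv F ** transpose (matrix_inv F))) phi0"
    unfolding raise3_pull3 model_frame_metric(4)[OF assms] by (subst w) (simp add: pull3_pull3)
  also have "F ** transpose (matrix_inv F ** transpose (matrix_inv F)) = transpose (matrix_inv F)"
    by (simp add: matrix_transpose_mul matrix_mul_assoc invertible_matrix_inv[OF d])
  finally show ?thesis .
qed

lemma model_frame_hodge:
  assumes "model_frame w F"
  shows "hodge_dual w = pull4 F psi0"
proof (intro ext)
  fix i j k l
  have d: "det F \<noteq> 0" using assms by (auto simp: model_frame_def)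
  define X where "X = (\<lambda>a b c. \<Sum>d\<in>UNIV. \<Sum>e\<in>UNIV. \<Sum>f\<in>UNIV. \<Sum>g\<in>UNIV.
     eps a b c d e f g * (F$d$i * F$e$j * F$f$k * F$g$l))"
  have 1: "det F * eps a b c i j k l = pull3 F X a b c" for a b c
    unfolding eps_det[symmetric] pull3_def X_def sum_distrib_left by (simp only: mult_ac)
  have "(\<Sum>a\<in>UNIV. \<Sum>b\<in>UNIV. \<Sum>c\<in>UNIV. det F * eps a b c i j k l * raise3 w a b c)
     = (\<Sum>a\<in>UNIV. \<Sum>b\<in>UNIV. \<Sum>c\<in>UNIV. X a b c * pull3 (transpose F) (raise3 w) a b c)"
    unfolding 1 by (rule pull3_adjoint)
  also have "pull3 (transpose F) (raise3 w) = phi0"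
    unfolding model_frame_raise3[OF assms]
    by (rule pull3_inverse) (metis invertible_matrix_inv(1)[OF d] matrix_transpose_mul transpose_mat)
  also have "(\<Sum>a\<in>UNIV. \<Sum>b\<in>UNIV. \<Sum>c\<in>UNIV. X a b c * phi0 a b c)
    = (\<Sum>a\<in>UNIV. \<Sum>b\<in>UNIV. \<Sum>c\<in>UNIV. \<Sum>x\<in>UNIV\<times>UNIV\<times>UNIV\<times>UNIV. 
       (F$fst x$i * F$fst (snd x)$j * F$fst (snd (snd x))$k * F$snd (snd (snd x))$l) *
        (eps a b c (fst x) (fst (snd x)) (fst (snd (snd x))) (snd (snd (snd x))) * phi0 a b c))"
    unfolding X_def sum_distrib_right sum.cartesian_product' by (simp add: split_def mult_ac)
  also have "\<dots> = (\<Sum>x\<in>UNIV\<times>UNIV\<times>UNIV\<times>UNIV. 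
       (F$fst x$i * F$fst (snd x)$j * F$fst (snd (snd x))$k * F$snd (snd (snd x))$l) *
        (\<Sum>a\<in>UNIV. \<Sum>b\<in>UNIV. \<Sum>c\<in>UNIV. eps a b c (fst x) (fst (snd x)) (fst (snd (snd x))) (snd (snd (snd x))) * phi0 a b c))"
    unfolding sum_distrib_left
    by (subst (3) sum.swap, subst (2) sum.swap, subst sum.swap, rule refl)
  also have "\<dots> = 6 * pull4 F psi0 i j k l"
    unfolding hodge_phi0 pull4_def sum_distrib_left sum.cartesian_product' by (simp add: split_def mult_ac)
  finally have "(\<Sum>a\<in>UNIV. \<Sum>b\<in>UNIV. \<Sum>c\<in>UNIV. det F * eps a b c i j k l * raise3 w a b c) = 6 * pull4 F psi0 i j k l" .
  then show "hodge_dual w i j k l = pull4 F psi0 i j k l"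
    unfolding hodge_dual_eps model_frame_metric(3)[OF assms]
    by (simp add: sum_distrib_left mult.assoc)
qed

section \<open>Normal form of nondegenerate 3-forms\<close>

definition tri :: "tensor3 \<Rightarrow> real^7 \<Rightarrow> real^7 \<Rightarrow> real^7 \<Rightarrow> real" where
  "tri w u v x = (\<Sum>i\<in>UNIV. \<Sum>j\<in>UNIV. \<Sum>k\<in>UNIV. u$i * v$j * x$k * w i j k)"

definition cols :: "(7 \<Rightarrow> real^7) \<Rightarrow> real^7^7" where
  "cols f = (\<chi> a i. f i $ a)"

lemma pull3_cols: "pull3 (cols f) w i j k = tri w (f i) (f j) (f k)"
  by (simp add: pull3_def tri_def cols_def)

lemma tri_linear:
  "tri w (u + u') v x = tri w u v x + tri w u' v x"
  "tri w u (v + v') x = tri w u v x + tri w u v' x"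
  "tri w u v (x + x') = tri w u v x + tri w u v x'"
  "tri w (r *\<^sub>R u) v x = r * tri w u v x"
  "tri w u (r *\<^sub>R v) x = r * tri w u v x"
  "tri w u v (r *\<^sub>R x) = r * tri w u v x"
  "tri w (u - u') v x = tri w u v x - tri w u' v x"
  "tri w u (v - v') x = tri w u v x - tri w u v' x"
  "tri w u v (x - x') = tri w u v x - tri w u v x'"
  by (simp_all add: tri_def sum.distrib sum_subtractf sum_distrib_left algebra_simps)

lemma tri_axis: "tri w (axis i 1) (axis j 1) (axis k 1) = w i j k"
proof -
  have a: "axis i 1 $ j = delta j i" for i j :: 7 by (simp add: axis_def delta_def)
  show ?thesis unfolding tri_def a mult.assoc sum_distrib_left[symmetric] by simp
qed

lemma tri_swap:
  assumes "alternating3 w"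
  shows "tri w v u x = - tri w u v x" "tri w u x v = - tri w u v x"
proof -
  let ?f = "tup u v x 0 0 0 0"
  have "pull3 (cols ?f) w 2 1 3 = - pull3 (cols ?f) w 1 2 3" "pull3 (cols ?f) w 1 3 2 = - pull3 (cols ?f) w 1 2 3"
    by (rule alternating3_swap[OF alternating3_pull3[OF assms]])+
  then show "tri w v u x = - tri w u v x" "tri w u x v = - tri w u v x"
    by (simp_all add: pull3_cols)
qed

lemma tri_repeat:
  assumes "alternating3 w"
  shows "tri w u u x = 0" "tri w u x u = 0" "tri w x u u = 0"
  using tri_swap[OF assms, of u u x] tri_swap[OF assms, of x u u] tri_swap[OF assms, of u x u] by linarith+

lemma det_cols:
  assumes "\<And>c. (\<Sum>i\<in>UNIV. c $ i *\<^sub>R f i) = 0 \<Longrightarrow> c = 0"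
  shows "det (cols f) \<noteq> 0"
proof -
  have "cols f *v c = (\<Sum>i\<in>UNIV. c $ i *\<^sub>R f i)" for c
    by (simp add: vec_eq_iff matrix_vector_mult_def cols_def mult.commute)
  then have "\<forall>c. cols f *v c = 0 \<longrightarrow> c = 0" using assms by auto
  then have "invertible (cols f)"
    by (metis invertible_def matrix_left_invertible_ker matrix_left_right_inverse)
  then show ?thesis by (simp add: invertible_det_nz)
qed

definition bil :: "real^7^7 \<Rightarrow> real^7 \<Rightarrow> real^7 \<Rightarrow> real" where
  "bil G u v = u \<bullet> (G *v v)"

lemma bil_linear:
  "bil G (u + u') v = bil G u v + bil G u' v"
  "bil G u (v + v') = bil G u v + bil G u v'"
  "bil G (r *\<^sub>R u) v = r * bil G u v"
  "bil G u (r *\<^sub>R v) = r * bil G u v"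
  "bil G (u - u') v = bil G u v - bil G u' v"
  "bil G u (v - v') = bil G u v - bil G u v'"
  by (simp_all add: bil_def inner_diff_left inner_diff_right matrix_vector_mult_diff_distrib inner_add_left inner_add_right matrix_vector_right_distrib matrix_vector_mult_scaleR)

lemma bil_commute:
  assumes "inner_product_matrix G" shows "bil G u v = bil G v u"
  using assms by (metis bil_def inner_product_matrix_def dot_lmul_matrix transpose_matrix_vector inner_commute)

lemma bil_pos:
  assumes "inner_product_matrix G" "u \<noteq> 0" shows "bil G u u > 0"
  using assms by (simp add: bil_def inner_product_matrix_def)

lemma contraction_wedge_cols:
  assumes "determines w G e"
  shows "contraction_wedge (pull3 (cols f) w) i j = - 6 * (det (cols f) * volume_coeff G e) * bil G (f i) (f j)"
proof -
  have "contraction_wedge w = (\<lambda>a b. - 6 * G $ a $ b * volume_coeff G e)"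
    using assms by (simp add: determines_def fun_eq_iff)
  then show ?thesis
    unfolding contraction_wedge_pull3
    by (simp add: pull2_def bil_def cols_def inner_vec_def matrix_vector_mult_def sum_distrib_left mult_ac sum_negf)
qed

lemma complete_frame2:
  assumes "p \<noteq> (0::real^7)" "\<And>c. f \<noteq> c *\<^sub>R p"
  obtains g where "g 1 = p" "g 2 = f" "det (cols g) \<noteq> 0"
proof -
  obtain r where r: "p $ r \<noteq> 0" using assms(1) by (auto simp: vec_eq_iff)
  obtain s where "f $ s \<noteq> ((f $ r / p $ r) *\<^sub>R p) $ s" using assms(2)[of "f $ r / p $ r"] by (auto simp: vec_eq_iff)
  then have rs: "p $ r * f $ s - p $ s * f $ r \<noteq> 0" using r by (auto simp: field_simps)
  have "r \<noteq> s" using rs by auto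
  have "card (UNIV - {1,2::7}) = card (UNIV - {r,s})"
    using \<open>r \<noteq> s\<close> by (simp add: card_Diff_subset)
  then obtain h :: "7 \<Rightarrow> 7" where h: "bij_betw h (UNIV - {1,2}) (UNIV - {r,s})"
    by (metis finite_same_card_bij finite)
  define g where "g i = (if i = 1 then p else if i = 2 then f else axis (h i) 1)" for i
  have "det (cols g) \<noteq> 0"
  proof (rule det_cols)
    fix c :: "real^7" assume "(\<Sum>i\<in>UNIV. c $ i *\<^sub>R g i) = 0"
    moreover have "(\<Sum>i\<in>UNIV. c $ i *\<^sub>R g i) = c $ 1 *\<^sub>R p + c $ 2 *\<^sub>R f + (\<Sum>i\<in>UNIV - {1,2}. c $ i *\<^sub>R axis (h i) 1)"
    proof -
      have "(\<Sum>i\<in>UNIV. c $ i *\<^sub>R g i) = (\<Sum>i\<in>{1,2}. c $ i *\<^sub>R g i) + (\<Sum>i\<in>UNIV-{1,2}. c $ i *\<^sub>R g i)"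
        by (subst sum.union_disjoint[symmetric]) (auto intro: sum.cong)
      moreover have "(\<Sum>i\<in>UNIV-{1,2}. c $ i *\<^sub>R g i) = (\<Sum>i\<in>UNIV-{1,2}. c $ i *\<^sub>R axis (h i) 1)"
        by (rule sum.cong) (auto simp: g_def)
      ultimately show ?thesis by (simp add: g_def)
    qed
    ultimately have z: "c $ 1 * p $ a + c $ 2 * f $ a + (\<Sum>i\<in>UNIV - {1,2}. c $ i * (if a = h i then 1 else 0)) = 0" for a
      by (auto simp: vec_eq_iff axis_def)
    have z0: "(\<Sum>i\<in>UNIV - {1,2}. c $ i * (if a = h i then 1 else 0)) = 0" if "a = r \<or> a = s" for a
      using bij_betwE[OF h] that by (intro sum.neutral) auto
    have e: "c $ 1 * p $ r + c $ 2 * f $ r = 0" "c $ 1 * p $ s + c $ 2 * f $ s = 0"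
      using z[of r] z[of s] z0[of r] z0[of s] by simp_all
    have "c $ 1 * (p $ r * f $ s - p $ s * f $ r) = (c $ 1 * p $ r + c $ 2 * f $ r) * f $ s - (c $ 1 * p $ s + c $ 2 * f $ s) * f $ r"
      by (simp add: algebra_simps)
    then have c1: "c $ 1 = 0" unfolding e using rs by (metis mult_eq_0_iff mult_zero_left diff_self)
    have "c $ 2 * (p $ r * f $ s - p $ s * f $ r) = (c $ 1 * p $ s + c $ 2 * f $ s) * p $ r - (c $ 1 * p $ r + c $ 2 * f $ r) * p $ s"
      by (simp add: algebra_simps)
    then have c2: "c $ 2 = 0" unfolding e using rs by (metis mult_eq_0_iff mult_zero_left diff_self)
    have "c $ k = 0" if k: "k \<in> UNIV - {1,2}" for k
    proof -
      have "(\<Sum>i\<in>UNIV - {1,2}. c $ i * (if h k = h i then 1 else 0)) = (\<Sum>i\<in>UNIV - {1,2}. if i = k then c $ k else 0)"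
        using inj_on_eq_iff[OF bij_betw_imp_inj_on[OF h] k] by (intro sum.cong refl) auto
      then show ?thesis using z[of "h k"] c1 c2 k by simp
    qed
    with c1 c2 have "c $ k = 0" for k by (cases "k = 1 \<or> k = 2") auto
    then show "c = 0" by (simp add: vec_eq_iff)
  qed
  then show thesis using that[of g] by (simp add: g_def)
qed

lemma contraction_wedge_degenerate:
  assumes w: "alternating3 w" and z: "\<And>k. w 1 2 k = 0"
  shows "contraction_wedge w 1 1 = 0"
proof -
  note rp = alternating3_repeat[OF w]
  have z': "w 1 k 2 = 0" for k using alternating3_swap(2)[OF w, of 1 2 k] z by simp
  show ?thesis
    unfolding contraction_wedge_pair_sum[OF w]
    apply (simp add: pair_sum_def rp z z')
    apply (simp add: wedge_row_def pair_sum_def rp z z')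
    apply (simp add: wedge_complement_def triple_sum_def rp z z' eps_eq_0)
    done
qed

lemma nondegenerate_pair:
  assumes w: "alternating3 w" and d: "determines w G e" and p: "p \<noteq> 0" and z: "\<And>y. tri w p f y = 0"
  shows "\<exists>c. f = c *\<^sub>R p"
proof (rule ccontr)
  assume "\<nexists>c. f = c *\<^sub>R p"
  then obtain g where g: "g 1 = p" "g 2 = f" "det (cols g) \<noteq> 0"
    using complete_frame2[OF p, of f] by metis
  have "contraction_wedge (pull3 (cols g) w) 1 1 = 0"
    by (rule contraction_wedge_degenerate[OF alternating3_pull3[OF w]]) (simp add: pull3_cols g z)
  moreover have "bil G p p > 0" "volume_coeff G e \<noteq> 0"
    using d p bil_pos inner_product_matrix_det by (auto simp: determines_def volume_coeff_def)
  ultimately show False using g d by (simp add: contraction_wedge_cols)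
qed

lemma contraction_wedge_adapted:
  assumes w: "alternating3 w"
    and "w 1 2 3 = L" "w 1 2 4 = 0" "w 1 2 5 = 0" "w 1 2 6 = 0" "w 1 2 7 = 0"
    "w 1 3 4 = 0" "w 1 3 5 = 0" "w 1 3 6 = 0" "w 1 3 7 = 0"
    "w 2 3 4 = 0" "w 2 3 5 = 0" "w 2 3 6 = 0" "w 2 3 7 = 0"
    "w 1 4 5 = 1" "w 1 4 6 = 0" "w 1 4 7 = 0"
    "w 2 4 5 = 0" "w 2 4 6 = 1" "w 2 4 7 = 0"
    "w 3 4 5 = 0" "w 3 4 6 = 0" "w 3 4 7 = 1"
  shows "contraction_wedge w 1 1 = 6 * L * w 1 6 7"
    "contraction_wedge w 2 2 = - 6 * L * w 2 5 7"
    "contraction_wedge w 3 3 = 6 * L * w 3 5 6"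
    "contraction_wedge w 1 2 = 3 * L * (w 2 6 7 - w 1 5 7)"
    "contraction_wedge w 1 3 = 3 * L * (w 3 6 7 + w 1 5 6)"
    "contraction_wedge w 2 3 = 3 * L * (w 2 5 6 - w 3 5 7)"
    "contraction_wedge w 1 4 = 3 * L * w 4 6 7"
    "contraction_wedge w 2 4 = - 3 * L * w 4 5 7"
    "contraction_wedge w 3 4 = 3 * L * w 4 5 6"
    "contraction_wedge w 4 4 = - 6"
    "w 4 5 6 = 0 \<Longrightarrow> w 4 5 7 = 0 \<Longrightarrow> w 4 6 7 = 0 \<Longrightarrow> contraction_wedge w 1 5 = 3 * L * w 5 6 7"
proof -
  note ev = alternating3_repeat[OF w] alternating3_sort[OF w] assms(2-)
  show "contraction_wedge w 1 1 = 6 * L * w 1 6 7"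
    "contraction_wedge w 2 2 = - 6 * L * w 2 5 7"
    "contraction_wedge w 3 3 = 6 * L * w 3 5 6"
    "contraction_wedge w 1 2 = 3 * L * (w 2 6 7 - w 1 5 7)"
    "contraction_wedge w 1 3 = 3 * L * (w 3 6 7 + w 1 5 6)"
    "contraction_wedge w 2 3 = 3 * L * (w 2 5 6 - w 3 5 7)"
    "contraction_wedge w 1 4 = 3 * L * w 4 6 7"
    "contraction_wedge w 2 4 = - 3 * L * w 4 5 7"
    "contraction_wedge w 3 4 = 3 * L * w 4 5 6"
    "contraction_wedge w 4 4 = - 6"
    "w 4 5 6 = 0 \<Longrightarrow> w 4 5 7 = 0 \<Longrightarrow> w 4 6 7 = 0 \<Longrightarrow> contraction_wedge w 1 5 = 3 * L * w 5 6 7"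
    unfolding contraction_wedge_pair_sum[OF w]
    by (simp_all add: pair_sum_def ev,
      simp_all add: wedge_row_def pair_sum_def ev,
      simp_all add: wedge_complement_def triple_sum_def ev eps_eval algebra_simps)
qed

lemma continuous_on_bil: "continuous_on S (\<lambda>v. bil G v v)"
proof -
  have eq: "(\<lambda>v. bil G v v) = (\<lambda>v. \<Sum>i\<in>UNIV. v $ i * (\<Sum>j\<in>UNIV. G $ i $ j * v $ j))"
    by (simp add: bil_def inner_vec_def matrix_vector_mult_def)
  show ?thesis unfolding eq by (intro continuous_intros)
qed

lemma bil_bounded_below:
  assumes "inner_product_matrix G"
  obtains m where "m > 0" "\<And>v. bil G v v \<ge> m * (norm v)\<^sup>2"
proof -
  have "compact (sphere (0::real^7) 1)" "sphere (0::real^7) 1 \<noteq> {}" by auto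
  moreover have "continuous_on (sphere 0 1) (\<lambda>v. bil G v v)"
    by (rule continuous_on_bil)
  ultimately obtain z where z: "z \<in> sphere 0 1" "\<forall>v\<in>sphere 0 1. bil G z z \<le> bil G v v"
    using continuous_attains_inf by blast
  have "bil G z z > 0" using z assms by (intro bil_pos) auto
  moreover have "bil G v v \<ge> bil G z z * (norm v)\<^sup>2" for v
  proof (cases "v = 0")
    case False
    have "bil G v v = bil G (norm v *\<^sub>R ((1 / norm v) *\<^sub>R v)) (norm v *\<^sub>R ((1 / norm v) *\<^sub>R v))"
      using False by simp
    also have "\<dots> = (norm v)\<^sup>2 * bil G ((1 / norm v) *\<^sub>R v) ((1 / norm v) *\<^sub>R v)"
      unfolding bil_linear(3)[of G "norm v"] bil_linear(4)[of G _ "norm v"] by (simp add: power2_eq_square mult_ac)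
    finally have e: "bil G v v = (norm v)\<^sup>2 * bil G ((1 / norm v) *\<^sub>R v) ((1 / norm v) *\<^sub>R v)" .
    have "bil G z z \<le> bil G ((1 / norm v) *\<^sub>R v) ((1 / norm v) *\<^sub>R v)"
      using z False by auto
    from mult_right_mono[OF this, of "(norm v)\<^sup>2"] show ?thesis by (simp add: e[symmetric] mult.commute)
  qed (simp add: bil_def)
  ultimately show thesis using that by blast
qed

lemma compact_bil_sphere:
  assumes "inner_product_matrix G"
  shows "compact {v. bil G v v = 1}"
proof -
  obtain m where m: "m > 0" "\<And>v. bil G v v \<ge> m * (norm v)\<^sup>2" using bil_bounded_below[OF assms] by blast
  have "norm v \<le> 1 + 1 / m" if "bil G v v = 1" for v
  proof (cases "norm v \<le> 1")
    case False
    then have "norm v \<le> (norm v)\<^sup>2" using mult_left_mono[of 1 "norm v" "norm v"] by (simp add: power2_eq_square)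
    also have "\<dots> \<le> 1 / m" using m(2)[of v] that m(1) by (simp add: field_simps)
    finally show ?thesis by simp
  next
    case True then show ?thesis using m(1) by (simp add: add_increasing2)
  qed
  then have "bounded {v. bil G v v = 1}" unfolding bounded_iff by blast
  moreover have "closed {v. bil G v v = 1}"
    by (intro closed_Collect_eq continuous_on_bil continuous_on_const)
  ultimately show ?thesis by (simp add: compact_eq_bounded_closed)
qed

text \<open>First-order condition at a maximum of a linear functional on the unit sphere.\<close>

lemma linear_maximum_on_sphere:
  assumes G: "inner_product_matrix G" and add: "\<And>y z. l (y + z) = l y + l z" and scale: "\<And>r y. l (r *\<^sub>R y) = r * l y"
    and x: "bil G x x = 1" and max: "\<And>y. bil G y y = 1 \<Longrightarrow> l y \<le> l x" and pos: "l x > (0::real)"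
  shows "l y = l x * bil G x y"
proof -
  define z where "z = y + (- bil G x y) *\<^sub>R x"
  have xz: "bil G x z = 0" by (simp add: z_def bil_linear x)
  have zx: "bil G z x = 0" using xz bil_commute[OF G] by simp
  have lz: "l z = l y - bil G x y * l x" by (simp only: z_def add scale)
  have "l z = 0"
  proof (cases "z = 0")
    case True then show ?thesis using scale[of 0 x] by simp
  next
    case False
    define c where "c = bil G z z"
    have c: "c > 0" unfolding c_def using False G by (rule bil_pos[rotated])
    have main: "l x + t * l z \<le> l x * sqrt (1 + t\<^sup>2 * c)" for t
    proof -
      let ?y = "x + t *\<^sub>R z"
      have b: "bil G ?y ?y = 1 + t\<^sup>2 * c" by (simp add: bil_linear x xz zx c_def power2_eq_square)
      have p: "1 + t\<^sup>2 * c > 0" using c by (simp add: add_pos_nonneg)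
      define q where "q = sqrt (1 + t\<^sup>2 * c)"
      have q: "q > 0" "q * q = 1 + t\<^sup>2 * c" using p by (auto simp: q_def)
      have "bil G ((1/q) *\<^sub>R ?y) ((1/q) *\<^sub>R ?y) = 1"
        unfolding bil_linear(3)[of G "1/q"] bil_linear(4)[of G _ "1/q"] b using q p by (simp add: field_simps)
      then have "l ((1/q) *\<^sub>R ?y) \<le> l x" by (rule max)
      then have "(1/q) * (l x + t * l z) \<le> l x" by (simp only: scale add)
      then show ?thesis using q(1) unfolding q_def[symmetric] by (simp add: field_simps)
    qed
    have "sqrt (1 + s) \<le> 1 + s / 2" if "s \<ge> 0" for s
      using that by (intro real_le_lsqrt) (auto simp: power2_eq_square algebra_simps)
    then have "sqrt (1 + t\<^sup>2 * c) \<le> 1 + t\<^sup>2 * c / 2" for t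
      using c by simp
    then have "l x + t * l z \<le> l x * (1 + t\<^sup>2 * c / 2)" for t
      using main[of t] pos by (meson mult_left_mono less_imp_le order_trans)
    from this[of "l z / (l x * c)"] have "l z * l z / (l x * c) \<le> l z * l z / (l x * c) / 2"
      using pos c by (simp add: field_simps power2_eq_square)
    then have "l z * l z / (l x * c) \<le> 0" by simp
    then have "l z * l z \<le> 0" using mult_pos_pos[OF pos c] by (simp only: divide_le_0_iff) linarith
    then show ?thesis by (metis mult_eq_0_iff order_antisym zero_le_square)
  qed
  then show ?thesis using lz by (simp add: mult.commute)
qed

lemma calibrated_triple:
  assumes w: "alternating3 w" and d: "determines w G e"
  obtains u v x L where "L > 0" "\<And>y. tri w u v y = L * bil G x y" "\<And>y. tri w v x y = L * bil G u y"
    "\<And>y. tri w x u y = L * bil G v y" "bil G u u = 1" "bil G v v = 1" "bil G x x = 1"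
proof -
  have G: "inner_product_matrix G" using d by (simp add: determines_def)
  define K where "K = {v. bil G v v = 1}"
  have norm1: "(1 / sqrt (bil G v v)) *\<^sub>R v \<in> K" if "v \<noteq> 0" for v
    unfolding K_def using bil_pos[OF G that] by (simp add: bil_linear)
  have 1: "compact (K \<times> K \<times> K)" unfolding K_def by (intro compact_Times compact_bil_sphere G)
  have "(1 / sqrt (bil G (axis 1 1) (axis 1 1))) *\<^sub>R axis 1 1 \<in> K" by (rule norm1) (simp add: axis_eq_0_iff)
  then have 2: "K \<times> K \<times> K \<noteq> {}" by blast
  have 3: "continuous_on (K \<times> K \<times> K) (\<lambda>(u,v,x). tri w u v x)"
    unfolding tri_def split_def by (intro continuous_intros)
  obtain t where t: "t \<in> K \<times> K \<times> K" "\<forall>s\<in>K \<times> K \<times> K. (\<lambda>(u,v,x). tri w u v x) s \<le> (\<lambda>(u,v,x). tri w u v x) t"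
    using continuous_attains_sup[OF 1 2 3] by meson
  obtain u v x where "t = (u,v,x)" by (cases t)
  with t have K: "u \<in> K" "v \<in> K" "x \<in> K" and max: "\<And>a b c. a \<in> K \<Longrightarrow> b \<in> K \<Longrightarrow> c \<in> K \<Longrightarrow> tri w a b c \<le> tri w u v x"
    by auto
  have pos: "tri w u v x > 0"
  proof (rule ccontr)
    assume "\<not> tri w u v x > 0"
    then have le: "tri w a b c \<le> 0" if "a \<in> K" "b \<in> K" "c \<in> K" for a b c using max[OF that] by linarith
    have z: "tri w a b c = 0" if "a \<in> K" "b \<in> K" "c \<in> K" for a b c
    proof -
      have "(-1) *\<^sub>R a \<in> K" using that unfolding K_def mem_Collect_eq bil_linear by simp
      then have "tri w ((-1) *\<^sub>R a) b c \<le> 0" using that le by blast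
      then show ?thesis unfolding tri_linear using le[OF that] by simp
    qed
    have "w i j k = 0" for i j k
    proof -
      let ?n = "\<lambda>i. (1 / sqrt (bil G (axis i 1) (axis i 1)))"
      have "tri w (?n i *\<^sub>R axis i 1) (?n j *\<^sub>R axis j 1) (?n k *\<^sub>R axis k 1) = 0"
        by (intro z norm1) (auto simp: axis_eq_0_iff)
      moreover have "?n i \<noteq> 0" for i using bil_pos[OF G, of "axis i 1"] by (auto simp: axis_eq_0_iff)
      ultimately show ?thesis unfolding tri_linear tri_axis by auto
    qed
    then have "w = (\<lambda>i j k. 0)" by (simp add: fun_eq_iff)
    then have "contraction_wedge w i j = 0" for i j by (simp add: contraction_wedge_def)
    then have "G $ 1 $ 1 * volume_coeff G e = 0" using d unfolding determines_def by fastforce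
    moreover have "G $ 1 $ 1 = bil G (axis 1 1) (axis 1 1)"
      by (simp add: bil_def inner_axis' matrix_vector_mult_basis column_def)
    moreover have "bil G (axis 1 1) (axis 1 1) > 0" by (intro bil_pos G) (simp add: axis_eq_0_iff)
    ultimately show False using d inner_product_matrix_det[OF G] by (auto simp: determines_def volume_coeff_def)
  qed
  have cyc: "tri w b c a = tri w a b c" for a b c
    using tri_swap[OF w] by (metis minus_equation_iff)
  have c1: "tri w v x u = tri w u v x" and c2: "tri w x u v = tri w u v x" by (metis cyc)+
  have m1: "tri w v x a \<le> tri w v x u" if "a \<in> K" for a using max[OF that K(2,3)] unfolding c1 by (metis cyc)
  have m2: "tri w x u b \<le> tri w x u v" if "b \<in> K" for b using max[OF K(1) that K(3)] unfolding c2 by (metis cyc)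
  have A: "tri w u v y = tri w u v x * bil G x y" for y
    by (rule linear_maximum_on_sphere[OF G]) (use K max pos in \<open>simp_all add: tri_linear K_def\<close>)
  have B: "tri w v x y = tri w v x u * bil G u y" for y
    by (rule linear_maximum_on_sphere[OF G]) (use K m1 pos c1 in \<open>simp_all add: tri_linear K_def\<close>)
  have C: "tri w x u y = tri w x u v * bil G v y" for y
    by (rule linear_maximum_on_sphere[OF G]) (use K m2 pos c2 in \<open>simp_all add: tri_linear K_def\<close>)
  show thesis by (rule that[OF pos A B[unfolded c1] C[unfolded c2]]) (use K in \<open>simp_all add: K_def\<close>)
qed

lemma phi0_of_adapted:
  assumes w: "alternating3 w" and L: "L > 0" and k: "k > 0"
    and v: "w 1 2 3 = L" "w 1 2 4 = 0" "w 1 2 5 = 0" "w 1 2 6 = 0" "w 1 2 7 = 0"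
    "w 1 3 4 = 0" "w 1 3 5 = 0" "w 1 3 6 = 0" "w 1 3 7 = 0"
    "w 2 3 4 = 0" "w 2 3 5 = 0" "w 2 3 6 = 0" "w 2 3 7 = 0"
    "w 1 4 5 = 1" "w 1 4 6 = 0" "w 1 4 7 = 0"
    "w 2 4 5 = 0" "w 2 4 6 = 1" "w 2 4 7 = 0"
    "w 3 4 5 = 0" "w 3 4 6 = 0" "w 3 4 7 = 1"
    and c: "contraction_wedge w 1 1 = - k" "contraction_wedge w 2 2 = - k" "contraction_wedge w 3 3 = - k"
    "contraction_wedge w 1 2 = 0" "contraction_wedge w 1 3 = 0" "contraction_wedge w 2 3 = 0"
    "contraction_wedge w 1 4 = 0" "contraction_wedge w 2 4 = 0" "contraction_wedge w 3 4 = 0" "contraction_wedge w 1 5 = 0"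
  obtains E where "pull3 E w = phi0"
proof -
  note cw = contraction_wedge_adapted[OF w v]
  define s where "s = - w 1 6 7"
  have s: "s > 0" using cw(1) c(1) L k by (simp add: s_def) (smt (verit) mult_pos_pos mult_nonneg_nonneg)
  have r0: "w 4 5 6 = 0" "w 4 5 7 = 0" "w 4 6 7 = 0" using cw(7-9) c L by auto
  have "w 5 6 7 = 0" using cw(11)[OF r0] c L by simp
  have "L * w 2 5 7 = L * s" "L * w 3 5 6 = L * (- s)" using cw(1-3) c(1-3) by (auto simp: s_def)
  then have d: "w 1 6 7 = - s" "w 2 5 7 = s" "w 3 5 6 = - s"
    using L mult_left_cancel[of L "w 2 5 7" s] mult_left_cancel[of L "w 3 5 6" "- s"] by (auto simp: s_def)
  have o: "w 2 6 7 = w 1 5 7" "w 3 6 7 = - w 1 5 6" "w 2 5 6 = w 3 5 7" using cw(4-6) c L by auto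
  note ev = alternating3_repeat[OF w] alternating3_sort[OF w] v r0 \<open>w 5 6 7 = 0\<close> d o
  define a where "a = 1 / root 3 L"
  have a: "a > 0" "a * a * a * L = 1" using L real_root_pow_pos2[of 3 L] by (auto simp: a_def field_simps power3_eq_cube)
  define q where "q = 1 / sqrt (a * s)"
  have q: "q > 0" "a * s * q * q = 1" using a s by (auto simp: q_def)
  define b where "b = 1 / (a * q)"
  have b: "a * b * q = 1" using a q by (simp add: b_def)
  let ?e = "\<lambda>i::7. axis i (1::real)"
  define f where "f = tup (a *\<^sub>R ?e 1) (a *\<^sub>R ?e 2) (a *\<^sub>R ?e 3) (b *\<^sub>R ?e 4)
     (q *\<^sub>R (?e 5 + (- w 3 5 7) *\<^sub>R ?e 4)) (q *\<^sub>R (?e 6 + w 1 5 6 *\<^sub>R ?e 4)) (q *\<^sub>R (?e 7 + w 1 5 7 *\<^sub>R ?e 4))"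
  have "pull3 (cols f) w = phi0"
    by (rule alternating3_eqI[OF alternating3_pull3[OF w] alternating_phi0])
      (use a q b in \<open>simp_all add: pull3_cols f_def tri_linear tri_axis ev phi0_def cross_values mult_ac\<close>)
  then show thesis by (rule that)
qed

text \<open>Choose \<open>(u, v, x)\<close> among the unit vectors of the induced metric so that the 3-form is maximal. The first-order
  conditions make contractions with two of the three vectors proportional to the third, so the 3-form is block
  adapted to the triple and its orthogonal complement; evaluating the defining equation of the metric
  on the triple then pins down the remaining coefficients up to a linear change in the complement.\<close>

theorem model_frame_exists:
  assumes w: "alternating3 w" and d: "determines w G e"
  shows "\<exists>F. model_frame w F"
proof -
  have G: "inner_product_matrix G" using d by (simp add: determines_def)
  obtain u v x L where L: "L > 0" and t: "\<And>y. tri w u v y = L * bil G x y" "\<And>y. tri w v x y = L * bil G u y"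
    "\<And>y. tri w x u y = L * bil G v y" and n: "bil G u u = 1" "bil G v v = 1" "bil G x x = 1"
    using calibrated_triple[OF w d] by metis
  note bc = bil_commute[OF G]
  have o: "bil G x u = 0" "bil G x v = 0" "bil G u v = 0"
    using t(1)[of u] t(1)[of v] t(2)[of v] L tri_repeat[OF w] by auto
  note o' = o o[unfolded bc[of x u] bc[of x v] bc[of u v]]
  define N where "N = {y. bil G u y = 0 \<and> bil G v y = 0 \<and> bil G x y = 0}"
  \<comment> \<open>a nonzero vector orthogonal to the calibrated triple\<close>
  obtain p where p: "p \<in> N" "p \<noteq> 0"
  proof -
    define f :: "real^7 \<Rightarrow> real^3" where "f y = vector [bil G u y, bil G v y, bil G x y]" for y
    have lin: "linear f"
      by (rule linearI) (simp_all add: f_def bil_linear vec_eq_iff forall_3 vector_3)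
    have "\<not> inj f"
    proof
      assume "inj f"
      then have "dim (f ` UNIV) = dim (UNIV :: (real^7) set)" by (intro dim_image_eq lin) (simp add: inj_on_subset)
      moreover have "dim (f ` UNIV) \<le> CARD(3)" by (rule dim_subset_UNIV_cart)
      ultimately show False by simp
    qed
    then obtain y where "y \<noteq> 0" "f y = 0" using lin linear_injective_0 by blast
    then show thesis using that[of y] by (simp add: N_def f_def vec_eq_iff forall_3 vector_3)
  qed
  have tN: "tri w u v y = 0" "tri w u x y = 0" "tri w v x y = 0" if "y \<in> N" for y
    using that t[of y] tri_swap(1)[OF w, of u x y] by (auto simp: N_def)
  \<comment> \<open>contraction with \<open>p\<close> gives three independent functionals on \<open>N\<close>\<close>
  define g :: "real^7 \<Rightarrow> real^3" where "g y = vector [tri w u p y, tri w v p y, tri w x p y]" for y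
  have g: "linear g"
    by (rule linearI) (simp_all add: g_def tri_linear vec_eq_iff forall_3 vector_3)
  have subN: "subspace N" unfolding N_def subspace_def by (auto simp: bil_linear) (simp add: bil_def)+
  have surj: "g ` N = UNIV"
  proof (rule ccontr)
    assume "g ` N \<noteq> UNIV"
    moreover have sub: "subspace (g ` N)" by (rule linear_subspace_image[OF g subN])
    ultimately have "span (g ` N) \<noteq> UNIV" by (metis span_eq_iff)
    then obtain c where c: "c \<noteq> 0" "\<And>y. y \<in> N \<Longrightarrow> c \<bullet> g y = 0"
      using span_not_UNIV_orthogonal[of "g ` N"] span_base by (metis imageI)
    define z where "z = c $ 1 *\<^sub>R u + c $ 2 *\<^sub>R v + c $ 3 *\<^sub>R x"
    have zN: "tri w z p y = 0" if "y \<in> N" for y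
      using c(2)[OF that] by (simp add: g_def inner_vec_def sum_3 vector_3 z_def tri_linear)
    have z3: "tri w z p u = 0" "tri w z p v = 0" "tri w z p x = 0"
    proof -
      have sw: "tri w a p b = - tri w a b p" for a b by (rule tri_swap[OF w])
      have sw': "tri w v u p = - tri w u v p" "tri w x u p = - tri w u x p" "tri w x v p = - tri w v x p"
        by (rule tri_swap[OF w])+
      show "tri w z p u = 0" "tri w z p v = 0" "tri w z p x = 0"
        by (simp_all add: z_def tri_linear sw sw' tN[OF p(1)] tri_repeat[OF w])
    qed
    have "tri w z p y = 0" for y
    proof -
      define r where "r = y + (- bil G u y) *\<^sub>R u + (- bil G v y) *\<^sub>R v + (- bil G x y) *\<^sub>R x"
      have "r \<in> N" by (simp add: N_def r_def bil_linear n o')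
      then have "tri w z p r = 0" by (rule zN)
      then show ?thesis by (simp add: r_def tri_linear z3)
    qed
    moreover have ortho: "bil G u z = c $ 1" "bil G v z = c $ 2" "bil G x z = c $ 3"
      by (simp_all add: z_def bil_linear n o')
    have "z \<noteq> 0"
    proof
      assume "z = 0"
      then have "c $ 1 = 0 \<and> c $ 2 = 0 \<and> c $ 3 = 0" using ortho by (simp add: bil_def)
      then show False using c(1) by (simp add: vec_eq_iff forall_3)
    qed
    ultimately obtain r where "p = r *\<^sub>R z" using nondegenerate_pair[OF w d] by blast
    then have "bil G u p = r * c $ 1" "bil G v p = r * c $ 2" "bil G x p = r * c $ 3"
      by (simp_all add: bil_linear ortho)
    then have "r *\<^sub>R c = 0" using p(1) by (auto simp: N_def vec_eq_iff forall_3)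
    then show False using c(1) p \<open>p = r *\<^sub>R z\<close> by auto
  qed
  have "axis i 1 \<in> g ` N" for i using surj by simp
  then have "\<exists>y\<in>N. g y = axis i 1" for i by (metis imageE)
  then obtain p2 p3 p4 where p2: "p2 \<in> N" "g p2 = axis 1 1" and p3: "p3 \<in> N" "g p3 = axis 2 1" and p4: "p4 \<in> N" "g p4 = axis 3 1"
    by meson
  have gv: "tri w u p p2 = 1" "tri w v p p2 = 0" "tri w x p p2 = 0"
    "tri w u p p3 = 0" "tri w v p p3 = 1" "tri w x p p3 = 0"
    "tri w u p p4 = 0" "tri w v p p4 = 0" "tri w x p p4 = 1"
    using p2(2) p3(2) p4(2) by (simp_all add: g_def vec_eq_iff forall_3 vector_3 axis_def)
  define f where "f = tup u v x p p2 p3 p4"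
  have Nz: "bil G u y = 0" "bil G v y = 0" "bil G x y = 0" if "y \<in> {p,p2,p3,p4}" for y
    using that p p2 p3 p4 by (auto simp: N_def)
  have det: "det (cols f) \<noteq> 0"
  proof (rule det_cols)
    fix c :: "real^7" assume "(\<Sum>i\<in>UNIV. c $ i *\<^sub>R f i) = 0"
    then have z: "c$1 *\<^sub>R u + c$2 *\<^sub>R v + c$3 *\<^sub>R x + c$4 *\<^sub>R p + c$5 *\<^sub>R p2 + c$6 *\<^sub>R p3 + c$7 *\<^sub>R p4 = 0" (is "?z = 0")
      by (simp add: sum_7 f_def)
    have "bil G u ?z = 0" "bil G v ?z = 0" "bil G x ?z = 0" unfolding z by (simp_all add: bil_def)
    then have c123: "c$1 = 0" "c$2 = 0" "c$3 = 0" by (simp_all add: bil_linear n o' Nz)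
    have "tri w u p ?z = 0" "tri w v p ?z = 0" "tri w x p ?z = 0" unfolding z by (simp_all add: tri_def)
    then have c567: "c$5 = 0" "c$6 = 0" "c$7 = 0" by (simp_all add: tri_linear gv c123 tri_repeat[OF w])
    then have "c$4 = 0" using z p(2) c123 by simp
    then show "c = 0" using c123 c567 by (simp add: vec_eq_iff forall_7)
  qed
  define w' where "w' = pull3 (cols f) w"
  have w': "alternating3 w'" unfolding w'_def by (rule alternating3_pull3[OF w])
  have cw: "contraction_wedge w' i j = - 6 * (det (cols f) * volume_coeff G e) * bil G (f i) (f j)" for i j
    unfolding w'_def by (rule contraction_wedge_cols[OF d])
  have v1: "w' 1 2 3 = L" by (simp add: w'_def pull3_cols f_def t n)
  have v2: "w' 1 2 4 = 0" "w' 1 2 5 = 0" "w' 1 2 6 = 0" "w' 1 2 7 = 0"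
    "w' 1 3 4 = 0" "w' 1 3 5 = 0" "w' 1 3 6 = 0" "w' 1 3 7 = 0"
    "w' 2 3 4 = 0" "w' 2 3 5 = 0" "w' 2 3 6 = 0" "w' 2 3 7 = 0"
    "w' 1 4 5 = 1" "w' 1 4 6 = 0" "w' 1 4 7 = 0"
    "w' 2 4 5 = 0" "w' 2 4 6 = 1" "w' 2 4 7 = 0"
    "w' 3 4 5 = 0" "w' 3 4 6 = 0" "w' 3 4 7 = 1"
    using tN p p2 p3 p4 gv by (simp_all add: w'_def pull3_cols f_def)
  have "contraction_wedge w' 4 4 = - 6" by (rule contraction_wedge_adapted(10)[OF w' v1 v2])
  then have "det (cols f) * volume_coeff G e * bil G p p = 1" unfolding cw f_def by simp
  then have k: "6 * (det (cols f) * volume_coeff G e) > 0" using bil_pos[OF G p(2)]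
    by (metis mult_pos_pos zero_less_mult_pos2 zero_less_numeral zero_less_one)
  obtain E where E: "pull3 E w' = phi0"
    by (rule phi0_of_adapted[OF w' L k v1 v2]) (simp_all add: cw, simp_all add: f_def n o' Nz)
  define F where "F = matrix_inv (cols f ** E)"
  have phi0: "pull3 (cols f ** E) w = phi0" using E by (simp add: w'_def pull3_pull3)
  have "det (cols f ** E) \<noteq> 0"
  proof
    assume "det (cols f ** E) = 0"
    then have "contraction_wedge phi0 1 1 = 0" unfolding phi0[symmetric] contraction_wedge_pull3 by simp
    then show False by (simp add: contraction_wedge_phi0)
  qed
  note inv = invertible_matrix_inv[OF this]
  have "w = pull3 F phi0" unfolding F_def phi0[symmetric] by (simp add: pull3_inverse[OF inv(1)])
  moreover have "det F \<noteq> 0" unfolding F_def using inv by (metis det_I det_mul mult_zero_left zero_neq_one)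
  ultimately show ?thesis unfolding model_frame_def by blast
qed

section \<open>Tensor algebra in an adapted frame\<close>

definition raise3_by :: "tensor3 \<Rightarrow> tensor3 \<Rightarrow> tensor3" where
  "raise3_by w u a b c = (\<Sum>i\<in>UNIV. \<Sum>j\<in>UNIV. \<Sum>k\<in>UNIV.
     upper_metric w a i * upper_metric w b j * upper_metric w c k * u i j k)"

lemma raise3_eq: "raise3 w = raise3_by w w"
  by (simp add: fun_eq_iff raise3_def raise3_by_def)

lemma raise3_by_pull3: "raise3_by w u = pull3 (transpose (matrix_inv (metric w))) u"
  by (simp add: fun_eq_iff raise3_by_def pull3_def upper_metric_def transpose_def)

lemma sum_bilinear:
  fixes a b :: "'x \<Rightarrow> real"
  shows "(\<Sum>d\<in>D. (\<Sum>x\<in>X. a x * f x d) * (\<Sum>z\<in>Z. b z * g z d)) = (\<Sum>x\<in>X. \<Sum>z\<in>Z. a x * b z * (\<Sum>d\<in>D. f x d * g z d))"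
proof -
  have "(\<Sum>d\<in>D. (\<Sum>x\<in>X. a x * f x d) * (\<Sum>z\<in>Z. b z * g z d)) = (\<Sum>d\<in>D. \<Sum>x\<in>X. \<Sum>z\<in>Z. a x * b z * (f x d * g z d))"
    by (simp add: sum_product mult_ac)
  also have "\<dots> = (\<Sum>x\<in>X. \<Sum>d\<in>D. \<Sum>z\<in>Z. a x * b z * (f x d * g z d))" by (rule sum.swap)
  also have "\<dots> = (\<Sum>x\<in>X. \<Sum>z\<in>Z. \<Sum>d\<in>D. a x * b z * (f x d * g z d))"
    by (rule sum.cong[OF refl], rule sum.swap)
  finally show ?thesis by (simp add: sum_distrib_left)
qed

lemma psi0_kernel:
  assumes u: "alternating3 u"
    and eq: "\<And>a b. (\<Sum>c\<in>UNIV. \<Sum>d\<in>UNIV. u b c d * phi0 a c d + phi0 b c d * u a c d) = 0"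
  shows "\<exists>t. \<forall>i j k. u i j k = (\<Sum>p\<in>UNIV. t p * psi0 p i j k)"
proof -
  have "(\<Sum>d\<in>UNIV. u b c d * phi0 a c d) = cross_sign a c * u b c (cross_index a c)" for a b c
    by (simp add: phi0_def if_distrib[of "(*) _"] cong: if_cong)
  moreover have "(\<Sum>d\<in>UNIV. phi0 b c d * u a c d) = cross_sign b c * u a c (cross_index b c)" for a b c
    by (simp add: phi0_def if_distrib[of "\<lambda>x. x * _"] cong: if_cong)
  ultimately have e: "(\<Sum>c\<in>UNIV. cross_sign a c * u b c (cross_index a c) + cross_sign b c * u a c (cross_index b c)) = 0" for a b
    using eq[of b a] by (simp add: sum.distrib)
  note ev = sum_7 cross_values alternating3_repeat[OF u] alternating3_sort[OF u]
  note [simp] = ev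
  note d = e[of 1 1, simplified] e[of 1 2, simplified] e[of 1 3, simplified] e[of 1 4, simplified]
    e[of 1 5, simplified] e[of 1 6, simplified] e[of 1 7, simplified] e[of 2 2, simplified]
    e[of 2 3, simplified] e[of 2 4, simplified] e[of 2 5, simplified] e[of 2 6, simplified]
    e[of 2 7, simplified] e[of 3 3, simplified] e[of 3 4, simplified] e[of 3 5, simplified]
    e[of 3 6, simplified] e[of 3 7, simplified] e[of 4 4, simplified] e[of 4 5, simplified]
    e[of 4 6, simplified] e[of 4 7, simplified] e[of 5 5, simplified] e[of 5 6, simplified]
    e[of 5 7, simplified] e[of 6 6, simplified] e[of 6 7, simplified] e[of 7 7, simplified]
  define t where "t = tup (- u 2 4 7) (u 1 4 7) (- u 1 4 6) (- u 1 2 7) (u 1 2 6) (- u 1 2 5) (u 1 2 4)"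
  have alt: "alternating3 (\<lambda>i j k. \<Sum>p\<in>UNIV. t p * psi0 p i j k)"
    unfolding alternating3_def
  proof (intro allI conjI)
    fix i j k
    show "(\<Sum>p\<in>UNIV. t p * psi0 p i j k) = - (\<Sum>p\<in>UNIV. t p * psi0 p j i k)"
      unfolding sum_negf[symmetric] by (intro sum.cong refl, subst psi0_swap(2)) simp
    show "(\<Sum>p\<in>UNIV. t p * psi0 p i j k) = - (\<Sum>p\<in>UNIV. t p * psi0 p i k j)"
      unfolding sum_negf[symmetric] by (intro sum.cong refl, subst psi0_swap(3)) simp
  qed
  have "u = (\<lambda>i j k. \<Sum>p\<in>UNIV. t p * psi0 p i j k)"
    by (rule alternating3_eqI[OF u alt])
      (simp_all add: psi0_def delta_def t_def, insert d, linarith+)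
  then show ?thesis by (metis (no_types))
qed

text \<open>A 3-form together with a frame in which it becomes the model; all pointwise identities are
  proved under this assumption and then hold in every basis.\<close>

locale framed =
  fixes w :: tensor3 and F :: "real^7^7"
  assumes frame: "model_frame w F"
begin

definition E where "E = matrix_inv F"

lemma FE: "F ** E = mat 1" and EF: "E ** F = mat 1"
  using frame invertible_matrix_inv[of F] by (auto simp: E_def model_frame_def)

lemma FE_sum: "(\<Sum>i\<in>UNIV. F$\<alpha>$i * E$i$\<beta>) = delta \<alpha> \<beta>"
  using FE by (simp add: vec_eq_iff matrix_matrix_mult_def mat_1_delta)

lemma EF_sum: "(\<Sum>\<alpha>\<in>UNIV. E$i$\<alpha> * F$\<alpha>$j) = delta i j"
  using EF by (simp add: vec_eq_iff matrix_matrix_mult_def mat_1_delta)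

lemma upper: "upper_metric w i j = (\<Sum>\<alpha>\<in>UNIV. E$i$\<alpha> * E$j$\<alpha>)"
  by (simp add: upper_metric_def model_frame_metric(4)[OF frame] E_def matrix_matrix_mult_def transpose_def)

lemma lower: "lower_metric w i j = (\<Sum>\<alpha>\<in>UNIV. F$\<alpha>$i * F$\<alpha>$j)"
  by (simp add: lower_metric_def model_frame_metric(1)[OF frame] matrix_matrix_mult_def transpose_def)

lemma upper_commute: "upper_metric w i j = upper_metric w j i"
  by (simp add: upper mult.commute)

lemma lower_commute: "lower_metric w i j = lower_metric w j i"
  by (simp add: lower mult.commute)

lemma dual_sum: "(\<Sum>k\<in>UNIV. (\<Sum>d\<in>UNIV. E$k$d * u d) * (\<Sum>m\<in>UNIV. F$m$k * v m)) = (\<Sum>d\<in>UNIV. u d * v d)"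
proof -
  have "(\<Sum>k\<in>UNIV. (\<Sum>d\<in>UNIV. E$k$d * u d) * (\<Sum>m\<in>UNIV. F$m$k * v m))
    = (\<Sum>k\<in>UNIV. (\<Sum>d\<in>UNIV. u d * E$k$d) * (\<Sum>m\<in>UNIV. v m * F$m$k))" by (simp add: mult.commute)
  also have "\<dots> = (\<Sum>d\<in>UNIV. \<Sum>m\<in>UNIV. u d * v m * (\<Sum>k\<in>UNIV. E$k$d * F$m$k))" by (rule sum_bilinear)
  also have "\<dots> = (\<Sum>d\<in>UNIV. \<Sum>m\<in>UNIV. u d * v m * delta m d)" by (simp add: FE_sum[symmetric] mult.commute)
  finally show ?thesis by simp
qed

lemma upper_F: "(\<Sum>j\<in>UNIV. upper_metric w i j * F$\<alpha>$j) = E$i$\<alpha>"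
proof -
  have "(\<Sum>j\<in>UNIV. upper_metric w i j * F$\<alpha>$j) = (\<Sum>j\<in>UNIV. (\<Sum>\<beta>\<in>UNIV. E$j$\<beta> * E$i$\<beta>) * (\<Sum>m\<in>UNIV. F$m$j * delta m \<alpha>))"
    by (simp add: upper mult.commute)
  also have "\<dots> = (\<Sum>\<beta>\<in>UNIV. E$i$\<beta> * delta \<beta> \<alpha>)" by (rule dual_sum)
  finally show ?thesis by simp
qed

lemma lower_E: "(\<Sum>j\<in>UNIV. lower_metric w i j * E$j$\<alpha>) = F$\<alpha>$i"
proof -
  have "(\<Sum>j\<in>UNIV. lower_metric w i j * E$j$\<alpha>) = (\<Sum>j\<in>UNIV. (\<Sum>d\<in>UNIV. E$j$d * delta d \<alpha>) * (\<Sum>m\<in>UNIV. F$m$j * F$m$i))"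
    by (simp add: lower mult.commute)
  also have "\<dots> = (\<Sum>m\<in>UNIV. delta m \<alpha> * F$m$i)" by (rule dual_sum)
  finally show ?thesis by simp
qed

lemma upper_lower: "(\<Sum>k\<in>UNIV. upper_metric w i k * lower_metric w k j) = delta i j"
proof -
  have "(\<Sum>k\<in>UNIV. upper_metric w i k * lower_metric w k j) = (\<Sum>k\<in>UNIV. (\<Sum>d\<in>UNIV. E$k$d * E$i$d) * (\<Sum>m\<in>UNIV. F$m$k * F$m$j))"
    by (simp add: upper lower mult.commute)
  also have "\<dots> = (\<Sum>d\<in>UNIV. E$i$d * F$d$j)" by (rule dual_sum)
  finally show ?thesis by (simp add: EF_sum)
qed

lemma upper_contract:
  "(\<Sum>i\<in>UNIV. \<Sum>j\<in>UNIV. upper_metric w i j * (u i * v j)) = (\<Sum>\<alpha>\<in>UNIV. (\<Sum>i\<in>UNIV. E$i$\<alpha> * u i) * (\<Sum>j\<in>UNIV. E$j$\<alpha> * v j))"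
proof -
  have "(\<Sum>\<alpha>\<in>UNIV. (\<Sum>i\<in>UNIV. E$i$\<alpha> * u i) * (\<Sum>j\<in>UNIV. E$j$\<alpha> * v j)) = (\<Sum>\<alpha>\<in>UNIV. (\<Sum>i\<in>UNIV. u i * E$i$\<alpha>) * (\<Sum>j\<in>UNIV. v j * E$j$\<alpha>))"
    by (simp add: mult.commute)
  also have "\<dots> = (\<Sum>i\<in>UNIV. \<Sum>j\<in>UNIV. u i * v j * (\<Sum>\<alpha>\<in>UNIV. E$i$\<alpha> * E$j$\<alpha>))" by (rule sum_bilinear)
  finally show ?thesis by (simp add: upper mult.commute)
qed

lemma from_frame:
  assumes "\<And>\<iota>. (\<Sum>i\<in>UNIV. E$i$\<iota> * X i) = Y \<iota>"
  shows "X i = (\<Sum>\<iota>\<in>UNIV. F$\<iota>$i * Y \<iota>)"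
proof -
  have "(\<Sum>\<iota>\<in>UNIV. F$\<iota>$i * Y \<iota>) = (\<Sum>\<iota>\<in>UNIV. \<Sum>j\<in>UNIV. (E$j$\<iota> * F$\<iota>$i) * X j)"
    by (simp add: assms[symmetric] sum_distrib_left mult_ac)
  also have "\<dots> = (\<Sum>j\<in>UNIV. delta j i * X j)"
    by (subst sum.swap) (simp add: sum_distrib_right[symmetric] EF_sum)
  finally show ?thesis by simp
qed

lemma phi_pull: "pull3 E w = phi0"
  using frame pull3_inverse[OF FE] by (simp add: model_frame_def)

lemma phi_push: "w = pull3 F phi0"
  using frame by (simp add: model_frame_def)

lemma raise3_by_frame: "raise3_by w u = pull3 (transpose E) (pull3 E u)"
  by (simp add: raise3_by_pull3 pull3_pull3 model_frame_metric(4)[OF frame] E_def matrix_transpose_mul)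

lemma raise_pairing:
  "(\<Sum>a\<in>UNIV. \<Sum>b\<in>UNIV. \<Sum>c\<in>UNIV. raise3_by w u a b c * v a b c)
   = (\<Sum>a\<in>UNIV. \<Sum>b\<in>UNIV. \<Sum>c\<in>UNIV. pull3 E u a b c * pull3 E v a b c)"
  unfolding raise3_by_frame by (subst pull3_adjoint) simp

lemma pull3_slot: "pull3 E (\<lambda>a j k. X a * Y a j k) = (\<lambda>\<beta> \<gamma> \<delta>. \<Sum>a\<in>UNIV. E$a$\<beta> * X a * (\<Sum>j\<in>UNIV. \<Sum>k\<in>UNIV. E$j$\<gamma> * E$k$\<delta> * Y a j k))"
  by (simp add: fun_eq_iff pull3_def sum_distrib_left mult_ac)

lemma partial_pull:
  "(\<Sum>j\<in>UNIV. \<Sum>k\<in>UNIV. E$j$\<gamma> * E$k$\<delta> * u i j k) = (\<Sum>\<iota>\<in>UNIV. F$\<iota>$i * pull3 E u \<iota> \<gamma> \<delta>)"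
  by (rule from_frame) (simp add: pull3_def sum_distrib_left mult_ac)

text \<open>Contraction of two slots of a raised tensor, evaluated in the frame.\<close>

lemma partial_pairing:
  "(\<Sum>j\<in>UNIV. \<Sum>k\<in>UNIV. raise3_by w u b j k * v i j k)
   = (\<Sum>\<beta>\<in>UNIV. \<Sum>\<iota>\<in>UNIV. E$b$\<beta> * F$\<iota>$i * (\<Sum>\<gamma>\<in>UNIV. \<Sum>\<delta>\<in>UNIV. pull3 E u \<beta> \<gamma> \<delta> * pull3 E v \<iota> \<gamma> \<delta>))"
proof -
  have "(\<Sum>j\<in>UNIV. \<Sum>k\<in>UNIV. raise3_by w u b j k * v i j k)
    = (\<Sum>a\<in>UNIV. \<Sum>j\<in>UNIV. \<Sum>k\<in>UNIV. raise3_by w u a j k * (delta a b * v i j k))"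
    by (simp add: mult.left_commute[of _ "delta _ b"] sum_distrib_left[symmetric])
  also have "\<dots> = (\<Sum>\<beta>\<in>UNIV. \<Sum>\<gamma>\<in>UNIV. \<Sum>\<delta>\<in>UNIV. pull3 E u \<beta> \<gamma> \<delta> * (E$b$\<beta> * (\<Sum>\<iota>\<in>UNIV. F$\<iota>$i * pull3 E v \<iota> \<gamma> \<delta>)))"
  proof -
    have "pull3 E (\<lambda>a j k. delta a b * v i j k) \<beta> \<gamma> \<delta> = E$b$\<beta> * (\<Sum>\<iota>\<in>UNIV. F$\<iota>$i * pull3 E v \<iota> \<gamma> \<delta>)" for \<beta> \<gamma> \<delta>
      unfolding pull3_slot[of "\<lambda>a. delta a b" "\<lambda>a. v i"] partial_pull
      by (simp add: mult.commute[of _ "delta _ b"] mult.assoc)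
    then show ?thesis unfolding raise_pairing by simp
  qed
  also have "\<dots> = (\<Sum>\<beta>\<in>UNIV. \<Sum>\<gamma>\<in>UNIV. \<Sum>\<delta>\<in>UNIV. \<Sum>\<iota>\<in>UNIV. E$b$\<beta> * F$\<iota>$i * (pull3 E u \<beta> \<gamma> \<delta> * pull3 E v \<iota> \<gamma> \<delta>))"
    by (simp add: sum_distrib_left mult_ac)
  also have "\<dots> = (\<Sum>\<beta>\<in>UNIV. \<Sum>\<iota>\<in>UNIV. \<Sum>\<gamma>\<in>UNIV. \<Sum>\<delta>\<in>UNIV. E$b$\<beta> * F$\<iota>$i * (pull3 E u \<beta> \<gamma> \<delta> * pull3 E v \<iota> \<gamma> \<delta>))"
    by (rule sum.cong[OF refl], subst (2) sum.swap, subst sum.swap, rule refl)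
  finally show ?thesis by (simp add: sum_distrib_left)
qed

lemma phi_phi: "(\<Sum>j\<in>UNIV. \<Sum>k\<in>UNIV. raise3 w b j k * w i j k) = 6 * delta b i"
  unfolding raise3_eq partial_pairing phi_pull phi0_phi0_2
  by (simp add: mult.left_commute[of _ 6] sum_distrib_left[symmetric] EF_sum)

lemma hodge_pull: "hodge_dual w = pull4 F psi0"
  by (rule model_frame_hodge[OF frame])

lemma hodge_slot: "hodge_dual w q i j k = (\<Sum>\<pi>\<in>UNIV. F$\<pi>$q * pull3 F (psi0 \<pi>) i j k)"
  unfolding hodge_pull pull4_def pull3_def by (simp add: sum_distrib_left mult_ac)

lemma pull3_sum: "pull3 G (\<lambda>i j k. \<Sum>p\<in>A. c p * X p i j k) i j k = (\<Sum>p\<in>A. c p * pull3 G (X p) i j k)"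
  unfolding pull3_def sum_distrib_left
  by (subst (3) sum.swap, subst (2) sum.swap, subst sum.swap) (simp only: mult_ac)

lemma pull3_hodge: "pull3 E (hodge_dual w q) i j k = (\<Sum>\<pi>\<in>UNIV. F$\<pi>$q * psi0 \<pi> i j k)"
proof -
  have "hodge_dual w q = (\<lambda>i j k. \<Sum>\<pi>\<in>UNIV. F$\<pi>$q * pull3 F (psi0 \<pi>) i j k)"
    by (simp add: fun_eq_iff hodge_slot)
  then have "pull3 E (hodge_dual w q) i j k = (\<Sum>\<pi>\<in>UNIV. F$\<pi>$q * pull3 E (pull3 F (psi0 \<pi>)) i j k)"
    by (simp only: pull3_sum)
  then show ?thesis by (simp only: pull3_inverse[OF FE])
qed

lemma raised_hodge: "(\<Sum>q\<in>UNIV. E$q$\<pi> * hodge_dual w q i j k) = pull3 F (psi0 \<pi>) i j k"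
proof -
  have "(\<Sum>q\<in>UNIV. E$q$\<pi> * hodge_dual w q i j k) = (\<Sum>q\<in>UNIV. (\<Sum>d\<in>UNIV. E$q$d * delta d \<pi>) * (\<Sum>m\<in>UNIV. F$m$q * pull3 F (psi0 m) i j k))"
    by (simp add: hodge_slot)
  also have "\<dots> = (\<Sum>d\<in>UNIV. delta d \<pi> * pull3 F (psi0 d) i j k)" by (rule dual_sum)
  finally show ?thesis by simp
qed

definition torsion_eq :: "tensor4 \<Rightarrow> tensor2 \<Rightarrow> bool" where
  "torsion_eq P T \<longleftrightarrow> (\<forall>m i j k. P m i j k = (\<Sum>p\<in>UNIV. \<Sum>q\<in>UNIV. T m p * upper_metric w p q * hodge_dual w q i j k))"

lemma torsion_frame:
  "(\<Sum>p\<in>UNIV. \<Sum>q\<in>UNIV. T m p * upper_metric w p q * hodge_dual w q i j k) = (\<Sum>\<pi>\<in>UNIV. (\<Sum>p\<in>UNIV. E$p$\<pi> * T m p) * pull3 F (psi0 \<pi>) i j k)"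
proof -
  have "(\<Sum>p\<in>UNIV. \<Sum>q\<in>UNIV. T m p * upper_metric w p q * hodge_dual w q i j k) = (\<Sum>p\<in>UNIV. \<Sum>q\<in>UNIV. upper_metric w p q * (T m p * hodge_dual w q i j k))"
    by (simp add: mult_ac)
  then show ?thesis unfolding upper_contract raised_hodge .
qed

lemma torsion_eq_exists:
  assumes alt: "\<And>m. alternating3 (P m)"
    and eq: "\<And>m b i. (\<Sum>j\<in>UNIV. \<Sum>k\<in>UNIV. raise3_by w (P m) b j k * w i j k) + (\<Sum>j\<in>UNIV. \<Sum>k\<in>UNIV. raise3 w b j k * P m i j k) = 0"
  shows "\<exists>T. torsion_eq P T"
proof -
  have "\<exists>t. \<forall>i j k. P m i j k = (\<Sum>\<pi>\<in>UNIV. t \<pi> * pull3 F (psi0 \<pi>) i j k)" for m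
  proof -
    let ?u = "pull3 E (P m)"
    define Z where "Z \<beta> \<iota> = (\<Sum>\<gamma>\<in>UNIV. \<Sum>\<delta>\<in>UNIV. ?u \<beta> \<gamma> \<delta> * phi0 \<iota> \<gamma> \<delta> + phi0 \<beta> \<gamma> \<delta> * ?u \<iota> \<gamma> \<delta>)" for \<beta> \<iota>
    have z: "(\<Sum>\<beta>\<in>UNIV. \<Sum>\<iota>\<in>UNIV. E$b$\<beta> * F$\<iota>$i * Z \<beta> \<iota>) = 0" for b i
      using eq[of m b i] unfolding raise3_eq partial_pairing phi_pull Z_def
      by (simp add: sum.distrib distrib_left)
    have Z: "Z \<beta> \<iota> = 0" for \<beta> \<iota>
    proof -
      have e: "transpose (\<chi> a b. Z b a) = (\<chi> a b. Z a b)" by (simp add: transpose_def)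
      have "E ** (\<chi> a b. Z a b) ** F = 0"
        using z by (simp add: vec_eq_iff matrix_matrix_mult_def sum_distrib_left sum_distrib_right mult_ac)
          (subst sum.swap, simp add: mult_ac)
      then have "F ** (E ** (\<chi> a b. Z a b) ** F) ** E = 0" by simp
      moreover have "F ** (E ** (\<chi> a b. Z a b) ** F) ** E = (F ** E) ** (\<chi> a b. Z a b) ** (F ** E)"
        by (simp add: matrix_mul_assoc)
      ultimately have "(\<chi> a b. Z a b) = 0" by (simp add: FE)
      then show ?thesis by (simp add: vec_eq_iff)
    qed
    have "\<exists>t. \<forall>i j k. ?u i j k = (\<Sum>p\<in>UNIV. t p * psi0 p i j k)"
      by (rule psi0_kernel[OF alternating3_pull3[OF alt]]) (use Z in \<open>simp add: Z_def\<close>)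
    then obtain t where "?u = (\<lambda>i j k. \<Sum>p\<in>UNIV. t p * psi0 p i j k)" by (auto simp: fun_eq_iff)
    then have "pull3 F ?u i j k = (\<Sum>\<pi>\<in>UNIV. t \<pi> * pull3 F (psi0 \<pi>) i j k)" for i j k
      by (simp add: pull3_sum)
    then show ?thesis by (auto simp: pull3_inverse[OF EF])
  qed
  then have "\<forall>m. \<exists>t. \<forall>i j k. P m i j k = (\<Sum>\<pi>\<in>UNIV. t \<pi> * pull3 F (psi0 \<pi>) i j k)" by blast
  from choice[OF this] obtain t where t: "\<And>m i j k. P m i j k = (\<Sum>\<pi>\<in>UNIV. t m \<pi> * pull3 F (psi0 \<pi>) i j k)"
    by blast
  define T where "T m p = (\<Sum>\<pi>\<in>UNIV. F$\<pi>$p * t m \<pi>)" for m p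
  have "(\<Sum>p\<in>UNIV. E$p$\<pi> * T m p) = t m \<pi>" for m \<pi>
  proof -
    have "(\<Sum>p\<in>UNIV. E$p$\<pi> * T m p) = (\<Sum>p\<in>UNIV. (\<Sum>d\<in>UNIV. E$p$d * delta d \<pi>) * (\<Sum>\<pi>\<in>UNIV. F$\<pi>$p * t m \<pi>))"
      by (simp add: T_def)
    also have "\<dots> = (\<Sum>d\<in>UNIV. delta d \<pi> * t m d)" by (rule dual_sum)
    finally show ?thesis by simp
  qed
  then have "torsion_eq P T" unfolding torsion_eq_def torsion_frame by (simp add: t)
  then show ?thesis by blast
qed

definition frame_torsion :: "tensor2 \<Rightarrow> tensor2" where
  "frame_torsion T \<alpha> \<pi> = (\<Sum>m\<in>UNIV. E$m$\<alpha> * (\<Sum>p\<in>UNIV. E$p$\<pi> * T m p))"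

lemma psi0_psi0_full: "(\<Sum>i\<in>UNIV. \<Sum>j\<in>UNIV. \<Sum>k\<in>UNIV. psi0 p i j k * psi0 q i j k) = 24 * delta p q"
  unfolding psi0_psi0 psi0_repeat
  by (simp add: sum_subtractf)

lemma torsion_eq_unique:
  assumes "torsion_eq P T" "torsion_eq P T'"
  shows "T = T'"
proof (intro ext)
  fix m p
  define D where "D \<pi> = (\<Sum>p\<in>UNIV. E$p$\<pi> * T m p) - (\<Sum>p\<in>UNIV. E$p$\<pi> * T' m p)" for \<pi>
  have z: "(\<Sum>\<pi>\<in>UNIV. D \<pi> * pull3 F (psi0 \<pi>) i j k) = 0" for i j k
    using assms unfolding torsion_eq_def torsion_frame D_def
    by (simp add: left_diff_distrib sum_subtractf)
  have "(\<Sum>\<pi>\<in>UNIV. D \<pi> * psi0 \<pi> i j k) = 0" for i j k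
  proof -
    have "pull3 E (\<lambda>i j k. \<Sum>\<pi>\<in>UNIV. D \<pi> * pull3 F (psi0 \<pi>) i j k) i j k = (\<Sum>\<pi>\<in>UNIV. D \<pi> * psi0 \<pi> i j k)"
      unfolding pull3_sum pull3_inverse[OF FE] ..
    then show ?thesis unfolding z by (simp add: pull3_def)
  qed
  then have "(\<Sum>i\<in>UNIV. \<Sum>j\<in>UNIV. \<Sum>k\<in>UNIV. (\<Sum>\<pi>\<in>UNIV. D \<pi> * psi0 \<pi> i j k) * psi0 q i j k) = 0" for q by simp
  moreover have "(\<Sum>i\<in>UNIV. \<Sum>j\<in>UNIV. \<Sum>k\<in>UNIV. (\<Sum>\<pi>\<in>UNIV. D \<pi> * psi0 \<pi> i j k) * psi0 q i j k)
    = (\<Sum>\<pi>\<in>UNIV. D \<pi> * (\<Sum>i\<in>UNIV. \<Sum>j\<in>UNIV. \<Sum>k\<in>UNIV. psi0 \<pi> i j k * psi0 q i j k))" for q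
    unfolding sum_distrib_left sum_distrib_right mult.assoc
    by (subst (3) sum.swap, subst (2) sum.swap, subst sum.swap, rule refl)
  moreover have "(\<Sum>\<pi>\<in>UNIV. D \<pi> * (24 * delta \<pi> q)) = 24 * D q" for q
  proof -
    have "(\<Sum>\<pi>\<in>UNIV. D \<pi> * (24 * delta \<pi> q)) = (\<Sum>\<pi>\<in>UNIV. 24 * D \<pi> * delta \<pi> q)" by (simp only: mult_ac)
    then show ?thesis by simp
  qed
  ultimately have D0: "D q = 0" for q
    unfolding psi0_psi0_full by simp
  have "T m p - T' m p = (\<Sum>\<pi>\<in>UNIV. F$\<pi>$p * D \<pi>)"
    by (rule from_frame) (simp add: D_def right_diff_distrib sum_subtractf)
  then show "T m p = T' m p" by (simp add: D0)
qed

end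

lemma sum_rotate3:
  "(\<Sum>j\<in>A. \<Sum>k\<in>B. \<Sum>q\<in>C. f j k q) = (\<Sum>q\<in>C. \<Sum>j\<in>A. \<Sum>k\<in>B. f j k q)"
proof -
  have "(\<Sum>j\<in>A. \<Sum>k\<in>B. \<Sum>q\<in>C. f j k q) = (\<Sum>j\<in>A. \<Sum>q\<in>C. \<Sum>k\<in>B. f j k q)"
    by (rule sum.cong[OF refl], rule sum.swap)
  also have "\<dots> = (\<Sum>q\<in>C. \<Sum>j\<in>A. \<Sum>k\<in>B. f j k q)" by (rule sum.swap)
  finally show ?thesis .
qed

context framed begin

definition frame4 :: "tensor4 \<Rightarrow> tensor4" where
  "frame4 P \<alpha> \<beta> \<gamma> \<delta> = (\<Sum>a\<in>UNIV. E$a$\<alpha> * pull3 E (P a) \<beta> \<gamma> \<delta>)"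

lemma frame4_swap:
  "(\<Sum>i\<in>UNIV. E$i$\<alpha> * pull3 E (\<lambda>b j k. P b i j k) \<beta> \<gamma> \<delta>) = frame4 P \<beta> \<alpha> \<gamma> \<delta>"
proof -
  have "(\<Sum>i\<in>UNIV. E$i$\<alpha> * pull3 E (\<lambda>b j k. P b i j k) \<beta> \<gamma> \<delta>)
    = (\<Sum>i\<in>UNIV. \<Sum>b\<in>UNIV. \<Sum>j\<in>UNIV. \<Sum>k\<in>UNIV. E$b$\<beta> * (E$i$\<alpha> * E$j$\<gamma> * E$k$\<delta> * P b i j k))"
    by (simp add: pull3_def sum_distrib_left mult_ac)
  also have "\<dots> = (\<Sum>b\<in>UNIV. \<Sum>i\<in>UNIV. \<Sum>j\<in>UNIV. \<Sum>k\<in>UNIV. E$b$\<beta> * (E$i$\<alpha> * E$j$\<gamma> * E$k$\<delta> * P b i j k))"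
    by (rule sum.swap)
  finally show ?thesis by (simp add: frame4_def pull3_def sum_distrib_left)
qed

lemma cross_term_frame:
  "(\<Sum>a\<in>UNIV. \<Sum>i\<in>UNIV. upper_metric w a i * (\<Sum>b\<in>UNIV. \<Sum>j\<in>UNIV. \<Sum>k\<in>UNIV. raise3_by w (P a) b j k * P b i j k))
   = (\<Sum>\<alpha>\<in>UNIV. \<Sum>\<beta>\<in>UNIV. \<Sum>\<gamma>\<in>UNIV. \<Sum>\<delta>\<in>UNIV. frame4 P \<alpha> \<beta> \<gamma> \<delta> * frame4 P \<beta> \<alpha> \<gamma> \<delta>)"
proof -
  let ?A = "\<lambda>a. pull3 E (P a)" and ?B = "\<lambda>i. pull3 E (\<lambda>b j k. P b i j k)"
  have "(\<Sum>a\<in>UNIV. \<Sum>i\<in>UNIV. upper_metric w a i * (\<Sum>b\<in>UNIV. \<Sum>j\<in>UNIV. \<Sum>k\<in>UNIV. raise3_by w (P a) b j k * P b i j k))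
    = (\<Sum>a\<in>UNIV. \<Sum>i\<in>UNIV. \<Sum>\<beta>\<in>UNIV. \<Sum>\<gamma>\<in>UNIV. \<Sum>\<delta>\<in>UNIV. upper_metric w a i * (?A a \<beta> \<gamma> \<delta> * ?B i \<beta> \<gamma> \<delta>))"
    unfolding raise_pairing by (simp add: sum_distrib_left)
  also have "\<dots> = (\<Sum>\<beta>\<in>UNIV. \<Sum>\<gamma>\<in>UNIV. \<Sum>\<delta>\<in>UNIV. \<Sum>a\<in>UNIV. \<Sum>i\<in>UNIV. upper_metric w a i * (?A a \<beta> \<gamma> \<delta> * ?B i \<beta> \<gamma> \<delta>))"
    using sum_swap33[where A = "UNIV :: 7 set" and B = "UNIV :: 7 set" and C = "{()}" and P = UNIV and Q = UNIV and R = UNIV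
      and f = "\<lambda>a i (_::unit) \<beta> \<gamma> \<delta>. upper_metric w a i * (?A a \<beta> \<gamma> \<delta> * ?B i \<beta> \<gamma> \<delta>)"] by simp
  also have "\<dots> = (\<Sum>\<beta>\<in>UNIV. \<Sum>\<gamma>\<in>UNIV. \<Sum>\<delta>\<in>UNIV. \<Sum>\<alpha>\<in>UNIV. frame4 P \<alpha> \<beta> \<gamma> \<delta> * frame4 P \<beta> \<alpha> \<gamma> \<delta>)"
    unfolding upper_contract frame4_swap[where P = P] frame4_def[of P, symmetric] by (rule refl)
  also have "\<dots> = (\<Sum>\<alpha>\<in>UNIV. \<Sum>\<beta>\<in>UNIV. \<Sum>\<gamma>\<in>UNIV. \<Sum>\<delta>\<in>UNIV. frame4 P \<alpha> \<beta> \<gamma> \<delta> * frame4 P \<beta> \<alpha> \<gamma> \<delta>)"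
    by (subst (3) sum.swap, subst (2) sum.swap, subst sum.swap, rule refl)
  finally show ?thesis .
qed

text \<open>The codifferential-like trace of the covariant derivative.\<close>

definition trace_first :: "tensor4 \<Rightarrow> tensor2" where
  "trace_first P j k = (\<Sum>a\<in>UNIV. \<Sum>i\<in>UNIV. upper_metric w a i * P a i j k)"

lemma trace_first_frame:
  "(\<Sum>j\<in>UNIV. \<Sum>k\<in>UNIV. E$j$\<gamma> * E$k$\<delta> * trace_first P j k) = (\<Sum>\<alpha>\<in>UNIV. frame4 P \<alpha> \<alpha> \<gamma> \<delta>)"
proof -
  have "(\<Sum>j\<in>UNIV. \<Sum>k\<in>UNIV. E$j$\<gamma> * E$k$\<delta> * trace_first P j k)
    = (\<Sum>j\<in>UNIV. \<Sum>k\<in>UNIV. \<Sum>a\<in>UNIV. \<Sum>i\<in>UNIV. \<Sum>\<alpha>\<in>UNIV. E$a$\<alpha> * (E$i$\<alpha> * E$j$\<gamma> * E$k$\<delta> * P a i j k))"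
    by (simp add: trace_first_def upper sum_distrib_left sum_distrib_right mult_ac)
  also have "\<dots> = (\<Sum>a\<in>UNIV. \<Sum>i\<in>UNIV. \<Sum>\<alpha>\<in>UNIV. \<Sum>j\<in>UNIV. \<Sum>k\<in>UNIV. E$a$\<alpha> * (E$i$\<alpha> * E$j$\<gamma> * E$k$\<delta> * P a i j k))"
    using sum_swap33[where A = "UNIV :: 7 set" and B = "UNIV :: 7 set" and C = "{()}" and P = UNIV and Q = UNIV and R = UNIV
      and f = "\<lambda>j k (_::unit) a i \<alpha>. E$a$\<alpha> * (E$i$\<alpha> * E$j$\<gamma> * E$k$\<delta> * P a i j k)"] by simp
  also have "\<dots> = (\<Sum>\<alpha>\<in>UNIV. \<Sum>a\<in>UNIV. \<Sum>i\<in>UNIV. \<Sum>j\<in>UNIV. \<Sum>k\<in>UNIV. E$a$\<alpha> * (E$i$\<alpha> * E$j$\<gamma> * E$k$\<delta> * P a i j k))"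
    by (subst (2) sum.swap, subst sum.swap, rule refl)
  finally show ?thesis by (simp add: frame4_def pull3_def sum_distrib_left)
qed

lemma trace_pairing_frame:
  "(\<Sum>b\<in>UNIV. \<Sum>j\<in>UNIV. \<Sum>k\<in>UNIV. raise3_by w (P b) b j k * X j k)
   = (\<Sum>\<alpha>\<in>UNIV. \<Sum>\<gamma>\<in>UNIV. \<Sum>\<delta>\<in>UNIV. frame4 P \<alpha> \<alpha> \<gamma> \<delta> * (\<Sum>j\<in>UNIV. \<Sum>k\<in>UNIV. E$j$\<gamma> * E$k$\<delta> * X j k))" (is "_ = ?R")
proof -
  let ?X = "\<lambda>\<gamma> \<delta>. (\<Sum>j\<in>UNIV. \<Sum>k\<in>UNIV. E$j$\<gamma> * E$k$\<delta> * X j k)"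
  have 1: "(\<Sum>j\<in>UNIV. \<Sum>k\<in>UNIV. raise3_by w u b j k * X j k) = (\<Sum>\<alpha>\<in>UNIV. \<Sum>\<gamma>\<in>UNIV. \<Sum>\<delta>\<in>UNIV. E$b$\<alpha> * pull3 E u \<alpha> \<gamma> \<delta> * ?X \<gamma> \<delta>)" for u b
  proof -
    have "(\<Sum>j\<in>UNIV. \<Sum>k\<in>UNIV. raise3_by w u b j k * X j k)
      = (\<Sum>a\<in>UNIV. \<Sum>j\<in>UNIV. \<Sum>k\<in>UNIV. raise3_by w u a j k * (delta a b * X j k))"
      by (simp add: mult.left_commute[of _ "delta _ b"] sum_distrib_left[symmetric])
    also have "\<dots> = (\<Sum>\<alpha>\<in>UNIV. \<Sum>\<gamma>\<in>UNIV. \<Sum>\<delta>\<in>UNIV. pull3 E u \<alpha> \<gamma> \<delta> * (E$b$\<alpha> * ?X \<gamma> \<delta>))"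
    proof -
      have "pull3 E (\<lambda>a j k. delta a b * X j k) \<beta> \<gamma> \<delta> = E$b$\<beta> * ?X \<gamma> \<delta>" for \<beta> \<gamma> \<delta>
        unfolding pull3_slot[of "\<lambda>a. delta a b" "\<lambda>a. X"]
        by (simp add: mult.commute[of _ "delta _ b"] mult.assoc)
      then show ?thesis unfolding raise_pairing by simp
    qed
    finally show ?thesis by (simp add: mult_ac)
  qed
  have "(\<Sum>b\<in>UNIV. \<Sum>j\<in>UNIV. \<Sum>k\<in>UNIV. raise3_by w (P b) b j k * X j k)
    = (\<Sum>b\<in>UNIV. \<Sum>\<alpha>\<in>UNIV. \<Sum>\<gamma>\<in>UNIV. \<Sum>\<delta>\<in>UNIV. E$b$\<alpha> * pull3 E (P b) \<alpha> \<gamma> \<delta> * ?X \<gamma> \<delta>)"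
    unfolding 1 ..
  also have "\<dots> = (\<Sum>\<alpha>\<in>UNIV. \<Sum>\<gamma>\<in>UNIV. \<Sum>\<delta>\<in>UNIV. \<Sum>b\<in>UNIV. E$b$\<alpha> * pull3 E (P b) \<alpha> \<gamma> \<delta> * ?X \<gamma> \<delta>)"
    by (subst sum.swap, subst (2) sum.swap, subst (3) sum.swap, rule refl)
  also have "\<dots> = ?R" by (simp only: sum_distrib_right[symmetric] frame4_def)
  finally show ?thesis .
qed

lemma trace_term_frame:
  "(\<Sum>b\<in>UNIV. \<Sum>j\<in>UNIV. \<Sum>k\<in>UNIV. raise3_by w (P b) b j k * trace_first P j k)
   = (\<Sum>\<gamma>\<in>UNIV. \<Sum>\<delta>\<in>UNIV. (\<Sum>\<alpha>\<in>UNIV. frame4 P \<alpha> \<alpha> \<gamma> \<delta>)\<^sup>2)"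
  unfolding trace_pairing_frame trace_first_frame power2_eq_square
  by (subst sum.swap, rule sum.cong[OF refl], subst sum.swap) (simp add: sum_distrib_right)

text \<open>The two natural contractions of the derivative of the 3-form to a vector differ only by sign.\<close>

lemma trace_vectors_opposite:
  assumes eq: "\<And>m b i. (\<Sum>j\<in>UNIV. \<Sum>k\<in>UNIV. raise3_by w (P m) b j k * w i j k) + (\<Sum>j\<in>UNIV. \<Sum>k\<in>UNIV. raise3 w b j k * P m i j k) = 0"
  shows "(\<Sum>j\<in>UNIV. \<Sum>k\<in>UNIV. raise3 w c j k * trace_first P j k)
    = - (\<Sum>i\<in>UNIV. upper_metric w c i * (\<Sum>b\<in>UNIV. \<Sum>j\<in>UNIV. \<Sum>k\<in>UNIV. raise3 w b j k * P b i j k))"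
proof -
  have "(\<Sum>b\<in>UNIV. (\<Sum>j\<in>UNIV. \<Sum>k\<in>UNIV. raise3_by w (P b) b j k * w i j k) + (\<Sum>j\<in>UNIV. \<Sum>k\<in>UNIV. raise3 w b j k * P b i j k)) = 0" for i
    unfolding eq by simp
  then have "(\<Sum>b\<in>UNIV. \<Sum>j\<in>UNIV. \<Sum>k\<in>UNIV. raise3 w b j k * P b i j k) = - (\<Sum>b\<in>UNIV. \<Sum>j\<in>UNIV. \<Sum>k\<in>UNIV. raise3_by w (P b) b j k * w i j k)" for i
    by (simp add: sum.distrib eq_neg_iff_add_eq_0 add.commute)
  moreover have "(\<Sum>i\<in>UNIV. upper_metric w c i * (\<Sum>b\<in>UNIV. \<Sum>j\<in>UNIV. \<Sum>k\<in>UNIV. raise3_by w (P b) b j k * w i j k))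
     = (\<Sum>j\<in>UNIV. \<Sum>k\<in>UNIV. raise3 w c j k * trace_first P j k)"
  proof -
    have L: "(\<Sum>b\<in>UNIV. \<Sum>j\<in>UNIV. \<Sum>k\<in>UNIV. raise3_by w (P b) b j k * w i j k)
      = (\<Sum>\<iota>\<in>UNIV. F$\<iota>$i * (\<Sum>\<alpha>\<in>UNIV. \<Sum>\<gamma>\<in>UNIV. \<Sum>\<delta>\<in>UNIV. frame4 P \<alpha> \<alpha> \<gamma> \<delta> * phi0 \<iota> \<gamma> \<delta>))" for i
      unfolding trace_pairing_frame partial_pull phi_pull sum_distrib_left mult.left_commute[of _ "F$_$i"]
      by (subst (3) sum.swap, subst (2) sum.swap, subst sum.swap, rule refl)
    have "(\<Sum>i\<in>UNIV. upper_metric w c i * (\<Sum>\<iota>\<in>UNIV. F$\<iota>$i * Y \<iota>)) = (\<Sum>\<iota>\<in>UNIV. E$c$\<iota> * Y \<iota>)" for Y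
    proof -
      have "(\<Sum>i\<in>UNIV. upper_metric w c i * (\<Sum>\<iota>\<in>UNIV. F$\<iota>$i * Y \<iota>)) = (\<Sum>\<iota>\<in>UNIV. \<Sum>i\<in>UNIV. upper_metric w c i * F$\<iota>$i * Y \<iota>)"
        unfolding sum_distrib_left mult.assoc by (rule sum.swap)
      then show ?thesis by (simp add: sum_distrib_right[symmetric] upper_F)
    qed
    note R = this
    have "(\<Sum>j\<in>UNIV. \<Sum>k\<in>UNIV. raise3 w c j k * trace_first P j k)
      = (\<Sum>a\<in>UNIV. \<Sum>j\<in>UNIV. \<Sum>k\<in>UNIV. raise3_by w w a j k * (delta a c * trace_first P j k))"
      by (simp add: raise3_eq mult.left_commute[of _ "delta _ c"] sum_distrib_left[symmetric])
    also have "\<dots> = (\<Sum>\<iota>\<in>UNIV. \<Sum>\<gamma>\<in>UNIV. \<Sum>\<delta>\<in>UNIV. phi0 \<iota> \<gamma> \<delta> * (E$c$\<iota> * (\<Sum>\<alpha>\<in>UNIV. frame4 P \<alpha> \<alpha> \<gamma> \<delta>)))"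
    proof -
      have "pull3 E (\<lambda>a j k. delta a c * trace_first P j k) \<beta> \<gamma> \<delta> = E$c$\<beta> * (\<Sum>\<alpha>\<in>UNIV. frame4 P \<alpha> \<alpha> \<gamma> \<delta>)" for \<beta> \<gamma> \<delta>
        unfolding pull3_slot[of "\<lambda>a. delta a c" "\<lambda>a. trace_first P"] trace_first_frame
        by (simp add: mult.commute[of _ "delta _ c"] mult.assoc)
      then show ?thesis unfolding raise_pairing phi_pull by simp
    qed
    also have "\<dots> = (\<Sum>\<iota>\<in>UNIV. E$c$\<iota> * (\<Sum>\<alpha>\<in>UNIV. \<Sum>\<gamma>\<in>UNIV. \<Sum>\<delta>\<in>UNIV. frame4 P \<alpha> \<alpha> \<gamma> \<delta> * phi0 \<iota> \<gamma> \<delta>))"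
      unfolding sum_distrib_left
      by (rule sum.cong[OF refl], subst (3) sum.swap, subst (2) sum.swap) (simp only: mult_ac)
    finally show ?thesis unfolding L R by simp
  qed
  ultimately show ?thesis by (simp add: sum_negf)
qed

lemma norm_frame:
  "(\<Sum>i\<in>UNIV. \<Sum>j\<in>UNIV. \<Sum>k\<in>UNIV. \<Sum>l\<in>UNIV. upper_metric w i k * upper_metric w j l * T i j * T k l)
   = (\<Sum>\<alpha>\<in>UNIV. \<Sum>\<pi>\<in>UNIV. (frame_torsion T \<alpha> \<pi>)\<^sup>2)"
proof -
  have "(\<Sum>i\<in>UNIV. \<Sum>j\<in>UNIV. \<Sum>k\<in>UNIV. \<Sum>l\<in>UNIV. upper_metric w i k * upper_metric w j l * T i j * T k l)
    = (\<Sum>i\<in>UNIV. \<Sum>k\<in>UNIV. upper_metric w i k * (\<Sum>j\<in>UNIV. \<Sum>l\<in>UNIV. upper_metric w j l * (T i j * T k l)))"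
    unfolding sum_distrib_left by (rule sum.cong[OF refl], subst sum.swap) (simp only: mult_ac)
  also have "\<dots> = (\<Sum>i\<in>UNIV. \<Sum>k\<in>UNIV. \<Sum>\<pi>\<in>UNIV. upper_metric w i k * ((\<Sum>j\<in>UNIV. E$j$\<pi> * T i j) * (\<Sum>l\<in>UNIV. E$l$\<pi> * T k l)))"
    unfolding upper_contract sum_distrib_left ..
  also have "\<dots> = (\<Sum>\<pi>\<in>UNIV. \<Sum>i\<in>UNIV. \<Sum>k\<in>UNIV. upper_metric w i k * ((\<Sum>j\<in>UNIV. E$j$\<pi> * T i j) * (\<Sum>l\<in>UNIV. E$l$\<pi> * T k l)))"
    by (subst (2) sum.swap, subst sum.swap, rule refl)
  also have "\<dots> = (\<Sum>\<pi>\<in>UNIV. \<Sum>\<alpha>\<in>UNIV. (frame_torsion T \<alpha> \<pi>)\<^sup>2)"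
    unfolding upper_contract by (simp add: frame_torsion_def power2_eq_square)
  finally show ?thesis by (subst sum.swap)
qed

lemma frame4_torsion:
  assumes "torsion_eq P T"
  shows "frame4 P \<alpha> \<beta> \<gamma> \<delta> = (\<Sum>\<pi>\<in>UNIV. frame_torsion T \<alpha> \<pi> * psi0 \<pi> \<beta> \<gamma> \<delta>)"
proof -
  have "P m = (\<lambda>i j k. \<Sum>\<pi>\<in>UNIV. (\<Sum>p\<in>UNIV. E$p$\<pi> * T m p) * pull3 F (psi0 \<pi>) i j k)" for m
    using assms unfolding torsion_eq_def torsion_frame by (simp add: fun_eq_iff)
  then have pe: "pull3 E (P m) \<beta> \<gamma> \<delta> = (\<Sum>\<pi>\<in>UNIV. (\<Sum>p\<in>UNIV. E$p$\<pi> * T m p) * psi0 \<pi> \<beta> \<gamma> \<delta>)" for m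
    by (simp only: pull3_sum pull3_inverse[OF FE])
  have "frame4 P \<alpha> \<beta> \<gamma> \<delta> = (\<Sum>m\<in>UNIV. \<Sum>\<pi>\<in>UNIV. E$m$\<alpha> * ((\<Sum>p\<in>UNIV. E$p$\<pi> * T m p) * psi0 \<pi> \<beta> \<gamma> \<delta>))"
    unfolding frame4_def pe sum_distrib_left by (rule refl)
  also have "\<dots> = (\<Sum>\<pi>\<in>UNIV. frame_torsion T \<alpha> \<pi> * psi0 \<pi> \<beta> \<gamma> \<delta>)"
    unfolding frame_torsion_def by (subst sum.swap) (simp add: sum_distrib_right mult.assoc)
  finally show ?thesis .
qed

end

text \<open>The left side is a quadratic form in the 49 components of the torsion, which is invariant under \<open>G\<^sub>2\<close>.
  Its value on each irreducible component is a multiple of the norm, and \<open>- 12\<close> is a lower bound for the multiples.\<close>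

lemma quadratic_torsion:
  fixes t :: tensor2
  defines "p \<equiv> \<lambda>\<alpha> \<beta> \<gamma> \<delta>. \<Sum>\<pi>\<in>UNIV. t \<alpha> \<pi> * psi0 \<pi> \<beta> \<gamma> \<delta>"
  shows "(\<Sum>\<gamma>\<in>UNIV. \<Sum>\<delta>\<in>UNIV. (\<Sum>\<alpha>\<in>UNIV. p \<alpha> \<alpha> \<gamma> \<delta>)\<^sup>2) - (\<Sum>\<alpha>\<in>UNIV. \<Sum>\<beta>\<in>UNIV. \<Sum>\<gamma>\<in>UNIV. \<Sum>\<delta>\<in>UNIV. p \<alpha> \<beta> \<gamma> \<delta> * p \<beta> \<alpha> \<gamma> \<delta>)
    \<ge> - 12 * (\<Sum>\<alpha>\<in>UNIV. \<Sum>\<pi>\<in>UNIV. (t \<alpha> \<pi>)\<^sup>2)"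
proof -
  define N where "N = (\<Sum>\<alpha>\<in>UNIV. \<Sum>\<pi>\<in>UNIV. (t \<alpha> \<pi>)\<^sup>2)"
  define tr where "tr = (\<Sum>\<alpha>\<in>UNIV. t \<alpha> \<alpha>)"
  define B where "B = (\<Sum>\<alpha>\<in>UNIV. \<Sum>\<beta>\<in>UNIV. t \<alpha> \<beta> * t \<beta> \<alpha>)"
  define S where "S = (\<Sum>\<alpha>\<in>UNIV. \<Sum>\<beta>\<in>UNIV. \<Sum>\<pi>\<in>UNIV. \<Sum>\<rho>\<in>UNIV. t \<alpha> \<pi> * t \<beta> \<rho> * psi0 \<pi> \<beta> \<rho> \<alpha>)"
  have pp: "(\<Sum>\<gamma>\<in>UNIV. \<Sum>\<delta>\<in>UNIV. p \<alpha> \<beta> \<gamma> \<delta> * p \<mu> \<nu> \<gamma> \<delta>) = (\<Sum>\<pi>\<in>UNIV. \<Sum>\<rho>\<in>UNIV. t \<alpha> \<pi> * t \<mu> \<rho> *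
     (4 * delta \<pi> \<rho> * delta \<beta> \<nu> - 4 * delta \<pi> \<nu> * delta \<beta> \<rho> - 2 * psi0 \<pi> \<beta> \<rho> \<nu>))" for \<alpha> \<beta> \<mu> \<nu>
  proof -
    have "(\<Sum>\<gamma>\<in>UNIV. \<Sum>\<delta>\<in>UNIV. p \<alpha> \<beta> \<gamma> \<delta> * p \<mu> \<nu> \<gamma> \<delta>) = (\<Sum>x\<in>UNIV\<times>UNIV. (\<Sum>\<pi>\<in>UNIV. t \<alpha> \<pi> * psi0 \<pi> \<beta> (fst x) (snd x)) * (\<Sum>\<pi>\<in>UNIV. t \<mu> \<pi> * psi0 \<pi> \<nu> (fst x) (snd x)))"
      unfolding p_def sum.cartesian_product' by simp
    also have "\<dots> = (\<Sum>\<pi>\<in>UNIV. \<Sum>\<rho>\<in>UNIV. t \<alpha> \<pi> * t \<mu> \<rho> * (\<Sum>x\<in>UNIV\<times>UNIV. psi0 \<pi> \<beta> (fst x) (snd x) * psi0 \<rho> \<nu> (fst x) (snd x)))"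
      by (rule sum_bilinear)
    also have "(\<lambda>\<pi> \<rho>. \<Sum>x\<in>UNIV\<times>UNIV. psi0 \<pi> \<beta> (fst x) (snd x) * psi0 \<rho> \<nu> (fst x) (snd x)) = (\<lambda>\<pi> \<rho>. \<Sum>j\<in>UNIV. \<Sum>k\<in>UNIV. psi0 \<pi> \<beta> j k * psi0 \<rho> \<nu> j k)"
      unfolding sum.cartesian_product' by simp
    finally show ?thesis unfolding psi0_psi0 by (simp add: mult_ac)
  qed
  have exp: "(\<Sum>\<pi>\<in>UNIV. \<Sum>\<rho>\<in>UNIV. t \<alpha> \<pi> * t \<mu> \<rho> * (4 * delta \<pi> \<rho> * delta \<beta> \<nu> - 4 * delta \<pi> \<nu> * delta \<beta> \<rho> - 2 * psi0 \<pi> \<beta> \<rho> \<nu>))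
     = 4 * delta \<beta> \<nu> * (\<Sum>\<pi>\<in>UNIV. t \<alpha> \<pi> * t \<mu> \<pi>) - 4 * (t \<alpha> \<nu> * t \<mu> \<beta>) - 2 * (\<Sum>\<pi>\<in>UNIV. \<Sum>\<rho>\<in>UNIV. t \<alpha> \<pi> * t \<mu> \<rho> * psi0 \<pi> \<beta> \<rho> \<nu>)" for \<alpha> \<beta> \<mu> \<nu>
  proof -
    have 1: "(\<Sum>\<pi>\<in>UNIV. \<Sum>\<rho>\<in>UNIV. (4 * delta \<beta> \<nu> * t \<alpha> \<pi>) * t \<mu> \<rho> * delta \<pi> \<rho>) = 4 * delta \<beta> \<nu> * (\<Sum>\<pi>\<in>UNIV. t \<alpha> \<pi> * t \<mu> \<pi>)"
      by (simp add: sum_distrib_left mult_ac)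
    have 2: "(\<Sum>\<pi>\<in>UNIV. \<Sum>\<rho>\<in>UNIV. (4 * t \<alpha> \<pi> * delta \<pi> \<nu>) * t \<mu> \<rho> * delta \<beta> \<rho>) = 4 * (t \<alpha> \<nu> * t \<mu> \<beta>)"
    proof -
      have "(\<Sum>\<pi>\<in>UNIV. \<Sum>\<rho>\<in>UNIV. (4 * t \<alpha> \<pi> * delta \<pi> \<nu>) * t \<mu> \<rho> * delta \<beta> \<rho>) = (\<Sum>\<pi>\<in>UNIV. (4 * t \<alpha> \<pi> * t \<mu> \<beta>) * delta \<pi> \<nu>)"
        by (simp only: delta_sum(4)) (simp only: mult_ac)
      then show ?thesis by simp
    qed
    have "(\<Sum>\<pi>\<in>UNIV. \<Sum>\<rho>\<in>UNIV. t \<alpha> \<pi> * t \<mu> \<rho> * (4 * delta \<pi> \<rho> * delta \<beta> \<nu> - 4 * delta \<pi> \<nu> * delta \<beta> \<rho> - 2 * psi0 \<pi> \<beta> \<rho> \<nu>))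
      = (\<Sum>\<pi>\<in>UNIV. \<Sum>\<rho>\<in>UNIV. (4 * delta \<beta> \<nu> * t \<alpha> \<pi>) * t \<mu> \<rho> * delta \<pi> \<rho>)
       - (\<Sum>\<pi>\<in>UNIV. \<Sum>\<rho>\<in>UNIV. (4 * t \<alpha> \<pi> * delta \<pi> \<nu>) * t \<mu> \<rho> * delta \<beta> \<rho>)
       - (\<Sum>\<pi>\<in>UNIV. \<Sum>\<rho>\<in>UNIV. 2 * (t \<alpha> \<pi> * t \<mu> \<rho> * psi0 \<pi> \<beta> \<rho> \<nu>))"
      unfolding sum_subtractf[symmetric] by (intro sum.cong refl) (simp add: algebra_simps)
    then show ?thesis unfolding 1 2 by (simp add: sum_distrib_left)
  qed
  have Q1: "(\<Sum>\<alpha>\<in>UNIV. \<Sum>\<beta>\<in>UNIV. \<Sum>\<gamma>\<in>UNIV. \<Sum>\<delta>\<in>UNIV. p \<alpha> \<beta> \<gamma> \<delta> * p \<beta> \<alpha> \<gamma> \<delta>) = 4 * N - 4 * tr\<^sup>2 - 2 * S"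
  proof -
    have "(\<Sum>\<alpha>\<in>UNIV. \<Sum>\<beta>\<in>UNIV. delta \<beta> \<alpha> * (4 * (\<Sum>\<pi>\<in>UNIV. t \<alpha> \<pi> * t \<beta> \<pi>))) = 4 * N"
      by (simp only: delta_sum) (simp add: N_def power2_eq_square sum_distrib_left)
    moreover have "tr\<^sup>2 = (\<Sum>\<alpha>\<in>UNIV. \<Sum>\<beta>\<in>UNIV. t \<alpha> \<alpha> * t \<beta> \<beta>)"
      unfolding tr_def power2_eq_square by (rule sum_product)
    then have "(\<Sum>\<alpha>\<in>UNIV. \<Sum>\<beta>\<in>UNIV. 4 * (t \<alpha> \<alpha> * t \<beta> \<beta>)) = 4 * tr\<^sup>2"
      by (simp only: sum_distrib_left)
    ultimately show ?thesis
      unfolding pp exp sum_subtractf by (simp add: S_def sum_distrib_left mult_ac)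
  qed
  have Q2: "(\<Sum>\<gamma>\<in>UNIV. \<Sum>\<delta>\<in>UNIV. (\<Sum>\<alpha>\<in>UNIV. p \<alpha> \<alpha> \<gamma> \<delta>)\<^sup>2) = 4 * N - 4 * B + 2 * S"
  proof -
    have "(\<Sum>\<gamma>\<in>UNIV. \<Sum>\<delta>\<in>UNIV. (\<Sum>\<alpha>\<in>UNIV. p \<alpha> \<alpha> \<gamma> \<delta>)\<^sup>2) = (\<Sum>\<gamma>\<in>UNIV. \<Sum>\<delta>\<in>UNIV. \<Sum>\<alpha>\<in>UNIV. \<Sum>\<beta>\<in>UNIV. p \<alpha> \<alpha> \<gamma> \<delta> * p \<beta> \<beta> \<gamma> \<delta>)"
      by (simp add: power2_eq_square sum_product)
    also have "\<dots> = (\<Sum>\<alpha>\<in>UNIV. \<Sum>\<beta>\<in>UNIV. \<Sum>\<gamma>\<in>UNIV. \<Sum>\<delta>\<in>UNIV. p \<alpha> \<alpha> \<gamma> \<delta> * p \<beta> \<beta> \<gamma> \<delta>)"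
      using sum_swap33[where A = "UNIV :: 7 set" and B = "UNIV :: 7 set" and C = "{()}" and P = UNIV and Q = UNIV and R = "{()}"
        and f = "\<lambda>\<gamma> \<delta> (_::unit) \<alpha> \<beta> (_::unit). p \<alpha> \<alpha> \<gamma> \<delta> * p \<beta> \<beta> \<gamma> \<delta>"] by simp
    also have "\<dots> = 4 * N - 4 * B + 2 * S"
    proof -
      have "(\<Sum>\<alpha>\<in>UNIV. \<Sum>\<beta>\<in>UNIV. delta \<alpha> \<beta> * (4 * (\<Sum>\<pi>\<in>UNIV. t \<alpha> \<pi> * t \<beta> \<pi>))) = 4 * N"
        by (simp only: delta_sum) (simp add: N_def power2_eq_square sum_distrib_left)
      moreover have "(\<Sum>\<alpha>\<in>UNIV. \<Sum>\<beta>\<in>UNIV. \<Sum>\<pi>\<in>UNIV. \<Sum>\<rho>\<in>UNIV. t \<alpha> \<pi> * t \<beta> \<rho> * psi0 \<pi> \<alpha> \<rho> \<beta>) = - S"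
      proof -
        have p1: "psi0 \<pi> \<alpha> \<rho> \<beta> = - psi0 \<pi> \<beta> \<rho> \<alpha>" for \<pi> \<alpha> \<rho> \<beta>
          using psi0_swap(2)[of \<pi> \<rho> \<alpha> \<beta>] psi0_swap(3)[of \<pi> \<rho> \<beta> \<alpha>] psi0_swap(2)[of \<pi> \<beta> \<rho> \<alpha>] by linarith
        have e: "t \<alpha> \<pi> * t \<beta> \<rho> * psi0 \<pi> \<alpha> \<rho> \<beta> = - (t \<alpha> \<pi> * t \<beta> \<rho> * psi0 \<pi> \<beta> \<rho> \<alpha>)" for \<pi> \<alpha> \<rho> \<beta>
          by (subst p1) (simp only: mult_minus_right)
        show ?thesis unfolding S_def sum_negf[symmetric] by (intro sum.cong refl) (rule e)
      qed
      moreover have "(\<Sum>\<alpha>\<in>UNIV. \<Sum>\<beta>\<in>UNIV. 4 * (t \<alpha> \<beta> * t \<beta> \<alpha>)) = 4 * B" by (simp add: B_def sum_distrib_left)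
      moreover have "(\<Sum>\<alpha>\<in>UNIV. \<Sum>\<beta>\<in>UNIV. 4 * delta \<alpha> \<beta> * (\<Sum>\<pi>\<in>UNIV. t \<alpha> \<pi> * t \<beta> \<pi>))
        = (\<Sum>\<alpha>\<in>UNIV. \<Sum>\<beta>\<in>UNIV. delta \<alpha> \<beta> * (4 * (\<Sum>\<pi>\<in>UNIV. t \<alpha> \<pi> * t \<beta> \<pi>)))" by (simp only: mult_ac)
      moreover have "(\<Sum>\<alpha>\<in>UNIV. \<Sum>\<beta>\<in>UNIV. 2 * (\<Sum>\<pi>\<in>UNIV. \<Sum>\<rho>\<in>UNIV. t \<alpha> \<pi> * t \<beta> \<rho> * psi0 \<pi> \<alpha> \<rho> \<beta>))
        = 2 * (\<Sum>\<alpha>\<in>UNIV. \<Sum>\<beta>\<in>UNIV. \<Sum>\<pi>\<in>UNIV. \<Sum>\<rho>\<in>UNIV. t \<alpha> \<pi> * t \<beta> \<rho> * psi0 \<pi> \<alpha> \<rho> \<beta>)" by (simp only: sum_distrib_left)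
      ultimately show ?thesis
        unfolding pp exp sum_subtractf by linarith
    qed
    finally show ?thesis .
  qed
  have "- N \<le> B"
  proof -
    have "0 \<le> (\<Sum>\<alpha>\<in>UNIV. \<Sum>\<beta>\<in>UNIV. (t \<alpha> \<beta> + t \<beta> \<alpha>)\<^sup>2)" by (simp add: sum_nonneg)
    also have "\<dots> = (\<Sum>\<alpha>\<in>UNIV. \<Sum>\<beta>\<in>UNIV. (t \<alpha> \<beta>)\<^sup>2) + (\<Sum>\<alpha>\<in>UNIV. \<Sum>\<beta>\<in>UNIV. (t \<beta> \<alpha>)\<^sup>2) + 2 * B"
      by (simp add: power2_sum sum.distrib B_def sum_distrib_left mult_ac)
    also have "(\<Sum>\<alpha>\<in>UNIV. \<Sum>\<beta>\<in>UNIV. (t \<beta> \<alpha>)\<^sup>2) = N" unfolding N_def by (rule sum.swap)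
    finally show ?thesis by (simp add: N_def)
  qed
  moreover have "(\<Sum>\<gamma>\<in>UNIV. \<Sum>\<delta>\<in>UNIV. (\<Sum>\<alpha>\<in>UNIV. p \<alpha> \<alpha> \<gamma> \<delta>)\<^sup>2) \<ge> 0" by (simp add: sum_nonneg)
  moreover have "tr\<^sup>2 \<ge> 0" by simp
  ultimately show ?thesis using Q1 Q2 unfolding N_def[symmetric] by linarith
qed

context framed begin

text \<open>The algebraic heart of the sign argument: the quadratic terms in the divergence of \<open>V\<close> are
  not bounded below by zero, but their bound is weaker than what the scalar curvature supplies.\<close>

theorem torsion_inequality:
  assumes "torsion_eq P T"
  shows "(\<Sum>b\<in>UNIV. \<Sum>j\<in>UNIV. \<Sum>k\<in>UNIV. raise3_by w (P b) b j k * trace_first P j k)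
    - (\<Sum>a\<in>UNIV. \<Sum>i\<in>UNIV. upper_metric w a i * (\<Sum>b\<in>UNIV. \<Sum>j\<in>UNIV. \<Sum>k\<in>UNIV. raise3_by w (P a) b j k * P b i j k))
    \<ge> - 12 * (\<Sum>i\<in>UNIV. \<Sum>j\<in>UNIV. \<Sum>k\<in>UNIV. \<Sum>l\<in>UNIV. upper_metric w i k * upper_metric w j l * T i j * T k l)"
  unfolding trace_term_frame cross_term_frame norm_frame frame4_torsion[OF assms] by (rule quadratic_torsion)

lemma norm_eq_0:
  assumes "(\<Sum>i\<in>UNIV. \<Sum>j\<in>UNIV. \<Sum>k\<in>UNIV. \<Sum>l\<in>UNIV. upper_metric w i k * upper_metric w j l * T i j * T k l) \<le> 0"
  shows "T i j = 0"
proof -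
  have "(\<Sum>\<alpha>\<in>UNIV. \<Sum>\<pi>\<in>UNIV. (frame_torsion T \<alpha> \<pi>)\<^sup>2) = 0"
    using assms unfolding norm_frame by (intro antisym) (simp_all add: sum_nonneg)
  then have z: "frame_torsion T \<alpha> \<pi> = 0" for \<alpha> \<pi>
    by (simp add: sum_nonneg_eq_0_iff sum_nonneg)
  have "(\<Sum>p\<in>UNIV. E$p$\<pi> * T m p) = 0" for m \<pi>
    using from_frame[of "\<lambda>m. \<Sum>p\<in>UNIV. E$p$\<pi> * T m p" "\<lambda>\<alpha>. frame_torsion T \<alpha> \<pi>" m] z by (simp add: frame_torsion_def)
  then show ?thesis using from_frame[of "T i" "\<lambda>_. 0" j] by simp
qed

text \<open>By alternation each of the three terms of the diamond product contributes equally, and the contraction of the form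
  with itself in two indices is six times the metric.\<close>

lemma trace_diamond:
  "(\<Sum>i\<in>UNIV. \<Sum>j\<in>UNIV. \<Sum>k\<in>UNIV. raise3 w i j k * diamond h w i j k) = 18 * (\<Sum>p\<in>UNIV. \<Sum>q\<in>UNIV. upper_metric w p q * h q p)"
proof -
  have altw: "alternating3 w" unfolding phi_push by (rule alternating3_pull3[OF alternating_phi0])
  have altr: "alternating3 (raise3 w)" unfolding raise3_pull3 by (rule alternating3_pull3[OF altw])
  let ?h = "\<lambda>i q. \<Sum>p\<in>UNIV. upper_metric w p q * h i p"
  have d: "diamond h w i j k = (\<Sum>q\<in>UNIV. ?h i q * w q j k) + (\<Sum>q\<in>UNIV. ?h j q * w i q k) + (\<Sum>q\<in>UNIV. ?h k q * w i j q)" for i j k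
    unfolding diamond_def sum_distrib_right by (subst sum.swap) (simp add: distrib_left sum.distrib mult_ac)
  have 1: "(\<Sum>i\<in>UNIV. \<Sum>j\<in>UNIV. \<Sum>k\<in>UNIV. raise3 w i j k * (\<Sum>q\<in>UNIV. ?h i q * w q j k)) = 6 * (\<Sum>i\<in>UNIV. ?h i i)"
  proof -
    have "(\<Sum>j\<in>UNIV. \<Sum>k\<in>UNIV. raise3 w i j k * (\<Sum>q\<in>UNIV. ?h i q * w q j k)) = 6 * ?h i i" for i
    proof -
      have "(\<Sum>j\<in>UNIV. \<Sum>k\<in>UNIV. raise3 w i j k * (\<Sum>q\<in>UNIV. ?h i q * w q j k)) = (\<Sum>j\<in>UNIV. \<Sum>k\<in>UNIV. \<Sum>q\<in>UNIV. ?h i q * (raise3 w i j k * w q j k))"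
        unfolding sum_distrib_left[of "raise3 w i _ _"] by (simp only: mult.left_commute)
      also have "\<dots> = (\<Sum>q\<in>UNIV. ?h i q * (\<Sum>j\<in>UNIV. \<Sum>k\<in>UNIV. raise3 w i j k * w q j k))"
        unfolding sum_distrib_left[of "sum _ _"] by (rule sum_rotate3)
      also have "\<dots> = (\<Sum>q\<in>UNIV. 6 * ?h i q * delta i q)" unfolding phi_phi by (simp only: mult_ac)
      finally show ?thesis by simp
    qed
    then show ?thesis by (simp add: sum_distrib_left)
  qed
  have 2: "(\<Sum>i\<in>UNIV. \<Sum>j\<in>UNIV. \<Sum>k\<in>UNIV. raise3 w i j k * (\<Sum>q\<in>UNIV. ?h j q * w i q k)) = 6 * (\<Sum>i\<in>UNIV. ?h i i)"
    unfolding 1[symmetric]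
    by (subst sum.swap, intro sum.cong refl, subst alternating3_swap(1)[OF altr], subst alternating3_swap(1)[OF altw]) (simp add: sum_negf)
  have 3: "(\<Sum>i\<in>UNIV. \<Sum>j\<in>UNIV. \<Sum>k\<in>UNIV. raise3 w i j k * (\<Sum>q\<in>UNIV. ?h k q * w i j q)) = 6 * (\<Sum>i\<in>UNIV. ?h i i)"
    unfolding 2[symmetric]
    by (rule sum.cong[OF refl], subst sum.swap, intro sum.cong refl, subst alternating3_swap(2)[OF altr], subst alternating3_swap(2)[OF altw]) (simp add: sum_negf)
  have "(\<Sum>i\<in>UNIV. \<Sum>j\<in>UNIV. \<Sum>k\<in>UNIV. raise3 w i j k * diamond h w i j k) = 18 * (\<Sum>i\<in>UNIV. ?h i i)"
    unfolding d distrib_left sum.distrib 1 2 3 by simp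
  then show ?thesis by (subst (asm) (2) sum.swap)
qed

lemma phi0_psi0_full: "(\<Sum>i\<in>UNIV. \<Sum>j\<in>UNIV. \<Sum>k\<in>UNIV. phi0 i j k * psi0 l i j k) = 0"
proof -
  have "(\<Sum>i\<in>UNIV. \<Sum>j\<in>UNIV. \<Sum>k\<in>UNIV. phi0 i j k * psi0 l i j k) = (\<Sum>i\<in>UNIV. \<Sum>j\<in>UNIV. \<Sum>k\<in>UNIV. phi0 j k i * psi0 l i j k)"
    by (intro sum.cong refl) (metis phi0_cyclic)
  also have "\<dots> = 0" unfolding phi0_psi0 by (simp add: alternating3_repeat[OF alternating_phi0])
  finally show ?thesis .
qed

text \<open>In the frame this is the vanishing of the full contraction of the 3-form with three indices of its dual,
  a 4-form: no invariant vector exists.\<close>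

lemma trace_contract_dual:
  "(\<Sum>i\<in>UNIV. \<Sum>j\<in>UNIV. \<Sum>k\<in>UNIV. raise3 w i j k * contract_dual X w i j k) = 0"
proof -
  have z: "(\<Sum>i\<in>UNIV. \<Sum>j\<in>UNIV. \<Sum>k\<in>UNIV. raise3 w i j k * hodge_dual w l i j k) = 0" for l
  proof -
    have "(\<Sum>i\<in>UNIV. \<Sum>j\<in>UNIV. \<Sum>k\<in>UNIV. raise3 w i j k * hodge_dual w l i j k)
      = (\<Sum>i\<in>UNIV. \<Sum>j\<in>UNIV. \<Sum>k\<in>UNIV. \<Sum>\<pi>\<in>UNIV. F$\<pi>$l * (phi0 i j k * psi0 \<pi> i j k))"
      unfolding raise3_eq raise_pairing phi_pull pull3_hodge sum_distrib_left by (simp only: mult_ac)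
    also have "\<dots> = (\<Sum>\<pi>\<in>UNIV. F$\<pi>$l * (\<Sum>i\<in>UNIV. \<Sum>j\<in>UNIV. \<Sum>k\<in>UNIV. phi0 i j k * psi0 \<pi> i j k))"
      unfolding sum_distrib_left by (subst (3) sum.swap, subst (2) sum.swap, subst sum.swap, rule refl)
    finally show ?thesis by (simp add: phi0_psi0_full)
  qed
  have "(\<Sum>i\<in>UNIV. \<Sum>j\<in>UNIV. \<Sum>k\<in>UNIV. raise3 w i j k * contract_dual X w i j k)
    = (\<Sum>i\<in>UNIV. \<Sum>j\<in>UNIV. \<Sum>k\<in>UNIV. \<Sum>l\<in>UNIV. (\<Sum>m\<in>UNIV. upper_metric w l m * X m) * (raise3 w i j k * hodge_dual w l i j k))"
    unfolding contract_dual_def sum_distrib_left sum_distrib_right by (simp only: mult_ac)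
  also have "\<dots> = (\<Sum>l\<in>UNIV. (\<Sum>m\<in>UNIV. upper_metric w l m * X m) * (\<Sum>i\<in>UNIV. \<Sum>j\<in>UNIV. \<Sum>k\<in>UNIV. raise3 w i j k * hodge_dual w l i j k))"
    unfolding sum_distrib_left[of "\<Sum>m\<in>UNIV. upper_metric w _ m * X m"] by (subst (3) sum.swap, subst (2) sum.swap, subst sum.swap, rule refl)
  finally show ?thesis by (simp add: z)
qed

lemma phi_phi_single:
  defines "\<Theta> \<equiv> \<lambda>i. pull3 (transpose E) (\<lambda>\<beta> \<gamma> \<pi>. \<Sum>\<iota>\<in>UNIV. F$\<iota>$i * psi0 \<beta> \<gamma> \<iota> \<pi>)"
  shows "(\<Sum>k\<in>UNIV. raise3 w b j k * w i p k) = delta b i * delta j p - delta b p * delta j i - (\<Sum>q\<in>UNIV. \<Theta> i b j q * lower_metric w q p)"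
    and "alternating3 (\<Theta> i)"
proof -
  show "alternating3 (\<Theta> i)"
    unfolding \<Theta>_def
  proof (rule alternating3_pull3, unfold alternating3_def, intro allI conjI)
    fix \<beta> \<gamma> \<pi>
    show "(\<Sum>\<iota>\<in>UNIV. F$\<iota>$i * psi0 \<beta> \<gamma> \<iota> \<pi>) = - (\<Sum>\<iota>\<in>UNIV. F$\<iota>$i * psi0 \<gamma> \<beta> \<iota> \<pi>)"
      unfolding sum_negf[symmetric] by (intro sum.cong refl, subst psi0_swap(1)) simp
    have "psi0 \<beta> \<gamma> \<iota> \<pi> = - psi0 \<beta> \<pi> \<iota> \<gamma>" for \<iota>
      using psi0_swap(2)[of \<beta> \<iota> \<gamma> \<pi>] psi0_swap(3)[of \<beta> \<iota> \<pi> \<gamma>] psi0_swap(2)[of \<beta> \<pi> \<iota> \<gamma>] by linarith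
    then show "(\<Sum>\<iota>\<in>UNIV. F$\<iota>$i * psi0 \<beta> \<gamma> \<iota> \<pi>) = - (\<Sum>\<iota>\<in>UNIV. F$\<iota>$i * psi0 \<beta> \<pi> \<iota> \<gamma>)"
      unfolding sum_negf[symmetric] by (intro sum.cong refl) simp
  qed
  have r: "raise3 w b j k = (\<Sum>d\<in>UNIV. E$k$d * (\<Sum>x\<in>UNIV\<times>UNIV. (E$b$fst x * E$j$snd x) * phi0 (fst x) (snd x) d))" for k
  proof -
    have "raise3 w b j k = (\<Sum>\<beta>\<in>UNIV. \<Sum>\<gamma>\<in>UNIV. \<Sum>d\<in>UNIV. E$k$d * ((E$b$\<beta> * E$j$\<gamma>) * phi0 \<beta> \<gamma> d))"
      unfolding raise3_eq raise3_by_frame phi_pull pull3_def by (simp add: transpose_def mult_ac)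
    also have "\<dots> = (\<Sum>d\<in>UNIV. \<Sum>\<beta>\<in>UNIV. \<Sum>\<gamma>\<in>UNIV. E$k$d * ((E$b$\<beta> * E$j$\<gamma>) * phi0 \<beta> \<gamma> d))" by (rule sum_rotate3)
    finally show ?thesis unfolding sum.cartesian_product' by (simp add: sum_distrib_left)
  qed
  have f: "w i p k = (\<Sum>d\<in>UNIV. F$d$k * (\<Sum>x\<in>UNIV\<times>UNIV. (F$fst x$i * F$snd x$p) * phi0 (fst x) (snd x) d))" for k
  proof -
    have "w i p k = (\<Sum>\<beta>\<in>UNIV. \<Sum>\<gamma>\<in>UNIV. \<Sum>d\<in>UNIV. F$d$k * ((F$\<beta>$i * F$\<gamma>$p) * phi0 \<beta> \<gamma> d))"
      by (subst phi_push) (simp add: pull3_def mult_ac)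
    also have "\<dots> = (\<Sum>d\<in>UNIV. \<Sum>\<beta>\<in>UNIV. \<Sum>\<gamma>\<in>UNIV. F$d$k * ((F$\<beta>$i * F$\<gamma>$p) * phi0 \<beta> \<gamma> d))" by (rule sum_rotate3)
    finally show ?thesis unfolding sum.cartesian_product' by (simp add: sum_distrib_left)
  qed
  have "(\<Sum>k\<in>UNIV. raise3 w b j k * w i p k) = (\<Sum>d\<in>UNIV. (\<Sum>x\<in>UNIV\<times>UNIV. (E$b$fst x * E$j$snd x) * phi0 (fst x) (snd x) d) * (\<Sum>x\<in>UNIV\<times>UNIV. (F$fst x$i * F$snd x$p) * phi0 (fst x) (snd x) d))"
    unfolding r f by (rule dual_sum)
  also have "\<dots> = (\<Sum>x\<in>UNIV\<times>UNIV. \<Sum>z\<in>UNIV\<times>UNIV. (E$b$fst x * E$j$snd x) * (F$fst z$i * F$snd z$p) * (\<Sum>d\<in>UNIV. phi0 (fst x) (snd x) d * phi0 (fst z) (snd z) d))"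
    by (rule sum_bilinear)
  also have "\<dots> = (\<Sum>\<beta>\<in>UNIV. \<Sum>\<gamma>\<in>UNIV. \<Sum>\<iota>\<in>UNIV. \<Sum>\<pi>\<in>UNIV. (E$b$\<beta> * E$j$\<gamma>) * (F$\<iota>$i * F$\<pi>$p) * (delta \<beta> \<iota> * delta \<gamma> \<pi> - delta \<beta> \<pi> * delta \<gamma> \<iota> - psi0 \<beta> \<gamma> \<iota> \<pi>))"
    unfolding phi0_phi0 sum.cartesian_product' by simp
  also have "\<dots> = (\<Sum>\<beta>\<in>UNIV. \<Sum>\<gamma>\<in>UNIV. \<Sum>\<iota>\<in>UNIV. \<Sum>\<pi>\<in>UNIV. (E$b$\<beta> * E$j$\<gamma>) * (F$\<iota>$i * F$\<pi>$p) * (delta \<beta> \<iota> * delta \<gamma> \<pi>))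
    - (\<Sum>\<beta>\<in>UNIV. \<Sum>\<gamma>\<in>UNIV. \<Sum>\<iota>\<in>UNIV. \<Sum>\<pi>\<in>UNIV. (E$b$\<beta> * E$j$\<gamma>) * (F$\<iota>$i * F$\<pi>$p) * (delta \<beta> \<pi> * delta \<gamma> \<iota>))
    - (\<Sum>\<beta>\<in>UNIV. \<Sum>\<gamma>\<in>UNIV. \<Sum>\<iota>\<in>UNIV. \<Sum>\<pi>\<in>UNIV. (E$b$\<beta> * E$j$\<gamma>) * (F$\<iota>$i * F$\<pi>$p) * psi0 \<beta> \<gamma> \<iota> \<pi>)"
    by (simp only: sum_subtractf right_diff_distrib)
  also have "(\<Sum>\<beta>\<in>UNIV. \<Sum>\<gamma>\<in>UNIV. \<Sum>\<iota>\<in>UNIV. \<Sum>\<pi>\<in>UNIV. (E$b$\<beta> * E$j$\<gamma>) * (F$\<iota>$i * F$\<pi>$p) * (delta \<beta> \<iota> * delta \<gamma> \<pi>)) = delta b i * delta j p"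
  proof -
    have "(\<Sum>\<iota>\<in>UNIV. \<Sum>\<pi>\<in>UNIV. (e * f) * (F$\<iota>$i * F$\<pi>$p) * (delta \<beta> \<iota> * delta \<gamma> \<pi>)) = (e * F$\<beta>$i) * (f * F$\<gamma>$p)" for e f \<beta> \<gamma>
    proof -
      have "(\<Sum>\<iota>\<in>UNIV. \<Sum>\<pi>\<in>UNIV. (e * f) * (F$\<iota>$i * F$\<pi>$p) * (delta \<beta> \<iota> * delta \<gamma> \<pi>)) = (\<Sum>\<iota>\<in>UNIV. \<Sum>\<pi>\<in>UNIV. (e * F$\<iota>$i * delta \<beta> \<iota>) * (f * F$\<pi>$p * delta \<gamma> \<pi>))"
        by (simp only: mult_ac)
      then show ?thesis by (simp only: sum_distrib_left[symmetric] sum_distrib_right[symmetric] delta_sum)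
    qed
    then show ?thesis by (simp only: sum_product[symmetric] EF_sum)
  qed
  also have "(\<Sum>\<beta>\<in>UNIV. \<Sum>\<gamma>\<in>UNIV. \<Sum>\<iota>\<in>UNIV. \<Sum>\<pi>\<in>UNIV. (E$b$\<beta> * E$j$\<gamma>) * (F$\<iota>$i * F$\<pi>$p) * (delta \<beta> \<pi> * delta \<gamma> \<iota>)) = delta b p * delta j i"
  proof -
    have "(\<Sum>\<iota>\<in>UNIV. \<Sum>\<pi>\<in>UNIV. (e * f) * (F$\<iota>$i * F$\<pi>$p) * (delta \<beta> \<pi> * delta \<gamma> \<iota>)) = (e * F$\<beta>$p) * (f * F$\<gamma>$i)" for e f \<beta> \<gamma>
    proof -
      have "(\<Sum>\<iota>\<in>UNIV. \<Sum>\<pi>\<in>UNIV. (e * f) * (F$\<iota>$i * F$\<pi>$p) * (delta \<beta> \<pi> * delta \<gamma> \<iota>)) = (\<Sum>\<iota>\<in>UNIV. \<Sum>\<pi>\<in>UNIV. (f * F$\<iota>$i * delta \<gamma> \<iota>) * (e * F$\<pi>$p * delta \<beta> \<pi>))"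
        by (simp only: mult_ac)
      then show ?thesis by (simp only: sum_distrib_left[symmetric] sum_distrib_right[symmetric] delta_sum mult.commute)
    qed
    then show ?thesis by (simp only: sum_product[symmetric] EF_sum)
  qed
  also have "(\<Sum>\<beta>\<in>UNIV. \<Sum>\<gamma>\<in>UNIV. \<Sum>\<iota>\<in>UNIV. \<Sum>\<pi>\<in>UNIV. (E$b$\<beta> * E$j$\<gamma>) * (F$\<iota>$i * F$\<pi>$p) * psi0 \<beta> \<gamma> \<iota> \<pi>) = (\<Sum>q\<in>UNIV. \<Theta> i b j q * lower_metric w q p)"
  proof -
    have le: "(\<Sum>q\<in>UNIV. lower_metric w q p * E$q$\<pi>) = F$\<pi>$p" for \<pi>
      using lower_E[of p \<pi>] by (simp add: lower_commute)
    have "(\<Sum>q\<in>UNIV. \<Theta> i b j q * lower_metric w q p)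
      = (\<Sum>q\<in>UNIV. \<Sum>\<beta>\<in>UNIV. \<Sum>\<gamma>\<in>UNIV. \<Sum>\<pi>\<in>UNIV. (lower_metric w q p * E$q$\<pi>) * ((E$b$\<beta> * E$j$\<gamma>) * (\<Sum>\<iota>\<in>UNIV. F$\<iota>$i * psi0 \<beta> \<gamma> \<iota> \<pi>)))"
      unfolding \<Theta>_def pull3_def transpose_def sum_distrib_right[of _ _ "lower_metric w _ p"] by (simp add: mult_ac)
    also have "\<dots> = (\<Sum>\<beta>\<in>UNIV. \<Sum>\<gamma>\<in>UNIV. \<Sum>\<pi>\<in>UNIV. (\<Sum>q\<in>UNIV. lower_metric w q p * E$q$\<pi>) * ((E$b$\<beta> * E$j$\<gamma>) * (\<Sum>\<iota>\<in>UNIV. F$\<iota>$i * psi0 \<beta> \<gamma> \<iota> \<pi>)))"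
      unfolding sum_distrib_right[of _ _ "_ * sum _ _"] by (subst sum.swap, rule sum.cong[OF refl], rule sum_rotate3[symmetric])
    also have "\<dots> = (\<Sum>\<beta>\<in>UNIV. \<Sum>\<gamma>\<in>UNIV. \<Sum>\<pi>\<in>UNIV. \<Sum>\<iota>\<in>UNIV. (E$b$\<beta> * E$j$\<gamma>) * (F$\<iota>$i * F$\<pi>$p) * psi0 \<beta> \<gamma> \<iota> \<pi>)"
      unfolding le sum_distrib_left by (simp only: mult_ac)
    also have "\<dots> = (\<Sum>\<beta>\<in>UNIV. \<Sum>\<gamma>\<in>UNIV. \<Sum>\<iota>\<in>UNIV. \<Sum>\<pi>\<in>UNIV. (E$b$\<beta> * E$j$\<gamma>) * (F$\<iota>$i * F$\<pi>$p) * psi0 \<beta> \<gamma> \<iota> \<pi>)"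
      by (rule sum.cong[OF refl], rule sum.cong[OF refl], rule sum.swap)
    finally show ?thesis by (rule sym)
  qed
  finally show "(\<Sum>k\<in>UNIV. raise3 w b j k * w i p k) = delta b i * delta j p - delta b p * delta j i - (\<Sum>q\<in>UNIV. \<Theta> i b j q * lower_metric w q p)" .
qed

text \<open>By the first Bianchi identity the part of the curvature that the dual 4-form could see cancels, so that only
  the scalar curvature survives.\<close>

theorem curvature_contraction:
  fixes K :: tensor3
  defines "KL \<equiv> \<lambda>b q j. \<Sum>p\<in>UNIV. lower_metric w q p * K b p j"
  assumes anti: "\<And>b q j. KL b q j = - KL b j q" and cyc: "\<And>b q j. KL b q j + KL q j b + KL j b q = 0"
  shows "(\<Sum>b\<in>UNIV. \<Sum>j\<in>UNIV. \<Sum>k\<in>UNIV. raise3 w b j k * (\<Sum>p\<in>UNIV. K b p i * w p j k + K b p j * w i p k + K b p k * w i j p))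
    = 4 * (\<Sum>b\<in>UNIV. K b b i)"
proof -
  have altw: "alternating3 w" unfolding phi_push by (rule alternating3_pull3[OF alternating_phi0])
  have altr: "alternating3 (raise3 w)" unfolding raise3_pull3 by (rule alternating3_pull3[OF altw])
  define \<Theta> where "\<Theta> = pull3 (transpose E) (\<lambda>\<beta> \<gamma> \<pi>. \<Sum>\<iota>\<in>UNIV. F$\<iota>$i * psi0 \<beta> \<gamma> \<iota> \<pi>)"
  have M: "(\<Sum>k\<in>UNIV. raise3 w b j k * w i p k) = delta b i * delta j p - delta b p * delta j i - (\<Sum>q\<in>UNIV. \<Theta> b j q * lower_metric w q p)" for b j p
    unfolding \<Theta>_def by (rule phi_phi_single(1))
  have alt: "alternating3 \<Theta>" unfolding \<Theta>_def by (rule phi_phi_single(2))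
  have t1: "(\<Sum>b\<in>UNIV. \<Sum>j\<in>UNIV. \<Sum>k\<in>UNIV. raise3 w b j k * (\<Sum>p\<in>UNIV. K b p i * w p j k)) = 6 * (\<Sum>b\<in>UNIV. K b b i)"
  proof -
    have "(\<Sum>j\<in>UNIV. \<Sum>k\<in>UNIV. raise3 w b j k * (\<Sum>p\<in>UNIV. K b p i * w p j k)) = 6 * K b b i" for b
    proof -
      have "(\<Sum>j\<in>UNIV. \<Sum>k\<in>UNIV. raise3 w b j k * (\<Sum>p\<in>UNIV. K b p i * w p j k)) = (\<Sum>j\<in>UNIV. \<Sum>k\<in>UNIV. \<Sum>p\<in>UNIV. K b p i * (raise3 w b j k * w p j k))"
        unfolding sum_distrib_left by (simp only: mult.left_commute)
      also have "\<dots> = (\<Sum>p\<in>UNIV. K b p i * (\<Sum>j\<in>UNIV. \<Sum>k\<in>UNIV. raise3 w b j k * w p j k))"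
        unfolding sum_distrib_left by (rule sum_rotate3)
      also have "\<dots> = (\<Sum>p\<in>UNIV. 6 * K b p i * delta b p)" unfolding phi_phi by (simp only: mult_ac)
      finally show ?thesis by simp
    qed
    then show ?thesis by (simp add: sum_distrib_left)
  qed
  have Z: "(\<Sum>b\<in>UNIV. \<Sum>j\<in>UNIV. \<Sum>q\<in>UNIV. \<Theta> b j q * KL b q j) = 0" (is "?Z = 0")
  proof -
    have c: "\<Theta> b j q = \<Theta> q b j" for b j q using alternating3_swap[OF alt] by metis
    have 2: "(\<Sum>b\<in>UNIV. \<Sum>j\<in>UNIV. \<Sum>q\<in>UNIV. \<Theta> b j q * KL q j b) = ?Z"
      by (subst sum_rotate3, subst c) (rule refl)
    have 3: "(\<Sum>b\<in>UNIV. \<Sum>j\<in>UNIV. \<Sum>q\<in>UNIV. \<Theta> b j q * KL j b q) = ?Z"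
      by (subst (2) sum_rotate3, subst (2) c) (rule refl)
    have "(\<Sum>b\<in>UNIV. \<Sum>j\<in>UNIV. \<Sum>q\<in>UNIV. \<Theta> b j q * (KL b q j + KL q j b + KL j b q)) = ?Z + ?Z + ?Z"
      unfolding distrib_left sum.distrib 2 3 ..
    then show ?thesis unfolding cyc by simp
  qed
  have tr: "(\<Sum>p\<in>UNIV. K b p p) = 0" for b
  proof -
    have "K b p j = (\<Sum>q\<in>UNIV. upper_metric w p q * KL b q j)" for p j
    proof -
      have "(\<Sum>q\<in>UNIV. upper_metric w p q * KL b q j) = (\<Sum>r\<in>UNIV. \<Sum>q\<in>UNIV. (upper_metric w p q * lower_metric w q r) * K b r j)"
        unfolding KL_def sum_distrib_left mult.assoc by (rule sum.swap)
      then show ?thesis by (simp only: sum_distrib_right[symmetric] upper_lower delta_sum)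
    qed
    then have e: "(\<Sum>p\<in>UNIV. K b p p) = (\<Sum>p\<in>UNIV. \<Sum>q\<in>UNIV. upper_metric w p q * KL b q p)" by simp
    also have "\<dots> = (\<Sum>p\<in>UNIV. \<Sum>q\<in>UNIV. - (upper_metric w p q * KL b q p))"
      by (subst sum.swap, intro sum.cong refl, subst upper_commute, subst anti) simp
    finally show ?thesis using e by (simp add: sum_negf)
  qed
  have t2: "(\<Sum>b\<in>UNIV. \<Sum>j\<in>UNIV. \<Sum>k\<in>UNIV. raise3 w b j k * (\<Sum>p\<in>UNIV. K b p j * w i p k)) = - (\<Sum>b\<in>UNIV. K b b i)"
  proof -
    have "(\<Sum>k\<in>UNIV. raise3 w b j k * (\<Sum>p\<in>UNIV. K b p j * w i p k)) = (\<Sum>p\<in>UNIV. K b p j * (\<Sum>k\<in>UNIV. raise3 w b j k * w i p k))" for b j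
      unfolding sum_distrib_left by (subst sum.swap) (simp only: mult.left_commute)
    then have "(\<Sum>b\<in>UNIV. \<Sum>j\<in>UNIV. \<Sum>k\<in>UNIV. raise3 w b j k * (\<Sum>p\<in>UNIV. K b p j * w i p k))
      = (\<Sum>b\<in>UNIV. \<Sum>j\<in>UNIV. \<Sum>p\<in>UNIV. (K b p j * delta b i) * delta j p) - (\<Sum>b\<in>UNIV. \<Sum>j\<in>UNIV. \<Sum>p\<in>UNIV. (K b p j * delta j i) * delta b p)
       - (\<Sum>b\<in>UNIV. \<Sum>j\<in>UNIV. \<Sum>p\<in>UNIV. \<Sum>q\<in>UNIV. K b p j * (\<Theta> b j q * lower_metric w q p))"
      unfolding M by (simp add: right_diff_distrib sum_subtractf sum_distrib_left mult_ac)
    also have "(\<Sum>b\<in>UNIV. \<Sum>j\<in>UNIV. \<Sum>p\<in>UNIV. (K b p j * delta b i) * delta j p) = 0"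
      by (simp only: delta_sum sum_distrib_right[symmetric]) (simp add: tr)
    also have "(\<Sum>b\<in>UNIV. \<Sum>j\<in>UNIV. \<Sum>p\<in>UNIV. (K b p j * delta j i) * delta b p) = (\<Sum>b\<in>UNIV. K b b i)"
      by (simp only: delta_sum)
    also have "(\<Sum>b\<in>UNIV. \<Sum>j\<in>UNIV. \<Sum>p\<in>UNIV. \<Sum>q\<in>UNIV. K b p j * (\<Theta> b j q * lower_metric w q p)) = 0"
    proof -
      have "(\<Sum>p\<in>UNIV. \<Sum>q\<in>UNIV. K b p j * (\<Theta> b j q * lower_metric w q p)) = (\<Sum>q\<in>UNIV. \<Theta> b j q * KL b q j)" for b j
        unfolding KL_def sum_distrib_left by (subst sum.swap) (simp only: mult_ac)
      then show ?thesis using Z by simp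
    qed
    finally show ?thesis by simp
  qed
  have t3: "(\<Sum>b\<in>UNIV. \<Sum>j\<in>UNIV. \<Sum>k\<in>UNIV. raise3 w b j k * (\<Sum>p\<in>UNIV. K b p k * w i j p)) = - (\<Sum>b\<in>UNIV. K b b i)"
    unfolding t2[symmetric]
    by (rule sum.cong[OF refl], subst sum.swap, intro sum.cong refl, subst alternating3_swap(2)[OF altr], subst alternating3_swap(2)[OF altw])
      (simp add: sum_negf)
  show ?thesis unfolding sum.distrib distrib_left t1 t2 t3 by simp
qed

end

section \<open>Calculus of smooth functions on open sets\<close>

lemma frechet_derivative_add:
  "f differentiable (at x) \<Longrightarrow> g differentiable (at x) \<Longrightarrow> frechet_derivative (\<lambda>x. f x + g x) (at x) = (\<lambda>v. frechet_derivative f (at x) v + frechet_derivative g (at x) v)"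
  by (rule frechet_derivative_at[symmetric]) (intro has_derivative_add, auto simp: frechet_derivative_works[symmetric])

lemma frechet_derivative_diff:
  "f differentiable (at x) \<Longrightarrow> g differentiable (at x) \<Longrightarrow> frechet_derivative (\<lambda>x. f x - g x) (at x) = (\<lambda>v. frechet_derivative f (at x) v - frechet_derivative g (at x) v)"
  by (rule frechet_derivative_at[symmetric]) (intro has_derivative_diff, auto simp: frechet_derivative_works[symmetric])

lemma hd_cong:
  assumes "open S" "\<And>x. x \<in> S \<Longrightarrow> f x = g x"
  shows "higher_differentiable_on S f n = higher_differentiable_on S g n"
proof -
  have d: "f differentiable (at x) \<longleftrightarrow> g differentiable (at x)" if "x \<in> S" "\<And>x. x \<in> S \<Longrightarrow> f x = g x" for x and f g :: "'a \<Rightarrow> 'b"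
    using has_derivative_transform_within_open[OF _ assms(1) that(1), of f _ UNIV g] has_derivative_transform_within_open[OF _ assms(1) that(1), of g _ UNIV f] that(2)
    unfolding differentiable_def by metis
  have fr: "frechet_derivative f (at x) = frechet_derivative g (at x)" if "x \<in> S" "\<And>x. x \<in> S \<Longrightarrow> f x = g x" "f differentiable (at x)" for x and f g :: "'a \<Rightarrow> 'b"
    using frechet_derivative_transform_within_open[OF that(3) assms(1) that(1,2)] by simp
  show ?thesis
    using assms(2)
  proof (induction n arbitrary: f g)
    case 0 then show ?case by (simp cong: continuous_on_cong)
  next
    case (Suc n)
    have "higher_differentiable_on S (\<lambda>x. frechet_derivative f (at x) v) n = higher_differentiable_on S (\<lambda>x. frechet_derivative g (at x) v) n"
      if "\<forall>x\<in>S. f differentiable (at x)" for v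
      by (rule Suc.IH) (use fr[of _ f g] Suc.prems that in simp)
    moreover have "(\<forall>x\<in>S. f differentiable (at x)) = (\<forall>x\<in>S. g differentiable (at x))"
      using d[of _ f g] Suc.prems by blast
    ultimately show ?case by auto
  qed
qed

lemma hd_Suc: "higher_differentiable_on S f (Suc n) \<Longrightarrow> higher_differentiable_on S f n"
proof (induction n arbitrary: f)
  case 0 then show ?case
    by (auto intro!: continuous_at_imp_continuous_on differentiable_imp_continuous_within)
next
  case (Suc n) then show ?case by (metis higher_differentiable_on.simps(2))
qed

lemma hd_const: "higher_differentiable_on S (\<lambda>x. c) n"
  by (induction n arbitrary: c) (auto simp: frechet_derivative_const)

lemma hd_add:
  assumes "open S" "higher_differentiable_on S f n" "higher_differentiable_on S g n"
  shows "higher_differentiable_on S (\<lambda>x. f x + g x) n"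
  using assms(2,3)
proof (induction n arbitrary: f g)
  case 0 then show ?case by (auto intro: continuous_intros)
next
  case (Suc n)
  have "higher_differentiable_on S (\<lambda>x. frechet_derivative (\<lambda>x. f x + g x) (at x) v) n" for v
    by (subst hd_cong[OF assms(1), where g = "\<lambda>x. frechet_derivative f (at x) v + frechet_derivative g (at x) v"])
      (use Suc in \<open>auto simp: frechet_derivative_add\<close>)
  then show ?case using Suc.prems by auto
qed

lemma hd_mult:
  fixes f g :: "'a::real_normed_vector \<Rightarrow> real"
  assumes "open S" "higher_differentiable_on S f n" "higher_differentiable_on S g n"
  shows "higher_differentiable_on S (\<lambda>x. f x * g x) n"
  using assms(2,3)
proof (induction n arbitrary: f g)
  case 0 then show ?case by (auto intro: continuous_intros)
next
  case (Suc n)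
  have fr: "frechet_derivative (\<lambda>x. f x * g x) (at x) v = f x * frechet_derivative g (at x) v + frechet_derivative f (at x) v * g x"
    if "x \<in> S" for x v
  proof -
    have "((\<lambda>x. f x * g x) has_derivative (\<lambda>v. f x * frechet_derivative g (at x) v + frechet_derivative f (at x) v * g x)) (at x)"
      using Suc.prems that by (intro has_derivative_mult) (auto simp: frechet_derivative_works[symmetric])
    then show ?thesis by (simp add: frechet_derivative_at[symmetric])
  qed
  have "higher_differentiable_on S (\<lambda>x. frechet_derivative (\<lambda>x. f x * g x) (at x) v) n" for v
    by (subst hd_cong[OF assms(1), where g = "\<lambda>x. f x * frechet_derivative g (at x) v + frechet_derivative f (at x) v * g x"], rule fr)
      (use Suc hd_Suc[OF Suc.prems(1)] hd_Suc[OF Suc.prems(2)] in \<open>auto intro!: hd_add assms(1)\<close>)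
  then show ?case using Suc.prems by auto
qed

lemma hd_sum:
  assumes "open S" "\<And>i. i \<in> I \<Longrightarrow> higher_differentiable_on S (f i) n"
  shows "higher_differentiable_on S (\<lambda>x. \<Sum>i\<in>I. f i x) n"
  using assms(2)
  by (induction I rule: infinite_finite_induct) (auto intro!: hd_add assms(1) hd_const)

lemma hd_prod:
  fixes f :: "'i \<Rightarrow> 'a::real_normed_vector \<Rightarrow> real"
  assumes "open S" "\<And>i. i \<in> I \<Longrightarrow> higher_differentiable_on S (f i) n"
  shows "higher_differentiable_on S (\<lambda>x. \<Prod>i\<in>I. f i x) n"
  using assms(2)
  by (induction I rule: infinite_finite_induct) (auto intro!: hd_mult assms(1) hd_const)

lemma hd_real_comp:
  fixes f :: "'a::real_normed_vector \<Rightarrow> real" and h h' :: "real \<Rightarrow> real"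
  assumes "open S" and f: "higher_differentiable_on S f n" and h: "\<And>x. x \<in> S \<Longrightarrow> (h has_real_derivative h' (f x)) (at (f x))"
    and step: "\<And>n. higher_differentiable_on S f n \<Longrightarrow> higher_differentiable_on S (\<lambda>x. h (f x)) n \<Longrightarrow> higher_differentiable_on S (\<lambda>x. h' (f x)) n"
  shows "higher_differentiable_on S (\<lambda>x. h (f x)) n"
  using f
proof (induction n)
  case 0
  have "continuous (at x) (\<lambda>x. h (f x))" if "x \<in> S" for x
  proof -
    have "isCont f x" using 0 that assms(1) by (simp add: continuous_on_eq_continuous_at)
    then show ?thesis using DERIV_isCont[OF h[OF that]] by (rule isCont_o2)
  qed
  then show ?case using assms(1) by (simp add: continuous_on_eq_continuous_at)
next
  case (Suc n)
  have der: "((\<lambda>x. h (f x)) has_derivative (\<lambda>v. h' (f x) * frechet_derivative f (at x) v)) (at x)" if "x \<in> S" for x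
  proof -
    have "(f has_derivative frechet_derivative f (at x)) (at x)"
      using Suc.prems that by (auto simp: frechet_derivative_works[symmetric])
    moreover have "(h has_derivative (*) (h' (f x))) (at (f x))" using h[OF that] by (simp add: has_field_derivative_def)
    ultimately show ?thesis using has_derivative_compose[of f _ x UNIV h] by blast
  qed
  have n: "higher_differentiable_on S f n" by (rule hd_Suc[OF Suc.prems])
  have "higher_differentiable_on S (\<lambda>x. frechet_derivative (\<lambda>x. h (f x)) (at x) v) n" for v
    by (subst hd_cong[OF assms(1), where g = "\<lambda>x. h' (f x) * frechet_derivative f (at x) v"])
      (use frechet_derivative_at[OF der, symmetric] Suc.prems n in \<open>auto intro!: hd_mult assms(1) step Suc.IH\<close>)
  then show ?case using der by (auto simp: differentiable_def)
qed

lemma hd_inverse: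
  fixes f :: "'a::real_normed_vector \<Rightarrow> real"
  assumes "open S" "higher_differentiable_on S f n" "\<And>x. x \<in> S \<Longrightarrow> f x \<noteq> 0"
  shows "higher_differentiable_on S (\<lambda>x. inverse (f x)) n"
proof (rule hd_real_comp[OF assms(1,2), where h' = "\<lambda>t. (- 1) * (inverse t * inverse t)"])
  fix x assume "x \<in> S"
  then show "(inverse has_real_derivative (- 1) * (inverse (f x) * inverse (f x))) (at (f x))"
    using DERIV_inverse[of "f x"] assms(3) by (simp add: power2_eq_square power_inverse)
qed (intro hd_mult hd_const assms(1); assumption)

lemma hd_root9:
  fixes f :: "'a::real_normed_vector \<Rightarrow> real"
  assumes "open S" "higher_differentiable_on S f n" "\<And>x. x \<in> S \<Longrightarrow> f x \<noteq> 0"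
  shows "higher_differentiable_on S (\<lambda>x. root 9 (f x)) n"
proof (rule hd_real_comp[OF assms(1,2), where h' = "\<lambda>t. root 9 t * (inverse 9 * inverse t)"])
  fix x assume x: "x \<in> S"
  have "(root 9 has_real_derivative inverse (real 9 * root 9 (f x) ^ (9 - Suc 0))) (at (f x))"
    by (rule DERIV_odd_real_root) (use assms(3)[OF x] in auto)
  moreover have "root 9 (f x) ^ 9 = f x" by (rule odd_real_root_pow) simp
  then have "root 9 (f x) * root 9 (f x) ^ 8 = f x" by (simp flip: power_Suc)
  then have "inverse (real 9 * root 9 (f x) ^ (9 - Suc 0)) = root 9 (f x) * (inverse 9 * inverse (f x))"
    using assms(3)[OF x] by (simp add: field_simps)
  ultimately show "(root 9 has_real_derivative root 9 (f x) * (inverse 9 * inverse (f x))) (at (f x))" by simp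
qed (intro hd_mult hd_const hd_inverse assms(1,3); assumption)

context
  fixes S :: "'a::real_normed_vector set"
  assumes S: "open S"
begin

lemma smooth_const: "smooth_on S (\<lambda>x. c)" by (simp add: smooth_on_def hd_const)
lemma smooth_add: "smooth_on S f \<Longrightarrow> smooth_on S g \<Longrightarrow> smooth_on S (\<lambda>x. f x + g x)"
  by (simp add: smooth_on_def hd_add S)
lemma smooth_mult: "smooth_on S f \<Longrightarrow> smooth_on S g \<Longrightarrow> smooth_on S (\<lambda>x. f x * g x :: real)"
  by (simp add: smooth_on_def hd_mult S)
lemma smooth_sum: "(\<And>i. i \<in> I \<Longrightarrow> smooth_on S (f i)) \<Longrightarrow> smooth_on S (\<lambda>x. \<Sum>i\<in>I. f i x)"
  by (simp add: smooth_on_def hd_sum S)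
lemma smooth_prod: "(\<And>i. i \<in> I \<Longrightarrow> smooth_on S (f i)) \<Longrightarrow> smooth_on S (\<lambda>x. \<Prod>i\<in>I. f i x :: real)"
  by (simp add: smooth_on_def hd_prod S)
lemma smooth_minus: "smooth_on S f \<Longrightarrow> smooth_on S (\<lambda>x. - f x :: real)"
  using smooth_mult[OF smooth_const[of "- 1"], of f] by simp
lemma smooth_diff: "smooth_on S f \<Longrightarrow> smooth_on S g \<Longrightarrow> smooth_on S (\<lambda>x. f x - g x :: real)"
  using smooth_add[OF _ smooth_minus, of f g] by simp
lemma smooth_inverse: "smooth_on S f \<Longrightarrow> (\<And>x. x \<in> S \<Longrightarrow> f x \<noteq> 0) \<Longrightarrow> smooth_on S (\<lambda>x. inverse (f x) :: real)"
  by (simp add: smooth_on_def hd_inverse S)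
lemma smooth_divide: "smooth_on S f \<Longrightarrow> smooth_on S g \<Longrightarrow> (\<And>x. x \<in> S \<Longrightarrow> g x \<noteq> 0) \<Longrightarrow> smooth_on S (\<lambda>x. f x / g x :: real)"
  unfolding divide_inverse by (intro smooth_mult smooth_inverse)
lemma smooth_root9: "smooth_on S f \<Longrightarrow> (\<And>x. x \<in> S \<Longrightarrow> f x \<noteq> 0) \<Longrightarrow> smooth_on S (\<lambda>x. root 9 (f x))"
  by (simp add: smooth_on_def hd_root9 S)
lemma smooth_cong: "(\<And>x. x \<in> S \<Longrightarrow> f x = g x) \<Longrightarrow> smooth_on S f \<longleftrightarrow> smooth_on S g"
  unfolding smooth_on_def using hd_cong[OF S] by blast

lemma smooth_differentiable: "smooth_on S f \<Longrightarrow> x \<in> S \<Longrightarrow> f differentiable (at x)"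
  unfolding smooth_on_def by (metis higher_differentiable_on.simps(2))

lemma smooth_continuous: "smooth_on S f \<Longrightarrow> continuous_on S f"
  unfolding smooth_on_def by (metis higher_differentiable_on.simps(1))

lemma smooth_det:
  assumes "\<And>i j. smooth_on S (\<lambda>x. A x $ i $ j)"
  shows "smooth_on S (\<lambda>x. det (A x :: real^'n^'n))"
  unfolding det_def by (intro smooth_sum smooth_mult smooth_const smooth_prod assms)

end

lemmas smooth_intros = smooth_const smooth_add smooth_mult smooth_sum smooth_minus smooth_diff

section \<open>Partial derivatives\<close>

lemma smooth_partial: "open S \<Longrightarrow> smooth_on S f \<Longrightarrow> smooth_on S (partial i f)"
  unfolding smooth_on_def partial_def[abs_def] by (metis higher_differentiable_on.simps(2))

lemma partial_has_derivative: "(f has_derivative f') (at x) \<Longrightarrow> partial i f x = f' (axis i 1)"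
  unfolding partial_def by (simp add: frechet_derivative_at[symmetric])

lemma partial_cong:
  assumes "open S" "x \<in> S" "\<And>y. y \<in> S \<Longrightarrow> f y = g y" "f differentiable (at x)"
  shows "partial i f x = partial i g x"
  unfolding partial_def using frechet_derivative_transform_within_open[OF assms(4,1,2,3)] by simp

lemma partial_add: "f differentiable (at x) \<Longrightarrow> g differentiable (at x) \<Longrightarrow> partial i (\<lambda>x. f x + g x) x = partial i f x + partial i g x"
  by (simp add: partial_def frechet_derivative_add)

lemma partial_diff: "f differentiable (at x) \<Longrightarrow> g differentiable (at x) \<Longrightarrow> partial i (\<lambda>x. f x - g x) x = partial i f x - partial i g x"
  by (simp add: partial_def frechet_derivative_diff)

lemma partial_mult: "f differentiable (at x) \<Longrightarrow> g differentiable (at x) \<Longrightarrow> partial i (\<lambda>x. f x * g x) x = f x * partial i g x + partial i f x * g x"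
  using partial_has_derivative[OF has_derivative_mult[of f "frechet_derivative f (at x)" x UNIV g "frechet_derivative g (at x)"], of i]
  by (simp add: frechet_derivative_works partial_def)

lemma partial_const: "partial i (\<lambda>x. c) x = 0"
  by (simp add: partial_def frechet_derivative_const)

lemma partial_sum:
  assumes "\<And>i. i \<in> I \<Longrightarrow> f i differentiable (at x)"
  shows "partial a (\<lambda>x. \<Sum>i\<in>I. f i x) x = (\<Sum>i\<in>I. partial a (f i) x)"
proof -
  have "((\<lambda>x. \<Sum>i\<in>I. f i x) has_derivative (\<lambda>v. \<Sum>i\<in>I. frechet_derivative (f i) (at x) v)) (at x)"
    using assms by (intro has_derivative_sum) (simp add: frechet_derivative_works)
  from partial_has_derivative[OF this] show ?thesis by (simp add: partial_def)
qed

lemma partial_cmult: "f differentiable (at x) \<Longrightarrow> partial i (\<lambda>x. c * f x) x = c * partial i f x"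
  by (subst partial_mult) (auto simp: partial_const)

lemma partial_DERIV:
  assumes "f differentiable (at (x + t *\<^sub>R axis i 1))"
  shows "((\<lambda>t. f (x + t *\<^sub>R axis i 1)) has_real_derivative partial i f (x + t *\<^sub>R axis i 1)) (at t)"
proof -
  have "((\<lambda>t. x + t *\<^sub>R axis i (1::real)) has_derivative (\<lambda>h. h *\<^sub>R axis i 1)) (at t)"
    by (auto intro!: derivative_eq_intros)
  from has_derivative_compose[OF this, of f "frechet_derivative f (at (x + t *\<^sub>R axis i 1))"] assms
  have "((\<lambda>t. f (x + t *\<^sub>R axis i 1)) has_derivative (\<lambda>h. frechet_derivative f (at (x + t *\<^sub>R axis i 1)) (h *\<^sub>R axis i 1))) (at t)"
    by (simp add: frechet_derivative_works[symmetric])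
  moreover have "frechet_derivative f (at (x + t *\<^sub>R axis i 1)) (h *\<^sub>R axis i 1) = partial i f (x + t *\<^sub>R axis i 1) * h" for h
    using linear_scale[OF linear_frechet_derivative[OF assms]] by (simp add: partial_def)
  ultimately show ?thesis by (simp add: has_field_derivative_def)
qed

lemma dist_add2: "dist x (x + a + b) = norm (a + b :: 'a::real_normed_vector)"
  by (metis add.assoc add_diff_cancel_left' dist_commute dist_norm)

text \<open>Clairaut's theorem, by applying the mean value theorem twice to the second difference.\<close>

lemma second_difference:
  fixes f :: "real^7 \<Rightarrow> real"
  assumes S: "open S" and f: "smooth_on S f" and r: "ball x r \<subseteq> S" and h: "0 < h" "2 * h < r"
  shows "\<exists>y. dist x y < 2 * h \<and> f (x + h *\<^sub>R axis i 1 + h *\<^sub>R axis j 1) - f (x + h *\<^sub>R axis i 1) - f (x + h *\<^sub>R axis j 1) + f x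
     = h * h * partial j (partial i f) y"
proof -
  let ?e = "\<lambda>i. axis i (1::real) :: real^7"
  have n: "norm (?e k) = 1" for k by simp
  have in_S: "x + s *\<^sub>R ?e i + t *\<^sub>R ?e j \<in> S" if "0 \<le> s" "s \<le> h" "0 \<le> t" "t \<le> h" for s t
  proof -
    have "norm (s *\<^sub>R ?e i + t *\<^sub>R ?e j) \<le> s + t" using norm_triangle_ineq[of "s *\<^sub>R ?e i" "t *\<^sub>R ?e j"] that by simp
    then have "dist x (x + s *\<^sub>R ?e i + t *\<^sub>R ?e j) < r" unfolding dist_add2 using that h by linarith
    then show ?thesis using r by auto
  qed
  note d = smooth_differentiable[OF S f] and d2 = smooth_differentiable[OF S smooth_partial[OF S f]]
  let ?g = "\<lambda>s. f ((x + h *\<^sub>R ?e j) + s *\<^sub>R ?e i) - f (x + s *\<^sub>R ?e i)"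
  have dg: "(?g has_real_derivative (partial i f ((x + h *\<^sub>R ?e j) + s *\<^sub>R ?e i) - partial i f (x + s *\<^sub>R ?e i))) (at s)" if "0 \<le> s" "s \<le> h" for s
    by (intro DERIV_diff partial_DERIV d) (use in_S[OF that, of h] in_S[OF that, of 0] h in \<open>auto simp: add_ac\<close>)
  obtain s where s: "0 < s" "s < h" "?g h - ?g 0 = (h - 0) * (partial i f ((x + h *\<^sub>R ?e j) + s *\<^sub>R ?e i) - partial i f (x + s *\<^sub>R ?e i))"
    using MVT2[of 0 h ?g "\<lambda>s. partial i f ((x + h *\<^sub>R ?e j) + s *\<^sub>R ?e i) - partial i f (x + s *\<^sub>R ?e i)"] h dg by auto
  let ?k = "\<lambda>t. partial i f ((x + s *\<^sub>R ?e i) + t *\<^sub>R ?e j)"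
  have dk: "(?k has_real_derivative partial j (partial i f) ((x + s *\<^sub>R ?e i) + t *\<^sub>R ?e j)) (at t)" if "0 \<le> t" "t \<le> h" for t
    by (intro partial_DERIV d2) (use in_S[of s t] s that in auto)
  obtain t where t: "0 < t" "t < h" "?k h - ?k 0 = (h - 0) * partial j (partial i f) ((x + s *\<^sub>R ?e i) + t *\<^sub>R ?e j)"
    using MVT2[of 0 h ?k "\<lambda>t. partial j (partial i f) ((x + s *\<^sub>R ?e i) + t *\<^sub>R ?e j)"] h dk by auto
  have "?g h - ?g 0 = h * h * partial j (partial i f) ((x + s *\<^sub>R ?e i) + t *\<^sub>R ?e j)"
    using s(3) t(3) by (simp add: add_ac mult.assoc)
  moreover have "dist x ((x + s *\<^sub>R ?e i) + t *\<^sub>R ?e j) < 2 * h"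
  proof -
    have "norm (s *\<^sub>R ?e i + t *\<^sub>R ?e j) \<le> s + t" using norm_triangle_ineq[of "s *\<^sub>R ?e i" "t *\<^sub>R ?e j"] s t by simp
    then show ?thesis unfolding dist_add2 using s t by linarith
  qed
  ultimately show ?thesis by (intro exI[of _ "(x + s *\<^sub>R ?e i) + t *\<^sub>R ?e j"]) (simp add: add_ac algebra_simps)
qed

lemma partial_commute:
  fixes f :: "real^7 \<Rightarrow> real"
  assumes S: "open S" and f: "smooth_on S f" and x: "x \<in> S"
  shows "partial i (partial j f) x = partial j (partial i f) x"
proof (rule ccontr)
  assume ne: "partial i (partial j f) x \<noteq> partial j (partial i f) x"
  define e where "e = \<bar>partial i (partial j f) x - partial j (partial i f) x\<bar> / 2"
  have e: "e > 0" using ne by (simp add: e_def)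
  obtain r where r: "r > 0" "ball x r \<subseteq> S" using S x by (meson open_contains_ball)
  have c: "continuous (at x) (partial i (partial j f))" for i j
    using smooth_continuous[OF S smooth_partial[OF S smooth_partial[OF S f]]] S x by (simp add: continuous_on_eq_continuous_at)
  have dlt: "\<exists>d>0. \<forall>y. dist y x < d \<longrightarrow> \<bar>partial i (partial j f) y - partial i (partial j f) x\<bar> < e" for i j
    using c[of i j] e unfolding continuous_at_eps_delta dist_real_def by blast
  obtain d1 where d1: "d1 > 0" "\<And>y. dist y x < d1 \<Longrightarrow> \<bar>partial i (partial j f) y - partial i (partial j f) x\<bar> < e" using dlt by blast
  obtain d2 where d2: "d2 > 0" "\<And>y. dist y x < d2 \<Longrightarrow> \<bar>partial j (partial i f) y - partial j (partial i f) x\<bar> < e" using dlt by blast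
  define h where "h = min r (min d1 d2) / 3"
  have h: "h > 0" "2 * h < r" "2 * h < d1" "2 * h < d2" using r d1 d2 by (auto simp: h_def)
  obtain y where y: "dist x y < 2 * h" "f (x + h *\<^sub>R axis i 1 + h *\<^sub>R axis j 1) - f (x + h *\<^sub>R axis i 1) - f (x + h *\<^sub>R axis j 1) + f x
     = h * h * partial j (partial i f) y" using second_difference[OF S f r(2) h(1,2)] by blast
  obtain z where z: "dist x z < 2 * h" "f (x + h *\<^sub>R axis j 1 + h *\<^sub>R axis i 1) - f (x + h *\<^sub>R axis j 1) - f (x + h *\<^sub>R axis i 1) + f x
     = h * h * partial i (partial j f) z" using second_difference[OF S f r(2) h(1,2)] by blast
  have "h * h * partial j (partial i f) y = h * h * partial i (partial j f) z"
    unfolding y(2)[symmetric] z(2)[symmetric] by (simp add: add_ac)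
  then have "partial j (partial i f) y = partial i (partial j f) z" using h by simp
  moreover have "\<bar>partial i (partial j f) z - partial i (partial j f) x\<bar> < e" using d1(2)[of z] z(1) h by (simp add: dist_commute)
  moreover have "\<bar>partial j (partial i f) y - partial j (partial i f) x\<bar> < e" using d2(2)[of y] y(1) h by (simp add: dist_commute)
  moreover have "\<not> (\<bar>c - a\<bar> < \<bar>a - b\<bar> / 2 \<and> \<bar>c - b\<bar> < \<bar>a - b\<bar> / 2)" for a b c :: real
    by (auto simp: abs_real_def split: if_splits)
  ultimately show False unfolding e_def by metis
qed

text \<open>Jacobi's formula for the derivative of a determinant.\<close>

lemma partial_det:
  fixes A :: "real^7 \<Rightarrow> real^7^7"
  assumes d: "\<And>i j. (\<lambda>y. A y $ i $ j) differentiable (at x)" and inv: "A x ** B = mat 1"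
  shows "partial a (\<lambda>y. det (A y)) x = det (A x) * (\<Sum>k\<in>UNIV. \<Sum>m\<in>UNIV. B $ k $ m * partial a (\<lambda>y. A y $ m $ k) x)"
proof -
  define D :: "real^7^7" where "D = (\<chi> i j. partial a (\<lambda>y. A y $ i $ j) x)"
  have det: "det M = (\<Sum>p\<in>UNIV. levi p * (\<Prod>k\<in>UNIV. M $ p k $ k))" for M :: "real^7^7"
    using det_eps_row[of M id] by (simp add: levi_def permutes_id)
  have prod: "partial a (\<lambda>y. \<Prod>k\<in>UNIV. A y $ p k $ k) x = (\<Sum>k\<in>UNIV. D $ p k $ k * (\<Prod>j\<in>UNIV-{k}. A x $ p j $ j))" for p :: "7 \<Rightarrow> 7"
  proof -
    have "((\<lambda>y. \<Prod>k\<in>UNIV. A y $ p k $ k) has_derivative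
      (\<lambda>v. \<Sum>k\<in>UNIV. frechet_derivative (\<lambda>y. A y $ p k $ k) (at x) v * (\<Prod>j\<in>UNIV-{k}. A x $ p j $ j))) (at x)"
      using d by (intro has_derivative_prod) (simp add: frechet_derivative_works[symmetric])
    from partial_has_derivative[OF this] show ?thesis by (simp add: partial_def D_def)
  qed
  have dp: "(\<lambda>y. \<Prod>k\<in>UNIV. A y $ p k $ k) differentiable (at x)" for p :: "7 \<Rightarrow> 7"
  proof -
    have "((\<lambda>y. \<Prod>k\<in>UNIV. A y $ p k $ k) has_derivative
      (\<lambda>v. \<Sum>k\<in>UNIV. frechet_derivative (\<lambda>y. A y $ p k $ k) (at x) v * (\<Prod>j\<in>UNIV-{k}. A x $ p j $ j))) (at x)"
      using d by (intro has_derivative_prod) (simp add: frechet_derivative_works[symmetric])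
    then show ?thesis by (auto simp: differentiable_def)
  qed
  have "partial a (\<lambda>y. det (A y)) x = (\<Sum>p\<in>UNIV. levi p * (\<Sum>k\<in>UNIV. D $ p k $ k * (\<Prod>j\<in>UNIV-{k}. A x $ p j $ j)))"
    unfolding det prod[symmetric] by (subst partial_sum) (auto intro!: dp simp: partial_cmult[OF dp])
  also have "\<dots> = (\<Sum>p\<in>UNIV. \<Sum>k\<in>UNIV. levi p * (D $ p k $ k * (\<Prod>j\<in>UNIV-{k}. A x $ p j $ j)))"
    by (simp only: sum_distrib_left)
  also have "\<dots> = (\<Sum>k\<in>UNIV. \<Sum>p\<in>UNIV. levi p * (D $ p k $ k * (\<Prod>j\<in>UNIV-{k}. A x $ p j $ j)))"
    by (rule sum.swap)
  also have "\<dots> = (\<Sum>k\<in>UNIV. det (A x) * (\<Sum>m\<in>UNIV. B $ k $ m * D $ m $ k))"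
  proof (rule sum.cong[OF refl])
    fix k :: 7
    define c where "c = B *v (\<chi> m. D $ m $ k)"
    have Ac: "A x *v c = (\<chi> m. D $ m $ k)" unfolding c_def by (simp add: matrix_vector_mul_assoc inv)
    have "(\<Sum>p\<in>UNIV. levi p * (D $ p k $ k * (\<Prod>j\<in>UNIV-{k}. A x $ p j $ j))) = det (\<chi> i j. if j = k then (A x *v c) $ i else A x $ i $ j)"
      unfolding det Ac
    proof (rule sum.cong[OF refl])
      fix p :: "7 \<Rightarrow> 7"
      have "(\<Prod>j\<in>UNIV. (\<chi> i j. if j = k then (\<chi> m. D $ m $ k) $ i else A x $ i $ j) $ p j $ j)
        = D $ p k $ k * (\<Prod>j\<in>UNIV-{k}. A x $ p j $ j)"
        by (subst prod.remove[of UNIV k]) (auto intro: prod.cong)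
      then show "levi p * (D $ p k $ k * (\<Prod>j\<in>UNIV-{k}. A x $ p j $ j)) = levi p * (\<Prod>j\<in>UNIV. (\<chi> i j. if j = k then (\<chi> m. D $ m $ k) $ i else A x $ i $ j) $ p j $ j)"
        by simp
    qed
    also have "\<dots> = c $ k * det (A x)" by (rule cramer_lemma)
    finally show "(\<Sum>p\<in>UNIV. levi p * (D $ p k $ k * (\<Prod>j\<in>UNIV-{k}. A x $ p j $ j))) = det (A x) * (\<Sum>m\<in>UNIV. B $ k $ m * D $ m $ k)"
      by (simp add: c_def matrix_vector_mult_def mult.commute)
  qed
  finally show ?thesis by (simp add: sum_distrib_left D_def)
qed

section \<open>Local geometry of a field of nondegenerate 3-forms\<close>

lemma smooth_abs:
  fixes f :: "'a::real_normed_vector \<Rightarrow> real"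
  assumes "open S" "smooth_on S f" "\<And>x. x \<in> S \<Longrightarrow> f x \<noteq> 0"
  shows "smooth_on S (\<lambda>x. \<bar>f x\<bar>)"
  unfolding smooth_on_def
proof
  fix n
  show "higher_differentiable_on S (\<lambda>x. \<bar>f x\<bar>) n"
  proof (rule hd_real_comp[OF assms(1), where f = f and h = abs and h' = "\<lambda>t. \<bar>t\<bar> * inverse t"])
    show "higher_differentiable_on S f n" using assms(2) by (simp add: smooth_on_def)
    fix x assume "x \<in> S"
    then have "f x \<noteq> 0" by (rule assms(3))
    then consider "f x > 0" | "f x < 0" by linarith
    then show "(abs has_real_derivative \<bar>f x\<bar> * inverse (f x)) (at (f x))"
    proof cases
      case 1
      have "(abs has_real_derivative 1) (at (f x))"
        by (rule has_field_derivative_transform_within_open[OF DERIV_ident, of "{0<..}"]) (use 1 in auto)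
      then show ?thesis using 1 by simp
    next
      case 2
      have "(abs has_real_derivative - 1) (at (f x))"
        by (rule has_field_derivative_transform_within_open[OF DERIV_minus[OF DERIV_ident], of "{..<0}"]) (use 2 in auto)
      then show ?thesis using 2 by simp
    qed
  qed (intro hd_mult hd_inverse assms(1,3); assumption)
qed

lemma smooth_congI: "open S \<Longrightarrow> (\<And>x. x \<in> S \<Longrightarrow> f x = g x) \<Longrightarrow> smooth_on S g \<Longrightarrow> smooth_on S f"
  using smooth_cong[of S f g] by blast

definition vol :: "tensor3 \<Rightarrow> real" where
  "vol u = volume_coeff (metric u) (orientation u)"

lemma det_scale7: "det (\<chi> i j. c * A $ i $ j) = c ^ 7 * det (A :: real^7^7)"
  unfolding det_def by (simp add: prod.distrib sum_distrib_left mult_ac)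

locale g2_field =
  fixes S :: "(real^7) set" and w :: "real^7 \<Rightarrow> tensor3"
  assumes S: "open S" and smooth: "\<And>i j k. smooth_on S (\<lambda>x. w x i j k)"
    and alt: "\<And>x. x \<in> S \<Longrightarrow> alternating3 (w x)" and nondeg: "\<And>x. x \<in> S \<Longrightarrow> nondegenerate (w x)"
begin

lemma frame_at:
  assumes "x \<in> S" obtains F where "framed (w x) F"
  using model_frame_exists[OF alt[OF assms]] nondeg[OF assms] that unfolding nondegenerate_def framed_def by blast

lemma vol_nonzero: "x \<in> S \<Longrightarrow> vol (w x) \<noteq> 0"
  by (rule frame_at) (auto simp: framed_def vol_def model_frame_metric(3) model_frame_def)

lemma wedge_eq: "x \<in> S \<Longrightarrow> contraction_wedge (w x) i j = - 6 * lower_metric (w x) i j * vol (w x)"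
proof (rule frame_at)
  fix F assume "framed (w x) F"
  then have m: "model_frame (w x) F" by (simp add: framed_def)
  from model_frame_determines(1)[OF m] model_frame_metric[OF m]
  show "contraction_wedge (w x) i j = - 6 * lower_metric (w x) i j * vol (w x)"
    by (simp add: determines_def vol_def lower_metric_def)
qed

lemma det_metric: "x \<in> S \<Longrightarrow> det (metric (w x)) = (vol (w x))\<^sup>2"
proof (rule frame_at)
  fix F assume "framed (w x) F"
  then have m: "model_frame (w x) F" by (simp add: framed_def)
  show "det (metric (w x)) = (vol (w x))\<^sup>2"
    unfolding vol_def model_frame_metric[OF m] model_frame_metric(3)[OF m]
    by (simp add: det_mul det_transpose power2_eq_square model_frame_determines(2)[OF m])
qed

lemma vol_root:
  assumes "x \<in> S"
  shows "vol (w x) = root 9 (- det (\<chi> i j. contraction_wedge (w x) i j) / 6 ^ 7)"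
proof -
  have "(\<chi> i j. contraction_wedge (w x) i j) = (\<chi> i j. (- 6 * vol (w x)) * metric (w x) $ i $ j)"
    by (simp add: wedge_eq[OF assms] lower_metric_def vec_eq_iff)
  then have "det (\<chi> i j. contraction_wedge (w x) i j) = (- 6 * vol (w x)) ^ 7 * (vol (w x))\<^sup>2"
    by (simp only: det_scale7 det_metric[OF assms])
  also have "\<dots> = - (6 ^ 7 * vol (w x) ^ 9)" by (simp add: power_mult_distrib flip: power_add)
  finally have "- det (\<chi> i j. contraction_wedge (w x) i j) / 6 ^ 7 = vol (w x) ^ 9" by simp
  then show ?thesis by (simp add: odd_real_root_power_cancel)
qed

lemma smooth_contraction_wedge: "smooth_on S (\<lambda>x. contraction_wedge (w x) i j)"
  unfolding contraction_wedge_eps divide_inverse by (intro smooth_intros S smooth)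

lemma smooth_vol: "smooth_on S (\<lambda>x. vol (w x))"
proof -
  have s: "smooth_on S (\<lambda>x. - det (\<chi> i j. contraction_wedge (w x) i j) / 6 ^ 7)"
    unfolding divide_inverse by (intro smooth_intros smooth_det S) (simp add: smooth_contraction_wedge)
  have "smooth_on S (\<lambda>x. root 9 (- det (\<chi> i j. contraction_wedge (w x) i j) / 6 ^ 7))"
    by (rule smooth_root9[OF S s]) (use vol_root vol_nonzero in fastforce)
  then show ?thesis by (rule smooth_congI[OF S, rotated]) (rule vol_root)
qed

lemma smooth_lower: "smooth_on S (\<lambda>x. lower_metric (w x) i j)"
proof -
  have e: "lower_metric (w x) i j = contraction_wedge (w x) i j / (- 6 * vol (w x))" if "x \<in> S" for x
    using wedge_eq[OF that, of i j] vol_nonzero[OF that] by simp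
  have "smooth_on S (\<lambda>x. contraction_wedge (w x) i j / (- 6 * vol (w x)))"
    by (intro smooth_divide smooth_intros S smooth_contraction_wedge smooth_vol) (simp add: vol_nonzero)
  then show ?thesis by (rule smooth_congI[OF S, rotated]) (rule e)
qed

lemma smooth_upper: "smooth_on S (\<lambda>x. upper_metric (w x) i j)"
proof -
  have e: "upper_metric (w x) i j = det (\<chi> a b. if b = i then delta a j else lower_metric (w x) a b) / det (\<chi> a b. lower_metric (w x) a b)"
    if x: "x \<in> S" for x
  proof -
    let ?G = "metric (w x)"
    have d: "det ?G \<noteq> 0" using det_metric[OF x] vol_nonzero[OF x] by simp
    have "?G *v column j (matrix_inv ?G) = axis j 1"
      using invertible_matrix_inv(1)[OF d] by (simp add: vec_eq_iff matrix_matrix_mult_def matrix_vector_mult_def column_def axis_def mat_def)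
    then have "column j (matrix_inv ?G) $ i = det (\<chi> a b. if b = i then axis j 1 $ a else ?G $ a $ b) / det ?G"
      using cramer[OF d] by simp
    moreover have "(\<chi> a b. if b = i then axis j 1 $ a else ?G $ a $ b) = (\<chi> a b. if b = i then delta a j else lower_metric (w x) a b)"
      by (simp add: vec_eq_iff axis_def delta_def lower_metric_def)
    moreover have "(\<chi> a b. lower_metric (w x) a b) = ?G" by (simp add: lower_metric_def vec_eq_iff)
    ultimately show ?thesis by (simp add: upper_metric_def column_def)
  qed
  have "smooth_on S (\<lambda>x. det (\<chi> a b. if b = i then delta a j else lower_metric (w x) a b))"
  proof (rule smooth_det[OF S])
    fix a b
    show "smooth_on S (\<lambda>x. (\<chi> a b. if b = i then delta a j else lower_metric (w x) a b) $ a $ b)"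
      by (cases "b = i") (simp_all add: smooth_const[OF S] smooth_lower)
  qed
  moreover have "smooth_on S (\<lambda>x. det (\<chi> a b. lower_metric (w x) a b))"
    by (rule smooth_det[OF S]) (simp add: smooth_lower)
  moreover have "det (\<chi> a b. lower_metric (w x) a b) \<noteq> 0" if "x \<in> S" for x
    using det_metric[OF that] vol_nonzero[OF that] by (simp add: lower_metric_def)
  ultimately have "smooth_on S (\<lambda>x. det (\<chi> a b. if b = i then delta a j else lower_metric (w x) a b) / det (\<chi> a b. lower_metric (w x) a b))"
    by (rule smooth_divide[OF S])
  then show ?thesis by (rule smooth_congI[OF S, rotated]) (rule e)
qed

lemma smooth_christoffel: "smooth_on S (\<lambda>x. christoffel w x k i j)"
  unfolding christoffel_def divide_inverse
  by (intro smooth_intros S smooth_upper smooth_partial[unfolded partial_def] smooth_lower smooth_partial)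

lemma smooth_nabla: "smooth_on S (\<lambda>x. nabla3 w w x m i j k)"
  unfolding nabla3_def by (intro smooth_intros S smooth_christoffel smooth_partial smooth)

lemma smooth_raise: "smooth_on S (\<lambda>x. raise3 (w x) i j k)"
  unfolding raise3_def by (intro smooth_intros S smooth_upper smooth)

lemmas smooth_field = smooth smooth_vol smooth_lower smooth_upper smooth_christoffel smooth_nabla smooth_raise

lemmas diff_field = smooth_field[THEN smooth_differentiable[OF S]]

abbreviation "\<Gamma> \<equiv> christoffel w"
abbreviation "P \<equiv> nabla3 w w"
abbreviation "gu x \<equiv> upper_metric (w x)"
abbreviation "gl x \<equiv> lower_metric (w x)"

lemma gu_commute: "x \<in> S \<Longrightarrow> gu x i j = gu x j i"
  by (rule frame_at) (auto intro: framed.upper_commute)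
lemma gl_commute: "x \<in> S \<Longrightarrow> gl x i j = gl x j i"
  by (rule frame_at) (auto intro: framed.lower_commute)
lemma gu_gl: "x \<in> S \<Longrightarrow> (\<Sum>k\<in>UNIV. gu x i k * gl x k j) = delta i j"
  by (rule frame_at) (auto intro: framed.upper_lower)

lemma partial_gl_commute: "x \<in> S \<Longrightarrow> partial a (\<lambda>y. gl y i j) x = partial a (\<lambda>y. gl y j i) x"
  by (rule partial_cong[OF S]) (auto simp: gl_commute diff_field)

lemma \<Gamma>_commute: "x \<in> S \<Longrightarrow> \<Gamma> x k i j = \<Gamma> x k j i"
  unfolding christoffel_def using partial_gl_commute[of x _ i j] by (simp add: algebra_simps)

lemma lower_raised: "x \<in> S \<Longrightarrow> (\<Sum>l\<in>UNIV. (\<Sum>m\<in>UNIV. gu x l m * X m) * gl x l j) = X j"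
proof -
  assume x: "x \<in> S"
  have "(\<Sum>l\<in>UNIV. (\<Sum>m\<in>UNIV. gu x l m * X m) * gl x l j) = (\<Sum>l\<in>UNIV. \<Sum>m\<in>UNIV. X m * (gu x m l * gl x l j))"
    unfolding sum_distrib_right by (intro sum.cong refl) (simp add: gu_commute[OF x] mult_ac)
  also have "\<dots> = (\<Sum>m\<in>UNIV. X m * delta m j)"
    by (subst sum.swap) (simp only: sum_distrib_left[symmetric] gu_gl[OF x])
  finally show ?thesis by simp
qed

lemma raise_lowered: "x \<in> S \<Longrightarrow> (\<Sum>k\<in>UNIV. (\<Sum>l\<in>UNIV. X l * gl x l k) * gu x k j) = X j"
proof -
  assume x: "x \<in> S"
  have "(\<Sum>k\<in>UNIV. (\<Sum>l\<in>UNIV. X l * gl x l k) * gu x k j) = (\<Sum>k\<in>UNIV. \<Sum>l\<in>UNIV. X l * (gu x j k * gl x k l))"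
    unfolding sum_distrib_right by (intro sum.cong refl) (simp add: gu_commute[OF x] gl_commute[OF x] mult_ac)
  also have "\<dots> = (\<Sum>l\<in>UNIV. X l * delta j l)"
    by (subst sum.swap) (simp only: sum_distrib_left[symmetric] gu_gl[OF x])
  finally show ?thesis by simp
qed

lemma \<Gamma>_lowered:
  assumes x: "x \<in> S"
  shows "(\<Sum>l\<in>UNIV. \<Gamma> x l a i * gl x l j) = (partial a (\<lambda>y. gl y i j) x + partial i (\<lambda>y. gl y a j) x - partial j (\<lambda>y. gl y a i) x) / 2"
proof -
  have "(\<Sum>l\<in>UNIV. \<Gamma> x l a i * gl x l j) = (\<Sum>l\<in>UNIV. (\<Sum>m\<in>UNIV. gu x l m * ((partial a (\<lambda>y. gl y i m) x + partial i (\<lambda>y. gl y a m) x - partial m (\<lambda>y. gl y a i) x) / 2)) * gl x l j)"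
    unfolding christoffel_def by (simp add: sum_divide_distrib)
  then show ?thesis by (simp only: lower_raised[OF x])
qed

lemma partial_gl:
  assumes x: "x \<in> S"
  shows "partial a (\<lambda>y. gl y i j) x = (\<Sum>l\<in>UNIV. \<Gamma> x l a i * gl x l j + \<Gamma> x l a j * gl x i l)"
proof -
  have "(\<Sum>l\<in>UNIV. \<Gamma> x l a j * gl x i l) = (\<Sum>l\<in>UNIV. \<Gamma> x l a j * gl x l i)"
    by (intro sum.cong refl) (simp add: gl_commute[OF x])
  then show ?thesis
    unfolding sum.distrib using \<Gamma>_lowered[OF x, of a i j] \<Gamma>_lowered[OF x, of a j i] partial_gl_commute[OF x, of a i j] by simp
qed

lemma partial_gu:
  assumes x: "x \<in> S"
  shows "partial a (\<lambda>y. gu y i j) x = - (\<Sum>l\<in>UNIV. \<Gamma> x i a l * gu x l j + \<Gamma> x j a l * gu x i l)"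
proof -
  have z: "(\<Sum>k\<in>UNIV. gu x i k * partial a (\<lambda>y. gl y k j) x + partial a (\<lambda>y. gu y i k) x * gl x k j) = 0" for j
  proof -
    have "partial a (\<lambda>y. \<Sum>k\<in>UNIV. gu y i k * gl y k j) x = partial a (\<lambda>y. delta i j) x"
      by (rule partial_cong[OF S x gu_gl]) (auto intro!: differentiable_sum differentiable_mult diff_field x)
    then show ?thesis
      by (subst (asm) partial_sum) (auto intro!: differentiable_mult diff_field x simp: partial_const partial_mult[OF diff_field(4) diff_field(3)] x)
  qed
  have k: "(\<Sum>k\<in>UNIV. gu x i k * partial a (\<lambda>y. gl y k m) x) = (\<Sum>l\<in>UNIV. (\<Sum>k\<in>UNIV. \<Gamma> x l a k * gu x i k) * gl x l m) + \<Gamma> x i a m" for m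
  proof -
    have "(\<Sum>k\<in>UNIV. gu x i k * partial a (\<lambda>y. gl y k m) x)
      = (\<Sum>k\<in>UNIV. \<Sum>l\<in>UNIV. \<Gamma> x l a k * gu x i k * gl x l m) + (\<Sum>k\<in>UNIV. \<Sum>l\<in>UNIV. \<Gamma> x l a m * (gu x i k * gl x k l))"
      unfolding partial_gl[OF x] by (simp add: sum_distrib_left distrib_left sum.distrib mult_ac)
    also have "(\<Sum>k\<in>UNIV. \<Sum>l\<in>UNIV. \<Gamma> x l a m * (gu x i k * gl x k l)) = \<Gamma> x i a m"
      by (subst sum.swap) (simp only: sum_distrib_left[symmetric] gu_gl[OF x] delta_sum)
    also have "(\<Sum>k\<in>UNIV. \<Sum>l\<in>UNIV. \<Gamma> x l a k * gu x i k * gl x l m) = (\<Sum>l\<in>UNIV. (\<Sum>k\<in>UNIV. \<Gamma> x l a k * gu x i k) * gl x l m)"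
      by (subst sum.swap) (simp only: sum_distrib_right)
    finally show ?thesis .
  qed
  have low: "(\<Sum>k\<in>UNIV. partial a (\<lambda>y. gu y i k) x * gl x k m) = - (\<Sum>l\<in>UNIV. (\<Sum>k\<in>UNIV. \<Gamma> x l a k * gu x i k) * gl x l m) - \<Gamma> x i a m" for m
    using z[of m] k[of m] unfolding sum.distrib by linarith
  have "partial a (\<lambda>y. gu y i j) x = (\<Sum>m\<in>UNIV. (\<Sum>k\<in>UNIV. partial a (\<lambda>y. gu y i k) x * gl x k m) * gu x m j)"
    by (rule raise_lowered[OF x, symmetric])
  also have "\<dots> = - (\<Sum>m\<in>UNIV. (\<Sum>l\<in>UNIV. (\<Sum>k\<in>UNIV. \<Gamma> x l a k * gu x i k) * gl x l m) * gu x m j) - (\<Sum>m\<in>UNIV. \<Gamma> x i a m * gu x m j)"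
    unfolding low left_diff_distrib sum_subtractf by (simp add: sum_negf)
  also have "\<dots> = - (\<Sum>k\<in>UNIV. \<Gamma> x j a k * gu x i k) - (\<Sum>m\<in>UNIV. \<Gamma> x i a m * gu x m j)"
    unfolding raise_lowered[OF x] ..
  finally show ?thesis by (simp add: sum.distrib)
qed

lemma raise_derivative:
  assumes x: "x \<in> S" and X: "\<And>i. X i differentiable (at x)"
    and D: "\<And>i. partial a (X i) x = DX i + (\<Sum>l\<in>UNIV. \<Gamma> x l a i * X l x)"
  shows "partial a (\<lambda>y. \<Sum>i\<in>UNIV. gu y b i * X i y) x = (\<Sum>i\<in>UNIV. gu x b i * DX i) - (\<Sum>l\<in>UNIV. \<Gamma> x b a l * (\<Sum>i\<in>UNIV. gu x l i * X i x))"
proof -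
  have "partial a (\<lambda>y. \<Sum>i\<in>UNIV. gu y b i * X i y) x = (\<Sum>i\<in>UNIV. gu x b i * partial a (X i) x + partial a (\<lambda>y. gu y b i) x * X i x)"
    by (subst partial_sum) (auto intro!: differentiable_mult diff_field x X simp: partial_mult[OF diff_field(4)[OF x] X])
  also have "\<dots> = (\<Sum>i\<in>UNIV. gu x b i * DX i) + (\<Sum>i\<in>UNIV. \<Sum>l\<in>UNIV. gu x b i * (\<Gamma> x l a i * X l x))
     - (\<Sum>i\<in>UNIV. \<Sum>l\<in>UNIV. \<Gamma> x b a l * (gu x l i * X i x)) - (\<Sum>i\<in>UNIV. \<Sum>l\<in>UNIV. gu x b l * (\<Gamma> x i a l * X i x))"
    unfolding D partial_gu[OF x]
    by (simp add: sum.distrib sum_distrib_left sum_distrib_right sum_subtractf sum_negf algebra_simps)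
  also have "(\<Sum>i\<in>UNIV. \<Sum>l\<in>UNIV. gu x b l * (\<Gamma> x i a l * X i x)) = (\<Sum>i\<in>UNIV. \<Sum>l\<in>UNIV. gu x b i * (\<Gamma> x l a i * X l x))"
    by (rule sum.swap)
  also have "(\<Sum>i\<in>UNIV. \<Sum>l\<in>UNIV. \<Gamma> x b a l * (gu x l i * X i x)) = (\<Sum>l\<in>UNIV. \<Gamma> x b a l * (\<Sum>i\<in>UNIV. gu x l i * X i x))"
    unfolding sum_distrib_left by (rule sum.swap)
  finally show ?thesis by simp
qed

lemma partial_vol:
  assumes x: "x \<in> S"
  shows "partial a (\<lambda>y. \<bar>vol (w y)\<bar>) x = \<bar>vol (w x)\<bar> * (\<Sum>l\<in>UNIV. \<Gamma> x l a l)"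
proof -
  let ?n = "\<lambda>y. \<bar>vol (w y)\<bar>"
  have d: "?n differentiable (at x)"
    by (rule smooth_differentiable[OF S smooth_abs[OF S smooth_vol vol_nonzero] x])
  have "?n x * partial a ?n x + partial a ?n x * ?n x = partial a (\<lambda>y. ?n y * ?n y) x"
    by (rule partial_mult[OF d d, symmetric])
  also have "\<dots> = partial a (\<lambda>y. det (metric (w y))) x"
    by (rule partial_cong[OF S x]) (auto simp: det_metric power2_eq_square intro!: differentiable_mult d diff_field x)
  also have "\<dots> = det (metric (w x)) * (\<Sum>k\<in>UNIV. \<Sum>m\<in>UNIV. matrix_inv (metric (w x)) $ k $ m * partial a (\<lambda>y. metric (w y) $ m $ k) x)"
    by (rule partial_det) (use diff_field(3)[OF x] det_metric[OF x] vol_nonzero[OF x] in \<open>auto simp: lower_metric_def intro!: invertible_matrix_inv\<close>)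
  also have "(\<Sum>k\<in>UNIV. \<Sum>m\<in>UNIV. matrix_inv (metric (w x)) $ k $ m * partial a (\<lambda>y. metric (w y) $ m $ k) x)
     = (\<Sum>k\<in>UNIV. \<Sum>m\<in>UNIV. gu x k m * partial a (\<lambda>y. gl y m k) x)"
    by (simp add: upper_metric_def lower_metric_def)
  also have "\<dots> = (\<Sum>k\<in>UNIV. \<Sum>m\<in>UNIV. \<Sum>l\<in>UNIV. \<Gamma> x l a m * (gu x m k * gl x k l)) + (\<Sum>k\<in>UNIV. \<Sum>m\<in>UNIV. \<Sum>l\<in>UNIV. \<Gamma> x l a k * (gu x k m * gl x m l))"
    unfolding partial_gl[OF x] sum_distrib_left distrib_left sum.distrib
    by (simp only: gu_commute[OF x] gl_commute[OF x] mult_ac)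
  also have "(\<Sum>k\<in>UNIV. \<Sum>m\<in>UNIV. \<Sum>l\<in>UNIV. \<Gamma> x l a m * (gu x m k * gl x k l)) = (\<Sum>k\<in>UNIV. \<Sum>m\<in>UNIV. \<Sum>l\<in>UNIV. \<Gamma> x l a k * (gu x k m * gl x m l))"
    by (rule sum.swap)
  also have "(\<Sum>k\<in>UNIV. \<Sum>m\<in>UNIV. \<Sum>l\<in>UNIV. \<Gamma> x l a k * (gu x k m * gl x m l)) = (\<Sum>k\<in>UNIV. \<Gamma> x k a k)"
  proof (rule sum.cong[OF refl])
    fix k
    show "(\<Sum>m\<in>UNIV. \<Sum>l\<in>UNIV. \<Gamma> x l a k * (gu x k m * gl x m l)) = \<Gamma> x k a k"
      by (subst sum.swap) (simp only: sum_distrib_left[symmetric] gu_gl[OF x] delta_sum)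
  qed
  finally have "2 * (?n x * partial a ?n x) = (vol (w x))\<^sup>2 * (2 * (\<Sum>k\<in>UNIV. \<Gamma> x k a k))"
    unfolding det_metric[OF x] by (simp add: mult_ac)
  also have "\<dots> = 2 * (?n x * (?n x * (\<Sum>k\<in>UNIV. \<Gamma> x k a k)))" by (simp add: power2_eq_square flip: abs_mult)
  finally show ?thesis using vol_nonzero[OF x] by simp
qed

text \<open>The derivative of the density cancels the contracted Christoffel symbol, which turns a covariant
  divergence into an ordinary one.\<close>

lemma divergence_formula:
  assumes x: "x \<in> S" and X: "\<And>b. X b differentiable (at x)"
    and D: "\<And>b. partial b (X b) x = DX b - (\<Sum>l\<in>UNIV. \<Gamma> x b b l * X l x)"
  shows "(\<Sum>b\<in>UNIV. partial b (\<lambda>y. \<bar>vol (w y)\<bar> * X b y) x) = \<bar>vol (w x)\<bar> * (\<Sum>b\<in>UNIV. DX b)"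
proof -
  have d: "(\<lambda>y. \<bar>vol (w y)\<bar>) differentiable (at x)"
    by (rule smooth_differentiable[OF S smooth_abs[OF S smooth_vol vol_nonzero] x])
  have "(\<Sum>b\<in>UNIV. partial b (\<lambda>y. \<bar>vol (w y)\<bar> * X b y) x) = (\<Sum>b\<in>UNIV. \<bar>vol (w x)\<bar> * DX b)
    - (\<Sum>b\<in>UNIV. \<Sum>l\<in>UNIV. \<bar>vol (w x)\<bar> * (\<Gamma> x b b l * X l x)) + (\<Sum>b\<in>UNIV. \<Sum>l\<in>UNIV. \<bar>vol (w x)\<bar> * (\<Gamma> x l l b * X b x))"
    unfolding partial_mult[OF d X] D partial_vol[OF x]
    by (simp add: sum.distrib sum_subtractf right_diff_distrib sum_distrib_left sum_distrib_right mult_ac \<Gamma>_commute[OF x, of _ _ _])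
  also have "(\<Sum>b\<in>UNIV. \<Sum>l\<in>UNIV. \<bar>vol (w x)\<bar> * (\<Gamma> x l l b * X b x)) = (\<Sum>b\<in>UNIV. \<Sum>l\<in>UNIV. \<bar>vol (w x)\<bar> * (\<Gamma> x b b l * X l x))"
    by (rule sum.swap)
  finally show ?thesis by (simp add: sum_distrib_left)
qed

end

context g2_field begin

text \<open>The difference between the covariant and the partial derivative of a 3-tensor.\<close>

definition act :: "(7 \<Rightarrow> 7 \<Rightarrow> real) \<Rightarrow> tensor3 \<Rightarrow> tensor3" where
  "act M u i j k = (\<Sum>l\<in>UNIV. M l i * u l j k + M l j * u i l k + M l k * u i j l)"

lemma partial_w: "partial a (\<lambda>y. w y i j k) x = P x a i j k + act (\<lambda>l. \<Gamma> x l a) (w x) i j k"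
  by (simp add: nabla3_def act_def)

lemma act_alt: "act M u i j k = (\<Sum>l\<in>UNIV. M l i * u l j k) + (\<Sum>l\<in>UNIV. M l j * u i l k) + (\<Sum>l\<in>UNIV. M l k * u i j l)"
  by (simp add: act_def sum.distrib)

lemma raise3_by_nested:
  "raise3_by u v b c d = (\<Sum>k\<in>UNIV. upper_metric u d k * (\<Sum>j\<in>UNIV. upper_metric u c j * (\<Sum>i\<in>UNIV. upper_metric u b i * v i j k)))"
proof -
  have "(\<Sum>k\<in>UNIV. upper_metric u d k * (\<Sum>j\<in>UNIV. upper_metric u c j * (\<Sum>i\<in>UNIV. upper_metric u b i * v i j k)))
    = (\<Sum>k\<in>UNIV. \<Sum>j\<in>UNIV. \<Sum>i\<in>UNIV. upper_metric u b i * upper_metric u c j * upper_metric u d k * v i j k)"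
    unfolding sum_distrib_left by (simp only: mult_ac)
  also have "\<dots> = (\<Sum>i\<in>UNIV. \<Sum>k\<in>UNIV. \<Sum>j\<in>UNIV. upper_metric u b i * upper_metric u c j * upper_metric u d k * v i j k)"
    by (rule sum_rotate3)
  also have "\<dots> = raise3_by u v b c d"
    unfolding raise3_by_def by (rule sum.cong[OF refl], rule sum.swap)
  finally show ?thesis ..
qed

lemma partial_raise:
  assumes x: "x \<in> S"
  shows "partial a (\<lambda>y. raise3 (w y) b c d) x = raise3_by (w x) (P x a) b c d
    - (\<Sum>l\<in>UNIV. \<Gamma> x b a l * raise3 (w x) l c d) - (\<Sum>l\<in>UNIV. \<Gamma> x c a l * raise3 (w x) b l d) - (\<Sum>l\<in>UNIV. \<Gamma> x d a l * raise3 (w x) b c l)"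
proof -
  define r1 where "r1 = (\<lambda>b j k y. \<Sum>i\<in>UNIV. gu y b i * w y i j k)"
  define r2 where "r2 = (\<lambda>b c k y. \<Sum>j\<in>UNIV. gu y c j * r1 b j k y)"
  have s1: "smooth_on S (r1 b j k)" for b j k unfolding r1_def by (intro smooth_intros S smooth_field)
  have s2: "smooth_on S (r2 b c k)" for b c k unfolding r2_def by (intro smooth_intros S smooth_field s1)
  note d1 = smooth_differentiable[OF S s1 x] and d2 = smooth_differentiable[OF S s2 x]
  define q1 where "q1 = (\<lambda>b j k. \<Sum>i\<in>UNIV. gu x b i * P x a i j k)"
  define q2 where "q2 = (\<lambda>b c k. \<Sum>j\<in>UNIV. gu x c j * q1 b j k)"
  have sw: "(\<Sum>i\<in>UNIV. g i * (\<Sum>l\<in>UNIV. h l * X i l)) = (\<Sum>l\<in>UNIV. h l * (\<Sum>i\<in>UNIV. g i * X i l))" for g h :: "7 \<Rightarrow> real" and X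
    unfolding sum_distrib_left by (subst sum.swap) (simp only: mult.left_commute)
  have p1: "partial a (r1 b j k) x = q1 b j k + (\<Sum>l\<in>UNIV. \<Gamma> x l a j * r1 b l k x) + (\<Sum>l\<in>UNIV. \<Gamma> x l a k * r1 b j l x) - (\<Sum>l\<in>UNIV. \<Gamma> x b a l * r1 l j k x)" for b j k
  proof -
    have "partial a (r1 b j k) x = (\<Sum>i\<in>UNIV. gu x b i * (P x a i j k + (\<Sum>l\<in>UNIV. \<Gamma> x l a j * w x i l k) + (\<Sum>l\<in>UNIV. \<Gamma> x l a k * w x i j l)))
      - (\<Sum>l\<in>UNIV. \<Gamma> x b a l * (\<Sum>i\<in>UNIV. gu x l i * w x i j k))"
      unfolding r1_def by (rule raise_derivative[OF x]) (auto intro: diff_field x simp: partial_w act_alt)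
    then show ?thesis unfolding r1_def q1_def by (simp add: distrib_left sum.distrib sw[of "gu x b"])
  qed
  have p2: "partial a (r2 b c k) x = q2 b c k + (\<Sum>l\<in>UNIV. \<Gamma> x l a k * r2 b c l x) - (\<Sum>l\<in>UNIV. \<Gamma> x b a l * r2 l c k x) - (\<Sum>l\<in>UNIV. \<Gamma> x c a l * r2 b l k x)" for b c k
  proof -
    have "partial a (r2 b c k) x = (\<Sum>j\<in>UNIV. gu x c j * (q1 b j k + (\<Sum>l\<in>UNIV. \<Gamma> x l a k * r1 b j l x) - (\<Sum>l\<in>UNIV. \<Gamma> x b a l * r1 l j k x)))
      - (\<Sum>l\<in>UNIV. \<Gamma> x c a l * (\<Sum>j\<in>UNIV. gu x l j * r1 b j k x))"
      unfolding r2_def by (rule raise_derivative[OF x d1]) (simp add: p1)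
    then show ?thesis unfolding r2_def q2_def by (simp add: distrib_left right_diff_distrib sum.distrib sum_subtractf sw[of "gu x c"])
  qed
  have e: "(\<lambda>y. raise3 (w y) b c d) = (\<lambda>y. \<Sum>k\<in>UNIV. gu y d k * r2 b c k y)" for b c d
    by (simp add: raise3_eq raise3_by_nested r2_def r1_def fun_eq_iff)
  then have ex: "raise3 (w x) b c d = (\<Sum>k\<in>UNIV. gu x d k * r2 b c k x)" for b c d by metis
  have "partial a (\<lambda>y. raise3 (w y) b c d) x = (\<Sum>k\<in>UNIV. gu x d k * (q2 b c k - (\<Sum>l\<in>UNIV. \<Gamma> x b a l * r2 l c k x) - (\<Sum>l\<in>UNIV. \<Gamma> x c a l * r2 b l k x)))
      - (\<Sum>l\<in>UNIV. \<Gamma> x d a l * (\<Sum>k\<in>UNIV. gu x l k * r2 b c k x))"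
    unfolding e by (rule raise_derivative[OF x d2]) (simp add: p2)
  then show ?thesis
    unfolding ex raise3_by_nested[of "w x"] q2_def q1_def by (simp add: right_diff_distrib sum_subtractf sw[of "gu x d"])
qed

lemma partial_pairing2:
  assumes dU: "\<And>j k. U j k differentiable (at x)" and dv: "\<And>j k. v j k differentiable (at x)"
    and U: "\<And>j k. partial a (U j k) x = A j k - (\<Sum>l\<in>UNIV. \<Gamma> x j a l * U l k x) - (\<Sum>l\<in>UNIV. \<Gamma> x k a l * U j l x)"
    and v: "\<And>j k. partial a (v j k) x = B j k + (\<Sum>l\<in>UNIV. \<Gamma> x l a j * v l k x) + (\<Sum>l\<in>UNIV. \<Gamma> x l a k * v j l x)"
  shows "partial a (\<lambda>y. \<Sum>j\<in>UNIV. \<Sum>k\<in>UNIV. U j k y * v j k y) x = (\<Sum>j\<in>UNIV. \<Sum>k\<in>UNIV. A j k * v j k x) + (\<Sum>j\<in>UNIV. \<Sum>k\<in>UNIV. U j k x * B j k)"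
proof -
  have "partial a (\<lambda>y. \<Sum>j\<in>UNIV. \<Sum>k\<in>UNIV. U j k y * v j k y) x = (\<Sum>j\<in>UNIV. \<Sum>k\<in>UNIV. U j k x * partial a (v j k) x + partial a (U j k) x * v j k x)"
    by (simp add: partial_sum differentiable_sum differentiable_mult dU dv partial_mult[OF dU dv])
  also have "\<dots> = (\<Sum>j\<in>UNIV. \<Sum>k\<in>UNIV. A j k * v j k x) + (\<Sum>j\<in>UNIV. \<Sum>k\<in>UNIV. U j k x * B j k)
     + ((\<Sum>j\<in>UNIV. \<Sum>k\<in>UNIV. \<Sum>l\<in>UNIV. U j k x * (\<Gamma> x l a j * v l k x)) - (\<Sum>j\<in>UNIV. \<Sum>k\<in>UNIV. \<Sum>l\<in>UNIV. U l k x * (\<Gamma> x j a l * v j k x)))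
     + ((\<Sum>j\<in>UNIV. \<Sum>k\<in>UNIV. \<Sum>l\<in>UNIV. U j k x * (\<Gamma> x l a k * v j l x)) - (\<Sum>j\<in>UNIV. \<Sum>k\<in>UNIV. \<Sum>l\<in>UNIV. U j l x * (\<Gamma> x k a l * v j k x)))"
    unfolding U v by (simp add: sum.distrib sum_subtractf sum_distrib_left sum_distrib_right algebra_simps)
  also have "(\<Sum>j\<in>UNIV. \<Sum>k\<in>UNIV. \<Sum>l\<in>UNIV. U j k x * (\<Gamma> x l a k * v j l x)) = (\<Sum>j\<in>UNIV. \<Sum>k\<in>UNIV. \<Sum>l\<in>UNIV. U j l x * (\<Gamma> x k a l * v j k x))"
    by (rule sum.cong[OF refl], rule sum.swap)
  also have "(\<Sum>j\<in>UNIV. \<Sum>k\<in>UNIV. \<Sum>l\<in>UNIV. U j k x * (\<Gamma> x l a j * v l k x)) = (\<Sum>j\<in>UNIV. \<Sum>k\<in>UNIV. \<Sum>l\<in>UNIV. U l k x * (\<Gamma> x j a l * v j k x))"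
  proof -
    have "(\<Sum>j\<in>UNIV. \<Sum>k\<in>UNIV. \<Sum>l\<in>UNIV. U j k x * (\<Gamma> x l a j * v l k x)) = (\<Sum>l\<in>UNIV. \<Sum>j\<in>UNIV. \<Sum>k\<in>UNIV. U j k x * (\<Gamma> x l a j * v l k x))"
      by (rule sum_rotate3)
    also have "\<dots> = (\<Sum>l\<in>UNIV. \<Sum>k\<in>UNIV. \<Sum>j\<in>UNIV. U j k x * (\<Gamma> x l a j * v l k x))"
      by (rule sum.cong[OF refl], rule sum.swap)
    finally show ?thesis .
  qed
  finally show ?thesis by simp
qed

text \<open>The covariant derivative of the identity that the form contracts with itself to six times the metric.\<close>

lemma parallel_identity:
  assumes x: "x \<in> S"
  shows "(\<Sum>j\<in>UNIV. \<Sum>k\<in>UNIV. raise3_by (w x) (P x m) b j k * w x i j k) + (\<Sum>j\<in>UNIV. \<Sum>k\<in>UNIV. raise3 (w x) b j k * P x m i j k) = 0"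
proof -
  have pp: "(\<Sum>j\<in>UNIV. \<Sum>k\<in>UNIV. raise3 (w y) b j k * w y i j k) = 6 * delta b i" if "y \<in> S" for y b i
    by (rule frame_at[OF that]) (rule framed.phi_phi)
  have z: "partial m (\<lambda>y. \<Sum>j\<in>UNIV. \<Sum>k\<in>UNIV. raise3 (w y) b j k * w y i j k) x = 0"
  proof -
    have "partial m (\<lambda>y. \<Sum>j\<in>UNIV. \<Sum>k\<in>UNIV. raise3 (w y) b j k * w y i j k) x = partial m (\<lambda>y. 6 * delta b i) x"
      by (rule partial_cong[OF S x pp]) (auto intro!: differentiable_sum differentiable_mult diff_field x)
    then show ?thesis by (simp add: partial_const)
  qed
  have "partial m (\<lambda>y. \<Sum>j\<in>UNIV. \<Sum>k\<in>UNIV. raise3 (w y) b j k * w y i j k) x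
    = (\<Sum>j\<in>UNIV. \<Sum>k\<in>UNIV. (raise3_by (w x) (P x m) b j k - (\<Sum>l\<in>UNIV. \<Gamma> x b m l * raise3 (w x) l j k)) * w x i j k)
    + (\<Sum>j\<in>UNIV. \<Sum>k\<in>UNIV. raise3 (w x) b j k * (P x m i j k + (\<Sum>l\<in>UNIV. \<Gamma> x l m i * w x l j k)))"
    by (rule partial_pairing2) (auto intro: diff_field x simp: partial_raise[OF x] partial_w act_alt)
  also have "\<dots> = (\<Sum>j\<in>UNIV. \<Sum>k\<in>UNIV. raise3_by (w x) (P x m) b j k * w x i j k) + (\<Sum>j\<in>UNIV. \<Sum>k\<in>UNIV. raise3 (w x) b j k * P x m i j k)
    - (\<Sum>j\<in>UNIV. \<Sum>k\<in>UNIV. \<Sum>l\<in>UNIV. \<Gamma> x b m l * (raise3 (w x) l j k * w x i j k)) + (\<Sum>j\<in>UNIV. \<Sum>k\<in>UNIV. \<Sum>l\<in>UNIV. \<Gamma> x l m i * (raise3 (w x) b j k * w x l j k))"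
    by (simp add: sum.distrib sum_subtractf sum_distrib_left sum_distrib_right algebra_simps)
  also have "(\<Sum>j\<in>UNIV. \<Sum>k\<in>UNIV. \<Sum>l\<in>UNIV. \<Gamma> x b m l * (raise3 (w x) l j k * w x i j k)) = 6 * \<Gamma> x b m i"
  proof -
    have "(\<Sum>j\<in>UNIV. \<Sum>k\<in>UNIV. \<Sum>l\<in>UNIV. \<Gamma> x b m l * (raise3 (w x) l j k * w x i j k)) = (\<Sum>l\<in>UNIV. 6 * \<Gamma> x b m l * delta l i)"
      by (subst sum_rotate3) (simp only: sum_distrib_left[symmetric] pp[OF x], simp only: mult_ac)
    then show ?thesis by simp
  qed
  also have "(\<Sum>j\<in>UNIV. \<Sum>k\<in>UNIV. \<Sum>l\<in>UNIV. \<Gamma> x l m i * (raise3 (w x) b j k * w x l j k)) = 6 * \<Gamma> x b m i"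
  proof -
    have "(\<Sum>j\<in>UNIV. \<Sum>k\<in>UNIV. \<Sum>l\<in>UNIV. \<Gamma> x l m i * (raise3 (w x) b j k * w x l j k)) = (\<Sum>l\<in>UNIV. 6 * \<Gamma> x l m i * delta b l)"
      by (subst sum_rotate3) (simp only: sum_distrib_left[symmetric] pp[OF x], simp only: mult_ac)
    then show ?thesis by simp
  qed
  finally show ?thesis using z by simp
qed

lemma alternating_act:
  assumes "alternating3 u" shows "alternating3 (act M u)"
  unfolding alternating3_def
proof (intro allI conjI)
  fix i j k
  have 1: "(\<Sum>l\<in>UNIV. c l * u l q r) = - (\<Sum>l\<in>UNIV. c l * u q l r)" for c q r
    unfolding sum_negf[symmetric] by (intro sum.cong refl, subst alternating3_swap(1)[OF assms]) simp
  have 2: "(\<Sum>l\<in>UNIV. c l * u q l r) = - (\<Sum>l\<in>UNIV. c l * u q r l)" for c q r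
    unfolding sum_negf[symmetric] by (intro sum.cong refl, subst alternating3_swap(2)[OF assms]) simp
  have 3: "(\<Sum>l\<in>UNIV. c l * u q r l) = - (\<Sum>l\<in>UNIV. c l * u r q l)" for c q r
    unfolding sum_negf[symmetric] by (intro sum.cong refl, subst alternating3_swap(1)[OF assms]) simp
  have 4: "(\<Sum>l\<in>UNIV. c l * u l q r) = - (\<Sum>l\<in>UNIV. c l * u l r q)" for c q r
    unfolding sum_negf[symmetric] by (intro sum.cong refl, subst alternating3_swap(2)[OF assms]) simp
  show "act M u i j k = - act M u j i k"
    unfolding act_alt using 1[of "\<lambda>l. M l i" j k] 1[of "\<lambda>l. M l j" i k] 3[of "\<lambda>l. M l k" i j] by linarith
  show "act M u i j k = - act M u i k j"
    unfolding act_alt using 4[of "\<lambda>l. M l i" j k] 2[of "\<lambda>l. M l j" i k] 2[of "\<lambda>l. M l k" i j] by linarith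
qed

lemma alternating_P:
  assumes x: "x \<in> S" shows "alternating3 (P x m)"
proof -
  have neg: "partial m (\<lambda>y. - f y) x = - partial m f x" if "f differentiable (at x)" for f
    using partial_cmult[OF that, of m "- 1"] by simp
  have a: "partial m (\<lambda>y. w y i j k) x = - partial m (\<lambda>y. w y j i k) x" "partial m (\<lambda>y. w y i j k) x = - partial m (\<lambda>y. w y i k j) x" for i j k
  proof -
    have "partial m (\<lambda>y. w y i j k) x = partial m (\<lambda>y. - w y j i k) x"
      by (rule partial_cong[OF S x]) (erule alternating3_swap(1)[OF alt], rule diff_field(1)[OF x])
    then show "partial m (\<lambda>y. w y i j k) x = - partial m (\<lambda>y. w y j i k) x" by (simp add: neg diff_field x)
    have "partial m (\<lambda>y. w y i j k) x = partial m (\<lambda>y. - w y i k j) x"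
      by (rule partial_cong[OF S x]) (erule alternating3_swap(2)[OF alt], rule diff_field(1)[OF x])
    then show "partial m (\<lambda>y. w y i j k) x = - partial m (\<lambda>y. w y i k j) x" by (simp add: neg diff_field x)
  qed
  have p: "P x m i j k = partial m (\<lambda>y. w y i j k) x - act (\<lambda>l. \<Gamma> x l m) (w x) i j k" for i j k
    using partial_w[of m i j k x] by simp
  note sw = alternating3_swap[OF alternating_act[OF alt[OF x], of "\<lambda>l. \<Gamma> x l m"]]
  show ?thesis
    unfolding alternating3_def p
  proof (intro allI conjI)
    fix i j k
    show "partial m (\<lambda>y. w y i j k) x - act (\<lambda>l. \<Gamma> x l m) (w x) i j k = - (partial m (\<lambda>y. w y j i k) x - act (\<lambda>l. \<Gamma> x l m) (w x) j i k)"
      using a(1)[of i j k] sw(1)[of j i k] by linarith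
    show "partial m (\<lambda>y. w y i j k) x - act (\<lambda>l. \<Gamma> x l m) (w x) i j k = - (partial m (\<lambda>y. w y i k j) x - act (\<lambda>l. \<Gamma> x l m) (w x) i k j)"
      using a(2)[of i j k] sw(2)[of i k j] by linarith
  qed
qed

lemma torsion_exists:
  assumes x: "x \<in> S" and F: "framed (w x) F"
  shows "framed.torsion_eq (w x) (P x) (torsion w x)"
proof -
  interpret framed "w x" F by (rule F)
  obtain T where T: "torsion_eq (P x) T"
    using torsion_eq_exists[of "P x"] alternating_P[OF x] parallel_identity[OF x] by blast
  have "torsion w x = T"
    unfolding torsion_def
  proof (rule the_equality)
    show "\<forall>m i j k. P x m i j k = (\<Sum>p\<in>UNIV. \<Sum>q\<in>UNIV. T m p * gu x p q * hodge_dual (w x) q i j k)"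
      using T by (simp add: torsion_eq_def)
    fix T' assume "\<forall>m i j k. P x m i j k = (\<Sum>p\<in>UNIV. \<Sum>q\<in>UNIV. T' m p * gu x p q * hodge_dual (w x) q i j k)"
    then have "torsion_eq (P x) T'" by (simp add: torsion_eq_def)
    then show "T' = T" using T torsion_eq_unique by blast
  qed
  with T show ?thesis by simp
qed

section \<open>Curvature\<close>

definition riem :: "real^7 \<Rightarrow> tensor4" where
  "riem x a b p i = partial a (\<lambda>y. \<Gamma> y p b i) x - partial b (\<lambda>y. \<Gamma> y p a i) x
     + (\<Sum>l\<in>UNIV. \<Gamma> x p a l * \<Gamma> x l b i) - (\<Sum>l\<in>UNIV. \<Gamma> x p b l * \<Gamma> x l a i)"

lemma riem_swap: "riem x b a p i = - riem x a b p i"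
  by (simp add: riem_def)

lemma ricci_riem: "ricci w x j k = (\<Sum>l\<in>UNIV. riem x l j l k)"
  by (simp add: ricci_def riem_def sum.distrib sum_subtractf)

lemma act_act:
  "act M (act N u) i j k - act N (act M u) i j k = act (\<lambda>m i. (\<Sum>l\<in>UNIV. N m l * M l i) - (\<Sum>l\<in>UNIV. M m l * N l i)) u i j k"
proof -
  define T1 where "T1 M u = (\<lambda>i j k. \<Sum>l\<in>UNIV. M l i * u l j k)" for M :: "7 \<Rightarrow> 7 \<Rightarrow> real" and u :: tensor3
  define T2 where "T2 M u = (\<lambda>i j k. \<Sum>l\<in>UNIV. M l j * u i l k)" for M :: "7 \<Rightarrow> 7 \<Rightarrow> real" and u :: tensor3
  define T3 where "T3 M u = (\<lambda>i j k. \<Sum>l\<in>UNIV. M l k * u i j l)" for M :: "7 \<Rightarrow> 7 \<Rightarrow> real" and u :: tensor3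
  have act: "act M u = (\<lambda>i j k. T1 M u i j k + T2 M u i j k + T3 M u i j k)" for M u
    by (simp add: fun_eq_iff act_alt T1_def T2_def T3_def)
  have comp: "T1 M (T1 N u) i j k = T1 (\<lambda>m i. \<Sum>l\<in>UNIV. N m l * M l i) u i j k"
    "T2 M (T2 N u) i j k = T2 (\<lambda>m i. \<Sum>l\<in>UNIV. N m l * M l i) u i j k"
    "T3 M (T3 N u) i j k = T3 (\<lambda>m i. \<Sum>l\<in>UNIV. N m l * M l i) u i j k" for M N
    unfolding T1_def T2_def T3_def sum_distrib_left sum_distrib_right by (subst sum.swap, simp only: mult_ac)+
  have com: "T1 M (T2 N u) i j k = T2 N (T1 M u) i j k" "T1 M (T3 N u) i j k = T3 N (T1 M u) i j k" "T2 M (T3 N u) i j k = T3 N (T2 M u) i j k" for M N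
    unfolding T1_def T2_def T3_def sum_distrib_left by (subst sum.swap, simp only: mult.left_commute)+
  have add: "T1 M (\<lambda>i j k. u i j k + v i j k + x i j k) i j k = T1 M u i j k + T1 M v i j k + T1 M x i j k"
    "T2 M (\<lambda>i j k. u i j k + v i j k + x i j k) i j k = T2 M u i j k + T2 M v i j k + T2 M x i j k"
    "T3 M (\<lambda>i j k. u i j k + v i j k + x i j k) i j k = T3 M u i j k + T3 M v i j k + T3 M x i j k" for M u v x
    by (simp_all add: T1_def T2_def T3_def distrib_left sum.distrib)
  have sub: "T1 (\<lambda>m i. M m i - N m i) u i j k = T1 M u i j k - T1 N u i j k"
    "T2 (\<lambda>m i. M m i - N m i) u i j k = T2 M u i j k - T2 N u i j k"
    "T3 (\<lambda>m i. M m i - N m i) u i j k = T3 M u i j k - T3 N u i j k" for M N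
    by (simp_all add: T1_def T2_def T3_def left_diff_distrib sum_subtractf)
  show ?thesis
    unfolding act add sub comp[symmetric] using com[of M N] com[of N M] by linarith
qed

definition nabla_P :: "real^7 \<Rightarrow> 7 \<Rightarrow> tensor4" where
  "nabla_P x a b i j k = partial a (\<lambda>y. P y b i j k) x - (\<Sum>l\<in>UNIV. \<Gamma> x l a b * P x l i j k) - act (\<lambda>l. \<Gamma> x l a) (P x b) i j k"

lemma partial_act:
  assumes x: "x \<in> S"
  shows "partial a (\<lambda>y. act (\<lambda>l. \<Gamma> y l b) (w y) i j k) x
    = act (\<lambda>l i. partial a (\<lambda>y. \<Gamma> y l b i) x) (w x) i j k + act (\<lambda>l. \<Gamma> x l b) (\<lambda>i j k. partial a (\<lambda>y. w y i j k) x) i j k"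
proof -
  have 1: "partial a (\<lambda>y. \<Gamma> y p b q * w y i j k) x = \<Gamma> x p b q * partial a (\<lambda>y. w y i j k) x + partial a (\<lambda>y. \<Gamma> y p b q) x * w x i j k" for p q i j k
    by (rule partial_mult) (auto intro: diff_field x)
  have "partial a (\<lambda>y. act (\<lambda>l. \<Gamma> y l b) (w y) i j k) x
    = (\<Sum>l\<in>UNIV. partial a (\<lambda>y. \<Gamma> y l b i * w y l j k) x + partial a (\<lambda>y. \<Gamma> y l b j * w y i l k) x + partial a (\<lambda>y. \<Gamma> y l b k * w y i j l) x)"
    unfolding act_def
    by (simp add: partial_sum partial_add differentiable_sum differentiable_add differentiable_mult diff_field[OF x])
  then show ?thesis unfolding 1 by (simp add: act_def sum.distrib)
qed

lemma act_add: "act M (\<lambda>i j k. u i j k + v i j k) i j k = act M u i j k + act M v i j k"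
  by (simp add: act_def distrib_left sum.distrib)

lemma commutator:
  assumes x: "x \<in> S"
  shows "nabla_P x a b i j k - nabla_P x b a i j k = - act (riem x a b) (w x) i j k"
proof -
  have pP: "partial a (\<lambda>y. P y b i j k) x = partial a (partial b (\<lambda>y. w y i j k)) x - act (\<lambda>l i. partial a (\<lambda>y. \<Gamma> y l b i) x) (w x) i j k
    - act (\<lambda>l. \<Gamma> x l b) (P x a) i j k - act (\<lambda>l. \<Gamma> x l b) (act (\<lambda>l. \<Gamma> x l a) (w x)) i j k" for a b
  proof -
    have e: "(\<lambda>y. P y b i j k) = (\<lambda>y. partial b (\<lambda>y. w y i j k) y - act (\<lambda>l. \<Gamma> y l b) (w y) i j k)"
      by (simp add: fun_eq_iff partial_w)
    have s: "smooth_on S (\<lambda>y. act (\<lambda>l. \<Gamma> y l b) (w y) i j k)"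
      unfolding act_def by (intro smooth_intros S smooth_field)
    have "partial a (\<lambda>y. P y b i j k) x = partial a (partial b (\<lambda>y. w y i j k)) x - partial a (\<lambda>y. act (\<lambda>l. \<Gamma> y l b) (w y) i j k) x"
      unfolding e by (rule partial_diff) (rule smooth_differentiable[OF S smooth_partial[OF S smooth] x] smooth_differentiable[OF S s x])+
    then show ?thesis unfolding partial_act[OF x] partial_w act_add by simp
  qed
  have sym: "(\<Sum>l\<in>UNIV. \<Gamma> x l a b * P x l i j k) = (\<Sum>l\<in>UNIV. \<Gamma> x l b a * P x l i j k)"
    using \<Gamma>_commute[OF x, of _ a b] by simp
  have c: "partial a (partial b (\<lambda>y. w y i j k)) x = partial b (partial a (\<lambda>y. w y i j k)) x"
    by (rule partial_commute[OF S smooth x])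
  have r: "act (riem x a b) u i j k = act (\<lambda>l i. partial a (\<lambda>y. \<Gamma> y l b i) x) u i j k - act (\<lambda>l i. partial b (\<lambda>y. \<Gamma> y l a i) x) u i j k
    + act (\<lambda>m i. (\<Sum>l\<in>UNIV. \<Gamma> x m a l * \<Gamma> x l b i) - (\<Sum>l\<in>UNIV. \<Gamma> x m b l * \<Gamma> x l a i)) u i j k" for u
    by (simp add: act_def riem_def[abs_def] sum.distrib sum_subtractf left_diff_distrib distrib_right)
  show ?thesis
    unfolding nabla_P_def pP r act_act[of "\<lambda>l. \<Gamma> x l b" "\<lambda>l. \<Gamma> x l a", symmetric] using sym c by simp
qed

lemma riem_bianchi:
  assumes x: "x \<in> S" shows "riem x a b p i + riem x b i p a + riem x i a p b = 0"
proof -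
  have p: "partial c (\<lambda>y. \<Gamma> y p a b) x = partial c (\<lambda>y. \<Gamma> y p b a) x" for a b c
    by (rule partial_cong[OF S x]) (auto simp: \<Gamma>_commute intro: diff_field x)
  have q: "(\<Sum>l\<in>UNIV. \<Gamma> x p c l * \<Gamma> x l a b) = (\<Sum>l\<in>UNIV. \<Gamma> x p c l * \<Gamma> x l b a)" for a b c
    using \<Gamma>_commute[OF x, of _ a b] by simp
  show ?thesis unfolding riem_def using p[of a b i] p[of b a i] p[of i a b] q[of a b i] q[of b a i] q[of i a b] by linarith
qed

lemma riem_metric:
  assumes x: "x \<in> S"
  shows "(\<Sum>p\<in>UNIV. gl x q p * riem x a b p j) = - (\<Sum>p\<in>UNIV. gl x j p * riem x a b p q)"
proof -
  define g2 where "g2 M u i j = (\<Sum>l\<in>UNIV. M l i * u l j) + (\<Sum>l\<in>UNIV. M l j * u i l)" for M u :: tensor2 and i j :: 7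
  have pg: "partial a (\<lambda>y. gl y i j) x = g2 (\<lambda>l. \<Gamma> x l a) (gl x) i j" if "x \<in> S" for x a i j
    unfolding partial_gl[OF that] g2_def by (simp add: sum.distrib)
  have ppg: "partial a (partial b (\<lambda>y. gl y i j)) x = g2 (\<lambda>l i. partial a (\<lambda>y. \<Gamma> y l b i) x) (gl x) i j + g2 (\<lambda>l. \<Gamma> x l b) (g2 (\<lambda>l. \<Gamma> x l a) (gl x)) i j" for a b i j
  proof -
    have 1: "partial a (\<lambda>y. \<Gamma> y p b q * gl y i j) x = \<Gamma> x p b q * partial a (\<lambda>y. gl y i j) x + partial a (\<lambda>y. \<Gamma> y p b q) x * gl x i j" for p q i j
      by (rule partial_mult) (auto intro: diff_field x)
    have "partial a (partial b (\<lambda>y. gl y i j)) x = partial a (\<lambda>y. (\<Sum>l\<in>UNIV. \<Gamma> y l b i * gl y l j) + (\<Sum>l\<in>UNIV. \<Gamma> y l b j * gl y i l)) x"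
      by (rule partial_cong[OF S x]) (auto simp: pg g2_def intro: smooth_differentiable[OF S smooth_partial[OF S smooth_lower] x])
    also have "\<dots> = (\<Sum>l\<in>UNIV. partial a (\<lambda>y. \<Gamma> y l b i * gl y l j) x) + (\<Sum>l\<in>UNIV. partial a (\<lambda>y. \<Gamma> y l b j * gl y i l) x)"
      by (simp add: partial_sum partial_add differentiable_sum differentiable_add differentiable_mult diff_field[OF x])
    finally show ?thesis unfolding 1 pg[OF x] by (simp add: g2_def sum.distrib)
  qed
  have gg: "g2 M (g2 N u) i j - g2 N (g2 M u) i j = g2 (\<lambda>m i. (\<Sum>l\<in>UNIV. N m l * M l i) - (\<Sum>l\<in>UNIV. M m l * N l i)) u i j" for M N u i j
  proof -
    have c1: "(\<Sum>l\<in>UNIV. M l i * (\<Sum>m\<in>UNIV. N m l * u m j)) = (\<Sum>m\<in>UNIV. (\<Sum>l\<in>UNIV. N m l * M l i) * u m j)" for M N :: tensor2 and i j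
      unfolding sum_distrib_left sum_distrib_right by (subst sum.swap, simp only: mult_ac)
    have c2: "(\<Sum>l\<in>UNIV. M l i * (\<Sum>m\<in>UNIV. N m l * u j m)) = (\<Sum>m\<in>UNIV. (\<Sum>l\<in>UNIV. N m l * M l i) * u j m)" for M N :: tensor2 and i j
      unfolding sum_distrib_left sum_distrib_right by (subst sum.swap, simp only: mult_ac)
    have c3: "(\<Sum>l\<in>UNIV. M l i * (\<Sum>m\<in>UNIV. N m j * u l m)) = (\<Sum>m\<in>UNIV. N m j * (\<Sum>l\<in>UNIV. M l i * u l m))" for M N :: tensor2 and i j
      unfolding sum_distrib_left by (subst sum.swap, simp only: mult.left_commute)
    show ?thesis unfolding g2_def distrib_left sum.distrib left_diff_distrib sum_subtractf c1 c2 c3 by simp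
  qed
  have "partial a (partial b (\<lambda>y. gl y j q)) x = partial b (partial a (\<lambda>y. gl y j q)) x"
    by (rule partial_commute[OF S smooth_lower x])
  then have "g2 (riem x a b) (gl x) j q = 0"
    unfolding ppg using gg[of "\<lambda>l. \<Gamma> x l b" "\<lambda>l. \<Gamma> x l a" "gl x" j q]
    by (simp add: g2_def riem_def[abs_def] left_diff_distrib distrib_right sum_subtractf sum.distrib)
  moreover have "(\<Sum>p\<in>UNIV. gl x q p * riem x a b p j) = (\<Sum>p\<in>UNIV. riem x a b p j * gl x p q)"
    using gl_commute[OF x, of q] by (simp add: mult.commute)
  moreover have "(\<Sum>p\<in>UNIV. gl x j p * riem x a b p q) = (\<Sum>p\<in>UNIV. riem x a b p q * gl x j p)"
    by (simp add: mult.commute)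
  ultimately show ?thesis unfolding g2_def by linarith
qed

theorem ricci_contraction:
  assumes x: "x \<in> S"
  shows "(\<Sum>b\<in>UNIV. \<Sum>j\<in>UNIV. \<Sum>k\<in>UNIV. raise3 (w x) b j k * (nabla_P x a b i j k - nabla_P x b a i j k)) = 4 * ricci w x a i"
proof -
  obtain F where "framed (w x) F" using frame_at[OF x] .
  then interpret framed "w x" F .
  define L where "L a b q j = (\<Sum>p\<in>UNIV. gl x q p * riem x a b p j)" for a b q j
  have s1: "L a b q j = - L b a q j" for a b q j
    unfolding L_def sum_negf[symmetric] by (intro sum.cong refl) (simp add: riem_swap[of x b a])
  have s2: "L a b q j = - L a b j q" for a b q j unfolding L_def by (rule riem_metric[OF x])
  have bi: "L a b q j + L b j q a + L j a q b = 0" for a b q j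
    unfolding L_def sum.distrib[symmetric] distrib_left[symmetric] riem_bianchi[OF x] by simp
  have pair: "L a b q j = L q j a b" for a b q j
  proof -
    have "L a b q j - L b j a q + L a j b q = 0"
      using bi[of a b q j] s2[of b j q a] s1[of j a q b] s2[of a j q b] by linarith
    moreover have "- L a b q j - L b q a j + L a q b j = 0"
      using bi[of a b j q] s2[of a b j q] s2[of b q j a] s1[of q a j b] s2[of a q j b] by linarith
    moreover have "L a q b j - L q j a b - L a j b q = 0"
      using bi[of a q b j] s2[of q j b a] s1[of j a b q] by linarith
    moreover have "L b q a j + L q j a b - L b j a q = 0"
      using bi[of b q a j] s1[of j b a q] by linarith
    ultimately show ?thesis by linarith
  qed
  have cyc: "L a b q j + L a q j b + L a j b q = 0" for b q j
    using bi[of q j a b] pair[of a b q j] pair[of a q j b] pair[of a j b q] by linarith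
  have c: "(\<Sum>b\<in>UNIV. \<Sum>j\<in>UNIV. \<Sum>k\<in>UNIV. raise3 (w x) b j k * act (riem x a b) (w x) i j k) = 4 * (\<Sum>b\<in>UNIV. riem x a b b i)"
    unfolding act_def by (rule curvature_contraction) (rule s2[unfolded L_def], rule cyc[unfolded L_def])
  have "(\<Sum>b\<in>UNIV. \<Sum>j\<in>UNIV. \<Sum>k\<in>UNIV. raise3 (w x) b j k * (nabla_P x a b i j k - nabla_P x b a i j k)) = - (4 * (\<Sum>b\<in>UNIV. riem x a b b i))"
    unfolding commutator[OF x] c[symmetric] by (simp add: sum_negf)
  also have "(\<Sum>b\<in>UNIV. riem x a b b i) = - ricci w x a i"
    unfolding ricci_riem sum_negf[symmetric] by (intro sum.cong refl) (rule riem_swap)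
  finally show ?thesis by simp
qed

section \<open>A divergence identity for the scalar curvature\<close>

definition Y :: "real^7 \<Rightarrow> 7 \<Rightarrow> real" where
  "Y x i = (\<Sum>b\<in>UNIV. \<Sum>j\<in>UNIV. \<Sum>k\<in>UNIV. raise3 (w x) b j k * P x b i j k)"

definition V :: "real^7 \<Rightarrow> 7 \<Rightarrow> real" where
  "V x a = (\<Sum>i\<in>UNIV. gu x a i * Y x i)"

definition U :: "real^7 \<Rightarrow> tensor2" where
  "U x j k = (\<Sum>a\<in>UNIV. \<Sum>i\<in>UNIV. gu x a i * P x a i j k)"

definition Z :: "real^7 \<Rightarrow> 7 \<Rightarrow> real" where
  "Z x b = (\<Sum>j\<in>UNIV. \<Sum>k\<in>UNIV. raise3 (w x) b j k * U x j k)"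

lemma smooth_Y: "smooth_on S (\<lambda>x. Y x i)"
  unfolding Y_def by (intro smooth_intros S smooth_field)
lemma smooth_V: "smooth_on S (\<lambda>x. V x i)"
  unfolding V_def by (intro smooth_intros S smooth_field smooth_Y)
lemma smooth_U: "smooth_on S (\<lambda>x. U x j k)"
  unfolding U_def by (intro smooth_intros S smooth_field)
lemma smooth_Z: "smooth_on S (\<lambda>x. Z x i)"
  unfolding Z_def by (intro smooth_intros S smooth_field smooth_U)
lemma smooth_abs_vol: "smooth_on S (\<lambda>x. \<bar>vol (w x)\<bar>)"
  by (rule smooth_abs[OF S smooth_vol vol_nonzero])

lemma partial_P:
  "partial a (\<lambda>y. P y b i j k) x = nabla_P x a b i j k + (\<Sum>l\<in>UNIV. \<Gamma> x l a b * P x l i j k) + (\<Sum>l\<in>UNIV. \<Gamma> x l a i * P x b l j k)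
     + (\<Sum>l\<in>UNIV. \<Gamma> x l a j * P x b i l k) + (\<Sum>l\<in>UNIV. \<Gamma> x l a k * P x b i j l)"
  by (simp add: nabla_P_def act_alt)

lemma partial_Y:
  assumes x: "x \<in> S"
  shows "partial a (\<lambda>y. Y y i) x = (\<Sum>b\<in>UNIV. \<Sum>j\<in>UNIV. \<Sum>k\<in>UNIV. raise3_by (w x) (P x a) b j k * P x b i j k)
     + (\<Sum>b\<in>UNIV. \<Sum>j\<in>UNIV. \<Sum>k\<in>UNIV. raise3 (w x) b j k * nabla_P x a b i j k) + (\<Sum>l\<in>UNIV. \<Gamma> x l a i * Y x l)"
proof -
  let ?r = "raise3 (w x)"
  have 1: "partial a (\<lambda>y. \<Sum>j\<in>UNIV. \<Sum>k\<in>UNIV. raise3 (w y) b j k * P y b i j k) x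
    = (\<Sum>j\<in>UNIV. \<Sum>k\<in>UNIV. (raise3_by (w x) (P x a) b j k - (\<Sum>l\<in>UNIV. \<Gamma> x b a l * ?r l j k)) * P x b i j k)
    + (\<Sum>j\<in>UNIV. \<Sum>k\<in>UNIV. ?r b j k * (nabla_P x a b i j k + (\<Sum>l\<in>UNIV. \<Gamma> x l a b * P x l i j k) + (\<Sum>l\<in>UNIV. \<Gamma> x l a i * P x b l j k)))" for b
    by (rule partial_pairing2) (auto intro: diff_field x simp: partial_raise[OF x] partial_P)
  have "partial a (\<lambda>y. Y y i) x = (\<Sum>b\<in>UNIV. partial a (\<lambda>y. \<Sum>j\<in>UNIV. \<Sum>k\<in>UNIV. raise3 (w y) b j k * P y b i j k) x)"
    unfolding Y_def by (rule partial_sum) (simp add: differentiable_sum differentiable_mult diff_field[OF x])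
  also have "\<dots> = (\<Sum>b\<in>UNIV. \<Sum>j\<in>UNIV. \<Sum>k\<in>UNIV. raise3_by (w x) (P x a) b j k * P x b i j k)
     + (\<Sum>b\<in>UNIV. \<Sum>j\<in>UNIV. \<Sum>k\<in>UNIV. ?r b j k * nabla_P x a b i j k)
     + (\<Sum>b\<in>UNIV. \<Sum>j\<in>UNIV. \<Sum>k\<in>UNIV. \<Sum>l\<in>UNIV. \<Gamma> x l a i * (?r b j k * P x b l j k))
     + (\<Sum>b\<in>UNIV. \<Sum>j\<in>UNIV. \<Sum>k\<in>UNIV. \<Sum>l\<in>UNIV. \<Gamma> x l a b * (?r b j k * P x l i j k))
     - (\<Sum>b\<in>UNIV. \<Sum>j\<in>UNIV. \<Sum>k\<in>UNIV. \<Sum>l\<in>UNIV. \<Gamma> x b a l * (?r l j k * P x b i j k))"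
    unfolding 1 by (simp add: sum.distrib sum_subtractf sum_distrib_left sum_distrib_right algebra_simps)
  also have "(\<Sum>b\<in>UNIV. \<Sum>j\<in>UNIV. \<Sum>k\<in>UNIV. \<Sum>l\<in>UNIV. \<Gamma> x l a i * (?r b j k * P x b l j k)) = (\<Sum>l\<in>UNIV. \<Gamma> x l a i * Y x l)"
  proof -
    have "(\<Sum>b\<in>UNIV. \<Sum>j\<in>UNIV. \<Sum>k\<in>UNIV. \<Sum>l\<in>UNIV. \<Gamma> x l a i * (?r b j k * P x b l j k))
      = (\<Sum>b\<in>UNIV. \<Sum>l\<in>UNIV. \<Sum>j\<in>UNIV. \<Sum>k\<in>UNIV. \<Gamma> x l a i * (?r b j k * P x b l j k))"
      by (rule sum.cong[OF refl], rule sum_rotate3)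
    also have "\<dots> = (\<Sum>l\<in>UNIV. \<Sum>b\<in>UNIV. \<Sum>j\<in>UNIV. \<Sum>k\<in>UNIV. \<Gamma> x l a i * (?r b j k * P x b l j k))"
      by (rule sum.swap)
    finally show ?thesis by (simp only: Y_def sum_distrib_left)
  qed
  also have "(\<Sum>b\<in>UNIV. \<Sum>j\<in>UNIV. \<Sum>k\<in>UNIV. \<Sum>l\<in>UNIV. \<Gamma> x l a b * (?r b j k * P x l i j k))
    = (\<Sum>b\<in>UNIV. \<Sum>j\<in>UNIV. \<Sum>k\<in>UNIV. \<Sum>l\<in>UNIV. \<Gamma> x b a l * (?r l j k * P x b i j k))"
  proof -
    have "(\<Sum>b\<in>UNIV. \<Sum>j\<in>UNIV. \<Sum>k\<in>UNIV. \<Sum>l\<in>UNIV. \<Gamma> x l a b * (?r b j k * P x l i j k))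
      = (\<Sum>b\<in>UNIV. \<Sum>l\<in>UNIV. \<Sum>j\<in>UNIV. \<Sum>k\<in>UNIV. \<Gamma> x l a b * (?r b j k * P x l i j k))"
      by (rule sum.cong[OF refl], rule sum_rotate3)
    also have "\<dots> = (\<Sum>l\<in>UNIV. \<Sum>b\<in>UNIV. \<Sum>j\<in>UNIV. \<Sum>k\<in>UNIV. \<Gamma> x l a b * (?r b j k * P x l i j k))"
      by (rule sum.swap)
    also have "\<dots> = (\<Sum>l\<in>UNIV. \<Sum>j\<in>UNIV. \<Sum>k\<in>UNIV. \<Sum>b\<in>UNIV. \<Gamma> x l a b * (?r b j k * P x l i j k))"
      by (rule sum.cong[OF refl], rule sum_rotate3[symmetric])
    finally show ?thesis .
  qed
  finally show ?thesis by simp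
qed

lemma divergence_V:
  assumes x: "x \<in> S"
  shows "(\<Sum>b\<in>UNIV. partial b (\<lambda>y. \<bar>vol (w y)\<bar> * V y b) x) = \<bar>vol (w x)\<bar> * (\<Sum>a\<in>UNIV. \<Sum>i\<in>UNIV. gu x a i *
     ((\<Sum>b\<in>UNIV. \<Sum>j\<in>UNIV. \<Sum>k\<in>UNIV. raise3_by (w x) (P x a) b j k * P x b i j k)
     + (\<Sum>b\<in>UNIV. \<Sum>j\<in>UNIV. \<Sum>k\<in>UNIV. raise3 (w x) b j k * nabla_P x a b i j k)))"
proof (rule divergence_formula[OF x])
  show "(\<lambda>y. V y b) differentiable (at x)" for b by (rule smooth_differentiable[OF S smooth_V x])
  show "partial b (\<lambda>y. V y b) x = (\<Sum>i\<in>UNIV. gu x b i *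
     ((\<Sum>c\<in>UNIV. \<Sum>j\<in>UNIV. \<Sum>k\<in>UNIV. raise3_by (w x) (P x b) c j k * P x c i j k)
     + (\<Sum>c\<in>UNIV. \<Sum>j\<in>UNIV. \<Sum>k\<in>UNIV. raise3 (w x) c j k * nabla_P x b c i j k))) - (\<Sum>l\<in>UNIV. \<Gamma> x b b l * V x l)" for b
    unfolding V_def by (rule raise_derivative[OF x]) (rule smooth_differentiable[OF S smooth_Y x], rule partial_Y[OF x])
qed

lemma partial_U:
  assumes x: "x \<in> S"
  shows "partial b (\<lambda>y. U y j k) x = (\<Sum>a\<in>UNIV. \<Sum>i\<in>UNIV. gu x a i * nabla_P x b a i j k) + (\<Sum>l\<in>UNIV. \<Gamma> x l b j * U x l k) + (\<Sum>l\<in>UNIV. \<Gamma> x l b k * U x j l)"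
proof -
  have 1: "partial b (\<lambda>y. \<Sum>i\<in>UNIV. gu y a i * P y a i j k) x = (\<Sum>i\<in>UNIV. gu x a i * (nabla_P x b a i j k + (\<Sum>l\<in>UNIV. \<Gamma> x l b a * P x l i j k)
     + (\<Sum>l\<in>UNIV. \<Gamma> x l b j * P x a i l k) + (\<Sum>l\<in>UNIV. \<Gamma> x l b k * P x a i j l))) - (\<Sum>l\<in>UNIV. \<Gamma> x a b l * (\<Sum>i\<in>UNIV. gu x l i * P x a i j k))" for a
    by (rule raise_derivative[OF x]) (auto intro: diff_field x simp: partial_P)
  have "partial b (\<lambda>y. U y j k) x = (\<Sum>a\<in>UNIV. partial b (\<lambda>y. \<Sum>i\<in>UNIV. gu y a i * P y a i j k) x)"
    unfolding U_def by (rule partial_sum) (simp add: differentiable_sum differentiable_mult diff_field[OF x])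
  also have "\<dots> = (\<Sum>a\<in>UNIV. \<Sum>i\<in>UNIV. gu x a i * nabla_P x b a i j k)
    + (\<Sum>a\<in>UNIV. \<Sum>i\<in>UNIV. \<Sum>l\<in>UNIV. \<Gamma> x l b j * (gu x a i * P x a i l k)) + (\<Sum>a\<in>UNIV. \<Sum>i\<in>UNIV. \<Sum>l\<in>UNIV. \<Gamma> x l b k * (gu x a i * P x a i j l))
    + (\<Sum>a\<in>UNIV. \<Sum>i\<in>UNIV. \<Sum>l\<in>UNIV. \<Gamma> x l b a * (gu x a i * P x l i j k)) - (\<Sum>a\<in>UNIV. \<Sum>l\<in>UNIV. \<Sum>i\<in>UNIV. \<Gamma> x a b l * (gu x l i * P x a i j k))"
    unfolding 1 by (simp add: sum.distrib sum_subtractf sum_distrib_left sum_distrib_right algebra_simps)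
  also have "(\<Sum>a\<in>UNIV. \<Sum>i\<in>UNIV. \<Sum>l\<in>UNIV. \<Gamma> x l b a * (gu x a i * P x l i j k)) = (\<Sum>a\<in>UNIV. \<Sum>l\<in>UNIV. \<Sum>i\<in>UNIV. \<Gamma> x a b l * (gu x l i * P x a i j k))"
    by (rule sum_rotate3)
  also have "(\<Sum>a\<in>UNIV. \<Sum>i\<in>UNIV. \<Sum>l\<in>UNIV. \<Gamma> x l b j * (gu x a i * P x a i l k)) = (\<Sum>l\<in>UNIV. \<Gamma> x l b j * U x l k)"
    unfolding U_def sum_distrib_left by (rule sum_rotate3)
  also have "(\<Sum>a\<in>UNIV. \<Sum>i\<in>UNIV. \<Sum>l\<in>UNIV. \<Gamma> x l b k * (gu x a i * P x a i j l)) = (\<Sum>l\<in>UNIV. \<Gamma> x l b k * U x j l)"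
    unfolding U_def sum_distrib_left by (rule sum_rotate3)
  finally show ?thesis by simp
qed

lemma divergence_Z:
  assumes x: "x \<in> S"
  shows "(\<Sum>b\<in>UNIV. partial b (\<lambda>y. \<bar>vol (w y)\<bar> * Z y b) x) = \<bar>vol (w x)\<bar> * (\<Sum>b\<in>UNIV. 
     (\<Sum>j\<in>UNIV. \<Sum>k\<in>UNIV. raise3_by (w x) (P x b) b j k * U x j k)
     + (\<Sum>j\<in>UNIV. \<Sum>k\<in>UNIV. raise3 (w x) b j k * (\<Sum>a\<in>UNIV. \<Sum>i\<in>UNIV. gu x a i * nabla_P x b a i j k)))"
proof (rule divergence_formula[OF x])
  show "(\<lambda>y. Z y b) differentiable (at x)" for b by (rule smooth_differentiable[OF S smooth_Z x])
  fix b
  have "partial b (\<lambda>y. Z y b) x = (\<Sum>j\<in>UNIV. \<Sum>k\<in>UNIV. (raise3_by (w x) (P x b) b j k - (\<Sum>l\<in>UNIV. \<Gamma> x b b l * raise3 (w x) l j k)) * U x j k)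
     + (\<Sum>j\<in>UNIV. \<Sum>k\<in>UNIV. raise3 (w x) b j k * (\<Sum>a\<in>UNIV. \<Sum>i\<in>UNIV. gu x a i * nabla_P x b a i j k))"
    unfolding Z_def
    by (rule partial_pairing2) (auto intro: diff_field x smooth_differentiable[OF S smooth_U x] simp: partial_raise[OF x] partial_U[OF x])
  also have "(\<Sum>j\<in>UNIV. \<Sum>k\<in>UNIV. (raise3_by (w x) (P x b) b j k - (\<Sum>l\<in>UNIV. \<Gamma> x b b l * raise3 (w x) l j k)) * U x j k)
    = (\<Sum>j\<in>UNIV. \<Sum>k\<in>UNIV. raise3_by (w x) (P x b) b j k * U x j k) - (\<Sum>j\<in>UNIV. \<Sum>k\<in>UNIV. \<Sum>l\<in>UNIV. \<Gamma> x b b l * (raise3 (w x) l j k * U x j k))"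
    by (simp add: left_diff_distrib sum_subtractf sum_distrib_right mult.assoc)
  also have "(\<Sum>j\<in>UNIV. \<Sum>k\<in>UNIV. \<Sum>l\<in>UNIV. \<Gamma> x b b l * (raise3 (w x) l j k * U x j k)) = (\<Sum>l\<in>UNIV. \<Gamma> x b b l * Z x l)"
    unfolding Z_def sum_distrib_left by (rule sum_rotate3)
  finally show "partial b (\<lambda>y. Z y b) x = (\<Sum>j\<in>UNIV. \<Sum>k\<in>UNIV. raise3_by (w x) (P x b) b j k * U x j k)
     + (\<Sum>j\<in>UNIV. \<Sum>k\<in>UNIV. raise3 (w x) b j k * (\<Sum>a\<in>UNIV. \<Sum>i\<in>UNIV. gu x a i * nabla_P x b a i j k)) - (\<Sum>l\<in>UNIV. \<Gamma> x b b l * Z x l)"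
    by simp
qed

lemma Z_eq: "x \<in> S \<Longrightarrow> Z x b = - V x b"
proof -
  assume x: "x \<in> S"
  obtain F where "framed (w x) F" using frame_at[OF x] .
  then interpret framed "w x" F .
  show ?thesis
    using trace_vectors_opposite[of "P x" b] parallel_identity[OF x]
    unfolding Z_def V_def Y_def U_def trace_first_def by blast
qed

definition cross_norm :: "real^7 \<Rightarrow> real" where
  "cross_norm x = (\<Sum>a\<in>UNIV. \<Sum>i\<in>UNIV. gu x a i * (\<Sum>b\<in>UNIV. \<Sum>j\<in>UNIV. \<Sum>k\<in>UNIV. raise3_by (w x) (P x a) b j k * P x b i j k))"

definition trace_norm :: "real^7 \<Rightarrow> real" where
  "trace_norm x = (\<Sum>b\<in>UNIV. \<Sum>j\<in>UNIV. \<Sum>k\<in>UNIV. raise3_by (w x) (P x b) b j k * U x j k)"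

definition scalar :: "real^7 \<Rightarrow> real" where
  "scalar x = (\<Sum>a\<in>UNIV. \<Sum>i\<in>UNIV. gu x a i * ricci w x a i)"

text \<open>Both sides come from commuting two covariant derivatives of the 3-form under a double contraction with
  it; the first derivatives that arise on the way form the norms on the right.\<close>

theorem divergence_identity:
  assumes x: "x \<in> S"
  shows "2 * (\<Sum>b\<in>UNIV. partial b (\<lambda>y. \<bar>vol (w y)\<bar> * V y b) x) = \<bar>vol (w x)\<bar> * (cross_norm x - trace_norm x + 4 * scalar x)"
proof -
  define W1 where "W1 = (\<Sum>a\<in>UNIV. \<Sum>i\<in>UNIV. gu x a i * (\<Sum>b\<in>UNIV. \<Sum>j\<in>UNIV. \<Sum>k\<in>UNIV. raise3 (w x) b j k * nabla_P x a b i j k))"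
  define W2 where "W2 = (\<Sum>a\<in>UNIV. \<Sum>i\<in>UNIV. gu x a i * (\<Sum>b\<in>UNIV. \<Sum>j\<in>UNIV. \<Sum>k\<in>UNIV. raise3 (w x) b j k * nabla_P x b a i j k))"
  have 1: "(\<Sum>b\<in>UNIV. partial b (\<lambda>y. \<bar>vol (w y)\<bar> * V y b) x) = \<bar>vol (w x)\<bar> * (cross_norm x + W1)"
    unfolding divergence_V[OF x] W1_def cross_norm_def by (simp add: distrib_left sum.distrib)
  have "(\<Sum>b\<in>UNIV. \<Sum>j\<in>UNIV. \<Sum>k\<in>UNIV. raise3 (w x) b j k * (\<Sum>a\<in>UNIV. \<Sum>i\<in>UNIV. gu x a i * nabla_P x b a i j k)) = W2"
  proof -
    have "(\<Sum>b\<in>UNIV. \<Sum>j\<in>UNIV. \<Sum>k\<in>UNIV. raise3 (w x) b j k * (\<Sum>a\<in>UNIV. \<Sum>i\<in>UNIV. gu x a i * nabla_P x b a i j k))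
      = (\<Sum>b\<in>UNIV. \<Sum>j\<in>UNIV. \<Sum>k\<in>UNIV. \<Sum>a\<in>UNIV. \<Sum>i\<in>UNIV. gu x a i * (raise3 (w x) b j k * nabla_P x b a i j k))"
      unfolding sum_distrib_left by (simp only: mult.left_commute)
    also have "\<dots> = (\<Sum>a\<in>UNIV. \<Sum>i\<in>UNIV. \<Sum>b\<in>UNIV. \<Sum>j\<in>UNIV. \<Sum>k\<in>UNIV. gu x a i * (raise3 (w x) b j k * nabla_P x b a i j k))"
      using sum_swap33[where A = "UNIV :: 7 set" and B = "UNIV :: 7 set" and C = "UNIV :: 7 set" and P = UNIV and Q = UNIV and R = "{()}"
        and f = "\<lambda>b j k a i (_::unit). gu x a i * (raise3 (w x) b j k * nabla_P x b a i j k)"] by simp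
    finally show ?thesis by (simp only: W2_def sum_distrib_left)
  qed
  then have 2: "(\<Sum>b\<in>UNIV. partial b (\<lambda>y. \<bar>vol (w y)\<bar> * Z y b) x) = \<bar>vol (w x)\<bar> * (trace_norm x + W2)"
    unfolding divergence_Z[OF x] trace_norm_def by (simp add: sum.distrib)
  have 3: "(\<Sum>b\<in>UNIV. partial b (\<lambda>y. \<bar>vol (w y)\<bar> * Z y b) x) = - (\<Sum>b\<in>UNIV. partial b (\<lambda>y. \<bar>vol (w y)\<bar> * V y b) x)"
    unfolding sum_negf[symmetric]
  proof (rule sum.cong[OF refl])
    fix b :: 7
    have d: "(\<lambda>y. \<bar>vol (w y)\<bar> * f y b) differentiable (at x)" if "smooth_on S (\<lambda>y. f y b)" for f :: "real^7 \<Rightarrow> 7 \<Rightarrow> real"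
      by (rule smooth_differentiable[OF S smooth_mult[OF S smooth_abs_vol that] x])
    have "partial b (\<lambda>y. \<bar>vol (w y)\<bar> * Z y b) x = partial b (\<lambda>y. - 1 * (\<bar>vol (w y)\<bar> * V y b)) x"
      by (rule partial_cong[OF S x _ d[OF smooth_Z]]) (simp add: Z_eq)
    then show "partial b (\<lambda>y. \<bar>vol (w y)\<bar> * Z y b) x = - partial b (\<lambda>y. \<bar>vol (w y)\<bar> * V y b) x"
      by (subst (asm) partial_cmult[OF d[OF smooth_V]]) simp
  qed
  have s4: "W1 - W2 = 4 * scalar x"
    unfolding W1_def W2_def scalar_def sum_subtractf[symmetric] right_diff_distrib[symmetric] ricci_contraction[OF x]
    by (simp add: sum_distrib_left mult_ac)
  have "2 * (\<Sum>b\<in>UNIV. partial b (\<lambda>y. \<bar>vol (w y)\<bar> * V y b) x) = \<bar>vol (w x)\<bar> * (cross_norm x + W1) - \<bar>vol (w x)\<bar> * (trace_norm x + W2)"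
    using 1 2 3 by linarith
  also have "\<dots> = \<bar>vol (w x)\<bar> * (cross_norm x - trace_norm x + (W1 - W2))" by (simp add: algebra_simps)
  finally show ?thesis unfolding s4 .
qed

text \<open>The trace of the equation gives the scalar curvature as \<open>- 4 |T|\<^sup>2\<close>. Of the resulting
  \<open>- 16 |T|\<^sup>2\<close> in the divergence identity at most \<open>12 |T|\<^sup>2\<close> is compensated by the quadratic
  terms.\<close>

theorem stationary_divergence:
  assumes x: "x \<in> S" and st: "\<And>i j k. ricci_harmonic w x i j k = 0"
  shows "(\<Sum>b\<in>UNIV. partial b (\<lambda>y. \<bar>vol (w y)\<bar> * V y b) x) \<le> - 2 * \<bar>vol (w x)\<bar> * torsion_norm_sq w x"
proof -
  obtain F where F: "framed (w x) F" using frame_at[OF x] .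
  then interpret framed "w x" F .
  have T: "torsion_eq (P x) (torsion w x)" by (rule torsion_exists[OF x F])
  have ineq: "trace_norm x - cross_norm x \<ge> - 12 * torsion_norm_sq w x"
    using torsion_inequality[OF T] unfolding trace_norm_def cross_norm_def U_def trace_first_def torsion_norm_sq_def .
  let ?h = "\<lambda>a b. - ricci w x a b + 3 * torsion_square w x a b - torsion_norm_sq w x * gl x a b"
  have "0 = (\<Sum>i\<in>UNIV. \<Sum>j\<in>UNIV. \<Sum>k\<in>UNIV. raise3 (w x) i j k * ricci_harmonic w x i j k)" using st by simp
  also have "\<dots> = 18 * (\<Sum>p\<in>UNIV. \<Sum>q\<in>UNIV. gu x p q * ?h q p)"
    unfolding ricci_harmonic_def distrib_left sum.distrib trace_diamond trace_contract_dual by simp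
  finally have tr: "(\<Sum>p\<in>UNIV. \<Sum>q\<in>UNIV. gu x p q * ?h q p) = 0" by simp
  have s: "(\<Sum>p\<in>UNIV. \<Sum>q\<in>UNIV. gu x p q * ricci w x q p) = scalar x"
    unfolding scalar_def by (subst sum.swap) (simp add: gu_commute[OF x])
  have t: "(\<Sum>p\<in>UNIV. \<Sum>q\<in>UNIV. gu x p q * torsion_square w x q p) = torsion_norm_sq w x"
  proof -
    have "(\<Sum>p\<in>UNIV. \<Sum>q\<in>UNIV. gu x p q * torsion_square w x q p) = (\<Sum>q\<in>UNIV. \<Sum>p\<in>UNIV. \<Sum>a\<in>UNIV. \<Sum>b\<in>UNIV. gu x a b * gu x q p * torsion w x a q * torsion w x b p)"
      unfolding torsion_square_def sum_distrib_left by (subst sum.swap) (simp add: gu_commute[OF x] mult_ac)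
    also have "\<dots> = (\<Sum>a\<in>UNIV. \<Sum>b\<in>UNIV. \<Sum>q\<in>UNIV. \<Sum>p\<in>UNIV. gu x a b * gu x q p * torsion w x a q * torsion w x b p)"
      using sum_swap33[where A = "UNIV :: 7 set" and B = "UNIV :: 7 set" and C = "{()}" and P = UNIV and Q = UNIV and R = "{()}"
        and f = "\<lambda>q p (_::unit) a b (_::unit). gu x a b * gu x q p * torsion w x a q * torsion w x b p"] by simp
    also have "\<dots> = torsion_norm_sq w x"
      unfolding torsion_norm_sq_def by (rule sum.cong[OF refl], rule sum.swap)
    finally show ?thesis .
  qed
  have g: "(\<Sum>p\<in>UNIV. \<Sum>q\<in>UNIV. gu x p q * gl x q p) = 7"
    by (simp add: gu_gl[OF x])
  have "(\<Sum>p\<in>UNIV. \<Sum>q\<in>UNIV. gu x p q * ?h q p) = - (\<Sum>p\<in>UNIV. \<Sum>q\<in>UNIV. gu x p q * ricci w x q p) + 3 * (\<Sum>p\<in>UNIV. \<Sum>q\<in>UNIV. gu x p q * torsion_square w x q p)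
    - torsion_norm_sq w x * (\<Sum>p\<in>UNIV. \<Sum>q\<in>UNIV. gu x p q * gl x q p)"
    by (simp add: sum.distrib sum_subtractf sum_negf sum_distrib_left algebra_simps)
  then have "scalar x = - 4 * torsion_norm_sq w x" using tr unfolding s t g by simp
  then have "cross_norm x - trace_norm x + 4 * scalar x \<le> - 4 * torsion_norm_sq w x" using ineq by simp
  then have "\<bar>vol (w x)\<bar> * (cross_norm x - trace_norm x + 4 * scalar x) \<le> \<bar>vol (w x)\<bar> * (- 4 * torsion_norm_sq w x)"
    by (rule mult_left_mono) simp
  then show ?thesis using divergence_identity[OF x] by simp
qed

lemma torsion_zero:
  assumes x: "x \<in> S" and n: "torsion_norm_sq w x \<le> 0" shows "torsion w x i j = 0"
proof -
  obtain F where F: "framed (w x) F" using frame_at[OF x] .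
  then interpret framed "w x" F .
  show ?thesis using n unfolding torsion_norm_sq_def by (rule norm_eq_0)
qed

lemma torsion_norm_nonneg: "x \<in> S \<Longrightarrow> torsion_norm_sq w x \<ge> 0"
proof -
  assume x: "x \<in> S"
  obtain F where F: "framed (w x) F" using frame_at[OF x] .
  then interpret framed "w x" F .
  show ?thesis unfolding torsion_norm_sq_def norm_frame by (simp add: sum_nonneg)
qed

text \<open>The torsion vanishes exactly when the form is parallel. The curvature then annihilates the form, and contracting this
  with the form shows that the Ricci tensor vanishes.\<close>

theorem torsion_free_stationary:
  assumes tf: "\<And>x i j. x \<in> S \<Longrightarrow> torsion w x i j = 0" and x: "x \<in> S"
  shows "ricci_harmonic w x i j k = 0"
proof -
  have P0: "P y m i j k = 0" if y: "y \<in> S" for y m i j k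
  proof -
    obtain F where F: "framed (w y) F" using frame_at[OF y] .
    then interpret framed "w y" F .
    show ?thesis using torsion_exists[OF y F] tf[OF y] by (simp add: torsion_eq_def)
  qed
  have pz: "partial a f x = 0" if "\<And>y. y \<in> S \<Longrightarrow> f y = 0" for a and f :: "real^7 \<Rightarrow> real"
  proof -
    have "partial a (\<lambda>y. 0) x = partial a f x" by (rule partial_cong[OF S x]) (simp_all add: that)
    then show ?thesis by (simp add: partial_const)
  qed
  have "nabla_P x a b i j k = 0" for a b i j k
    unfolding nabla_P_def act_def by (simp add: P0[OF x] pz[OF P0])
  then have "ricci w x a i = 0" for a i using ricci_contraction[OF x, of a i] by simp
  moreover have "torsion_square w x a b = 0" for a b by (simp add: torsion_square_def tf[OF x])
  moreover have "torsion_norm_sq w x = 0" by (simp add: torsion_norm_sq_def tf[OF x])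
  moreover have "div_torsion w x j = 0" for j
  proof -
    have "partial a (\<lambda>y. torsion w y i j) x = 0" for a i j by (rule pz) (rule tf)
    then show ?thesis by (simp add: div_torsion_def nabla2_def tf[OF x])
  qed
  ultimately show ?thesis by (simp add: ricci_harmonic_def diamond_def contract_dual_def)
qed

end

section \<open>Naturality under changes of coordinates\<close>

text \<open>Both the Christoffel symbols and the second derivatives of a coordinate change are symmetric in two
  indices; this is the common reason why neither contributes to an exterior derivative.\<close>

lemma symmetric_part_cancels:
  fixes A :: tensor4
  assumes "\<And>i b j k. A i b j k = A b i j k" "\<And>i b j k. A i b j k = - A i b k j"
  shows "(A i b j k - A i j b k + A i k b j) - (A b i j k - A b j i k + A b k i j)
    - (A j b i k - A j i b k + A j k b i) - (A k b j i - A k j b i + A k i b j) = 0"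
  using assms(1)[of i b j k] assms(1)[of i j b k] assms(1)[of i k b j] assms(1)[of b j i k] assms(1)[of b k i j]
    assms(1)[of j k b i] assms(2)[of k b j i] by linarith

text \<open>The exterior derivative, written for alternating components.\<close>

definition ext_d :: "(real^7 \<Rightarrow> tensor3) \<Rightarrow> real^7 \<Rightarrow> tensor4" where
  "ext_d w x i b j k = partial i (\<lambda>y. w y b j k) x - partial b (\<lambda>y. w y i j k) x
     - partial j (\<lambda>y. w y b i k) x - partial k (\<lambda>y. w y b j i) x"

context g2_field begin

lemma ext_d_P:
  assumes x: "x \<in> S"
  shows "ext_d w x i b j k = P x i b j k - P x b i j k - P x j b i k - P x k b j i"
proof -
  note sw = alternating3_swap[OF alt[OF x]]
  define A where "A i b j k = (\<Sum>l\<in>UNIV. \<Gamma> x l i b * w x l j k)" for i b j k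
  have 1: "A i b j k = A b i j k" for i b j k unfolding A_def using \<Gamma>_commute[OF x, of _ i b] by simp
  have 2: "A i b j k = - A i b k j" for i b j k
    unfolding A_def sum_negf[symmetric] by (intro sum.cong refl, subst sw(2)) simp
  have p: "partial i (\<lambda>y. w y b j k) x = P x i b j k + (A i b j k - A i j b k + A i k b j)" for i b j k
  proof -
    have "(\<Sum>l\<in>UNIV. \<Gamma> x l i j * w x b l k) = - A i j b k"
      unfolding A_def sum_negf[symmetric] by (intro sum.cong refl, subst sw(1)) simp
    moreover have "(\<Sum>l\<in>UNIV. \<Gamma> x l i k * w x b j l) = A i k b j"
      unfolding A_def by (intro sum.cong refl, subst sw(2), subst sw(1)) simp
    ultimately show ?thesis unfolding partial_w act_alt using A_def[of i b j k] by linarith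
  qed
  show ?thesis unfolding ext_d_def p using symmetric_part_cancels[of A i b j k, OF 1 2] by linarith
qed

text \<open>Only the full alternation of \<open>\<nabla>\<phi>\<close> enters, because the term with the derivative in the free direction is
  half the derivative of the constant norm of \<open>\<phi>\<close>. This frees \<open>V\<close> from the connection.\<close>

lemma Y_ext_d:
  assumes x: "x \<in> S"
  shows "Y x i = - (\<Sum>b\<in>UNIV. \<Sum>j\<in>UNIV. \<Sum>k\<in>UNIV. raise3 (w x) b j k * ext_d w x i b j k) / 3"
proof -
  obtain F where F: "framed (w x) F" using frame_at[OF x] .
  then interpret framed "w x" F .
  let ?r = "raise3 (w x)"
  have altr: "alternating3 ?r" unfolding raise3_pull3 by (rule alternating3_pull3[OF alt[OF x]])
  note sr = alternating3_swap[OF altr] and sP = alternating3_swap[OF alternating_P[OF x]]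
  have "(\<Sum>b\<in>UNIV. (\<Sum>j\<in>UNIV. \<Sum>k\<in>UNIV. raise3_by (w x) (P x i) b j k * w x b j k) + (\<Sum>j\<in>UNIV. \<Sum>k\<in>UNIV. ?r b j k * P x i b j k)) = 0"
    unfolding parallel_identity[OF x] by simp
  moreover have "(\<Sum>b\<in>UNIV. \<Sum>j\<in>UNIV. \<Sum>k\<in>UNIV. raise3_by (w x) (P x i) b j k * w x b j k) = (\<Sum>b\<in>UNIV. \<Sum>j\<in>UNIV. \<Sum>k\<in>UNIV. ?r b j k * P x i b j k)"
    unfolding raise3_eq raise_pairing by (simp only: mult.commute)
  ultimately have 0: "(\<Sum>b\<in>UNIV. \<Sum>j\<in>UNIV. \<Sum>k\<in>UNIV. ?r b j k * P x i b j k) = 0"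
    by (simp add: sum.distrib)
  have 2: "(\<Sum>b\<in>UNIV. \<Sum>j\<in>UNIV. \<Sum>k\<in>UNIV. ?r b j k * P x j b i k) = Y x i"
    unfolding Y_def by (subst sum.swap, intro sum.cong refl, subst sr(1), subst sP(1)) simp
  have 3: "(\<Sum>b\<in>UNIV. \<Sum>j\<in>UNIV. \<Sum>k\<in>UNIV. ?r b j k * P x k b j i) = Y x i"
  proof -
    have "(\<Sum>b\<in>UNIV. \<Sum>j\<in>UNIV. \<Sum>k\<in>UNIV. ?r b j k * P x k b j i) = (\<Sum>k\<in>UNIV. \<Sum>b\<in>UNIV. \<Sum>j\<in>UNIV. ?r b j k * P x k b j i)"
      by (rule sum_rotate3)
    also have "\<dots> = (\<Sum>k\<in>UNIV. \<Sum>j\<in>UNIV. \<Sum>b\<in>UNIV. ?r b j k * P x k b j i)"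
      by (rule sum.cong[OF refl], rule sum.swap)
    also have "\<dots> = (\<Sum>k\<in>UNIV. \<Sum>j\<in>UNIV. \<Sum>b\<in>UNIV. ?r k j b * P x k i j b)"
      by (intro sum.cong refl, subst sr(3), subst sP(3)) simp
    finally show ?thesis by (simp only: Y_def)
  qed
  have "(\<Sum>b\<in>UNIV. \<Sum>j\<in>UNIV. \<Sum>k\<in>UNIV. ?r b j k * ext_d w x i b j k) = 0 - Y x i - Y x i - Y x i"
    unfolding ext_d_P[OF x] right_diff_distrib sum_subtractf 0 2 3 by (simp only: Y_def)
  then show ?thesis by simp
qed

end

lemma partial_component: "F differentiable (at x) \<Longrightarrow> partial i (\<lambda>y. F y $ a) x = frechet_derivative F (at x) (axis i 1) $ a"
  by (rule partial_has_derivative, rule bounded_linear.has_derivative[OF bounded_linear_vec_nth])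
    (simp add: frechet_derivative_works[symmetric])

lemma smooth_component:
  fixes F :: "real^7 \<Rightarrow> real^7"
  assumes S: "open S" and F: "smooth_on S F" shows "smooth_on S (\<lambda>x. F x $ a)"
proof -
  have "higher_differentiable_on S (\<lambda>x. F x $ a) n" if "higher_differentiable_on S F n" for n
    using that
  proof (induction n arbitrary: F)
    case 0 then show ?case by (auto intro: continuous_intros)
  next
    case (Suc n)
    have d: "((\<lambda>y. F y $ a) has_derivative (\<lambda>v. frechet_derivative F (at x) v $ a)) (at x)" if "x \<in> S" for x
      by (rule bounded_linear.has_derivative[OF bounded_linear_vec_nth]) (use Suc.prems that in \<open>simp add: frechet_derivative_works[symmetric]\<close>)
    have "higher_differentiable_on S (\<lambda>x. frechet_derivative (\<lambda>y. F y $ a) (at x) v) n" for v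
      by (subst hd_cong[OF S, where g = "\<lambda>x. frechet_derivative F (at x) v $ a"])
        (use frechet_derivative_at[OF d, symmetric] Suc in auto)
    then show ?case using d by (auto simp: differentiable_def)
  qed
  then show ?thesis using F by (simp add: smooth_on_def)
qed

lemma partial_chain:
  fixes F :: "real^7 \<Rightarrow> real^7"
  assumes F: "F differentiable (at x)" and g: "g differentiable (at (F x))"
  shows "partial i (\<lambda>y. g (F y)) x = (\<Sum>s\<in>UNIV. partial i (\<lambda>y. F y $ s) x * partial s g (F x))"
    and "(\<lambda>y. g (F y)) differentiable (at x)"
proof -
  let ?F' = "frechet_derivative F (at x)" and ?g' = "frechet_derivative g (at (F x))"
  have d: "((\<lambda>y. g (F y)) has_derivative (\<lambda>v. ?g' (?F' v))) (at x)"
    by (rule has_derivative_compose[of F _ x UNIV]) (use F g in \<open>simp_all add: frechet_derivative_works[symmetric]\<close>)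
  then show "(\<lambda>y. g (F y)) differentiable (at x)" by (auto simp: differentiable_def)
  have lin: "linear ?g'" by (rule linear_frechet_derivative[OF g])
  have e: "v = (\<Sum>s\<in>UNIV. v $ s *\<^sub>R axis s 1)" for v :: "real^7"
    by (simp add: vec_eq_iff axis_def if_distrib[of "(*) _"] cong: if_cong)
  have "partial i (\<lambda>y. g (F y)) x = ?g' (?F' (axis i 1))" by (rule partial_has_derivative[OF d])
  also have "\<dots> = ?g' (\<Sum>s\<in>UNIV. ?F' (axis i 1) $ s *\<^sub>R axis s 1)" by (subst e[of "?F' (axis i 1)"]) (rule refl)
  also have "\<dots> = (\<Sum>s\<in>UNIV. ?F' (axis i 1) $ s * ?g' (axis s 1))"
    by (simp add: linear_sum[OF lin] linear_scale[OF lin])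
  finally show "partial i (\<lambda>y. g (F y)) x = (\<Sum>s\<in>UNIV. partial i (\<lambda>y. F y $ s) x * partial s g (F x))"
    unfolding partial_component[OF F] by (simp add: partial_def)
qed

text \<open>A local diffeomorphism between open sets that pulls one field of 3-forms back to another, as
  the transition maps of an atlas do; no injectivity is assumed.\<close>

locale g2_map =
  src: g2_field S w + tgt: g2_field S' w' for S w S' w' +
  fixes F :: "real^7 \<Rightarrow> real^7"
  assumes F: "smooth_on S F" and maps: "\<And>x. x \<in> S \<Longrightarrow> F x \<in> S'"
    and pull: "\<And>x i j k. x \<in> S \<Longrightarrow> w x i j k = (\<Sum>a\<in>UNIV. \<Sum>b\<in>UNIV. \<Sum>e\<in>UNIV. partial i (\<lambda>y. F y $ a) x * partial j (\<lambda>y. F y $ b) x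
      * partial k (\<lambda>y. F y $ e) x * w' (F x) a b e)"
begin

definition J :: "real^7 \<Rightarrow> real^7^7" where
  "J x = (\<chi> a i. partial i (\<lambda>y. F y $ a) x)"

lemma w_pull: "x \<in> S \<Longrightarrow> w x = pull3 (J x) (w' (F x))"
  by (simp add: fun_eq_iff pull J_def pull3_def)

text \<open>A singular pull-back would be degenerate.\<close>

lemma det_J: assumes x: "x \<in> S" shows "det (J x) \<noteq> 0"
proof
  assume "det (J x) = 0"
  then have z: "contraction_wedge (w x) i j = 0" for i j unfolding w_pull[OF x] contraction_wedge_pull3 by simp
  have "det (\<chi> i j. contraction_wedge (w x) i j) = 0" using det_scale7[of 0 "mat 1"] by (simp add: z)
  then have "vol (w x) = 0" unfolding src.vol_root[OF x] by simp
  then show False using src.vol_nonzero[OF x] by simp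
qed

lemma frames:
  assumes x: "x \<in> S" and m: "model_frame (w' (F x)) \<Phi>"
  shows "model_frame (w x) (\<Phi> ** J x)"
  using m det_J[OF x] w_pull[OF x] by (simp add: model_frame_def det_mul pull3_pull3)

lemma frame_exists: assumes x: "x \<in> S" obtains \<Phi> where "model_frame (w' (F x)) \<Phi>"
  using tgt.frame_at[OF maps[OF x]] unfolding framed_def by blast

lemma vol_map: assumes x: "x \<in> S" shows "\<bar>vol (w x)\<bar> = \<bar>det (J x)\<bar> * \<bar>vol (w' (F x))\<bar>"
proof -
  obtain \<Phi> where m: "model_frame (w' (F x)) \<Phi>" by (rule frame_exists[OF x])
  show ?thesis unfolding vol_def model_frame_metric(3)[OF m] model_frame_metric(3)[OF frames[OF x m]]
    by (simp add: det_mul abs_mult)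
qed

definition K where "K x = matrix_inv (J x)"

lemma JK: "x \<in> S \<Longrightarrow> J x ** K x = mat 1" "x \<in> S \<Longrightarrow> K x ** J x = mat 1"
  unfolding K_def by (rule invertible_matrix_inv, erule det_J)+

lemma inv_frame:
  assumes x: "x \<in> S" and m: "model_frame (w' (F x)) \<Phi>"
  shows "matrix_inv (\<Phi> ** J x) = K x ** matrix_inv \<Phi>"
proof (rule matrix_inv_eqI)
  have d: "det \<Phi> \<noteq> 0" using m by (simp add: model_frame_def)
  have "(\<Phi> ** J x) ** (K x ** matrix_inv \<Phi>) = \<Phi> ** (J x ** K x) ** matrix_inv \<Phi>" by (simp only: matrix_mul_assoc)
  then show "(\<Phi> ** J x) ** (K x ** matrix_inv \<Phi>) = mat 1" by (simp add: JK[OF x] invertible_matrix_inv[OF d])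
qed

lemma raise_map: assumes x: "x \<in> S" shows "raise3 (w x) = pull3 (transpose (K x)) (raise3 (w' (F x)))"
proof -
  obtain \<Phi> where m: "model_frame (w' (F x)) \<Phi>" by (rule frame_exists[OF x])
  show ?thesis
    unfolding model_frame_raise3[OF m] model_frame_raise3[OF frames[OF x m]] inv_frame[OF x m]
    by (simp add: pull3_pull3 matrix_transpose_mul)
qed

lemma upper_map: assumes x: "x \<in> S"
  shows "matrix_inv (metric (w x)) = K x ** matrix_inv (metric (w' (F x))) ** transpose (K x)"
proof -
  obtain \<Phi> where m: "model_frame (w' (F x)) \<Phi>" by (rule frame_exists[OF x])
  show ?thesis
    unfolding model_frame_metric(4)[OF m] model_frame_metric(4)[OF frames[OF x m]] inv_frame[OF x m]
    by (simp add: matrix_transpose_mul matrix_mul_assoc)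
qed

lemma sF: "smooth_on S (\<lambda>y. F y $ a)" by (rule smooth_component[OF src.S F])

lemma ext_d_map:
  assumes x: "x \<in> S"
  shows "ext_d w x i b j k = (\<Sum>p\<in>UNIV. J x $ p $ i * pull3 (J x) (ext_d w' (F x) p) b j k)"
proof -
  let ?J = "\<lambda>a i y. partial i (\<lambda>y. F y $ a) y"
  define H where "H p i b = partial i (?J p b) x" for p i b
  have Hc: "H p i b = H p b i" for p i b unfolding H_def
    using partial_commute[OF src.S sF x, of i b p] by simp
  define A where "A i b j k = (\<Sum>p\<in>UNIV. \<Sum>q\<in>UNIV. \<Sum>r\<in>UNIV. H p i b * ?J q j x * ?J r k x * w' (F x) p q r)" for i b j k
  define M where "M i b j k = (\<Sum>s\<in>UNIV. ?J s i x * pull3 (J x) (\<lambda>p q r. partial s (\<lambda>z. w' z p q r) (F x)) b j k)" for i b j k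
  note sw = alternating3_swap[OF tgt.alt[OF maps[OF x]]]
  have A1: "A i b j k = A b i j k" for i b j k unfolding A_def using Hc by simp
  have A2: "A i b j k = - A i b k j" for i b j k
    unfolding A_def sum_negf[symmetric] by (rule sum.cong[OF refl], subst sum.swap, intro sum.cong refl, subst sw(2)) simp
  have p: "partial i (\<lambda>y. w y b j k) x = (A i b j k - A i j b k + A i k b j) + M i b j k" for i b j k
  proof -
    have dJ: "?J a c differentiable (at x)" for a c
      by (rule smooth_differentiable[OF src.S smooth_partial[OF src.S sF] x])
    have dF: "F differentiable (at x)" by (rule smooth_differentiable[OF src.S F x])
    have dw: "(\<lambda>z. w' z p q r) differentiable (at (F x))" for p q r by (rule tgt.diff_field(1)[OF maps[OF x]])
    note dwF = partial_chain(2)[OF dF dw] and pwF = partial_chain(1)[OF dF dw]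
    have t: "partial i (\<lambda>y. ?J p b y * ?J q j y * ?J r k y * w' (F y) p q r) x
      = H p i b * ?J q j x * ?J r k x * w' (F x) p q r + ?J p b x * H q i j * ?J r k x * w' (F x) p q r
       + ?J p b x * ?J q j x * H r i k * w' (F x) p q r + ?J p b x * ?J q j x * ?J r k x * (\<Sum>s\<in>UNIV. ?J s i x * partial s (\<lambda>z. w' z p q r) (F x))" for p q r
      by (simp add: partial_mult differentiable_mult dJ dwF pwF H_def algebra_simps)
    have "partial i (\<lambda>y. w y b j k) x = partial i (\<lambda>y. \<Sum>p\<in>UNIV. \<Sum>q\<in>UNIV. \<Sum>r\<in>UNIV. ?J p b y * ?J q j y * ?J r k y * w' (F y) p q r) x"
      by (rule partial_cong[OF src.S x pull]) (auto intro: src.diff_field x)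
    also have "\<dots> = (\<Sum>p\<in>UNIV. \<Sum>q\<in>UNIV. \<Sum>r\<in>UNIV. partial i (\<lambda>y. ?J p b y * ?J q j y * ?J r k y * w' (F y) p q r) x)"
      by (simp add: partial_sum differentiable_sum differentiable_mult dJ dwF)
    also have "\<dots> = A i b j k + (\<Sum>p\<in>UNIV. \<Sum>q\<in>UNIV. \<Sum>r\<in>UNIV. ?J p b x * H q i j * ?J r k x * w' (F x) p q r)
       + (\<Sum>p\<in>UNIV. \<Sum>q\<in>UNIV. \<Sum>r\<in>UNIV. ?J p b x * ?J q j x * H r i k * w' (F x) p q r)
       + (\<Sum>p\<in>UNIV. \<Sum>q\<in>UNIV. \<Sum>r\<in>UNIV. ?J p b x * ?J q j x * ?J r k x * (\<Sum>s\<in>UNIV. ?J s i x * partial s (\<lambda>z. w' z p q r) (F x)))"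
      unfolding t A_def by (simp only: sum.distrib)
    also have "(\<Sum>p\<in>UNIV. \<Sum>q\<in>UNIV. \<Sum>r\<in>UNIV. ?J p b x * H q i j * ?J r k x * w' (F x) p q r) = - A i j b k"
      unfolding A_def sum_negf[symmetric] by (subst sum.swap, intro sum.cong refl, subst sw(1)) simp
    also have "(\<Sum>p\<in>UNIV. \<Sum>q\<in>UNIV. \<Sum>r\<in>UNIV. ?J p b x * ?J q j x * H r i k * w' (F x) p q r) = A i k b j"
      unfolding A_def by (subst sum_rotate3, intro sum.cong refl, subst sw(2), subst sw(1)) simp
    also have "(\<Sum>p\<in>UNIV. \<Sum>q\<in>UNIV. \<Sum>r\<in>UNIV. ?J p b x * ?J q j x * ?J r k x * (\<Sum>s\<in>UNIV. ?J s i x * partial s (\<lambda>z. w' z p q r) (F x))) = M i b j k"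
    proof -
      have "(\<Sum>p\<in>UNIV. \<Sum>q\<in>UNIV. \<Sum>r\<in>UNIV. ?J p b x * ?J q j x * ?J r k x * (\<Sum>s\<in>UNIV. ?J s i x * partial s (\<lambda>z. w' z p q r) (F x)))
        = (\<Sum>p\<in>UNIV. \<Sum>q\<in>UNIV. \<Sum>r\<in>UNIV. \<Sum>s\<in>UNIV. ?J s i x * (?J p b x * ?J q j x * ?J r k x * partial s (\<lambda>z. w' z p q r) (F x)))"
        unfolding sum_distrib_left by (simp only: mult_ac)
      also have "\<dots> = (\<Sum>s\<in>UNIV. \<Sum>p\<in>UNIV. \<Sum>q\<in>UNIV. \<Sum>r\<in>UNIV. ?J s i x * (?J p b x * ?J q j x * ?J r k x * partial s (\<lambda>z. w' z p q r) (F x)))"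
        using sum_swap33[where A = "UNIV :: 7 set" and B = "UNIV :: 7 set" and C = "UNIV :: 7 set" and P = UNIV and Q = "{()}" and R = "{()}"
          and f = "\<lambda>p q r s (_::unit) (_::unit). ?J s i x * (?J p b x * ?J q j x * ?J r k x * partial s (\<lambda>z. w' z p q r) (F x))"] by simp
      finally show ?thesis unfolding M_def pull3_def J_def by (simp only: sum_distrib_left vec_lambda_beta)
    qed
    finally show ?thesis by simp
  qed
  have "ext_d w x i b j k = M i b j k - M b i j k - M j b i k - M k b j i"
    unfolding ext_d_def p using symmetric_part_cancels[of A i b j k, OF A1 A2] by linarith
  also have "\<dots> = (\<Sum>p\<in>UNIV. J x $ p $ i * pull3 (J x) (ext_d w' (F x) p) b j k)"
  proof -
    let ?D = "\<lambda>s p q r. partial s (\<lambda>z. w' z p q r) (F x)"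
    let ?c = "\<lambda>p q r s. J x $ p $ i * (J x $ q $ b * J x $ r $ j * J x $ s $ k)"
    have M: "M i b j k = (\<Sum>p\<in>UNIV. \<Sum>q\<in>UNIV. \<Sum>r\<in>UNIV. \<Sum>s\<in>UNIV. J x $ p $ i * (J x $ q $ b * J x $ r $ j * J x $ s $ k * ?D p q r s))" for i b j k
      unfolding M_def pull3_def by (simp add: sum_distrib_left J_def)
    have 1: "M i b j k = (\<Sum>p\<in>UNIV. \<Sum>q\<in>UNIV. \<Sum>r\<in>UNIV. \<Sum>s\<in>UNIV. ?c p q r s * ?D p q r s)"
      unfolding M by (simp only: mult_ac)
    have 2: "M b i j k = (\<Sum>p\<in>UNIV. \<Sum>q\<in>UNIV. \<Sum>r\<in>UNIV. \<Sum>s\<in>UNIV. ?c p q r s * ?D q p r s)"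
      unfolding M by (subst sum.swap) (simp only: mult_ac)
    have 3: "M j b i k = (\<Sum>p\<in>UNIV. \<Sum>q\<in>UNIV. \<Sum>r\<in>UNIV. \<Sum>s\<in>UNIV. ?c p q r s * ?D r q p s)"
    proof -
      have "M j b i k = (\<Sum>r\<in>UNIV. \<Sum>q\<in>UNIV. \<Sum>p\<in>UNIV. \<Sum>s\<in>UNIV. ?c p q r s * ?D r q p s)"
        unfolding M by (simp only: mult_ac)
      also have "\<dots> = (\<Sum>p\<in>UNIV. \<Sum>r\<in>UNIV. \<Sum>q\<in>UNIV. \<Sum>s\<in>UNIV. ?c p q r s * ?D r q p s)" by (rule sum_rotate3)
      also have "\<dots> = (\<Sum>p\<in>UNIV. \<Sum>q\<in>UNIV. \<Sum>r\<in>UNIV. \<Sum>s\<in>UNIV. ?c p q r s * ?D r q p s)"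
        by (rule sum.cong[OF refl], rule sum.swap)
      finally show ?thesis .
    qed
    have 4: "M k b j i = (\<Sum>p\<in>UNIV. \<Sum>q\<in>UNIV. \<Sum>r\<in>UNIV. \<Sum>s\<in>UNIV. ?c p q r s * ?D s q r p)"
    proof -
      have "M k b j i = (\<Sum>s\<in>UNIV. \<Sum>q\<in>UNIV. \<Sum>r\<in>UNIV. \<Sum>p\<in>UNIV. ?c p q r s * ?D s q r p)"
        unfolding M by (simp only: mult_ac)
      also have "\<dots> = (\<Sum>s\<in>UNIV. \<Sum>p\<in>UNIV. \<Sum>q\<in>UNIV. \<Sum>r\<in>UNIV. ?c p q r s * ?D s q r p)"
        by (rule sum.cong[OF refl], rule sum_rotate3)
      also have "\<dots> = (\<Sum>p\<in>UNIV. \<Sum>s\<in>UNIV. \<Sum>q\<in>UNIV. \<Sum>r\<in>UNIV. ?c p q r s * ?D s q r p)" by (rule sum.swap)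
      also have "\<dots> = (\<Sum>p\<in>UNIV. \<Sum>q\<in>UNIV. \<Sum>r\<in>UNIV. \<Sum>s\<in>UNIV. ?c p q r s * ?D s q r p)"
        by (rule sum.cong[OF refl], rule sum_rotate3[symmetric])
      finally show ?thesis .
    qed
    show ?thesis
      unfolding 1 2 3 4 pull3_def ext_d_def sum_distrib_left sum_subtractf[symmetric]
      by (intro sum.cong refl) (simp add: algebra_simps)
  qed
  finally show ?thesis .
qed

lemma Y_map: assumes x: "x \<in> S" shows "src.Y x i = (\<Sum>p\<in>UNIV. J x $ p $ i * tgt.Y (F x) p)"
proof -
  let ?r = "raise3 (w' (F x))"
  have "(\<Sum>b\<in>UNIV. \<Sum>j\<in>UNIV. \<Sum>k\<in>UNIV. raise3 (w x) b j k * ext_d w x i b j k)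
    = (\<Sum>b\<in>UNIV. \<Sum>j\<in>UNIV. \<Sum>k\<in>UNIV. \<Sum>p\<in>UNIV. J x $ p $ i * (raise3 (w x) b j k * pull3 (J x) (ext_d w' (F x) p) b j k))"
    unfolding ext_d_map[OF x] sum_distrib_left by (simp only: mult.left_commute)
  also have "\<dots> = (\<Sum>p\<in>UNIV. \<Sum>b\<in>UNIV. \<Sum>j\<in>UNIV. \<Sum>k\<in>UNIV. J x $ p $ i * (raise3 (w x) b j k * pull3 (J x) (ext_d w' (F x) p) b j k))"
    using sum_swap33[where A = "UNIV :: 7 set" and B = "UNIV :: 7 set" and C = "UNIV :: 7 set" and P = UNIV and Q = "{()}" and R = "{()}"
      and f = "\<lambda>b j k p (_::unit) (_::unit). J x $ p $ i * (raise3 (w x) b j k * pull3 (J x) (ext_d w' (F x) p) b j k)"] by simp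
  also have "\<dots> = (\<Sum>p\<in>UNIV. J x $ p $ i * (\<Sum>b\<in>UNIV. \<Sum>j\<in>UNIV. \<Sum>k\<in>UNIV. raise3 (w x) b j k * pull3 (J x) (ext_d w' (F x) p) b j k))"
    by (simp only: sum_distrib_left)
  also have "(\<lambda>p. \<Sum>b\<in>UNIV. \<Sum>j\<in>UNIV. \<Sum>k\<in>UNIV. raise3 (w x) b j k * pull3 (J x) (ext_d w' (F x) p) b j k)
    = (\<lambda>p. \<Sum>b\<in>UNIV. \<Sum>j\<in>UNIV. \<Sum>k\<in>UNIV. ?r b j k * ext_d w' (F x) p b j k)"
    unfolding raise_map[OF x] pull3_adjoint by (simp add: pull3_inverse[OF JK(1)[OF x]])
  finally have e: "(\<Sum>b\<in>UNIV. \<Sum>j\<in>UNIV. \<Sum>k\<in>UNIV. raise3 (w x) b j k * ext_d w x i b j k)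
    = (\<Sum>p\<in>UNIV. J x $ p $ i * (\<Sum>b\<in>UNIV. \<Sum>j\<in>UNIV. \<Sum>k\<in>UNIV. ?r b j k * ext_d w' (F x) p b j k))" .
  have "- (\<Sum>p\<in>UNIV. a p * c p) / 3 = (\<Sum>p\<in>UNIV. a p * (- c p / 3))" for a c :: "7 \<Rightarrow> real"
    by (simp add: sum_negf sum_divide_distrib)
  then show ?thesis unfolding src.Y_ext_d[OF x] tgt.Y_ext_d[OF maps[OF x]] e .
qed

theorem V_map: assumes x: "x \<in> S" shows "(\<Sum>a\<in>UNIV. J x $ q $ a * src.V x a) = tgt.V (F x) q"
proof -
  let ?y = "(\<chi> p. tgt.Y (F x) p) :: real^7"
  let ?g = "matrix_inv (metric (w' (F x)))"
  have e1: "(\<chi> i. src.Y x i) = transpose (J x) *v ?y"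
    by (simp add: vec_eq_iff Y_map[OF x] matrix_vector_mult_def transpose_def)
  have e2: "(\<chi> a. src.V x a) = matrix_inv (metric (w x)) *v (\<chi> i. src.Y x i)"
    by (simp add: vec_eq_iff src.V_def matrix_vector_mult_def upper_metric_def)
  have "J x *v (\<chi> a. src.V x a) = (J x ** (K x ** ?g ** transpose (K x)) ** transpose (J x)) *v ?y"
    unfolding e2 e1 upper_map[OF x] matrix_vector_mul_assoc matrix_mul_assoc ..
  also have "J x ** (K x ** ?g ** transpose (K x)) ** transpose (J x) = (J x ** K x) ** ?g ** transpose (J x ** K x)"
    by (simp only: matrix_mul_assoc matrix_transpose_mul)
  also have "\<dots> = ?g" by (simp add: JK[OF x] transpose_mat)
  finally have "(J x *v (\<chi> a. src.V x a)) $ q = (?g *v ?y) $ q" by simp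
  then show ?thesis by (simp add: matrix_vector_mult_def tgt.V_def upper_metric_def)
qed

end

section \<open>Integration of compactly supported functions\<close>

lemma hd_Un:
  assumes "open S" "open T" "higher_differentiable_on S f n" "higher_differentiable_on T f n"
  shows "higher_differentiable_on (S \<union> T) f n"
  using assms(3,4) by (induction n arbitrary: f) (auto intro: continuous_on_open_Un assms(1,2))

lemma hd_subset: "higher_differentiable_on S f n \<Longrightarrow> T \<subseteq> S \<Longrightarrow> higher_differentiable_on T f n"
  by (induction n arbitrary: f) (auto intro: continuous_on_subset)

lemma hd_zero_extension:
  fixes f :: "'a::real_normed_vector \<Rightarrow> 'b::real_normed_vector"
  assumes "open S" "closed K" "K \<subseteq> S" "higher_differentiable_on S f n" "\<And>x. x \<in> S \<Longrightarrow> x \<notin> K \<Longrightarrow> f x = 0"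
  shows "higher_differentiable_on UNIV (\<lambda>x. if x \<in> S then f x else 0) n"
proof -
  let ?g = "\<lambda>x. if x \<in> S then f x else 0"
  have "higher_differentiable_on S ?g n"
    by (subst hd_cong[OF assms(1), where g = f]) (use assms(4) in auto)
  moreover have "higher_differentiable_on (- K) ?g n"
    by (subst hd_cong[where g = "\<lambda>_. 0"]) (use assms(2,5) hd_const in auto)
  moreover have "S \<union> - K = UNIV" using assms(3) by auto
  ultimately show ?thesis using hd_Un[of S "- K" ?g n] assms(1,2) by (simp add: open_Compl)
qed

text \<open>Needed separately from the general chain rules above because the ramp function below is
  only once differentiable.\<close>

lemma hd1_compose:
  fixes f :: "'a::real_normed_vector \<Rightarrow> real"
  assumes S: "open S" and f: "higher_differentiable_on S f (Suc 0)"
    and h: "\<And>t. (h has_real_derivative h' t) (at t)" and h': "continuous_on UNIV h'"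
  shows "higher_differentiable_on S (\<lambda>x. h (f x)) (Suc 0)"
proof -
  have der: "((\<lambda>x. h (f x)) has_derivative (\<lambda>v. h' (f x) * frechet_derivative f (at x) v)) (at x)" if "x \<in> S" for x
  proof -
    have "(f has_derivative frechet_derivative f (at x)) (at x)"
      using f that by (auto simp: frechet_derivative_works[symmetric])
    moreover have "(h has_derivative (*) (h' (f x))) (at (f x))" using h by (simp add: has_field_derivative_def)
    ultimately show ?thesis using has_derivative_compose[of f _ x UNIV h] by blast
  qed
  have c: "continuous_on S f" using hd_Suc[OF f] by simp
  have "continuous_on S (\<lambda>x. frechet_derivative (\<lambda>x. h (f x)) (at x) v)" for v
  proof -
    have "continuous_on S (\<lambda>x. h' (f x) * frechet_derivative f (at x) v)"
      using f by (intro continuous_on_mult continuous_on_compose2[OF h' c]) auto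
    then show ?thesis by (rule continuous_on_eq) (simp add: frechet_derivative_at[OF der, symmetric])
  qed
  then show ?thesis using der by (auto simp: differentiable_def)
qed

text \<open>A \<open>C\<^sup>1\<close> function which is positive exactly on the positive half-line; composed with
  the difference of the squared radius and the squared distance it yields bump functions.\<close>

definition ramp :: "real \<Rightarrow> real" where "ramp t = t * \<bar>t\<bar> + t * t"

lemma ramp_nonneg: "0 \<le> ramp t" by (cases "t \<ge> 0") (auto simp: ramp_def)
lemma ramp_pos: "0 < t \<Longrightarrow> 0 < ramp t" by (simp add: ramp_def add_pos_pos)
lemma ramp_zero: "t \<le> 0 \<Longrightarrow> ramp t = 0" by (simp add: ramp_def)

lemma ramp_derivative: "(ramp has_real_derivative 2 * \<bar>t\<bar> + 2 * t) (at t)"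
proof -
  consider "t > 0" | "t < 0" | "t = 0" by linarith
  then show ?thesis
  proof cases
    case 1
    have "((\<lambda>t. 2 * t * t) has_real_derivative 2 * \<bar>t\<bar> + 2 * t) (at t)"
      using 1 by (auto intro!: derivative_eq_intros)
    then show ?thesis
      by (rule has_field_derivative_transform_within_open[where S = "{0<..}"]) (use 1 in \<open>auto simp: ramp_def\<close>)
  next
    case 2
    have "((\<lambda>t. 0) has_real_derivative 2 * \<bar>t\<bar> + 2 * t) (at t)"
      using 2 by (auto intro!: derivative_eq_intros)
    then show ?thesis
      by (rule has_field_derivative_transform_within_open[where S = "{..<0}"]) (use 2 in \<open>auto simp: ramp_def\<close>)
  next
    case 3
    have "((\<lambda>h. \<bar>h\<bar> + h) \<longlongrightarrow> 0) (at (0::real))"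
      using tendsto_add[OF tendsto_rabs[OF tendsto_ident_at] tendsto_ident_at, of 0 UNIV] by simp
    then have "((\<lambda>h. (ramp (0 + h) - ramp 0) / h) \<longlongrightarrow> 0) (at (0::real))"
      by (rule Lim_transform_eventually) (auto simp: eventually_at_filter ramp_def field_simps)
    then show ?thesis using 3 by (simp add: DERIV_def)
  qed
qed

lemma hd1_ramp:
  "open S \<Longrightarrow> higher_differentiable_on S f (Suc 0) \<Longrightarrow> higher_differentiable_on S (\<lambda>x. ramp (f x)) (Suc 0)"
  by (erule hd1_compose[OF _ _ ramp_derivative]) (auto intro!: continuous_intros)

lemma integrable_compact_support:
  fixes H :: "'a::euclidean_space \<Rightarrow> real"
  assumes "continuous_on UNIV H" "compact K" "\<And>x. x \<notin> K \<Longrightarrow> H x = 0"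
  shows "integrable lborel H"
proof -
  have "integrable lborel (\<lambda>x. indicator K x *\<^sub>R H x)"
    using assms(1,2) by (intro borel_integrable_compact) (auto intro: continuous_on_subset)
  moreover have "(\<lambda>x. indicator K x *\<^sub>R H x) = H" using assms(3) by (auto simp: fun_eq_iff indicator_def)
  ultimately show ?thesis by simp
qed

lemma nonneg_zero_integral:
  fixes H :: "'a::euclidean_space \<Rightarrow> real"
  assumes c: "continuous_on UNIV H" and i: "integrable lborel H" and n: "\<And>x. 0 \<le> H x"
    and z: "integral\<^sup>L lborel H = 0"
  shows "H x = 0"
proof -
  have "AE x in lborel. H x = 0" using integral_nonneg_eq_0_iff_AE[OF i] n z by simp
  then have "AE x in lebesgue. x \<in> {x. H x = 0}" by (simp add: AE_completion_iff)
  moreover have "closed {x. H x = 0}" using continuous_closed_vimage[of "{0}" H] c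
    by (simp add: vimage_def continuous_on_eq_continuous_within)
  ultimately show ?thesis using mem_closed_if_AE_lebesgue[of "{x. H x = 0}"] by blast
qed

text \<open>The integral of a difference quotient vanishes by translation invariance, and the
  difference quotients converge boundedly to the derivative.\<close>

lemma integral_partial_zero:
  fixes G :: "real^7 \<Rightarrow> real"
  assumes G: "higher_differentiable_on UNIV G (Suc 0)" and K: "compact K" and z: "\<And>x. x \<notin> K \<Longrightarrow> G x = 0"
  shows "integrable lborel (partial a G)" "integral\<^sup>L lborel (partial a G) = 0"
proof -
  let ?e = "axis a 1 :: real^7"
  have d: "G differentiable (at x)" for x using G by simp
  have cG: "continuous_on UNIV G" using hd_Suc[OF G] by simp
  have cP: "continuous_on UNIV (partial a G)" using G by (simp add: partial_def[abs_def])
  have Pz: "partial a G x = 0" if "x \<notin> K" for x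
    using partial_cong[of "- K" x G "\<lambda>_. 0" a] that z d K by (simp add: partial_const open_Compl compact_imp_closed)
  have iG: "integrable lborel G" by (rule integrable_compact_support[OF cG K z])
  show "integrable lborel (partial a G)" by (rule integrable_compact_support[OF cP K Pz])
  obtain R where R: "K \<subseteq> cball 0 R" using compact_imp_bounded[OF K] unfolding bounded_iff subset_eq mem_cball_0 by blast
  obtain B where B: "\<And>x. \<bar>partial a G x\<bar> \<le> B" and B0: "0 \<le> B"
  proof -
    have "bounded (partial a G ` K)" using cP K by (intro compact_imp_bounded compact_continuous_image) (auto intro: continuous_on_subset)
    then obtain B where B: "\<forall>x\<in>K. \<bar>partial a G x\<bar> \<le> B" by (auto simp: bounded_iff)
    have "\<bar>partial a G x\<bar> \<le> \<bar>B\<bar>" for x using B Pz[of x] by (cases "x \<in> K") force+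
    then show ?thesis using that[of "\<bar>B\<bar>"] by simp
  qed
  define t where "t n = inverse (real (Suc n))" for n
  have t: "t n > 0" "t n \<le> 1" for n by (auto simp: t_def inverse_le_1_iff)
  define D where "D n x = (G (x + t n *\<^sub>R ?e) - G x) / t n" for n x
  have shift: "integrable lborel (\<lambda>x. G (x + c))" "integral\<^sup>L lborel (\<lambda>x. G (x + c)) = integral\<^sup>L lborel G" for c
  proof -
    have m: "(+) c \<in> measurable lborel borel" by measurable
    have G': "G \<in> borel_measurable borel" using cG by (rule borel_measurable_continuous_onI)
    show "integral\<^sup>L lborel (\<lambda>x. G (x + c)) = integral\<^sup>L lborel G"
      using integral_distr[OF m G'] by (simp add: lborel_distr_plus add.commute)
    show "integrable lborel (\<lambda>x. G (x + c))"
      using integrable_distr_eq[OF m G'] iG by (simp add: lborel_distr_plus add.commute)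
  qed
  have D0: "integral\<^sup>L lborel (D n) = 0" for n
    unfolding D_def using shift iG by simp
  have mv: "\<bar>D n x\<bar> \<le> B" for n x
  proof -
    have "\<exists>z. z > 0 \<and> z < t n \<and> G (x + t n *\<^sub>R ?e) - G (x + 0 *\<^sub>R ?e) = (t n - 0) * partial a G (x + z *\<^sub>R ?e)"
      using MVT2[of 0 "t n" "\<lambda>s. G (x + s *\<^sub>R ?e)" "\<lambda>s. partial a G (x + s *\<^sub>R ?e)"] t(1)[of n] partial_DERIV[OF d] by blast
    then obtain z where "G (x + t n *\<^sub>R ?e) - G x = t n * partial a G (x + z *\<^sub>R ?e)" by auto
    then have "D n x = partial a G (x + z *\<^sub>R ?e)" using t(1)[of n] by (simp add: D_def)
    then show ?thesis using B by simp
  qed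
  have far: "D n x = 0" if "x \<notin> cball 0 (R + 1)" for n x
  proof -
    have "norm x \<le> norm (x + t n *\<^sub>R ?e) + norm (t n *\<^sub>R ?e)" using norm_triangle_ineq4[of "x + t n *\<^sub>R ?e" "t n *\<^sub>R ?e"] by simp
    moreover have "norm (t n *\<^sub>R ?e) \<le> 1" using t[of n] by simp
    ultimately have "x \<notin> K" "x + t n *\<^sub>R ?e \<notin> K" using that R by auto
    then show ?thesis by (simp add: D_def z)
  qed
  have "(\<lambda>n. integral\<^sup>L lborel (D n)) \<longlonglongrightarrow> integral\<^sup>L lborel (partial a G)"
  proof (rule integral_dominated_convergence[where w = "\<lambda>x. B * indicator (cball 0 (R + 1)) x"])
    show "partial a G \<in> borel_measurable lborel" using borel_measurable_continuous_onI[OF cP] by simp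
    show "D n \<in> borel_measurable lborel" for n
      unfolding D_def using borel_measurable_integrable[OF shift(1)] borel_measurable_integrable[OF iG] by measurable
    show "integrable lborel (\<lambda>x::real^7. B * indicator (cball 0 (R + 1)) x :: real)"
      using emeasure_compact_finite[of "cball (0::real^7) (R + 1)"] by (intro integrable_mult_right integrable_real_indicator) auto
    show "AE x in lborel. norm (D n x) \<le> B * indicator (cball 0 (R + 1)) x" for n
      using mv far by (auto simp: indicator_def)
    show "AE x in lborel. (\<lambda>n. D n x) \<longlonglongrightarrow> partial a G x"
    proof (rule AE_I2)
      fix x
      have "((\<lambda>s. G (x + s *\<^sub>R ?e)) has_real_derivative partial a G x) (at 0)" using partial_DERIV[of G x 0 a] d by simp
      then have "((\<lambda>h. (G (x + h *\<^sub>R ?e) - G x) / h) \<longlongrightarrow> partial a G x) (at 0)" by (simp add: DERIV_def)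
      moreover have "filterlim t (at 0) sequentially"
        using LIMSEQ_inverse_real_of_nat t(1) unfolding filterlim_at t_def by (auto intro!: eventuallyI)
      ultimately show "(\<lambda>n. D n x) \<longlonglongrightarrow> partial a G x" unfolding D_def by (rule filterlim_compose)
    qed
  qed
  then show "integral\<^sup>L lborel (partial a G) = 0" unfolding D0 by (simp add: LIMSEQ_const_iff)
qed

lemma lborel_change_of_variables:
  fixes F :: "real^7 \<Rightarrow> real^7" and f :: "real^7 \<Rightarrow> real"
  assumes S: "open S" "open (F ` S)" and inj: "inj_on F S" and F: "\<And>x. x \<in> S \<Longrightarrow> F differentiable (at x)"
    and g: "\<And>x. x \<in> S \<Longrightarrow> g x = \<bar>det (\<chi> a i. partial i (\<lambda>y. F y $ a) x)\<bar> * f (F x)"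
    and ig: "integrable lborel (\<lambda>x. if x \<in> S then g x else 0)"
    and ih: "integrable lborel (\<lambda>x. if x \<in> F ` S then f x else 0)"
  shows "integral\<^sup>L lborel (\<lambda>x. if x \<in> S then g x else 0) = integral\<^sup>L lborel (\<lambda>x. if x \<in> F ` S then f x else 0)"
proof -
  have HK: "h absolutely_integrable_on T" "(h has_integral integral\<^sup>L lborel (\<lambda>x. if x \<in> T then h x else 0)) T"
    if "integrable lborel (\<lambda>x. if x \<in> T then h x else 0)" for h :: "real^7 \<Rightarrow> real" and T
  proof -
    show "(h has_integral integral\<^sup>L lborel (\<lambda>x. if x \<in> T then h x else 0)) T"
      using has_integral_integral_lborel[OF that] by (simp add: has_integral_restrict_UNIV)
    have "integrable lebesgue (\<lambda>x. if x \<in> T then h x else 0)"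
      using that integrable_completion[of "\<lambda>x. if x \<in> T then h x else 0" lborel] borel_measurable_integrable[OF that] by simp
    then have "(\<lambda>x. if x \<in> T then h x else 0) absolutely_integrable_on UNIV" by (simp add: set_integrable_def)
    then show "h absolutely_integrable_on T" by (simp add: absolutely_integrable_restrict_UNIV)
  qed
  let ?F' = "\<lambda>x. frechet_derivative F (at x)"
  have m: "matrix (?F' x) = (\<chi> a i. partial i (\<lambda>y. F y $ a) x)" if "x \<in> S" for x
    by (simp add: vec_eq_iff matrix_def partial_component[OF F[OF that]])
  have der: "(F has_derivative ?F' x) (at x within S)" if "x \<in> S" for x
    using F[OF that] by (simp add: frechet_derivative_works has_derivative_at_withinI)
  let ?v = "\<lambda>h x. (\<chi> i. h x) :: real^1"
  have vec: "?v h absolutely_integrable_on T" "integral T (?v h) = ?v (\<lambda>_. integral T h) undefined"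
    if "h absolutely_integrable_on T" for h :: "real^7 \<Rightarrow> real" and T
  proof -
    show 1: "?v h absolutely_integrable_on T" using that by (simp add: absolutely_integrable_on_1_iff)
    show "integral T (?v h) = ?v (\<lambda>_. integral T h) undefined"
      using integral_component_eq_cart[OF set_lebesgue_integral_eq_integral(1)[OF 1], of 1, symmetric] by (simp add: vec_eq_iff)
  qed
  have e: "integral S (\<lambda>x. \<bar>det (matrix (?F' x))\<bar> *\<^sub>R ?v f (F x)) = integral S (?v g)"
    by (rule integral_cong) (simp add: vec_eq_iff g m)
  have "integral S (\<lambda>x. \<bar>det (matrix (?F' x))\<bar> *\<^sub>R ?v f (F x)) = integral (F ` S) (?v f)"
    using has_absolute_integral_change_of_variables[of S F ?F' "?v f" "integral (F ` S) (?v f)"] S inj der vec(1)[OF HK(1)[OF ih]]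
    by auto
  then have "?v (\<lambda>_. integral S g) undefined = ?v (\<lambda>_. integral (F ` S) f) undefined"
    unfolding e vec(2)[OF HK(1)[OF ig]] vec(2)[OF HK(1)[OF ih]] .
  then have "integral S g = integral (F ` S) f" by (simp add: vec_eq_iff)
  then show ?thesis using integral_unique[OF HK(2)[OF ig]] integral_unique[OF HK(2)[OF ih]] by simp
qed

section \<open>The divergence theorem on a compact manifold\<close>

locale g2_manifold =
  fixes M :: "'a topology" and A :: "'a chart set" and \<phi> :: "'a chart \<Rightarrow> real^7 \<Rightarrow> tensor3"
  assumes manifold: "smooth_7_manifold M A" and compact_manifold: "compact_space M" and g2_structure: "G2_structure A \<phi>"
begin

definition point :: "'a chart \<Rightarrow> real^7 \<Rightarrow> 'a" where "point c = inv_into (fst c) (snd c)"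

context
  fixes c assumes c: "c \<in> A"
begin

lemma chart: "openin M (fst c)" "open (chart_image c)"
    "homeomorphic_map (subtopology M (fst c)) (top_of_set (chart_image c)) (snd c)"
  using manifold c by (auto simp: smooth_7_manifold_def is_chart_def)

lemma domain_space: "topspace (subtopology M (fst c)) = fst c"
  using openin_subset[OF chart(1)] by auto

lemma chart_inj: "inj_on (snd c) (fst c)"
  using chart(3) unfolding homeomorphic_eq_everything_map domain_space by blast

lemma point_chart: "q \<in> fst c \<Longrightarrow> point c (snd c q) = q"
  unfolding point_def by (rule inv_into_f_f[OF chart_inj])

lemma chart_point: "x \<in> chart_image c \<Longrightarrow> point c x \<in> fst c" "x \<in> chart_image c \<Longrightarrow> snd c (point c x) = x"
  unfolding point_def chart_image_def by (auto intro: inv_into_into f_inv_into_f)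

lemma chart_in_image: "q \<in> fst c \<Longrightarrow> snd c q \<in> chart_image c"
  by (simp add: chart_image_def)

lemma point_space: "x \<in> chart_image c \<Longrightarrow> point c x \<in> topspace M"
  using chart_point(1) openin_subset[OF chart(1)] by blast

lemma open_chart_image: assumes "openin M U" shows "open (snd c ` (fst c \<inter> U))"
proof -
  have "openin (subtopology M (fst c)) (fst c \<inter> U)" using assms by (auto simp: openin_subtopology)
  then have "openin (top_of_set (chart_image c)) (snd c ` (fst c \<inter> U))"
    using homeomorphic_imp_open_map[OF chart(3)] by (simp add: open_map_def)
  then show ?thesis using chart(2) by (simp add: openin_open_eq)
qed

lemma open_chart_preimage: assumes "open T" shows "openin M {q \<in> fst c. snd c q \<in> T}"
proof -
  have "continuous_map (subtopology M (fst c)) euclidean (snd c)"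
    using homeomorphic_imp_continuous_map[OF chart(3)] by (simp add: continuous_map_in_subtopology)
  then have "openin (subtopology M (fst c)) {q \<in> fst c. snd c q \<in> T}"
    using openin_continuous_map_preimage[of _ euclidean "snd c" T] assms domain_space by fastforce
  then show ?thesis using openin_trans_full chart(1) by blast
qed

lemma closed_chart_preimage:
  assumes "compact K" "K \<subseteq> chart_image c"
  shows "closedin M {q \<in> fst c. snd c q \<in> K}" "snd c ` {q \<in> fst c. snd c q \<in> K} = K"
proof -
  show e: "snd c ` {q \<in> fst c. snd c q \<in> K} = K" using assms(2) by (auto simp: chart_image_def)
  have "compactin (top_of_set (chart_image c)) K" using assms by (simp add: compactin_subtopology)
  then have "compactin (subtopology M (fst c)) {q \<in> fst c. snd c q \<in> K}"
    using homeomorphic_map_compactness_eq[OF chart(3), of "{q \<in> fst c. snd c q \<in> K}"] e domain_space by auto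
  then have "compactin M {q \<in> fst c. snd c q \<in> K}" by (simp add: compactin_subtopology)
  then show "closedin M {q \<in> fst c. snd c q \<in> K}"
    using manifold compactin_imp_closedin unfolding smooth_7_manifold_def by blast
qed

lemma field: "g2_field (chart_image c) (\<phi> c)"
  using g2_structure c chart(2) unfolding G2_structure_def smooth_3_form_def by unfold_locales auto

end

lemma overlap_iff: "c \<in> A \<Longrightarrow> x \<in> overlap c d \<longleftrightarrow> x \<in> chart_image c \<and> point c x \<in> fst d"
  using chart_point[of c x] point_chart[of c] unfolding overlap_def chart_image_def by force

lemma transition_point: "transition c d x = snd d (point c x)"
  by (simp add: transition_def point_def)

context
  fixes c d assumes c: "c \<in> A" and d: "d \<in> A"
begin

lemma overlap_open: "open (overlap c d)"
  unfolding overlap_def by (rule open_chart_image[OF c chart(1)[OF d]])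

lemma point_transition: "x \<in> overlap c d \<Longrightarrow> point d (transition c d x) = point c x"
  using point_chart[OF d] by (simp add: overlap_iff[OF c] transition_point)

lemma transition_in: "x \<in> overlap c d \<Longrightarrow> transition c d x \<in> overlap d c"
  using point_transition[of x] chart_in_image[OF d] chart_point[OF c]
  by (auto simp: overlap_iff[OF c] overlap_iff[OF d] transition_point)

lemma transition_inverse: "x \<in> overlap c d \<Longrightarrow> transition d c (transition c d x) = x"
  unfolding transition_point[of d c] by (simp add: point_transition overlap_iff[OF c] chart_point[OF c])

lemma transition_smooth: "smooth_on (overlap c d) (transition c d)"
  using manifold c d by (simp add: smooth_7_manifold_def)

lemma transition_g2_map: "g2_map (overlap c d) (\<phi> c) (chart_image d) (\<phi> d) (transition c d)"
proof -
  have sub: "overlap c d \<subseteq> chart_image c" by (auto simp: overlap_iff[OF c])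
  interpret c: g2_field "chart_image c" "\<phi> c" by (rule field[OF c])
  have sm: "smooth_on (overlap c d) (\<lambda>x. \<phi> c x i j k)" for i j k
    unfolding smooth_on_def by (rule allI, rule hd_subset[OF _ sub]) (use c.smooth[of i j k] in \<open>simp add: smooth_on_def\<close>)
  interpret o: g2_field "overlap c d" "\<phi> c"
    by unfold_locales (use sm c.alt c.nondeg sub overlap_open in auto)
  interpret d: g2_field "chart_image d" "\<phi> d" by (rule field[OF d])
  have "\<phi> c x i j k = (\<Sum>a\<in>UNIV. \<Sum>b\<in>UNIV. \<Sum>e\<in>UNIV. jacobian c d x a i * jacobian c d x b j * jacobian c d x e k * \<phi> d (transition c d x) a b e)"
    if "x \<in> overlap c d" for x i j k
  proof -
    have "smooth_3_form A \<phi>" using g2_structure by (simp add: G2_structure_def)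
    then have "\<forall>c\<in>A. \<forall>d\<in>A. \<forall>x\<in>overlap c d. \<forall>i j k. \<phi> c x i j k = (\<Sum>a\<in>UNIV. \<Sum>b\<in>UNIV. \<Sum>e\<in>UNIV.
        jacobian c d x a i * jacobian c d x b j * jacobian c d x e k * \<phi> d (transition c d x) a b e)"
      unfolding smooth_3_form_def by (elim conjE)
    from this[rule_format, OF c d that] show ?thesis .
  qed
  then have pl: "\<phi> c x i j k = (\<Sum>a\<in>UNIV. \<Sum>b\<in>UNIV. \<Sum>e\<in>UNIV. partial i (\<lambda>y. transition c d y $ a) x
      * partial j (\<lambda>y. transition c d y $ b) x * partial k (\<lambda>y. transition c d y $ e) x * \<phi> d (transition c d x) a b e)"
    if "x \<in> overlap c d" for x i j k
    using that unfolding jacobian_def by blast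
  have tin: "transition c d x \<in> chart_image d" if "x \<in> overlap c d" for x
    using transition_in[OF that] by (simp add: overlap_iff[OF d])
  show ?thesis by unfold_locales (fact transition_smooth, fact tin, fact pl)
qed

end

lemma transition_image: "c \<in> A \<Longrightarrow> d \<in> A \<Longrightarrow> transition c d ` overlap c d = overlap d c"
proof -
  assume c: "c \<in> A" and d: "d \<in> A"
  have "x \<in> transition c d ` overlap c d" if "x \<in> overlap d c" for x
    using imageI[OF transition_in[OF d c that], of "transition c d"] by (simp only: transition_inverse[OF d c that])
  moreover have "transition c d ` overlap c d \<subseteq> overlap d c" by (rule image_subsetI) (rule transition_in[OF c d])
  ultimately show ?thesis by blast
qed

lemma transition_inj: "c \<in> A \<Longrightarrow> d \<in> A \<Longrightarrow> inj_on (transition c d) (overlap c d)"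
  by (rule inj_on_inverseI) (rule transition_inverse)

definition C1 :: "('a \<Rightarrow> real) \<Rightarrow> bool" where
  "C1 f \<longleftrightarrow> (\<forall>d\<in>A. higher_differentiable_on (chart_image d) (\<lambda>x. f (point d x)) (Suc 0))"

lemma C1_diff: "C1 f \<Longrightarrow> d \<in> A \<Longrightarrow> x \<in> chart_image d \<Longrightarrow> (\<lambda>x. f (point d x)) differentiable (at x)"
  by (simp add: C1_def)

lemma C1_hd: "C1 f \<Longrightarrow> d \<in> A \<Longrightarrow> higher_differentiable_on (chart_image d) (\<lambda>x. f (point d x)) (Suc 0)"
  by (simp add: C1_def)

definition supported :: "'a chart \<Rightarrow> ('a \<Rightarrow> real) \<Rightarrow> 'a set \<Rightarrow> bool" where
  "supported c f C \<longleftrightarrow> C1 f \<and> closedin M C \<and> C \<subseteq> fst c \<and> compact (snd c ` C) \<and> (\<forall>q. q \<notin> C \<longrightarrow> f q = 0)"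

lemma bump_exists:
  assumes c: "c \<in> A" and p: "p \<in> fst c"
  obtains f C where "supported c f C" "\<And>q. 0 \<le> f q" "0 < f p" "openin M {q. 0 < f q}"
proof -
  let ?y = "snd c p"
  obtain r where r: "r > 0" "cball ?y r \<subseteq> chart_image c"
    using chart(2)[OF c] chart_in_image[OF c p] open_contains_cball by metis
  define C where "C = {q \<in> fst c. snd c q \<in> cball ?y r}"
  define u where "u z = r * r - (\<Sum>a\<in>UNIV. (z $ a - ?y $ a) * (z $ a - ?y $ a))" for z :: "real^7"
  define f where "f q = (if q \<in> fst c then ramp (u (snd c q)) else 0)" for q
  have u_dist: "u z = r\<^sup>2 - (dist ?y z)\<^sup>2" for z
    by (simp add: u_def dist_norm norm_vec_def L2_set_def sum_nonneg power2_eq_square[symmetric] power2_commute)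
  have u0: "u z \<le> 0" if "z \<notin> cball ?y r" for z
    using that r(1) power_mono[of r "dist ?y z" 2] by (simp add: u_dist)
  have upos: "0 < u z \<longleftrightarrow> z \<in> ball ?y r" for z
    using r(1) power_mono_iff[of r "dist ?y z" 2] by (simp add: u_dist not_le[symmetric])
  have fz: "f q = 0" if "q \<notin> C" for q using that u0 by (auto simp: f_def C_def ramp_zero)
  have hu: "higher_differentiable_on S (\<lambda>x. ramp (u (T x))) (Suc 0)" if S: "open S" and T: "smooth_on S T" for S and T :: "real^7 \<Rightarrow> real^7"
  proof (rule hd1_ramp[OF S])
    have "smooth_on S (\<lambda>x. u (T x))" unfolding u_def by (intro smooth_intros S smooth_component[OF S T])
    then show "higher_differentiable_on S (\<lambda>x. u (T x)) (Suc 0)" by (simp only: smooth_on_def)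
  qed
  have "C1 f" unfolding C1_def
  proof
    fix d assume d: "d \<in> A"
    let ?f = "\<lambda>x. f (point d x)" and ?D = "snd d ` (fst d \<inter> (topspace M - C))"
    have cl: "closedin M C" unfolding C_def by (rule closed_chart_preimage[OF c _ r(2)]) simp
    have oD: "open ?D" using cl by (intro open_chart_image[OF d]) (simp add: openin_diff)
    have pD: "point d x \<notin> C" if "x \<in> ?D" for x using that point_chart[OF d] by auto
    have "higher_differentiable_on (overlap d c) ?f (Suc 0)"
    proof (subst hd_cong[OF overlap_open[OF d c], where g = "\<lambda>x. ramp (u (transition d c x))"])
      show "?f x = ramp (u (transition d c x))" if "x \<in> overlap d c" for x
        using that by (simp add: overlap_iff[OF d] f_def transition_point)
    qed (rule hu[OF overlap_open[OF d c] transition_smooth[OF d c]])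
    moreover have "higher_differentiable_on ?D ?f (Suc 0)"
      by (subst hd_cong[OF oD, where g = "\<lambda>_. 0"]) (use pD fz hd_const in auto)
    moreover have "overlap d c \<union> ?D = chart_image d"
    proof -
      have "fst d \<subseteq> topspace M" by (rule openin_subset[OF chart(1)[OF d]])
      then show ?thesis unfolding overlap_def chart_image_def C_def by auto
    qed
    ultimately show "higher_differentiable_on (chart_image d) ?f (Suc 0)"
      using hd_Un[OF overlap_open[OF d c] oD] by metis
  qed
  then have "supported c f C"
    using closed_chart_preimage[OF c compact_cball r(2)] fz unfolding supported_def C_def by auto
  moreover have "0 < f p" using p r(1) upos[of ?y] by (simp add: f_def ramp_pos)
  moreover have "{q. 0 < f q} = {q \<in> fst c. snd c q \<in> ball ?y r}"
  proof -
    have "0 < ramp t \<longleftrightarrow> 0 < t" for t using ramp_pos[of t] ramp_zero[of t] by (cases "0 < t") auto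
    then show ?thesis unfolding f_def upos[symmetric] by auto
  qed
  then have "openin M {q. 0 < f q}" using open_chart_preimage[OF c open_ball, of ?y r] by simp
  ultimately show ?thesis using that[of f C] ramp_nonneg by (simp add: f_def)
qed

end

lemma (in g2_manifold) partition_of_unity:
  assumes c0: "c0 \<in> A" and p0: "p0 \<in> fst c0"
  obtains I :: "'a set" and ch R C where "finite I" "p0 \<in> I" "ch p0 = c0" "\<And>p. p \<in> I \<Longrightarrow> ch p \<in> A" "\<And>p. p \<in> I \<Longrightarrow> supported (ch p) (R p) (C p)"
    "\<And>p q. p \<in> I \<Longrightarrow> q \<in> topspace M \<Longrightarrow> 0 \<le> R p q" "0 < R p0 p0" "\<And>q. q \<in> topspace M \<Longrightarrow> (\<Sum>p\<in>I. R p q) = 1"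
proof -
  have p0M: "p0 \<in> topspace M" using openin_subset[OF chart(1)[OF c0]] p0 by blast
  have "\<forall>p\<in>topspace M. \<exists>c. c \<in> A \<and> p \<in> fst c"
    using manifold unfolding smooth_7_manifold_def by blast
  then obtain c' where c': "\<forall>p\<in>topspace M. c' p \<in> A \<and> p \<in> fst (c' p)" by (rule bchoice[THEN exE])
  define ch where "ch p = (if p = p0 then c0 else c' p)" for p
  have ch: "ch p \<in> A" "p \<in> fst (ch p)" if "p \<in> topspace M" for p using c' c0 p0 that by (auto simp: ch_def)
  have "\<forall>p\<in>topspace M. \<exists>z. supported (ch p) (fst z) (snd z) \<and> (\<forall>q. 0 \<le> fst z q) \<and> 0 < fst z p \<and> openin M {q. 0 < fst z q}"
  proof
    fix p assume p: "p \<in> topspace M"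
    show "\<exists>z. supported (ch p) (fst z) (snd z) \<and> (\<forall>q. 0 \<le> fst z q) \<and> 0 < fst z p \<and> openin M {q. 0 < fst z q}"
    proof (rule bump_exists[OF ch[OF p]])
      fix f C assume "supported (ch p) f C" "\<And>q. 0 \<le> f q" "0 < f p" "openin M {q. 0 < f q}"
      then show ?thesis by (intro exI[of _ "(f, C)"]) auto
    qed
  qed
  then obtain z where z: "\<forall>p\<in>topspace M. supported (ch p) (fst (z p)) (snd (z p)) \<and> (\<forall>q. 0 \<le> fst (z p) q) \<and> 0 < fst (z p) p \<and> openin M {q. 0 < fst (z p) q}"
    by (rule bchoice[THEN exE])
  define b where "b p = fst (z p)" for p
  define C where "C p = snd (z p)" for p
  have b: "supported (ch p) (b p) (C p)" "0 \<le> b p q" "0 < b p p" "openin M {q. 0 < b p q}" if "p \<in> topspace M" for p q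
    using z that by (auto simp: b_def C_def)
  have "\<exists>I0. finite I0 \<and> I0 \<subseteq> topspace M \<and> topspace M \<subseteq> (\<Union>p\<in>I0. {q. 0 < b p q})"
  proof -
    let ?U = "(\<lambda>p. {q. 0 < b p q}) ` topspace M"
    have U: "\<Union>?U = topspace M"
    proof
      show "\<Union>?U \<subseteq> topspace M" using openin_subset[OF b(4)] by blast
      show "topspace M \<subseteq> \<Union>?U" using b(3) by blast
    qed
    have o: "openin M U" if "U \<in> ?U" for U using that b(4) by blast
    have "\<exists>F. finite F \<and> F \<subseteq> ?U \<and> topspace M \<subseteq> \<Union>F"
      using compact_manifold[unfolded compact_space_alt, rule_format, of ?U] o U by simp
    then obtain F where F: "finite F" "F \<subseteq> ?U" "topspace M \<subseteq> \<Union>F" by (elim exE conjE) (rule that; assumption)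
    obtain I0 where "I0 \<subseteq> topspace M" "finite I0" "F = (\<lambda>p. {q. 0 < b p q}) ` I0"
      using finite_subset_image[OF F(1,2)] by (elim exE conjE) (rule that; assumption)
    then show ?thesis using F(3) by (intro exI[of _ I0]) simp
  qed
  then obtain I0 where I0: "finite I0" "I0 \<subseteq> topspace M" "topspace M \<subseteq> (\<Union>p\<in>I0. {q. 0 < b p q})"
    by (elim exE conjE) (rule that; assumption)
  define I where "I = insert p0 I0"
  have I: "finite I" "p0 \<in> I" "I \<subseteq> topspace M" using I0 p0M by (auto simp: I_def)
  define N where "N q = (\<Sum>p\<in>I. b p q)" for q
  have N: "0 < N q" if q: "q \<in> topspace M" for q
  proof -
    obtain p where "p \<in> I0" "0 < b p q" using subsetD[OF I0(3) q] by auto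
    then have "p \<in> I" "0 < b p q" by (auto simp: I_def)
    then show ?thesis unfolding N_def using I b(2) by (intro sum_pos2[of I p]) auto
  qed
  define R where "R p q = b p q * inverse (N q)" for p q
  have C1R: "C1 (R p)" if "p \<in> I" for p unfolding C1_def
  proof
    fix d assume d: "d \<in> A"
    have bd: "higher_differentiable_on (chart_image d) (\<lambda>x. b p (point d x)) (Suc 0)" if "p \<in> I" for p
      using b(1)[of p] I(3) that d unfolding supported_def C1_def by blast
    have "higher_differentiable_on (chart_image d) (\<lambda>x. N (point d x)) (Suc 0)"
      unfolding N_def by (rule hd_sum[OF chart(2)[OF d] bd])
    then have "higher_differentiable_on (chart_image d) (\<lambda>x. inverse (N (point d x))) (Suc 0)"
      by (rule hd_inverse[OF chart(2)[OF d]]) (use N[OF point_space[OF d]] in force)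
    then show "higher_differentiable_on (chart_image d) (\<lambda>x. R p (point d x)) (Suc 0)"
      unfolding R_def by (rule hd_mult[OF chart(2)[OF d] bd[OF that]])
  qed
  show ?thesis
  proof (rule that[of I ch R C])
    show "supported (ch p) (R p) (C p)" if "p \<in> I" for p
      using b(1)[of p] I(3) that C1R[OF that] unfolding supported_def by (auto simp: R_def)
    show "0 \<le> R p q" if "p \<in> I" "q \<in> topspace M" for p q using b(2)[of p q] N[OF that(2)] that I(3) by (auto simp: R_def)
    show "0 < R p0 p0" using b(3)[OF p0M] N[OF p0M] by (simp add: R_def)
    show "(\<Sum>p\<in>I. R p q) = 1" if "q \<in> topspace M" for q
      unfolding R_def sum_distrib_right[symmetric] N_def[symmetric] using N[OF that] by simp
    show "ch p0 = c0" by (simp add: ch_def)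
    show "ch p \<in> A" if "p \<in> I" for p using ch(1) I(3) that by blast
  qed (rule I)+
qed

context g2_manifold begin

definition W :: "'a chart \<Rightarrow> real^7 \<Rightarrow> 7 \<Rightarrow> real" where
  "W c x a = \<bar>vol (\<phi> c x)\<bar> * g2_field.V (\<phi> c) x a"

definition divergence :: "'a chart \<Rightarrow> real^7 \<Rightarrow> real" where
  "divergence c x = (\<Sum>a\<in>UNIV. partial a (\<lambda>y. W c y a) x)"

definition flux :: "'a chart \<Rightarrow> ('a \<Rightarrow> real) \<Rightarrow> ('a \<Rightarrow> real) \<Rightarrow> real^7 \<Rightarrow> real" where
  "flux c f g x = (\<Sum>a\<in>UNIV. W c x a * partial a (\<lambda>y. f (point c y)) x) * g (point c x)"

definition extension :: "'a chart \<Rightarrow> (real^7 \<Rightarrow> real) \<Rightarrow> real^7 \<Rightarrow> real" where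
  "extension c h x = (if x \<in> chart_image c then h x else 0)"

abbreviation chart_integral :: "'a chart \<Rightarrow> (real^7 \<Rightarrow> real) \<Rightarrow> real" where
  "chart_integral c h \<equiv> integral\<^sup>L lborel (extension c h)"

lemma W_smooth: assumes c: "c \<in> A" shows "smooth_on (chart_image c) (\<lambda>x. W c x a)"
proof -
  interpret c: g2_field "chart_image c" "\<phi> c" by (rule field[OF c])
  show ?thesis unfolding W_def by (rule smooth_mult[OF c.S c.smooth_abs_vol c.smooth_V])
qed

lemma flux_transition:
  assumes c: "c \<in> A" and d: "d \<in> A" and f: "C1 f" and x: "x \<in> overlap c d"
  shows "flux c f g x = \<bar>det (\<chi> a i. partial i (\<lambda>y. transition c d y $ a) x)\<bar> * flux d f g (transition c d x)"
proof -
  interpret m: g2_map "overlap c d" "\<phi> c" "chart_image d" "\<phi> d" "transition c d" by (rule transition_g2_map[OF c d])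
  let ?T = "transition c d"
  let ?P = "\<lambda>s. partial s (\<lambda>y. f (point d y)) (?T x)"
  have xc: "x \<in> chart_image c" and Tx: "?T x \<in> chart_image d" using x m.maps by (auto simp: overlap_iff[OF c])
  have p: "partial a (\<lambda>y. f (point c y)) x = (\<Sum>s\<in>UNIV. m.J x $ s $ a * ?P s)" for a
  proof -
    have "partial a (\<lambda>y. f (point c y)) x = partial a (\<lambda>y. f (point d (?T y))) x"
      by (rule partial_cong[OF overlap_open[OF c d] x]) (simp_all add: point_transition[OF c d] C1_diff[OF f c xc])
    also have "\<dots> = (\<Sum>s\<in>UNIV. partial a (\<lambda>y. ?T y $ s) x * ?P s)"
      by (rule partial_chain(1)[OF smooth_differentiable[OF m.src.S m.F x] C1_diff[OF f d Tx]])
    finally show ?thesis by (simp add: m.J_def)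
  qed
  have "(\<Sum>a\<in>UNIV. m.src.V x a * partial a (\<lambda>y. f (point c y)) x) = (\<Sum>a\<in>UNIV. \<Sum>s\<in>UNIV. m.J x $ s $ a * m.src.V x a * ?P s)"
    unfolding p sum_distrib_left by (simp only: mult_ac)
  also have "\<dots> = (\<Sum>s\<in>UNIV. (\<Sum>a\<in>UNIV. m.J x $ s $ a * m.src.V x a) * ?P s)"
    unfolding sum_distrib_right by (rule sum.swap)
  also have "\<dots> = (\<Sum>s\<in>UNIV. m.tgt.V (?T x) s * ?P s)" unfolding m.V_map[OF x] ..
  finally have "(\<Sum>a\<in>UNIV. W c x a * partial a (\<lambda>y. f (point c y)) x) = \<bar>det (m.J x)\<bar> * (\<Sum>s\<in>UNIV. W d (?T x) s * ?P s)"
    unfolding W_def m.vol_map[OF x] mult.assoc sum_distrib_left[symmetric] by simp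
  then show ?thesis unfolding flux_def point_transition[OF c d x] m.J_def by simp
qed

text \<open>A function may vanish off a closed set without being supported in the chart at hand; this covers both the chart
  of the support and every other chart.\<close>

lemma C1_partial_off_support:
  assumes c: "c \<in> A" and f: "C1 f" and C: "closedin M C" "\<And>q. q \<notin> C \<Longrightarrow> f q = 0"
    and x: "x \<in> chart_image c" "point c x \<notin> C"
  shows "partial a (\<lambda>y. f (point c y)) x = 0"
proof -
  let ?D = "snd c ` (fst c \<inter> (topspace M - C))"
  have D: "open ?D" using C(1) by (intro open_chart_image[OF c]) (simp add: openin_diff)
  have xD: "x \<in> ?D"
    using x chart_point[OF c x(1)] point_space[OF c x(1)] by (intro image_eqI[of _ _ "point c x"]) simp_all
  have z: "f (point c y) = 0" if "y \<in> ?D" for y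
  proof -
    from that obtain q where "q \<in> fst c" "q \<notin> C" "y = snd c q" by (elim imageE IntE DiffE) simp
    then show ?thesis using point_chart[OF c] C(2) by simp
  qed
  have "partial a (\<lambda>y. f (point c y)) x = partial a (\<lambda>_. 0) x"
    by (rule partial_cong[OF D xD z C1_diff[OF f c x(1)]])
  then show ?thesis by (simp add: partial_const)
qed

lemma flux_zero:
  assumes c: "c \<in> A" and f: "supported c' f C" and x: "x \<in> chart_image c" "point c x \<notin> C"
  shows "flux c f g x = 0"
  using C1_partial_off_support[OF c _ _ _ x, of f] f by (simp add: flux_def supported_def)

lemma flux_continuous:
  assumes c: "c \<in> A" and f: "C1 f" and g: "C1 g"
  shows "continuous_on (chart_image c) (flux c f g)"
proof -
  have "continuous_on (chart_image c) (partial a (\<lambda>y. f (point c y)))" for a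
    using C1_hd[OF f c] by (simp add: partial_def[abs_def])
  moreover have "continuous_on (chart_image c) (\<lambda>x. g (point c x))" using hd_Suc[OF C1_hd[OF g c]] by simp
  ultimately show ?thesis
    unfolding flux_def[abs_def] using smooth_continuous[OF chart(2)[OF c] W_smooth[OF c]] by (intro continuous_intros)
qed

lemma supported_image:
  assumes c: "c \<in> A" and f: "supported c f C"
  shows "compact (snd c ` C)" "snd c ` C \<subseteq> chart_image c" "\<And>x. x \<in> chart_image c \<Longrightarrow> x \<notin> snd c ` C \<Longrightarrow> point c x \<notin> C"
proof -
  show "compact (snd c ` C)" "snd c ` C \<subseteq> chart_image c" using f by (auto simp: supported_def chart_image_def)
  fix x assume x: "x \<in> chart_image c" "x \<notin> snd c ` C"
  then show "point c x \<notin> C" using chart_point(2)[OF c x(1)] by (metis imageI)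
qed

lemma extension_compact:
  assumes c: "c \<in> A" and f: "supported c f C" and h: "higher_differentiable_on (chart_image c) h n"
    and z: "\<And>x. x \<in> chart_image c \<Longrightarrow> point c x \<notin> C \<Longrightarrow> h x = 0"
  shows "higher_differentiable_on UNIV (extension c h) n" "\<And>x. x \<notin> snd c ` C \<Longrightarrow> extension c h x = 0"
proof -
  note s = supported_image[OF c f]
  have z': "h x = 0" if "x \<in> chart_image c" "x \<notin> snd c ` C" for x using z s(3) that by blast
  show "higher_differentiable_on UNIV (extension c h) n"
    unfolding extension_def[abs_def]
    by (rule hd_zero_extension[OF chart(2)[OF c] compact_imp_closed[OF s(1)] s(2) h z'])
  show "extension c h x = 0" if "x \<notin> snd c ` C" for x using z' that by (simp add: extension_def)
qed

lemma extension_integrable: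
  assumes c: "c \<in> A" and f: "supported c f C" and h: "continuous_on (chart_image c) h"
    and z: "\<And>x. x \<in> chart_image c \<Longrightarrow> point c x \<notin> C \<Longrightarrow> h x = 0"
  shows "integrable lborel (extension c h)" "continuous_on UNIV (extension c h)"
proof -
  show co: "continuous_on UNIV (extension c h)" using extension_compact(1)[OF c f, of h 0] h z by simp
  show "integrable lborel (extension c h)"
    by (rule integrable_compact_support[OF co supported_image(1)[OF c f] extension_compact(2)[OF c f, of h 0]]) (use h z in auto)
qed

lemma flux_integrable:
  assumes c: "c \<in> A" and f: "C1 f" and g: "C1 g" and s: "supported c f C \<or> supported c g C"
  shows "integrable lborel (extension c (flux c f g))"
  using s
proof
  assume s: "supported c f C"
  show ?thesis by (rule extension_integrable(1)[OF c s flux_continuous[OF c f g]]) (rule flux_zero[OF c s])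
next
  assume s: "supported c g C"
  then have "g q = 0" if "q \<notin> C" for q using that by (simp add: supported_def)
  then show ?thesis by (intro extension_integrable(1)[OF c s flux_continuous[OF c f g]]) (simp add: flux_def)
qed

text \<open>Both integrals live on the overlap, since one factor vanishes outside each chart; there the
  integrands are related by the Jacobian determinant.\<close>

lemma flux_integral:
  assumes c: "c \<in> A" and d: "d \<in> A" and f: "supported c f C" and g: "supported d g D"
  shows "chart_integral c (flux c f g) = chart_integral d (flux d f g)"
proof -
  have f1: "C1 f" and g1: "C1 g" using f g by (auto simp: supported_def)
  have C: "C \<subseteq> fst c" and D: "D \<subseteq> fst d" and z: "\<And>q. q \<notin> D \<Longrightarrow> g q = 0" using f g by (auto simp: supported_def)
  have ec: "extension c (flux c f g) = (\<lambda>x. if x \<in> overlap c d then flux c f g x else 0)"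
  proof
    fix x
    have "flux c f g x = 0" if "x \<in> chart_image c" "point c x \<notin> fst d" using z D that by (auto simp: flux_def)
    then show "extension c (flux c f g) x = (if x \<in> overlap c d then flux c f g x else 0)"
      by (auto simp: extension_def overlap_iff[OF c])
  qed
  have ed: "extension d (flux d f g) = (\<lambda>x. if x \<in> transition c d ` overlap c d then flux d f g x else 0)"
  proof
    fix x
    have "flux d f g x = 0" if "x \<in> chart_image d" "point d x \<notin> fst c" using flux_zero[OF d f] C that by blast
    then show "extension d (flux d f g) x = (if x \<in> transition c d ` overlap c d then flux d f g x else 0)"
      unfolding transition_image[OF c d] by (auto simp: extension_def overlap_iff[OF d])
  qed
  have "integrable lborel (extension c (flux c f g))" "integrable lborel (extension d (flux d f g))"
    using flux_integrable[OF c f1 g1] flux_integrable[OF d f1 g1] f g by blast+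
  then show ?thesis
    unfolding ec ed
    by (intro lborel_change_of_variables overlap_open[OF c d] transition_inj[OF c d] flux_transition[OF c d f1]
        smooth_differentiable[OF overlap_open[OF c d] transition_smooth[OF c d]])
      (simp_all add: transition_image[OF c d] overlap_open[OF d c])
qed

lemma C1_const: "C1 (\<lambda>_. k)" by (simp add: C1_def frechet_derivative_const)

lemma divergence_continuous: "c \<in> A \<Longrightarrow> continuous_on (chart_image c) (divergence c)"
  unfolding divergence_def[abs_def]
  by (intro continuous_on_sum smooth_continuous[OF chart(2)] smooth_partial[OF chart(2)] W_smooth)

lemma weighted_continuous:
  assumes c: "c \<in> A" and f: "C1 f"
  shows "continuous_on (chart_image c) (\<lambda>x. f (point c x) * divergence c x)"
  using divergence_continuous[OF c] hd_Suc[OF C1_hd[OF f c]] by (auto intro!: continuous_on_mult)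

text \<open>Integration by parts for the compactly supported product of the weight and \<open>V\<close>.\<close>

lemma integral_divergence:
  assumes c: "c \<in> A" and f: "supported c f C"
  shows "chart_integral c (\<lambda>x. f (point c x) * divergence c x) = - chart_integral c (flux c f (\<lambda>_. 1))"
proof -
  have f1: "C1 f" and z: "\<And>q. q \<notin> C \<Longrightarrow> f q = 0" using f by (auto simp: supported_def)
  let ?f = "\<lambda>x. f (point c x)"
  define G where "G a = extension c (\<lambda>x. ?f x * W c x a)" for a
  have W1: "higher_differentiable_on (chart_image c) (\<lambda>x. W c x a) (Suc 0)" for a
    using W_smooth[OF c] unfolding smooth_on_def by blast
  have hG: "higher_differentiable_on (chart_image c) (\<lambda>x. ?f x * W c x a) (Suc 0)" for a
    by (rule hd_mult[OF chart(2)[OF c] C1_hd[OF f1 c] W1])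
  have G: "higher_differentiable_on UNIV (G a) (Suc 0)" "\<And>x. x \<notin> snd c ` C \<Longrightarrow> G a x = 0" for a
    unfolding G_def using extension_compact[OF c f hG] z by auto
  note P = integral_partial_zero[OF G(1) supported_image(1)[OF c f] G(2)]
  have e: "(\<Sum>a\<in>UNIV. partial a (G a) x) = extension c (\<lambda>x. ?f x * divergence c x) x + extension c (flux c f (\<lambda>_. 1)) x" for x
  proof (cases "x \<in> chart_image c")
    case x: True
    have "partial a (G a) x = ?f x * partial a (\<lambda>y. W c y a) x + W c x a * partial a ?f x" for a
    proof -
      have "partial a (G a) x = partial a (\<lambda>x. ?f x * W c x a) x"
        by (rule partial_cong[OF chart(2)[OF c] x]) (use G(1) in \<open>auto simp: G_def extension_def\<close>)
      then show ?thesis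
        using partial_mult[OF C1_diff[OF f1 c x] smooth_differentiable[OF chart(2)[OF c] W_smooth[OF c] x]] by (simp add: mult.commute)
    qed
    then show ?thesis using x by (simp add: extension_def divergence_def flux_def sum.distrib sum_distrib_left)
  next
    case x: False
    then have xC: "x \<in> - (snd c ` C)" using supported_image(2)[OF c f] by blast
    have "partial a (G a) x = partial a (\<lambda>_. 0) x" for a
      by (rule partial_cong[OF _ xC]) (use G supported_image(1)[OF c f] in \<open>auto simp: open_Compl compact_imp_closed\<close>)
    then show ?thesis using x by (simp add: extension_def partial_const)
  qed
  have i1: "integrable lborel (extension c (\<lambda>x. ?f x * divergence c x))"
    by (rule extension_integrable(1)[OF c f weighted_continuous[OF c f1]]) (simp add: z)
  have i2: "integrable lborel (extension c (flux c f (\<lambda>_. 1)))" using flux_integrable[OF c f1 C1_const] f by blast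
  have "0 = (\<Sum>a\<in>UNIV. integral\<^sup>L lborel (partial a (G a)))" by (simp add: P(2))
  also have "\<dots> = integral\<^sup>L lborel (\<lambda>x. \<Sum>a\<in>UNIV. partial a (G a) x)"
    by (rule Bochner_Integration.integral_sum[symmetric]) (rule P(1))
  also have "\<dots> = chart_integral c (\<lambda>x. ?f x * divergence c x) + chart_integral c (flux c f (\<lambda>_. 1))"
    unfolding e by (rule Bochner_Integration.integral_add[OF i1 i2])
  finally show ?thesis by simp
qed

text \<open>Integrals over the manifold are sums of integrals in charts, by means of a partition of unity.
  After integration by parts the contributions \<open>R\<^sub>j V(R\<^sub>i)\<close> can be moved from the chart of \<open>R\<^sub>i\<close>
  to that of \<open>R\<^sub>j\<close>, where they add up to zero because the sum of the \<open>R\<^sub>i\<close> is constant.\<close>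

theorem divergence_theorem:
  assumes I: "finite I" and ch: "\<And>p. p \<in> I \<Longrightarrow> ch p \<in> A" and R: "\<And>p. p \<in> I \<Longrightarrow> supported (ch p) (R p) (C p)"
    and one: "\<And>q. q \<in> topspace M \<Longrightarrow> (\<Sum>p\<in>I. R p q) = 1"
  shows "(\<Sum>p\<in>I. chart_integral (ch p) (\<lambda>x. R p (point (ch p) x) * divergence (ch p) x)) = 0"
proof -
  have R1: "C1 (R p)" if "p \<in> I" for p using R[OF that] by (simp add: supported_def)
  have int: "integrable lborel (extension (ch q) (flux (ch q) (R p) (R r)))" if "p \<in> I" "r \<in> I" "q = p \<or> q = r" for p q r
    using flux_integrable[OF ch[of q] R1[OF that(1)] R1[OF that(2)], of "C q"] R[of q] that by blast
  have split: "chart_integral (ch p) (flux (ch p) (R p) (\<lambda>_. 1)) = (\<Sum>r\<in>I. chart_integral (ch p) (flux (ch p) (R p) (R r)))" if p: "p \<in> I" for p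
  proof -
    have "extension (ch p) (flux (ch p) (R p) (\<lambda>_. 1)) x = (\<Sum>r\<in>I. extension (ch p) (flux (ch p) (R p) (R r)) x)" for x
    proof (cases "x \<in> chart_image (ch p)")
      case True
      have "(\<Sum>r\<in>I. k * R r (point (ch p) x)) = k" for k :: real
        unfolding sum_distrib_left[symmetric] one[OF point_space[OF ch[OF p] True]] by simp
      then show ?thesis unfolding extension_def flux_def if_P[OF True] by (simp only: mult_1_right)
    qed (simp add: extension_def)
    then have "chart_integral (ch p) (flux (ch p) (R p) (\<lambda>_. 1)) = integral\<^sup>L lborel (\<lambda>x. \<Sum>r\<in>I. extension (ch p) (flux (ch p) (R p) (R r)) x)"
      by (rule Bochner_Integration.integral_cong[OF refl])
    also have "\<dots> = (\<Sum>r\<in>I. chart_integral (ch p) (flux (ch p) (R p) (R r)))"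
      by (rule Bochner_Integration.integral_sum) (use int p in blast)
    finally show ?thesis .
  qed
  have cancel: "(\<Sum>p\<in>I. chart_integral (ch r) (flux (ch r) (R p) (R r))) = 0" if r: "r \<in> I" for r
  proof -
    have "(\<Sum>p\<in>I. extension (ch r) (flux (ch r) (R p) (R r)) x) = 0" for x
    proof (cases "x \<in> chart_image (ch r)")
      case x: True
      have "(\<Sum>p\<in>I. partial a (\<lambda>y. R p (point (ch r) y)) x) = 0" for a
      proof -
        have d: "(\<lambda>y. R p (point (ch r) y)) differentiable (at x)" if "p \<in> I" for p
          by (rule C1_diff[OF R1[OF that] ch[OF r] x])
        have "(\<Sum>p\<in>I. partial a (\<lambda>y. R p (point (ch r) y)) x) = partial a (\<lambda>y. \<Sum>p\<in>I. R p (point (ch r) y)) x"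
          by (rule partial_sum[symmetric, OF d])
        also have "\<dots> = partial a (\<lambda>_. 1) x"
          by (rule partial_cong[OF chart(2)[OF ch[OF r]] x]) (use one point_space[OF ch[OF r]] d I in \<open>auto intro!: differentiable_sum\<close>)
        finally show ?thesis by (simp add: partial_const)
      qed
      then have "(\<Sum>a\<in>UNIV. W (ch r) x a * (\<Sum>p\<in>I. partial a (\<lambda>y. R p (point (ch r) y)) x)) = 0" by simp
      then have "(\<Sum>p\<in>I. \<Sum>a\<in>UNIV. W (ch r) x a * partial a (\<lambda>y. R p (point (ch r) y)) x) = 0"
        unfolding sum_distrib_left by (subst sum.swap)
      then show ?thesis using x by (simp add: extension_def flux_def sum_distrib_right[symmetric])
    qed (simp add: extension_def)
    then have "0 = integral\<^sup>L lborel (\<lambda>x. \<Sum>p\<in>I. extension (ch r) (flux (ch r) (R p) (R r)) x)" by simp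
    also have "\<dots> = (\<Sum>p\<in>I. chart_integral (ch r) (flux (ch r) (R p) (R r)))"
      by (rule Bochner_Integration.integral_sum) (use int r in blast)
    finally show ?thesis by simp
  qed
  have "(\<Sum>p\<in>I. chart_integral (ch p) (\<lambda>x. R p (point (ch p) x) * divergence (ch p) x))
    = - (\<Sum>p\<in>I. \<Sum>r\<in>I. chart_integral (ch p) (flux (ch p) (R p) (R r)))"
  proof -
    have "chart_integral (ch p) (\<lambda>x. R p (point (ch p) x) * divergence (ch p) x) = - (\<Sum>r\<in>I. chart_integral (ch p) (flux (ch p) (R p) (R r)))"
      if "p \<in> I" for p
      unfolding split[OF that, symmetric] by (rule integral_divergence[OF ch[OF that] R[OF that]])
    then show ?thesis unfolding sum_negf[symmetric] by (rule sum.cong[OF refl])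
  qed
  also have "(\<Sum>p\<in>I. \<Sum>r\<in>I. chart_integral (ch p) (flux (ch p) (R p) (R r))) = (\<Sum>p\<in>I. \<Sum>r\<in>I. chart_integral (ch r) (flux (ch r) (R p) (R r)))"
    by (intro sum.cong refl flux_integral[OF ch ch R R])
  also have "\<dots> = (\<Sum>r\<in>I. \<Sum>p\<in>I. chart_integral (ch r) (flux (ch r) (R p) (R r)))" by (rule sum.swap)
  also have "\<dots> = 0" using cancel by simp
  finally show ?thesis by simp
qed

text \<open>The base point is taken as one of the centres of the partition of unity, with the given chart as its chart, so
  that the vanishing of that one summand gives the claim in this chart.\<close>

theorem nonpositive_divergence_zero:
  assumes np: "\<And>c x. c \<in> A \<Longrightarrow> x \<in> chart_image c \<Longrightarrow> divergence c x \<le> 0"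
    and c: "c \<in> A" and x: "x \<in> chart_image c"
  shows "divergence c x = 0"
proof (rule partition_of_unity[OF c chart_point(1)[OF c x]])
  fix I ch R C
  assume I: "finite I" and p0: "point c x \<in> I" and ch0: "ch (point c x) = c" and ch: "\<And>p. p \<in> I \<Longrightarrow> ch p \<in> A"
    and R: "\<And>p. p \<in> I \<Longrightarrow> supported (ch p) (R p) (C p)" and pos: "\<And>p q. p \<in> I \<Longrightarrow> q \<in> topspace M \<Longrightarrow> 0 \<le> (R p q :: real)"
    and pos0: "0 < R (point c x) (point c x)" and one: "\<And>q. q \<in> topspace M \<Longrightarrow> (\<Sum>p\<in>I. R p q) = 1"
  define H where "H p x = - extension (ch p) (\<lambda>x. R p (point (ch p) x) * divergence (ch p) x) x" for p x
  have H: "continuous_on UNIV (H p)" "integrable lborel (H p)" "0 \<le> H p y" if p: "p \<in> I" for p y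
  proof -
    have f1: "C1 (R p)" and z: "\<And>q. q \<notin> C p \<Longrightarrow> R p q = 0" using R[OF p] by (auto simp: supported_def)
    note E = extension_integrable[OF ch[OF p] R[OF p] weighted_continuous[OF ch[OF p] f1]]
    show "continuous_on UNIV (H p)" unfolding H_def[abs_def] by (intro continuous_on_minus E(2)) (simp add: z)
    have "integrable lborel (extension (ch p) (\<lambda>x. R p (point (ch p) x) * divergence (ch p) x))" by (rule E(1)) (simp add: z)
    then show "integrable lborel (H p)" unfolding H_def[abs_def] by simp
    show "0 \<le> H p y" using np[OF ch[OF p], of y] pos[OF p point_space[OF ch[OF p]], of y]
      by (auto simp: H_def extension_def mult_nonneg_nonpos)
  qed
  have s: "(\<Sum>p\<in>I. integral\<^sup>L lborel (H p)) = 0"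
  proof -
    have "integral\<^sup>L lborel (H p) = - chart_integral (ch p) (\<lambda>x. R p (point (ch p) x) * divergence (ch p) x)" for p
      unfolding H_def[abs_def] by (rule Bochner_Integration.integral_minus)
    then show ?thesis by (simp only: sum_negf divergence_theorem[OF I ch R one] minus_zero)
  qed
  have n: "0 \<le> integral\<^sup>L lborel (H p)" if "p \<in> I" for p
    by (rule integral_nonneg_AE[OF AE_I2]) (rule H(3)[OF that])
  have "integral\<^sup>L lborel (H (point c x)) = 0"
    using sum_nonneg_0[OF I n s p0] .
  from nonneg_zero_integral[OF H[OF p0] this, of x]
  have "H (point c x) x = 0" .
  then show ?thesis using pos0 x by (simp add: H_def extension_def ch0)
qed

theorem stationary_iff_torsion_free: "stationary_ricci_harmonic A \<phi> \<longleftrightarrow> torsion_free A \<phi>"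
proof
  assume st: "stationary_ricci_harmonic A \<phi>"
  have bound: "divergence c x \<le> - 2 * \<bar>vol (\<phi> c x)\<bar> * torsion_norm_sq (\<phi> c) x" if c: "c \<in> A" and x: "x \<in> chart_image c" for c x
  proof -
    interpret c: g2_field "chart_image c" "\<phi> c" by (rule field[OF c])
    show ?thesis unfolding divergence_def W_def
      by (rule c.stationary_divergence[OF x]) (use st c x in \<open>simp add: stationary_ricci_harmonic_def\<close>)
  qed
  have np: "divergence c x \<le> 0" if c: "c \<in> A" and x: "x \<in> chart_image c" for c x
  proof -
    have "0 \<le> \<bar>vol (\<phi> c x)\<bar> * torsion_norm_sq (\<phi> c) x"
      by (rule mult_nonneg_nonneg[OF abs_ge_zero g2_field.torsion_norm_nonneg[OF field[OF c] x]])
    then show ?thesis using bound[OF c x] by (simp add: mult.assoc)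
  qed
  show "torsion_free A \<phi>" unfolding torsion_free_def
  proof (intro ballI allI)
    fix c x i j assume c: "c \<in> A" and x: "x \<in> chart_image c"
    interpret c: g2_field "chart_image c" "\<phi> c" by (rule field[OF c])
    have "\<bar>vol (\<phi> c x)\<bar> * torsion_norm_sq (\<phi> c) x \<le> 0"
      using bound[OF c x] nonpositive_divergence_zero[OF np c x] by (simp add: mult.commute)
    then have "torsion_norm_sq (\<phi> c) x \<le> 0"
      using c.vol_nonzero[OF x] by (simp add: mult_le_0_iff)
    then show "torsion (\<phi> c) x i j = 0" by (rule c.torsion_zero[OF x])
  qed
next
  assume tf: "torsion_free A \<phi>"
  show "stationary_ricci_harmonic A \<phi>" unfolding stationary_ricci_harmonic_def
  proof (intro ballI allI)
    fix c x i j k assume c: "c \<in> A" and x: "x \<in> chart_image c"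
    interpret c: g2_field "chart_image c" "\<phi> c" by (rule field[OF c])
    show "ricci_harmonic (\<phi> c) x i j k = 0"
      by (rule c.torsion_free_stationary[OF _ x]) (use tf c in \<open>simp add: torsion_free_def\<close>)
  qed
qed

end

theorem mainTheorem1:
  fixes M :: "'a topology"
    and A :: "'a chart set"
    and \<phi> :: "'a chart \<Rightarrow> real^7 \<Rightarrow> tensor3"
  assumes "smooth_7_manifold M A"
    and "compact_space M"
    and "G2_structure A \<phi>"
  shows "stationary_ricci_harmonic A \<phi> \<longleftrightarrow> torsion_free A \<phi>"
  by (rule g2_manifold.stationary_iff_torsion_free) (unfold_locales; fact)

end
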